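(* Let $m\in\mathbb{N}$, $\nu>0$ and $a=-2$. Let $m_*\in\mathbb{N}$ be such that $m_*>m$ and assume $B_{m_*}<+\infty$. If $\nu^3\ge 8C_*B_0$, where $C_*$ is the constant described in the context, then the invariant measure $\mu\in\mathcal{P}(\dot H^m)$ for the transition semigroup $(P_t)_{t\ge0}$ associated with $$\omega_t+a u\omega_x-u_x\omega-\nu\omega_{xx}=\xi_t,\qquad u_x=\mathcal{H}(\omega),$$ is unique.
   Context: Notation: $\mathbb{N}=\{1,2,\dots\}$, $\mathbb{S}^1=\mathbb{R}/2\pi\mathbb{Z}$, $\mathbb{Z}^*=\mathbb{Z}\setminus\{0\}$. $H$ is the real Hilbert space of $u\in L^2(\mathbb{S}^1)$ with $\int_0^{2\pi}u\,dx=0$, with inner product $\langle u,v\rangle_H=\int_0^{2\pi}uv\,dx$ and orthonormal basis $e_k(x)=\pi^{-1/2}\cos(kx)$ for $k\ge1$, $e_k(x)=\pi^{-1/2}\sin(-kx)$ for $k\le-1$; $u_k=\langle u,e_k\rangle_H$. For $m\in\mathbb{N}$, $\dot H^m=\{u\in H:\|u\|_{\dot H^m}^2:=\sum_{k\in\mathbb{Z}^*}|k|^{2m}u_k^2<\infty\}$. $X_T^m=C([0,T];\dot H^m)$ with the sup norm, $X_\infty^m=C([0,\infty);\dot H^m)$. $\mathcal{P}(\dot H^m)$ is the set of Borel probability measures on $\dot H^m$. Hilbert transform: with complex Fourier coefficients $\hat u(k)=\frac1{2\pi}\int_0^{2\pi}u(x)e^{-ikx}dx$, $\widehat{\mathcal{H}(u)}(k)=-i\,\mathrm{sgn}(k)\hat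 u(k)$, $\mathrm{sgn}(0)=0$. In the equation, $u$ is the mean-zero function with $u_x=\mathcal{H}(\omega)$, i.e. $u=-(-\partial_x^2)^{-1/2}\omega$. Noise: $(\Omega,\mathcal{F},\mathbb{P},(\mathcal{F}_t)_{t\ge0})$ is a filtered probability space, $\{\beta_k\}_{k\in\mathbb{Z}^*}$ are independent real Brownian motions adapted to $(\mathcal{F}_t)$ whose increments after time $s$ are independent of $\mathcal{F}_s$ for every $s\ge 0$; $\{b_k\}_{k\in\mathbb{Z}^*}$ is a fixed real sequence, $\xi(t,x)=\sum_{k\in\mathbb{Z}^*}b_k\beta_k(t)e_k(x)$, $B_m=\sum_{k\in\mathbb{Z}^*}|k|^{2m}b_k^2$ and $B_0=\sum_{k\in\mathbb{Z}^*}b_k^2$. Solution: $\omega\in X_T^m$ is a solution on $[0,T]$ with initial value $\omega_0\in\dot H^m$ if, $\mathbb{P}$-a.s., for all $t\in[0,T]$, in $\dot H^m$, $$\omega(t)=e^{\nu t\partial_x^2}\omega_0+\int_0^te^{\nu(t-s)\partial_x^2}\{-a(u\omega)_x(s)+(1+a)(u_x\omega)(s)\}ds+\int_0^te^{\nu(t-s)\partial_x^2}d\xi(s),$$ where $e^{\nu t\partial_x^2}$ is the heat semigroup. For $a=-2$ and $B_{m_*}<\infty$ for some integer $m_*>m$, there is for each $y\in\dot H^m$ a unique adapted global solution $\omega(\cdot;y)\in X_\infty^m$ with $\omega(0)=y$. Transition semigroup: $P_tf(y)=\mathbb{E}[f(\omega(t;y))]$ for bounded Borel $f:\dot H^m\to\mathbb{R}$,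 $y\in\dot H^m$. An invariant measure is $\mu\in\mathcal{P}(\dot H^m)$ with $\int P_tf\,d\mu=\int f\,d\mu$ for all $t\ge0$ and all bounded Borel $f$. Constant $C_*$: $C_*>0$ is a fixed absolute constant (such a constant exists) with the following property: for $a=-2$, every $\nu>0$, every noise with $B_p<\infty$ for some integer $p>1$, and any two solutions $\omega^{(1)},\omega^{(2)}\in X^1_\infty$ of the equation (driven by the same noise) with deterministic initial data $\omega_0^{(1)},\omega_0^{(2)}\in\dot H^1$, one has almost surely for all $t\ge0$ $$\|\omega^{(1)}(t)-\omega^{(2)}(t)\|_H^2\le\|\omega^{(1)}_0-\omega^{(2)}_0\|_H^2\exp\Big\{-\frac{\nu t}{4}+\frac{C_*}{\nu}\Big(\int_0^t\|\omega^{(1)}(s)\|_{\dot H^1}^2ds+\int_0^t\|\omega^{(2)}(s)\|_{\dot H^1}^2ds\Big)\Big\}.$$ *)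

theory Defs
  imports "HOL-Probability.Probability"
begin

section \<open>The space \<open>L\<^sup>2\<close> of the circle\<close>

text \<open>The circle \<open>\<real> / 2\<pi>\<int>\<close> is represented, as a measure space, by the interval \<open>[0, 2\<pi>]\<close>
  with Lebesgue measure.\<close>

definition circle :: "real measure" where
  "circle = lebesgue_on {0..2 * pi}"

definition square_integrable :: "(real \<Rightarrow> real) \<Rightarrow> bool" where
  "square_integrable f \<longleftrightarrow>
     f \<in> borel_measurable circle \<and> integrable circle (\<lambda>x. (f x)\<^sup>2)"

definition L2_rel :: "(real \<Rightarrow> real) \<Rightarrow> (real \<Rightarrow> real) \<Rightarrow> bool" where
  "L2_rel f g \<longleftrightarrow>
     square_integrable f \<and> square_integrable g \<and> (AE x in circle. f x = g x)"

lemma square_integrable_0: "square_integrable (\<lambda>x. 0)"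
  by (simp add: square_integrable_def)

lemma square_integrable_mult:
  assumes "square_integrable f" "square_integrable g"
  shows "integrable circle (\<lambda>x. f x * g x)"
proof (rule Bochner_Integration.integrable_bound)
  show "integrable circle (\<lambda>x. (f x)\<^sup>2 + (g x)\<^sup>2)"
    using assms by (auto simp: square_integrable_def)
  show "(\<lambda>x. f x * g x) \<in> borel_measurable circle"
    using assms by (auto simp: square_integrable_def)
  have "\<bar>a * b\<bar> \<le> a\<^sup>2 + b\<^sup>2" for a b :: real
  proof -
    have "2 * (\<bar>a\<bar> * \<bar>b\<bar>) \<le> a\<^sup>2 + b\<^sup>2"
      using sum_squares_bound[of "\<bar>a\<bar>" "\<bar>b\<bar>"] by simp
    moreover have "0 \<le> \<bar>a\<bar> * \<bar>b\<bar>" by simp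
    ultimately show ?thesis unfolding abs_mult by linarith
  qed
  then show "AE x in circle. norm (f x * g x) \<le> norm ((f x)\<^sup>2 + (g x)\<^sup>2)"
    by simp
qed

lemma square_integrable_add:
  assumes "square_integrable f" "square_integrable g"
  shows "square_integrable (\<lambda>x. f x + g x)"
  using assms square_integrable_mult[OF assms]
  by (auto simp: square_integrable_def power2_sum mult.assoc)

lemma square_integrable_scale:
  assumes "square_integrable f"
  shows "square_integrable (\<lambda>x. c * f x)"
  using assms by (auto simp: square_integrable_def power_mult_distrib)

lemma square_integrable_uminus:
  assumes "square_integrable f"
  shows "square_integrable (\<lambda>x. - f x)"
  using assms by (auto simp: square_integrable_def)

lemma part_equivp_L2_rel: "part_equivp L2_rel"
proof (rule part_equivpI)
  show "\<exists>f. L2_rel f f"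
    using square_integrable_0 by (auto simp: L2_rel_def)
  show "symp L2_rel"
    by (rule sympI) (auto simp: L2_rel_def elim: AE_mp)
  show "transp L2_rel"
    by (rule transpI) (auto simp: L2_rel_def elim: AE_mp)
qed

quotient_type L2 = "real \<Rightarrow> real" / partial: L2_rel
  morphisms rep_L2 abs_L2
  by (rule part_equivp_L2_rel)

instantiation L2 :: real_inner
begin

lift_definition zero_L2 :: L2 is "\<lambda>x. 0"
  by (simp add: L2_rel_def square_integrable_0)

lift_definition plus_L2 :: "L2 \<Rightarrow> L2 \<Rightarrow> L2" is "\<lambda>f g x. f x + g x"
  by (auto simp: L2_rel_def square_integrable_add elim!: AE_mp)

lift_definition uminus_L2 :: "L2 \<Rightarrow> L2" is "\<lambda>f x. - f x"
  by (auto simp: L2_rel_def square_integrable_uminus elim!: AE_mp)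

lift_definition scaleR_L2 :: "real \<Rightarrow> L2 \<Rightarrow> L2" is "\<lambda>c f x. c * f x"
  by (auto simp: L2_rel_def square_integrable_scale elim!: AE_mp)

lift_definition inner_L2 :: "L2 \<Rightarrow> L2 \<Rightarrow> real" is "\<lambda>f g. LINT x|circle. f x * g x"
  by (rule integral_cong_AE) (auto simp: L2_rel_def square_integrable_def elim!: AE_mp)

definition minus_L2 :: "L2 \<Rightarrow> L2 \<Rightarrow> L2" where "minus_L2 u v = u + - v"

definition norm_L2 :: "L2 \<Rightarrow> real" where "norm_L2 u = sqrt (inner u u)"

definition sgn_L2 :: "L2 \<Rightarrow> L2" where "sgn_L2 u = scaleR (inverse (norm u)) u"

definition dist_L2 :: "L2 \<Rightarrow> L2 \<Rightarrow> real" where "dist_L2 u v = norm (u - v)"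

definition uniformity_L2 :: "(L2 \<times> L2) filter" where
  "uniformity_L2 = (INF e\<in>{0<..}. principal {(x, y). dist x y < e})"

definition open_L2 :: "L2 set \<Rightarrow> bool" where
  "open_L2 U \<longleftrightarrow> (\<forall>x\<in>U. eventually (\<lambda>(x', y). x' = x \<longrightarrow> y \<in> U) uniformity)"

instance
proof
  fix u v w :: L2 and a b :: real
  show "u + v + w = u + (v + w)"
    by transfer (auto simp: L2_rel_def square_integrable_add add.assoc)
  show "u + v = v + u"
    by transfer (auto simp: L2_rel_def square_integrable_add add.commute)
  show "0 + u = u"
    by transfer (auto simp: L2_rel_def)
  show "- u + u = 0"
    by transfer (auto simp: L2_rel_def square_integrable_0)
  show "u - v = u + - v"
    by (simp add: minus_L2_def)
  show "a *\<^sub>R (u + v) = a *\<^sub>R u + a *\<^sub>R v"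
    by transfer (auto simp: L2_rel_def square_integrable_add square_integrable_scale distrib_left)
  show "(a + b) *\<^sub>R u = a *\<^sub>R u + b *\<^sub>R u"
    by transfer (auto simp: L2_rel_def square_integrable_add square_integrable_scale distrib_right)
  show "a *\<^sub>R b *\<^sub>R u = (a * b) *\<^sub>R u"
    by transfer (auto simp: L2_rel_def square_integrable_scale mult.assoc)
  show "1 *\<^sub>R u = u"
    by transfer (auto simp: L2_rel_def)
  show "sgn u = scaleR (inverse (norm u)) u"
    by (rule sgn_L2_def)
  show "dist u v = norm (u - v)"
    by (rule dist_L2_def)
  show "(uniformity :: (L2 \<times> L2) filter) = (INF e\<in>{0<..}. principal {(x, y). dist x y < e})"
    by (rule uniformity_L2_def)
  show "open U \<longleftrightarrow> (\<forall>x\<in>U. eventually (\<lambda>(x', y). x' = x \<longrightarrow> y \<in> U) uniformity)" for U :: "L2 set"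
    by (rule open_L2_def)
  show "inner u v = inner v u"
    by transfer (simp add: mult.commute)
  show "inner (u + v) w = inner u w + inner v w"
    by transfer (simp add: L2_rel_def distrib_right square_integrable_mult)
  show "inner (a *\<^sub>R u) v = a * inner u v"
    by transfer (simp add: mult.assoc)
  show "0 \<le> inner u u"
    by transfer simp
  show "inner u u = 0 \<longleftrightarrow> u = 0"
  proof transfer
    fix f assume "L2_rel f f"
    then have f: "square_integrable f" by (simp add: L2_rel_def)
    then have "(LINT x|circle. f x * f x) = 0 \<longleftrightarrow> (AE x in circle. f x * f x = 0)"
      by (intro integral_nonneg_eq_0_iff_AE square_integrable_mult) auto
    then show "((LINT x|circle. f x * f x) = 0) = L2_rel f (\<lambda>x. 0)"
      using f by (simp add: L2_rel_def square_integrable_0)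
  qed
  show "norm u = sqrt (inner u u)"
    by (rule norm_L2_def)
qed

end


section \<open>Mean-zero functions and the spaces \<open>H\<close>, \<open>H\<^sup>m\<close>\<close>

abbreviation nonzero_ints :: "int set" where
  "nonzero_ints \<equiv> UNIV - {0}"

definition H_space :: "L2 set" where
  "H_space = {u. (LINT x|circle. rep_L2 u x) = 0}"

definition basis_fun :: "int \<Rightarrow> real \<Rightarrow> real" where
  "basis_fun k x =
     (if k \<ge> 1 then cos (real_of_int k * x) / sqrt pi else sin (- real_of_int k * x) / sqrt pi)"

definition e_basis :: "int \<Rightarrow> L2" where
  "e_basis k = abs_L2 (basis_fun k)"

definition Hdot :: "nat \<Rightarrow> L2 set" where
  "Hdot m = {u \<in> H_space.
     (\<lambda>k. \<bar>real_of_int k\<bar> ^ (2 * m) * (inner u (e_basis k))\<^sup>2) summable_on nonzero_ints}"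

definition Hdot_norm :: "nat \<Rightarrow> L2 \<Rightarrow> real" where
  "Hdot_norm m u =
     sqrt (\<Sum>\<^sub>\<infinity>k\<in>nonzero_ints. \<bar>real_of_int k\<bar> ^ (2 * m) * (inner u (e_basis k))\<^sup>2)"

definition Hdot_topology :: "nat \<Rightarrow> L2 topology" where
  "Hdot_topology m = Metric_space.mtopology (Hdot m) (\<lambda>u v. Hdot_norm m (u - v))"

definition Hdot_borel :: "nat \<Rightarrow> L2 measure" where
  "Hdot_borel m = sigma (Hdot m) {U. openin (Hdot_topology m) U}"


section \<open>The operators in the equation\<close>

definition fourier_coeff :: "L2 \<Rightarrow> int \<Rightarrow> complex" where
  "fourier_coeff u k =
     1 / (2 * pi) * (LINT x|circle. complex_of_real (rep_L2 u x) * exp (- \<i> * of_int k * of_real x))"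

definition hilbert_transform :: "L2 \<Rightarrow> L2" where
  "hilbert_transform u =
     (THE v. \<forall>k. fourier_coeff v k = - \<i> * of_int (sgn k) * fourier_coeff u k)"

text \<open>Weak derivatives on the circle: the test functions are periodic of class \<open>C\<^sup>1\<close>.\<close>

definition has_weak_deriv :: "L2 \<Rightarrow> L2 \<Rightarrow> bool" where
  "has_weak_deriv f g \<longleftrightarrow>
     (\<forall>\<phi> \<phi>'. (\<forall>x. \<phi> (x + 2 * pi) = \<phi> x) \<longrightarrow>
             (\<forall>x. (\<phi> has_real_derivative \<phi>' x) (at x)) \<longrightarrow> continuous_on UNIV \<phi>' \<longrightarrow>
        (LINT x|circle. rep_L2 f x * \<phi>' x) = - (LINT x|circle. rep_L2 g x * \<phi> x))"

definition weak_deriv :: "L2 \<Rightarrow> L2" where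
  "weak_deriv f = (THE g. has_weak_deriv f g)"

text \<open>Pointwise product; meaningful when the product is again square integrable, in particular
  when one factor is essentially bounded.\<close>

definition mult_L2 :: "L2 \<Rightarrow> L2 \<Rightarrow> L2" where
  "mult_L2 f g = abs_L2 (\<lambda>x. rep_L2 f x * rep_L2 g x)"

definition velocity :: "L2 \<Rightarrow> L2" where
  "velocity w = (THE u. u \<in> H_space \<and> has_weak_deriv u (hilbert_transform w))"

definition nonlinearity :: "real \<Rightarrow> L2 \<Rightarrow> L2" where
  "nonlinearity a w =
     (- a) *\<^sub>R weak_deriv (mult_L2 (velocity w) w)
     + (1 + a) *\<^sub>R mult_L2 (weak_deriv (velocity w)) w"

text \<open>\<open>heat \<tau>\<close> is the operator \<open>exp (\<tau> \<partial>\<^sub>x\<^sup>2)\<close> on \<open>H_space\<close>, diagonal in the basis \<open>e_basis\<close>.\<close>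

definition heat :: "real \<Rightarrow> L2 \<Rightarrow> L2" where
  "heat \<tau> f =
     (\<Sum>\<^sub>\<infinity>k\<in>nonzero_ints. (exp (- (real_of_int k)\<^sup>2 * \<tau>) * inner f (e_basis k)) *\<^sub>R e_basis k)"


section \<open>The noise\<close>

definition brownian_motion :: "'w measure \<Rightarrow> (real \<Rightarrow> 'w \<Rightarrow> real) \<Rightarrow> bool" where
  "brownian_motion M B \<longleftrightarrow>
     prob_space M \<and>
     (\<forall>t\<ge>0. B t \<in> borel_measurable M) \<and>
     (AE x in M. B 0 x = 0) \<and>
     (\<forall>s t. 0 \<le> s \<and> s < t \<longrightarrow>
        distributed M lborel (\<lambda>x. B t x - B s x) (normal_density 0 (sqrt (t - s)))) \<and>
     (\<forall>(n::nat) \<tau>. 0 \<le> \<tau> 0 \<and> (\<forall>i<n. \<tau> i \<le> \<tau> (Suc i)) \<longrightarrow>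
        prob_space.indep_vars M (\<lambda>_. borel) (\<lambda>i x. B (\<tau> (Suc i)) x - B (\<tau> i) x) {..<n}) \<and>
     (AE x in M. continuous_on {0..} (\<lambda>t. B t x))"

definition filtered_prob_space :: "'w measure \<Rightarrow> (real \<Rightarrow> 'w measure) \<Rightarrow> bool" where
  "filtered_prob_space M F \<longleftrightarrow>
     prob_space M \<and> (\<forall>t\<ge>0. subalgebra M (F t)) \<and>
     (\<forall>s t. 0 \<le> s \<and> s \<le> t \<longrightarrow> sets (F s) \<subseteq> sets (F t))"

text \<open>Independence of the Brownian motions is independence of the whole paths, and the increments
  after time \<open>s\<close> of the whole family are jointly independent of \<open>F s\<close>.\<close>

definition brownian_family ::
  "'w measure \<Rightarrow> (real \<Rightarrow> 'w measure) \<Rightarrow> (int \<Rightarrow> real \<Rightarrow> 'w \<Rightarrow> real) \<Rightarrow> bool" where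
  "brownian_family M F \<beta> \<longleftrightarrow>
     filtered_prob_space M F \<and>
     (\<forall>k\<in>nonzero_ints. brownian_motion M (\<beta> k)) \<and>
     prob_space.indep_vars M (\<lambda>_. Pi\<^sub>M {0..} (\<lambda>_. borel)) (\<lambda>k x. \<lambda>t\<in>{0..}. \<beta> k t x) nonzero_ints \<and>
     (\<forall>k\<in>nonzero_ints. \<forall>t\<ge>0. \<beta> k t \<in> borel_measurable (F t)) \<and>
     (\<forall>s\<ge>0. prob_space.indep_set M (sets (F s))
        (sets (vimage_algebra (space M)
          (\<lambda>x. \<lambda>(k, t)\<in>nonzero_ints \<times> {s..}. \<beta> k t x - \<beta> k s x)
          (Pi\<^sub>M (nonzero_ints \<times> {s..}) (\<lambda>_. borel)))))"

text \<open>Stochastic integral over \<open>[0, t]\<close> of a deterministic integrand \<open>g\<close> of class \<open>C\<^sup>1\<close>: limit of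
  the left-point sums. For such \<open>g\<close> the sums converge for every continuous path
  (Riemann--Stieltjes), so the limit is a version of the Ito integral, which is the limit of the
  same sums in mean square, and it is defined simultaneously for all \<open>t\<close>.\<close>

definition wiener_integral ::
  "real \<Rightarrow> (real \<Rightarrow> real) \<Rightarrow> (real \<Rightarrow> 'w \<Rightarrow> real) \<Rightarrow> 'w \<Rightarrow> real" where
  "wiener_integral t g B x =
     lim (\<lambda>n. \<Sum>i<n. g (t * real i / real n) *
                     (B (t * real (Suc i) / real n) x - B (t * real i / real n) x))"

text \<open>The integral over \<open>s\<close> in \<open>[0, t]\<close> of \<open>heat (\<nu> * (t - s))\<close> against the noise \<open>\<xi>\<close> with
  components \<open>b k * \<beta> k\<close> in the basis \<open>e_basis\<close>.\<close>

definition stoch_conv ::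
  "real \<Rightarrow> (int \<Rightarrow> real) \<Rightarrow> (int \<Rightarrow> real \<Rightarrow> 'w \<Rightarrow> real) \<Rightarrow> real \<Rightarrow> 'w \<Rightarrow> L2" where
  "stoch_conv \<nu> b \<beta> t x =
     (\<Sum>\<^sub>\<infinity>k\<in>nonzero_ints.
        (b k * wiener_integral t (\<lambda>s. exp (- (real_of_int k)\<^sup>2 * (\<nu> * (t - s)))) (\<beta> k) x) *\<^sub>R e_basis k)"

definition noise_finite :: "nat \<Rightarrow> (int \<Rightarrow> real) \<Rightarrow> bool" where
  "noise_finite m b \<longleftrightarrow> (\<lambda>k. \<bar>real_of_int k\<bar> ^ (2 * m) * (b k)\<^sup>2) summable_on nonzero_ints"

definition noise_B :: "nat \<Rightarrow> (int \<Rightarrow> real) \<Rightarrow> real" where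
  "noise_B m b = (\<Sum>\<^sub>\<infinity>k\<in>nonzero_ints. \<bar>real_of_int k\<bar> ^ (2 * m) * (b k)\<^sup>2)"


section \<open>Solutions\<close>

text \<open>A process \<open>w\<close> takes a time and a sample point. The time integral is an \<open>L2\<close>-valued
  gauge integral; along paths in \<open>C([0, T]; H\<^sup>m)\<close>, \<open>m \<ge> 1\<close>, its integrand is continuous.\<close>

definition solution_on ::
  "'w measure \<Rightarrow> real \<Rightarrow> real \<Rightarrow> (int \<Rightarrow> real) \<Rightarrow> (int \<Rightarrow> real \<Rightarrow> 'w \<Rightarrow> real) \<Rightarrow> nat \<Rightarrow> real \<Rightarrow>
   L2 \<Rightarrow> (real \<Rightarrow> 'w \<Rightarrow> L2) \<Rightarrow> bool" where
  "solution_on M a \<nu> b \<beta> m T y w \<longleftrightarrow>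
     y \<in> Hdot m \<and>
     (AE x in M. continuous_map (top_of_set {0..T}) (Hdot_topology m) (\<lambda>t. w t x)) \<and>
     (AE x in M. \<forall>t\<in>{0..T}.
        w t x = heat (\<nu> * t) y
              + integral {0..t} (\<lambda>s. heat (\<nu> * (t - s)) (nonlinearity a (w s x)))
              + stoch_conv \<nu> b \<beta> t x)"

definition global_solution ::
  "'w measure \<Rightarrow> real \<Rightarrow> real \<Rightarrow> (int \<Rightarrow> real) \<Rightarrow> (int \<Rightarrow> real \<Rightarrow> 'w \<Rightarrow> real) \<Rightarrow> nat \<Rightarrow>
   L2 \<Rightarrow> (real \<Rightarrow> 'w \<Rightarrow> L2) \<Rightarrow> bool" where
  "global_solution M a \<nu> b \<beta> m y w \<longleftrightarrow>
     (AE x in M. continuous_map (top_of_set {0..}) (Hdot_topology m) (\<lambda>t. w t x)) \<and>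
     (\<forall>T>0. solution_on M a \<nu> b \<beta> m T y w)"

definition adapted :: "(real \<Rightarrow> 'w measure) \<Rightarrow> nat \<Rightarrow> (real \<Rightarrow> 'w \<Rightarrow> L2) \<Rightarrow> bool" where
  "adapted F m w \<longleftrightarrow> (\<forall>t\<ge>0. w t \<in> F t \<rightarrow>\<^sub>M Hdot_borel m)"

text \<open>A choice of adapted global solutions \<open>W y\<close>, one for each initial value \<open>y\<close>.\<close>

definition solution_family ::
  "'w measure \<Rightarrow> (real \<Rightarrow> 'w measure) \<Rightarrow> real \<Rightarrow> real \<Rightarrow> (int \<Rightarrow> real) \<Rightarrow>
   (int \<Rightarrow> real \<Rightarrow> 'w \<Rightarrow> real) \<Rightarrow> nat \<Rightarrow> (L2 \<Rightarrow> real \<Rightarrow> 'w \<Rightarrow> L2) \<Rightarrow> bool" where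
  "solution_family M F a \<nu> b \<beta> m W \<longleftrightarrow>
     (\<forall>y\<in>Hdot m. adapted F m (W y) \<and> global_solution M a \<nu> b \<beta> m y (W y))"


section \<open>Transition semigroup, invariant measures and the stability constant\<close>

definition transition ::
  "'w measure \<Rightarrow> (L2 \<Rightarrow> real \<Rightarrow> 'w \<Rightarrow> L2) \<Rightarrow> real \<Rightarrow> (L2 \<Rightarrow> real) \<Rightarrow> L2 \<Rightarrow> real" where
  "transition M W t f y = (LINT x|M. f (W y t x))"

definition invariant_measure ::
  "nat \<Rightarrow> (real \<Rightarrow> (L2 \<Rightarrow> real) \<Rightarrow> L2 \<Rightarrow> real) \<Rightarrow> L2 measure \<Rightarrow> bool" where
  "invariant_measure m P \<mu> \<longleftrightarrow>
     prob_space \<mu> \<and> sets \<mu> = sets (Hdot_borel m) \<and>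
     (\<forall>t\<ge>0. \<forall>f\<in>borel_measurable (Hdot_borel m). bounded (f ` Hdot m) \<longrightarrow>
        (LINT y|\<mu>. P t f y) = (LINT y|\<mu>. f y))"

text \<open>The absolute constant works on every probability space; a formula can only quantify over
  the spaces on one sample type \<open>'w\<close>, and a theorem assuming \<open>stability_constant TYPE('w) C\<close>
  assumes no more than that.\<close>

definition stability_constant :: "'w itself \<Rightarrow> real \<Rightarrow> bool" where
  "stability_constant _ C \<longleftrightarrow> C > 0 \<and>
     (\<forall>(M :: 'w measure) F \<beta> b \<nu> p y1 y2 w1 w2.
        brownian_family M F \<beta> \<longrightarrow> \<nu> > 0 \<longrightarrow> 1 < p \<longrightarrow> noise_finite p b \<longrightarrow>
        global_solution M (-2) \<nu> b \<beta> 1 y1 w1 \<longrightarrow> global_solution M (-2) \<nu> b \<beta> 1 y2 w2 \<longrightarrow>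
        (AE x in M. \<forall>t\<ge>0.
           (norm (w1 t x - w2 t x))\<^sup>2 \<le> (norm (y1 - y2))\<^sup>2 *
             exp (- (\<nu> * t / 4) + C / \<nu> *
               (integral {0..t} (\<lambda>s. (Hdot_norm 1 (w1 s x))\<^sup>2)
                + integral {0..t} (\<lambda>s. (Hdot_norm 1 (w2 s x))\<^sup>2)))))"

end

theory Submission imports Defs begin

text \<open>The nonlinearity is orthogonal to \<open>\<omega>\<close> when \<open>a = -2\<close>, so the energy balance bounds
  \<open>2 \<nu> \<integral>\<^sub>0\<^sup>t \<parallel>\<omega>\<parallel>\<^sub>1\<^sup>2\<close> in mean by \<open>\<parallel>y\<parallel>\<^sup>2 + 3/2 t B\<^sub>0 + 2\<close>. No Ito calculus is needed for it:
  the balance is taken for the first \<open>n\<close> modes along a time grid, stopped when these modes get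
  large, and the martingale part is then a finite transform of Brownian increments; the bound
  passes to the limit by Fatou's lemma. With the stability estimate and Markov's inequality, for
  \<open>t\<close> large two solutions from a ball are close to each other at time \<open>t\<close> with probability at
  least \<open>3/16\<close>, so \<open>P\<^sub>t \<phi>\<close> oscillates by at most \<open>7/8\<close> on the ball when \<open>\<phi>\<close> is Lipschitz with values
  in \<open>[0, 1]\<close>. If \<open>A\<close> is the positive set of a Hahn decomposition of \<open>\<mu>\<^sub>1 - \<mu>\<^sub>2\<close> and \<open>\<phi>\<close> approximates
  the indicator of \<open>A\<close>, then \<open>\<theta> = \<mu>\<^sub>1 A - \<mu>\<^sub>2 A\<close> is almost \<open>\<integral> P\<^sub>t \<phi> d\<mu>\<^sub>1 - \<integral> P\<^sub>t \<phi> d\<mu>\<^sub>2\<close>, which is at most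
  \<open>7/8 \<theta>\<close> up to a small error; so \<open>\<theta> = 0\<close>.\<close>

section \<open>The space of square integrable functions\<close>

text \<open>The noise may be degenerate, so no smoothing of the semigroup is at hand: the stability
  estimate brings two solutions together in the norm of \<open>H\<close> only, which says something
  about Lipschitz functions and nothing about indicators. Hence the time is chosen after the
  Lipschitz constant, and the Hahn set is approximated by functions that are Lipschitz in the norm
  of \<open>H\<close>; this works because the coordinates, which are such functions, generate the
  Borel sets of \<open>H\<^sup>m\<close>. One application of the contraction suffices, without
  iteration in time. The constants: the two dissipation integrals raise the exponent at the mean
  rate 3/2 C B/\<nu>^2 \<le> 3/16 \<nu>, below the decay rate \<nu>/4. The factor 3/2, where Ito's
  formula has 1, is the price of Young's inequality for the product of drift and noise increments.
  Markov's inequality then costs a probability near 3/4, rounded up to 13/16 for large times, and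
  closeness of the solutions another 1/16; together 7/8. Stopping makes the martingale part square
  integrable. The discretisation error is below 1 only off a small event; this bound and that event
  cost 1 each, the additive 2 of the energy bound.\<close>

lemma L2_rel_rep: "L2_rel (rep_L2 u) (rep_L2 u)"
  using Quotient_rep_reflp[OF Quotient_L2] .

lemma square_integrable_rep: "square_integrable (rep_L2 u)"
  using L2_rel_rep by (simp add: L2_rel_def)

lemma measurable_rep [measurable]: "rep_L2 u \<in> borel_measurable circle"
  using square_integrable_rep[of u] by (simp add: square_integrable_def)

lemma abs_rep_L2 [simp]: "abs_L2 (rep_L2 u) = u"
  using Quotient_abs_rep[OF Quotient_L2] .

lemma rep_abs_L2_AE:
  assumes "square_integrable f"
  shows "AE x in circle. rep_L2 (abs_L2 f) x = f x"
proof -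
  have "L2_rel f f" using assms by (simp add: L2_rel_def)
  then have "L2_rel (rep_L2 (abs_L2 f)) f"
    using Quotient_rep_abs[OF Quotient_L2] by blast
  then show ?thesis by (simp add: L2_rel_def)
qed

lemma abs_L2_eqI:
  assumes "square_integrable f" "square_integrable g" "AE x in circle. f x = g x"
  shows "abs_L2 f = abs_L2 g"
  using Quotient_rel_abs[OF Quotient_L2, of f g] assms by (simp add: L2_rel_def)

lemma L2_eqI:
  assumes "AE x in circle. rep_L2 u x = rep_L2 v x"
  shows "u = v"
  using abs_L2_eqI[OF square_integrable_rep square_integrable_rep assms] by simp

lemma measurable_square_integrable:
  "square_integrable f \<Longrightarrow> f \<in> borel_measurable circle"
  by (simp add: square_integrable_def)

lemma inner_L2_rep: "inner u v = (LINT x|circle. rep_L2 u x * rep_L2 v x)"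
  by (simp add: inner_L2_def)

lemma inner_abs_L2:
  assumes "square_integrable f" "square_integrable g"
  shows "inner (abs_L2 f) (abs_L2 g) = (LINT x|circle. f x * g x)"
  unfolding inner_L2_rep
  using rep_abs_L2_AE[OF assms(1)] rep_abs_L2_AE[OF assms(2)] assms[THEN measurable_square_integrable]
  by (intro integral_cong_AE) (auto elim: AE_mp)

lemma inner_abs_L2_right:
  assumes "square_integrable g"
  shows "inner u (abs_L2 g) = (LINT x|circle. rep_L2 u x * g x)"
  using inner_abs_L2[OF square_integrable_rep[of u] assms] by simp

lemma norm_L2_rep: "(norm u)\<^sup>2 = (LINT x|circle. (rep_L2 u x)\<^sup>2)" for u :: L2
  unfolding power2_norm_eq_inner inner_L2_rep by (simp add: power2_eq_square)

lemma norm_abs_L2: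
  assumes "square_integrable f"
  shows "(norm (abs_L2 f))\<^sup>2 = (LINT x|circle. (f x)\<^sup>2)"
  unfolding power2_norm_eq_inner inner_abs_L2[OF assms assms] by (simp add: power2_eq_square)

lemma abs_L2_add:
  assumes "square_integrable f" "square_integrable g"
  shows "abs_L2 (\<lambda>x. f x + g x) = abs_L2 f + abs_L2 g"
  by (subst plus_L2.abs_eq) (use assms in \<open>auto simp: eq_onp_def L2_rel_def\<close>)

lemma abs_L2_scale:
  assumes "square_integrable f"
  shows "abs_L2 (\<lambda>x. c * f x) = c *\<^sub>R abs_L2 f"
  by (subst scaleR_L2.abs_eq) (use assms in \<open>auto simp: eq_onp_def L2_rel_def\<close>)

lemma abs_L2_zero: "abs_L2 (\<lambda>x. 0) = 0"
  by (simp add: zero_L2_def)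

lemma abs_L2_diff:
  assumes "square_integrable f" "square_integrable g"
  shows "abs_L2 (\<lambda>x. f x - g x) = abs_L2 f - abs_L2 g"
  using abs_L2_add[OF assms(1) square_integrable_scale[OF assms(2), of "-1"]]
  by (simp add: abs_L2_scale[OF assms(2), of "-1", simplified])

lemma abs_L2_sum:
  assumes "finite A" "\<And>i. i \<in> A \<Longrightarrow> square_integrable (f i)"
  shows "square_integrable (\<lambda>x. \<Sum>i\<in>A. f i x) \<and> abs_L2 (\<lambda>x. \<Sum>i\<in>A. f i x) = (\<Sum>i\<in>A. abs_L2 (f i))"
  using assms
proof (induction A rule: finite_induct)
  case empty
  then show ?case by (simp add: square_integrable_0 abs_L2_zero)
next
  case (insert i A)
  then show ?case
    using abs_L2_add[of "f i" "\<lambda>x. \<Sum>i\<in>A. f i x"] square_integrable_add[of "f i" "\<lambda>x. \<Sum>i\<in>A. f i x"] by auto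
qed

lemma rep_diff_AE: "AE x in circle. rep_L2 (u - v) x = rep_L2 u x - rep_L2 v x"
proof -
  have si: "square_integrable (\<lambda>x. rep_L2 u x - rep_L2 v x)"
    using square_integrable_add[OF square_integrable_rep[of u] square_integrable_uminus[OF square_integrable_rep[of v]]]
    by simp
  have "abs_L2 (\<lambda>x. rep_L2 u x - rep_L2 v x) = u - v"
    using abs_L2_diff[OF square_integrable_rep square_integrable_rep, of u v] by simp
  with rep_abs_L2_AE[OF si] show ?thesis by simp
qed

section \<open>Integrable functions on the circle\<close>

lemma finite_measure_circle: "finite_measure circle"
  unfolding circle_def by (rule finite_measure_lebesgue_on) simp

interpretation circle: finite_measure circle
  by (rule finite_measure_circle)

lemma space_circle [simp]: "space circle = {0..2*pi}"
  by (simp add: circle_def)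

lemma measure_circle [simp]: "measure circle {0..2*pi} = 2 * pi"
  by (simp add: circle_def measure_restrict_space)

lemma integrable_square_integrable:
  assumes "square_integrable f" shows "integrable circle f"
proof -
  have "square_integrable (\<lambda>x. 1)" by (simp add: square_integrable_def)
  from square_integrable_mult[OF assms this] show ?thesis by simp
qed

lemma square_integrable_const: "square_integrable (\<lambda>x. c)"
  by (simp add: square_integrable_def)

lemma square_integrable_bounded:
  assumes "f \<in> borel_measurable circle" "AE x in circle. \<bar>f x\<bar> \<le> C"
  shows "square_integrable f"
  unfolding square_integrable_def
proof
  show "integrable circle (\<lambda>x. (f x)\<^sup>2)"
  proof (rule circle.integrable_const_bound[where B = "C\<^sup>2"])
    show "AE x in circle. norm ((f x)\<^sup>2) \<le> C\<^sup>2"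
      using assms(2)
    proof eventually_elim
      case (elim x)
      then have "\<bar>f x\<bar>^2 \<le> C^2" by (intro power_mono) auto
      then show ?case by simp
    qed
  qed (use assms in measurable)
qed (use assms in simp)

lemma continuous_imp_measurable_circle:
  assumes "continuous_on {0..2*pi} f" shows "f \<in> borel_measurable circle"
  unfolding circle_def using assms by (rule continuous_imp_measurable_on_sets_lebesgue) simp

lemma square_integrable_continuous:
  assumes "continuous_on {0..2*pi} (f :: real \<Rightarrow> real)"
  shows "square_integrable f"
proof -
  have "compact (f ` {0..2*pi})" using assms by (intro compact_continuous_image) auto
  then obtain C where C: "\<And>x. x \<in> {0..2*pi} \<Longrightarrow> \<bar>f x\<bar> \<le> C"
    using compact_imp_bounded[of "f ` {0..2*pi}"] unfolding bounded_iff by (metis imageI real_norm_def)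
  show ?thesis
    by (rule square_integrable_bounded[where C = C])
       (use C in \<open>auto intro!: AE_I2 continuous_imp_measurable_circle assms\<close>)
qed

lemma circle_integral_continuous:
  assumes "continuous_on {0..2*pi} (f :: real \<Rightarrow> real)"
  shows "(LINT x|circle. f x) = integral {0..2*pi} f" 
    and "integrable circle f"
  unfolding circle_def
   apply (rule lebesgue_integral_eq_integral)
  using integrable_square_integrable[OF square_integrable_continuous[OF assms]]
  by (auto simp: circle_def)

lemma norm_L2_tail_bound:
  assumes "AE x in circle. g x \<le> \<bar>rep_L2 u x\<bar>" "AE x in circle. 0 \<le> g x" "g \<in> borel_measurable circle"
  shows "(LINT x|circle. (g x)\<^sup>2) \<le> (norm u)\<^sup>2"
  unfolding norm_L2_rep
proof (rule integral_mono_AE')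
  show "integrable circle (\<lambda>x. (rep_L2 u x)\<^sup>2)"
    using square_integrable_rep[of u] by (simp add: square_integrable_def)
  show "AE x in circle. (g x)\<^sup>2 \<le> (rep_L2 u x)\<^sup>2"
    using assms(1,2) by eventually_elim (simp add: abs_le_square_iff[symmetric])
qed auto

text \<open>The excess of the limit \<open>v\<close> over the bound,
  \<open>max 0 (\<bar>v\<bar> - C)\<close>, is dominated pointwise by the modulus of
  \<open>v - u n\<close>, so its \<open>L2\<close> norm is 0. No almost everywhere convergent
  subsequence has to be extracted.\<close>

lemma AE_bounded_limit:
  assumes "\<And>n. AE x in circle. \<bar>rep_L2 (u n) x\<bar> \<le> C" "u \<longlonglongrightarrow> v"
  shows "AE x in circle. \<bar>rep_L2 v x\<bar> \<le> C"
proof -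
  define g where "g x = max 0 (\<bar>rep_L2 v x\<bar> - C)" for x
  have [measurable]: "g \<in> borel_measurable circle" unfolding g_def by measurable
  have le: "(LINT x|circle. (g x)\<^sup>2) \<le> (norm (v - u n))\<^sup>2" for n
  proof (rule norm_L2_tail_bound)
    show "AE x in circle. g x \<le> \<bar>rep_L2 (v - u n) x\<bar>"
      using assms(1)[of n] rep_diff_AE[of v "u n"] by eventually_elim (auto simp: g_def)
  qed (auto simp: g_def)
  have "(\<lambda>n. (norm (v - u n))\<^sup>2) \<longlonglongrightarrow> (norm (v - v))\<^sup>2"
    using assms(2) by (intro tendsto_intros)
  from LIMSEQ_le_const[OF this] le have "(LINT x|circle. (g x)\<^sup>2) \<le> 0" by auto
  moreover have int: "integrable circle (\<lambda>x. (g x)\<^sup>2)"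
  proof (rule Bochner_Integration.integrable_bound)
    show "integrable circle (\<lambda>x. (\<bar>rep_L2 v x\<bar> + \<bar>C\<bar>)\<^sup>2)"
      using square_integrable_add[OF _ square_integrable_const, of "\<lambda>x. \<bar>rep_L2 v x\<bar>" "\<bar>C\<bar>"] square_integrable_rep[of v]
      by (auto simp: square_integrable_def)
    show "AE x in circle. norm ((g x)\<^sup>2) \<le> norm ((\<bar>rep_L2 v x\<bar> + \<bar>C\<bar>)\<^sup>2)"
      by (rule AE_I2) (auto simp: g_def intro!: power_mono)
  qed auto
  ultimately have "(LINT x|circle. (g x)\<^sup>2) = 0"
    using integral_nonneg_AE[of "\<lambda>x. (g x)\<^sup>2" circle] by (auto intro: antisym)
  then have "AE x in circle. (g x)\<^sup>2 = 0"
    using integral_nonneg_eq_0_iff_AE[OF int] by auto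
  then show ?thesis by eventually_elim (auto simp: g_def)
qed

section \<open>Completeness of the space (Riesz-Fischer)\<close>

lemma L2_norm_L1_bound: "(LINT x|circle. \<bar>rep_L2 u x\<bar>) \<le> sqrt (2*pi) * norm u"
proof -
  have si: "square_integrable (\<lambda>x. \<bar>rep_L2 u x\<bar>)"
    using square_integrable_rep[of u] by (auto simp: square_integrable_def)
  have "(LINT x|circle. \<bar>rep_L2 u x\<bar>) = inner (abs_L2 (\<lambda>x. \<bar>rep_L2 u x\<bar>)) (abs_L2 (\<lambda>x. 1))"
    by (subst inner_abs_L2) (auto simp: si square_integrable_const)
  also have "\<dots> \<le> norm (abs_L2 (\<lambda>x. \<bar>rep_L2 u x\<bar>)) * norm (abs_L2 (\<lambda>x. 1))"
    by (rule norm_cauchy_schwarz)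
  also have "norm (abs_L2 (\<lambda>x. \<bar>rep_L2 u x\<bar>)) = norm u"
    by (rule power2_eq_imp_eq) (use norm_abs_L2[OF si] norm_L2_rep[of u] in auto)
  also have "norm (abs_L2 (\<lambda>x. 1)) = sqrt (2*pi)"
    by (rule power2_eq_imp_eq) (auto simp: norm_abs_L2 square_integrable_const)
  finally show ?thesis by (simp add: mult.commute)
qed

text \<open>Geometric decay of the increments makes their \<open>L1\<close> norms summable, so the
  representatives converge absolutely at almost every point. Fatou's lemma then turns the pointwise
  limit into a limit in norm.\<close>

lemma L2_complete_aux:
  fixes X :: "nat \<Rightarrow> L2"
  assumes fast: "\<And>n. norm (X (Suc n) - X n) \<le> (1/2)^n" and "Cauchy X"
  shows "convergent X"
proof -
  define g where "g n x = rep_L2 (X (Suc n)) x - rep_L2 (X n) x" for n x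
  have [measurable]: "g n \<in> borel_measurable circle" for n unfolding g_def by measurable
  have gi: "integrable circle (g n)" for n
    unfolding g_def using integrable_square_integrable[OF square_integrable_rep] by auto
  have gb: "(LINT x|circle. norm (g n x)) \<le> sqrt (2*pi) * (1/2)^n" for n
  proof -
    have "(LINT x|circle. norm (g n x)) = (LINT x|circle. \<bar>rep_L2 (X (Suc n) - X n) x\<bar>)"
      using rep_diff_AE[of "X (Suc n)" "X n"] by (intro integral_cong_AE) (auto simp: g_def elim: AE_mp)
    also have "\<dots> \<le> sqrt (2*pi) * norm (X (Suc n) - X n)" by (rule L2_norm_L1_bound)
    also have "\<dots> \<le> sqrt (2*pi) * (1/2)^n" by (intro mult_left_mono fast) auto
    finally show ?thesis .
  qed
  have "AE x in circle. summable (\<lambda>n. norm (g n x))"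
  proof -
    have "(\<integral>\<^sup>+x. (\<Sum>n. ennreal (norm (g n x))) \<partial>circle) = (\<Sum>n. \<integral>\<^sup>+x. ennreal (norm (g n x)) \<partial>circle)"
      by (rule nn_integral_suminf) auto
    also have "\<dots> = (\<Sum>n. ennreal (LINT x|circle. norm (g n x)))"
      using gi by (intro suminf_cong nn_integral_eq_integral) auto
    also have "\<dots> \<le> (\<Sum>n. ennreal (sqrt (2*pi) * (1/2)^n))"
      using gb by (intro suminf_le) (auto intro!: ennreal_leI)
    also have "\<dots> < \<infinity>"
      by (subst suminf_ennreal2) (auto intro!: summable_mult summable_geometric)
    finally have "AE x in circle. (\<Sum>n. ennreal (norm (g n x))) \<noteq> \<infinity>"
      by (intro nn_integral_noteq_infinite) auto
    then show ?thesis
      by eventually_elim (auto intro: summable_suminf_not_top)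
  qed
  then have conv: "AE x in circle. convergent (\<lambda>n. rep_L2 (X n) x)"
  proof eventually_elim
    case (elim x)
    then have "summable (\<lambda>n. g n x)" by (rule summable_norm_cancel)
    then have "convergent (\<lambda>n. \<Sum>i<n. g i x)" by (simp add: summable_iff_convergent)
    then have "convergent (\<lambda>n. rep_L2 (X n) x - rep_L2 (X 0) x)"
      by (simp add: g_def sum_lessThan_telescope[of "\<lambda>n. rep_L2 (X n) x"])
    then have "convergent (\<lambda>n. (rep_L2 (X n) x - rep_L2 (X 0) x) + rep_L2 (X 0) x)"
      by (intro convergent_add convergent_const)
    then show ?case by simp
  qed
  define f where "f x = lim (\<lambda>n. rep_L2 (X n) x)" for x
  have [measurable]: "f \<in> borel_measurable circle" unfolding f_def by measurable
  have lim: "AE x in circle. (\<lambda>n. rep_L2 (X n) x) \<longlonglongrightarrow> f x"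
    using conv by eventually_elim (simp add: f_def convergent_LIMSEQ_iff)
  \<comment> \<open>Fatou's lemma in the index \<open>m\<close>. It is stated for the nonnegative
    integral because \<open>f\<close> is not yet known to be square integrable.\<close>
  have key: "(\<integral>\<^sup>+x. ennreal ((rep_L2 (X n) x - f x)\<^sup>2) \<partial>circle) \<le> ennreal (e\<^sup>2)"
    if "\<And>m. m \<ge> n \<Longrightarrow> norm (X n - X m) \<le> e" for n e
  proof -
    have "(\<integral>\<^sup>+x. ennreal ((rep_L2 (X n) x - f x)\<^sup>2) \<partial>circle)
        = (\<integral>\<^sup>+x. liminf (\<lambda>m. ennreal ((rep_L2 (X n) x - rep_L2 (X m) x)\<^sup>2)) \<partial>circle)"
    proof (rule nn_integral_cong_AE)
      show "AE x in circle. ennreal ((rep_L2 (X n) x - f x)\<^sup>2) = liminf (\<lambda>m. ennreal ((rep_L2 (X n) x - rep_L2 (X m) x)\<^sup>2))"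
        using lim
      proof eventually_elim
        case (elim x)
        then have "(\<lambda>m. ennreal ((rep_L2 (X n) x - rep_L2 (X m) x)\<^sup>2)) \<longlonglongrightarrow> ennreal ((rep_L2 (X n) x - f x)\<^sup>2)"
          by (intro tendsto_intros tendsto_ennrealI)
        then show ?case by (intro lim_imp_Liminf[symmetric]) auto
      qed
    qed
    also have "\<dots> \<le> liminf (\<lambda>m. \<integral>\<^sup>+x. ennreal ((rep_L2 (X n) x - rep_L2 (X m) x)\<^sup>2) \<partial>circle)"
      by (rule nn_integral_liminf) auto
    also have "\<dots> \<le> liminf (\<lambda>m. ennreal (e\<^sup>2))"
    proof (rule Liminf_mono)
      show "\<forall>\<^sub>F m in sequentially. (\<integral>\<^sup>+x. ennreal ((rep_L2 (X n) x - rep_L2 (X m) x)\<^sup>2) \<partial>circle) \<le> ennreal (e\<^sup>2)"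
        using eventually_ge_at_top[of n]
      proof eventually_elim
        case (elim m)
        have "(\<integral>\<^sup>+x. ennreal ((rep_L2 (X n) x - rep_L2 (X m) x)\<^sup>2) \<partial>circle)
            = (\<integral>\<^sup>+x. ennreal ((rep_L2 (X n - X m) x)\<^sup>2) \<partial>circle)"
          using rep_diff_AE[of "X n" "X m"] by (intro nn_integral_cong_AE) (auto elim: AE_mp)
        also have "\<dots> = ennreal ((norm (X n - X m))\<^sup>2)"
          unfolding norm_L2_rep using square_integrable_rep[of "X n - X m"]
          by (intro nn_integral_eq_integral) (auto simp: square_integrable_def)
        also have "\<dots> \<le> ennreal (e\<^sup>2)" using that[OF elim] by (auto intro!: ennreal_leI power_mono)
        finally show ?case .
      qed
    qed
    also have "\<dots> = ennreal (e\<^sup>2)" by (simp add: Liminf_const)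
    finally show ?thesis .
  qed
  have ev: "\<exists>N. \<forall>n\<ge>N. \<forall>m\<ge>n. norm (X n - X m) \<le> e" if "e > 0" for e
    using CauchyD[OF \<open>Cauchy X\<close> that] by (meson less_imp_le order_trans)
  have sid: "square_integrable (\<lambda>x. rep_L2 (X n) x - f x)" if "\<And>m. m \<ge> n \<Longrightarrow> norm (X n - X m) \<le> e" for n e
    unfolding square_integrable_def
  proof
    show "integrable circle (\<lambda>x. (rep_L2 (X n) x - f x)\<^sup>2)"
      using key[OF that] by (intro integrableI_bounded) (auto intro: le_less_trans simp: less_top[symmetric] top_unique)
  qed measurable
  obtain N where N: "\<forall>n\<ge>N. \<forall>m\<ge>n. norm (X n - X m) \<le> 1" using ev[of 1] by auto
  \<comment> \<open>\<open>f\<close> is \<open>X N\<close> minus their difference, and the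
    difference is square integrable by \<open>sid\<close>.\<close>
  have "square_integrable (\<lambda>x. rep_L2 (X N) x + - (rep_L2 (X N) x - f x))"
    using N by (intro square_integrable_add square_integrable_uminus square_integrable_rep sid[of N 1]) auto
  then have sif: "square_integrable f" by simp
  have "X \<longlonglongrightarrow> abs_L2 f"
  proof (rule LIMSEQ_I)
    fix r :: real assume "r > 0"
    then obtain N where N: "\<forall>n\<ge>N. \<forall>m\<ge>n. norm (X n - X m) \<le> r/2" using ev[of "r/2"] by auto
    show "\<exists>no. \<forall>n\<ge>no. norm (X n - abs_L2 f) < r"
    proof (intro exI allI impI)
      fix n assume "n \<ge> N"
      with N have b: "\<And>m. m \<ge> n \<Longrightarrow> norm (X n - X m) \<le> r/2" by auto
      have "ennreal ((norm (X n - abs_L2 f))\<^sup>2) = ennreal (LINT x|circle. (rep_L2 (X n) x - f x)\<^sup>2)"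
        using norm_abs_L2[OF sid[OF b]] abs_L2_diff[OF square_integrable_rep sif, of "X n"] by simp
      also have "\<dots> = (\<integral>\<^sup>+x. ennreal ((rep_L2 (X n) x - f x)\<^sup>2) \<partial>circle)"
        using sid[OF b] by (intro nn_integral_eq_integral[symmetric]) (auto simp: square_integrable_def)
      also have "\<dots> \<le> ennreal ((r/2)\<^sup>2)" by (rule key[OF b])
      finally have "(norm (X n - abs_L2 f))\<^sup>2 \<le> (r/2)\<^sup>2" by (simp add: ennreal_le_iff)
      then have "norm (X n - abs_L2 f) \<le> r/2" using \<open>r > 0\<close> by (simp add: abs_le_square_iff[symmetric])
      then show "norm (X n - abs_L2 f) < r" using \<open>r > 0\<close> by simp
    qed
  qed
  then show ?thesis by (auto simp: convergent_def)
qed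

text \<open>A Cauchy sequence converges once a rapidly convergent subsequence does. Completeness is
  used twice later: for unordered Fourier sums, and for the existence of gauge integrals of
  continuous \<open>L2\<close>-valued functions.\<close>

instance L2 :: banach
proof
  fix X :: "nat \<Rightarrow> L2" assume X: "Cauchy X"
  have "\<forall>n. \<exists>N. \<forall>p\<ge>N. \<forall>q\<ge>N. norm (X p - X q) < (1/2)^n"
    using CauchyD[OF X] by (meson half_gt_zero_iff zero_less_one zero_less_power)
  then obtain N where N: "\<And>n p q. p \<ge> N n \<Longrightarrow> q \<ge> N n \<Longrightarrow> norm (X p - X q) < (1/2)^n" by metis
  define r where "r n = (\<Sum>i\<le>n. Suc (N i))" for n
  have r: "strict_mono r" by (rule strict_mono_Suc_iff[THEN iffD2]) (simp add: r_def)
  have rN: "r n \<ge> N n" for n unfolding r_def by (cases n) auto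
  have "convergent (X \<circ> r)"
  proof (rule L2_complete_aux)
    show "norm ((X \<circ> r) (Suc n) - (X \<circ> r) n) \<le> (1/2)^n" for n
      using N[of n "r (Suc n)" "r n"] rN[of n] strict_monoD[OF r, of n "Suc n"] by auto
    show "Cauchy (X \<circ> r)" using X r by (rule Cauchy_subseq_Cauchy)
  qed
  then obtain l where "(X \<circ> r) \<longlonglongrightarrow> l" by (auto simp: convergent_def)
  then show "convergent X" using Cauchy_converges_subseq[of X r l] X r unfolding convergent_def by auto
qed

section \<open>Completeness of the trigonometric system\<close>

lemma integral_cos_int:
  "integral {0..2*pi} (\<lambda>x. cos (of_int n * x)) = (if n = 0 then 2 * pi else 0)"
proof (cases "n = 0")
  case False
  have "((\<lambda>x. cos (of_int n * x)) has_integral (sin (of_int n * (2*pi)) / of_int n - sin (of_int n * 0) / of_int n)) {0..2*pi}"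
    by (rule fundamental_theorem_of_calculus)
       (use False in \<open>auto intro!: derivative_eq_intros simp flip: has_real_derivative_iff_has_vector_derivative\<close>)
  moreover have "sin (of_int n * (2*pi)) = 0" using sin_integer_2pi[of "of_int n"] by (simp add: mult_ac)
  ultimately show ?thesis using False by (simp add: integral_unique)
qed simp

lemma integral_sin_int:
  "integral {0..2*pi} (\<lambda>x. sin (of_int n * x)) = 0"
proof (cases "n = 0")
  case False
  have "((\<lambda>x. sin (of_int n * x)) has_integral (- cos (of_int n * (2*pi)) / of_int n - (- cos (of_int n * 0) / of_int n))) {0..2*pi}"
    by (rule fundamental_theorem_of_calculus)
       (use False in \<open>auto intro!: derivative_eq_intros simp flip: has_real_derivative_iff_has_vector_derivative\<close>)
  moreover have "cos (of_int n * (2*pi)) = 1" using cos_integer_2pi[of "of_int n"] by (simp add: mult_ac)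
  ultimately show ?thesis by (simp add: integral_unique)
qed simp

lemma continuous_basis_fun: "continuous_on S (basis_fun k)"
  unfolding basis_fun_def by (cases "k \<ge> 1") (auto intro!: continuous_intros)

lemma square_integrable_basis_fun: "square_integrable (basis_fun k)"
  by (intro square_integrable_continuous continuous_basis_fun)

lemma basis_fun_pos: "k \<ge> 1 \<Longrightarrow> basis_fun k = (\<lambda>x. cos (of_int k * x) / sqrt pi)"
  and basis_fun_neg: "k < 1 \<Longrightarrow> basis_fun k = (\<lambda>x. - sin (of_int k * x) / sqrt pi)"
  by (auto simp: basis_fun_def)

lemma integral_trig_products:
  "integral {0..2*pi} (\<lambda>x. cos (of_int j * x) * cos (of_int k * x)) =
     (if j = k then pi else 0) + (if j = -k then pi else 0)"
  "integral {0..2*pi} (\<lambda>x. sin (of_int j * x) * sin (of_int k * x)) =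
     (if j = k then pi else 0) - (if j = -k then pi else 0)"
  "integral {0..2*pi} (\<lambda>x. sin (of_int j * x) * cos (of_int k * x)) = 0"
proof -
  have i: "(\<lambda>x. cos (of_int n * x)) integrable_on {0..2*pi}" "(\<lambda>x. sin (of_int n * x)) integrable_on {0..2*pi}" for n
    by (intro integrable_continuous_real continuous_intros)+
  have "integral {0..2*pi} (\<lambda>x. cos (of_int j * x) * cos (of_int k * x)) =
     integral {0..2*pi} (\<lambda>x. (cos (of_int (j - k) * x) + cos (of_int (j + k) * x)) / 2)"
    by (simp add: cos_times_cos ring_distribs)
  also have "\<dots> = (integral {0..2*pi} (\<lambda>x. cos (of_int (j - k) * x)) + integral {0..2*pi} (\<lambda>x. cos (of_int (j + k) * x))) / 2"
    using i(1)[of "j-k"] i(1)[of "j+k"] by (simp only: integral_divide Henstock_Kurzweil_Integration.integral_add)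
  finally show "integral {0..2*pi} (\<lambda>x. cos (of_int j * x) * cos (of_int k * x)) =
     (if j = k then pi else 0) + (if j = -k then pi else 0)"
    by (simp only: integral_cos_int) auto
  have "integral {0..2*pi} (\<lambda>x. sin (of_int j * x) * sin (of_int k * x)) =
     integral {0..2*pi} (\<lambda>x. (cos (of_int (j - k) * x) - cos (of_int (j + k) * x)) / 2)"
    by (simp add: sin_times_sin ring_distribs)
  also have "\<dots> = (integral {0..2*pi} (\<lambda>x. cos (of_int (j - k) * x)) - integral {0..2*pi} (\<lambda>x. cos (of_int (j + k) * x))) / 2"
    using i(1)[of "j-k"] i(1)[of "j+k"] by (simp only: integral_divide Henstock_Kurzweil_Integration.integral_diff)
  finally show "integral {0..2*pi} (\<lambda>x. sin (of_int j * x) * sin (of_int k * x)) =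
     (if j = k then pi else 0) - (if j = -k then pi else 0)"
    by (simp only: integral_cos_int) auto
  have "integral {0..2*pi} (\<lambda>x. sin (of_int j * x) * cos (of_int k * x)) =
     integral {0..2*pi} (\<lambda>x. (sin (of_int (j + k) * x) + sin (of_int (j - k) * x)) / 2)"
    by (simp add: sin_times_cos ring_distribs)
  also have "\<dots> = (integral {0..2*pi} (\<lambda>x. sin (of_int (j + k) * x)) + integral {0..2*pi} (\<lambda>x. sin (of_int (j - k) * x))) / 2"
    using i(2)[of "j-k"] i(2)[of "j+k"] by (simp only: integral_divide Henstock_Kurzweil_Integration.integral_add)
  finally show "integral {0..2*pi} (\<lambda>x. sin (of_int j * x) * cos (of_int k * x)) = 0"
    by (simp only: integral_sin_int) auto
qed

lemma inner_e_basis: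
  assumes "j \<noteq> 0" "k \<noteq> 0"
  shows "inner (e_basis j) (e_basis k) = (if j = k then 1 else 0)"
proof -
  have "inner (e_basis j) (e_basis k) = integral {0..2*pi} (\<lambda>x. basis_fun j x * basis_fun k x)"
    unfolding e_basis_def inner_abs_L2[OF square_integrable_basis_fun square_integrable_basis_fun]
    by (intro circle_integral_continuous continuous_intros continuous_basis_fun)
  also have "\<dots> = (if j = k then 1 else 0)"
  proof -
    consider "j \<ge> 1" "k \<ge> 1" | "j \<ge> 1" "k < 1" | "j < 1" "k \<ge> 1" | "j < 1" "k < 1" by linarith
    then show ?thesis
    proof cases
      case 1
      then show ?thesis using integral_trig_products(1)[of j k]
        by (simp add: basis_fun_pos integral_divide)
    next
      case 2
      then show ?thesis using integral_trig_products(3)[of k j]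
        by (auto simp: basis_fun_pos basis_fun_neg mult.commute integral_divide)
    next
      case 3
      then show ?thesis using integral_trig_products(3)[of j k]
        by (auto simp: basis_fun_pos basis_fun_neg mult.commute integral_divide)
    next
      case 4
      then show ?thesis using integral_trig_products(2)[of j k] assms
        by (auto simp: basis_fun_neg integral_divide)
    qed
  qed
  finally show ?thesis .
qed

lemma norm_e_basis [simp]: "k \<noteq> 0 \<Longrightarrow> norm (e_basis k) = 1"
  using inner_e_basis[of k k] by (simp add: norm_eq_sqrt_inner)

text \<open>The product-to-sum formulas make this class an algebra, and \<open>cos\<close> with
  index 0 supplies the constants. It therefore contains every real polynomial in
  \<open>cos x\<close> and \<open>sin x\<close>, as an approximation by Stone-Weierstrass
  requires.\<close>

inductive trig_poly :: "(real \<Rightarrow> real) \<Rightarrow> bool" where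
  cos: "trig_poly (\<lambda>x. cos (of_int k * x))"
| sin: "trig_poly (\<lambda>x. sin (of_int k * x))"
| add: "trig_poly f \<Longrightarrow> trig_poly g \<Longrightarrow> trig_poly (\<lambda>x. f x + g x)"
| scale: "trig_poly f \<Longrightarrow> trig_poly (\<lambda>x. c * f x)"

lemma trig_poly_const: "trig_poly (\<lambda>x. c)"
  using trig_poly.scale[OF trig_poly.cos[of 0], of c] by simp

lemma trig_poly_mult_cos: "trig_poly g \<Longrightarrow> trig_poly (\<lambda>x. cos (of_int k * x) * g x)"
proof (induction rule: trig_poly.induct)
  case (cos j)
  have "(\<lambda>x::real. cos (of_int k * x) * cos (of_int j * x)) =
        (\<lambda>x. 1/2 * cos (of_int (k - j) * x) + 1/2 * cos (of_int (k + j) * x))"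
    by (simp add: cos_times_cos ring_distribs add_divide_distrib)
  then show ?case by (simp only:) (intro trig_poly.intros)
next
  case (sin j)
  have "(\<lambda>x::real. cos (of_int k * x) * sin (of_int j * x)) =
        (\<lambda>x. 1/2 * sin (of_int (k + j) * x) + (- 1/2) * sin (of_int (k - j) * x))"
    by (simp add: cos_times_sin ring_distribs diff_divide_distrib)
  then show ?case by (simp only:) (intro trig_poly.intros)
next
  case (add f g)
  then show ?case using trig_poly.add by (simp add: distrib_left)
next
  case (scale f c)
  then show ?case using trig_poly.scale[of _ c] by (simp add: mult.left_commute)
qed

lemma trig_poly_mult_sin: "trig_poly g \<Longrightarrow> trig_poly (\<lambda>x. sin (of_int k * x) * g x)"
proof (induction rule: trig_poly.induct)
  case (cos j)
  have "(\<lambda>x::real. sin (of_int k * x) * cos (of_int j * x)) =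
        (\<lambda>x. 1/2 * sin (of_int (k + j) * x) + 1/2 * sin (of_int (k - j) * x))"
    by (simp add: sin_times_cos ring_distribs add_divide_distrib)
  then show ?case by (simp only:) (intro trig_poly.intros)
next
  case (sin j)
  have "(\<lambda>x::real. sin (of_int k * x) * sin (of_int j * x)) =
        (\<lambda>x. 1/2 * cos (of_int (k - j) * x) + (- 1/2) * cos (of_int (k + j) * x))"
    by (simp add: sin_times_sin ring_distribs diff_divide_distrib)
  then show ?case by (simp only:) (intro trig_poly.intros)
next
  case (add f g)
  then show ?case using trig_poly.add by (simp add: distrib_left)
next
  case (scale f c)
  then show ?case using trig_poly.scale[of _ c] by (simp add: mult.left_commute)
qed

lemma trig_poly_mult: "trig_poly f \<Longrightarrow> trig_poly g \<Longrightarrow> trig_poly (\<lambda>x. f x * g x)"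
proof (induction rule: trig_poly.induct)
  case (add f1 f2)
  then show ?case using trig_poly.add by (simp add: distrib_right)
next
  case (scale f c)
  then show ?case using trig_poly.scale[of _ c] by (simp add: mult.assoc)
qed (auto intro: trig_poly_mult_cos trig_poly_mult_sin)

lemma trig_poly_real_polynomial:
  fixes p :: "complex \<Rightarrow> real"
  assumes "real_polynomial_function p"
  shows "trig_poly (\<lambda>x. p (cis x))"
  using assms
proof (induction rule: real_polynomial_function.induct)
  case (linear f)
  interpret bounded_linear f by fact
  have "f (cis x) = f 1 * cos (of_int 1 * x) + f \<i> * sin (of_int 1 * x)" for x
  proof -
    have "cis x = cos x *\<^sub>R 1 + sin x *\<^sub>R \<i>" by (simp add: complex_eq_iff)
    then show ?thesis by (simp only: add scaleR) (simp add: mult.commute)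
  qed
  then show ?case by (simp only:) (intro trig_poly.intros)
qed (auto intro: trig_poly_const trig_poly.add trig_poly_mult)

lemma trig_poly_continuous: "trig_poly f \<Longrightarrow> continuous_on S f"
  by (induction rule: trig_poly.induct) (auto intro!: continuous_intros)

lemma inner_abs_cos_sin_zero:
  assumes "(LINT x|circle. rep_L2 v x) = 0" "\<And>k. k \<noteq> 0 \<Longrightarrow> inner v (e_basis k) = 0"
  shows "(LINT x|circle. rep_L2 v x * cos (of_int k * x)) = 0"
    and "(LINT x|circle. rep_L2 v x * sin (of_int k * x)) = 0"
proof -
  have c: "(LINT x|circle. rep_L2 v x * cos (of_int k * x)) = 0" if "k \<ge> 1" for k
    using assms(2)[of k] that unfolding e_basis_def inner_abs_L2_right[OF square_integrable_basis_fun]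
    by (simp add: basis_fun_pos)
  have s: "(LINT x|circle. rep_L2 v x * sin (of_int k * x)) = 0" if "k < 0" for k
    using assms(2)[of k] that unfolding e_basis_def inner_abs_L2_right[OF square_integrable_basis_fun]
    by (simp add: basis_fun_neg)
  consider "k \<ge> 1" | "k = 0" | "k < 0" by linarith
  then show "(LINT x|circle. rep_L2 v x * cos (of_int k * x)) = 0"
    by cases (use c[of k] c[of "-k"] assms(1) in auto)
  consider "k \<ge> 1" | "k = 0" | "k < 0" by linarith
  then show "(LINT x|circle. rep_L2 v x * sin (of_int k * x)) = 0"
    by cases (use s[of k] s[of "-k"] in auto)
qed

lemma integrable_rep_mult_continuous:
  assumes "continuous_on {0..2*pi} f"
  shows "integrable circle (\<lambda>x. rep_L2 v x * f x)"
  by (intro square_integrable_mult square_integrable_rep square_integrable_continuous assms)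

lemma orthogonal_trig_poly:
  assumes "(LINT x|circle. rep_L2 v x) = 0" "\<And>k. k \<noteq> 0 \<Longrightarrow> inner v (e_basis k) = 0" "trig_poly f"
  shows "(LINT x|circle. rep_L2 v x * f x) = 0"
  using assms(3)
proof (induction rule: trig_poly.induct)
  case (add f g)
  then show ?case
    using integrable_rep_mult_continuous[OF trig_poly_continuous] by (simp add: distrib_left)
next
  case (scale f c)
  then show ?case by (simp add: mult.left_commute)
qed (use inner_abs_cos_sin_zero[OF assms(1,2)] in auto)

text \<open>Stone-Weierstrass is applied on the unit circle of the complex plane, where periodicity
  is built in: polynomials restricted to it and composed with \<open>cis\<close> are trigonometric
  polynomials, to which \<open>v\<close> is orthogonal.\<close>

lemma orthogonal_circle_continuous:
  fixes g :: "complex \<Rightarrow> real"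
  assumes "(LINT x|circle. rep_L2 v x) = 0" "\<And>k. k \<noteq> 0 \<Longrightarrow> inner v (e_basis k) = 0"
    and g: "continuous_on UNIV g"
  shows "(LINT x|circle. rep_L2 v x * g (cis x)) = 0"
proof -
  let ?V = "rep_L2 v"
  have V: "integrable circle ?V" by (rule integrable_square_integrable[OF square_integrable_rep])
  have cg: "continuous_on S (\<lambda>x. g (cis x))" for S
    by (rule continuous_on_compose2[OF g]) (auto intro!: continuous_intros)
  have "\<bar>LINT x|circle. ?V x * g (cis x)\<bar> \<le> e * (LINT x|circle. \<bar>?V x\<bar>)" if e: "e > 0" for e
  proof -
    obtain p where p: "real_polynomial_function p" "\<And>z. z \<in> sphere 0 1 \<Longrightarrow> \<bar>g z - p z\<bar> < e"
      by (rule Stone_Weierstrass_real_polynomial_function[of "sphere 0 1" g e])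
         (use g e in \<open>auto intro: continuous_on_subset\<close>)
    have tp: "trig_poly (\<lambda>x. p (cis x))" by (rule trig_poly_real_polynomial[OF p(1)])
    have "(LINT x|circle. ?V x * g (cis x)) = (LINT x|circle. ?V x * g (cis x)) - (LINT x|circle. ?V x * p (cis x))"
      using orthogonal_trig_poly[OF assms(1,2) tp] by simp
    also have "\<dots> = (LINT x|circle. ?V x * (g (cis x) - p (cis x)))"
      using integrable_rep_mult_continuous[OF cg] integrable_rep_mult_continuous[OF trig_poly_continuous[OF tp]]
      by (simp add: right_diff_distrib)
    also have "\<bar>\<dots>\<bar> \<le> (LINT x|circle. \<bar>?V x * (g (cis x) - p (cis x))\<bar>)"
      by (rule integral_abs_bound)
    also have "\<dots> \<le> (LINT x|circle. e * \<bar>?V x\<bar>)"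
    proof (rule integral_mono')
      show "integrable circle (\<lambda>x. e * \<bar>?V x\<bar>)" using V by simp
      show "\<bar>?V x * (g (cis x) - p (cis x))\<bar> \<le> e * \<bar>?V x\<bar>" for x
        using p(2)[of "cis x"] by (simp add: abs_mult mult.commute[of e] mult_left_mono)
    qed (use e in auto)
    finally show ?thesis by simp
  qed
  note bound = this
  show ?thesis
  proof (rule ccontr)
    define L where "L = (LINT x|circle. ?V x * g (cis x))"
    define I where "I = (LINT x|circle. \<bar>?V x\<bar>)"
    assume "(LINT x|circle. ?V x * g (cis x)) \<noteq> 0"
    then have "\<bar>L\<bar> > 0" by (simp add: L_def)
    have "I \<ge> 0" by (simp add: I_def)
    \<comment> \<open>The bound is used with \<open>e\<close> equal to
      \<open>\<bar>L\<bar> / (2 * (I + 1))\<close>; the summand 1 keeps the denominator positive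
      when \<open>I\<close> is 0.\<close>
    then have "\<bar>L\<bar> \<le> \<bar>L\<bar> / (2 * (I + 1)) * I"
      unfolding L_def I_def using bound \<open>\<bar>L\<bar> > 0\<close>[unfolded L_def]
      by (metis add_nonneg_pos divide_pos_pos mult_pos_pos zero_less_numeral zero_less_one)
    also have "\<dots> < \<bar>L\<bar>" using \<open>I \<ge> 0\<close> \<open>\<bar>L\<bar> > 0\<close> by (simp add: field_simps add_nonneg_pos)
    finally show False by simp
  qed
qed

lemma cis_eq_in_period:
  assumes "cis x = cis y" "0 \<le> x" "x < 2*pi" "0 \<le> y" "y < 2*pi"
  shows "x = y"
proof -
  have "sin x = sin y \<and> cos x = cos y" using assms(1) by (simp add: complex_eq_iff)
  then obtain n :: int where n: "x = y + 2 * pi * of_int n" unfolding sin_cos_eq_iff by auto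
  have a: "2 * pi * of_int n < 2 * pi * 1" and b: "2 * pi * (-1) < 2 * pi * of_int n" using n assms by linarith+
  have "of_int n < (1::real)" "-1 < (of_int n :: real)"
    using mult_left_less_imp_less[OF a] mult_left_less_imp_less[OF b] by simp_all
  then have "n = 0" by linarith
  then show ?thesis using n by simp
qed


lemma AE_circle_not_2pi: "AE x in circle. x \<noteq> 2*pi"
  unfolding circle_def
  by (rule AE_restrict_space_iff[THEN iffD2]) (auto intro: AE_I'[where N = "{2*pi}"])

lemma orthogonal_compact:
  assumes v: "(LINT x|circle. rep_L2 v x) = 0" "\<And>k. k \<noteq> 0 \<Longrightarrow> inner v (e_basis k) = 0"
    and T: "compact T" "T \<subseteq> {0..<2*pi}"
  shows "(LINT x|circle. rep_L2 v x * indicator T x) = 0"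
proof (cases "T = {}")
  case False
  define g where "g n z = max 0 (1 - real n * infdist z (cis ` T))" for n z
  have cg: "continuous_on S (g n)" for n S
    unfolding g_def by (intro continuous_intros)
  have closed: "closed (cis ` T)"
    by (intro compact_imp_closed compact_continuous_image T continuous_intros)
  have lim: "(\<lambda>n. g n z) \<longlonglongrightarrow> indicator (cis ` T) z" for z
  proof (cases "z \<in> cis ` T")
    case True
    then show ?thesis by (simp add: g_def)
  next
    case nz: False
    then have pos: "infdist z (cis ` T) > 0"
      using infdist_pos_not_in_closed[OF closed] False by auto
    have "\<forall>\<^sub>F n in sequentially. g n z = 0"
    proof -
      obtain N :: nat where N: "1 / infdist z (cis ` T) < real N" using reals_Archimedean2 by blast
      show ?thesis
        using eventually_ge_at_top[of N]
      proof eventually_elim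
        case (elim n)
        have "1 < real N * infdist z (cis ` T)" using N pos by (simp add: field_simps)
        also have "\<dots> \<le> real n * infdist z (cis ` T)" using elim pos by (intro mult_right_mono) auto
        finally show ?case by (simp add: g_def)
      qed
    qed
    then show ?thesis using nz by (simp add: tendsto_eventually)
  qed
  have "(\<lambda>n. LINT x|circle. rep_L2 v x * g n (cis x)) \<longlonglongrightarrow> (LINT x|circle. rep_L2 v x * indicator T x)"
  proof (rule integral_dominated_convergence[where w = "\<lambda>x. \<bar>rep_L2 v x\<bar>"])
    show "integrable circle (\<lambda>x. \<bar>rep_L2 v x\<bar>)"
      using integrable_square_integrable[OF square_integrable_rep[of v]] by simp
    have "T \<in> sets lebesgue" using T(1) by (simp add: compact_imp_closed)
    then have "T \<in> sets circle" using T(2) by (auto simp: circle_def sets_restrict_space_iff)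
    then show "(\<lambda>x. rep_L2 v x * indicator T x) \<in> borel_measurable circle" by measurable
    show "(\<lambda>x. rep_L2 v x * g n (cis x)) \<in> borel_measurable circle" for n
      by (intro borel_measurable_times measurable_rep continuous_imp_measurable_circle
           continuous_on_compose2[OF cg[of UNIV]]) (auto intro!: continuous_intros)
    show "AE x in circle. (\<lambda>n. rep_L2 v x * g n (cis x)) \<longlonglongrightarrow> rep_L2 v x * indicator T x"
      using AE_circle_not_2pi AE_space
    proof eventually_elim
      case (elim x)
      have "(cis x \<in> cis ` T) = (x \<in> T)"
        using cis_eq_in_period[of x] elim T(2) by force
      then have "(indicator (cis ` T) (cis x) :: real) = indicator T x" by (simp add: indicator_def)
      with tendsto_mult[OF tendsto_const lim[of "cis x"]] show ?case by metis
    qed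
    show "AE x in circle. norm (rep_L2 v x * g n (cis x)) \<le> \<bar>rep_L2 v x\<bar>" for n
      by (rule AE_I2) (auto simp: g_def abs_mult infdist_nonneg intro!: mult_left_le)
  qed
  moreover have "(LINT x|circle. rep_L2 v x * g n (cis x)) = 0" for n
    by (rule orthogonal_circle_continuous[OF v cg])
  ultimately show ?thesis by (simp add: LIMSEQ_const_iff)
qed simp

text \<open>If \<open>v\<close> were positive on a set of positive measure, inner regularity would
  give a compact subset of positive measure. But the integral of \<open>v\<close> over each compact
  \<open>T\<close> vanishes, and as \<open>v\<close> is positive there, \<open>T\<close> must be
  null.\<close>

lemma orthogonal_imp_nonpos:
  assumes v: "(LINT x|circle. rep_L2 v x) = 0" "\<And>k. k \<noteq> 0 \<Longrightarrow> inner v (e_basis k) = 0"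
  shows "AE x in circle. rep_L2 v x \<le> 0"
proof -
  define S where "S = {x \<in> {0..<2*pi}. rep_L2 v x > 0}"
  have "{x \<in> space circle. rep_L2 v x > 0} \<in> sets circle" by measurable
  then have "{x \<in> {0..2*pi}. rep_L2 v x > 0} \<in> sets lebesgue"
    by (simp add: circle_def sets_restrict_space_iff)
  then have "{x \<in> {0..2*pi}. rep_L2 v x > 0} - {2*pi} \<in> sets lebesgue" by (intro sets.Diff) auto
  moreover have "{x \<in> {0..2*pi}. rep_L2 v x > 0} - {2*pi} = S" by (auto simp: S_def)
  ultimately have S: "S \<in> sets lebesgue" by simp
  have null: "emeasure lebesgue S = 0"
  proof (rule ccontr)
    assume nz: "emeasure lebesgue S \<noteq> 0"
    have "emeasure lebesgue S \<le> emeasure lebesgue {0..2*pi}"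
      by (rule emeasure_mono) (auto simp: S_def)
    then have fin: "emeasure lebesgue S < \<infinity>" by (simp add: le_less_trans)
    have mpos: "measure lebesgue S > 0"
      using nz fin by (simp add: measure_def enn2real_positive_iff zero_less_iff_neq_zero)
    obtain T where T: "closed T" "T \<subseteq> S" "S - T \<in> lmeasurable" "emeasure lebesgue (S - T) < ennreal (measure lebesgue S)"
      using sets_lebesgue_inner_closed[OF S mpos] by blast
    have "bounded T" by (rule bounded_subset[of "{0..2*pi}"]) (use T(2) in \<open>auto simp: S_def\<close>)
    with T(1) have cT: "compact T" by (simp add: compact_eq_bounded_closed)
    have TS: "T \<subseteq> {0..<2*pi}" using T(2) by (auto simp: S_def)
    have Tl: "T \<in> sets lebesgue" using T(1) by simp
    have Tc: "T \<in> sets circle" using TS Tl by (auto simp: circle_def sets_restrict_space_iff)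
    have "(LINT x|circle. rep_L2 v x * indicator T x) = 0" by (rule orthogonal_compact[OF v cT TS])
    moreover have "integrable circle (\<lambda>x. rep_L2 v x * indicator T x)"
      using integrable_real_mult_indicator[OF Tc integrable_square_integrable[OF square_integrable_rep[of v]]] .
    moreover have "AE x in circle. 0 \<le> rep_L2 v x * indicator T x"
      using T(2) by (intro AE_I2) (auto simp: S_def indicator_def)
    ultimately have "AE x in circle. rep_L2 v x * indicator T x = 0"
      using integral_nonneg_eq_0_iff_AE by blast
    then have "AE x in circle. x \<notin> T"
      by eventually_elim (use T(2) in \<open>auto simp: S_def indicator_def\<close>)
    then have "emeasure circle T = 0"
      using AE_iff_null_sets[OF Tc] by auto
    moreover have "emeasure circle T = emeasure lebesgue T"
      unfolding circle_def using TS by (intro emeasure_restrict_space) auto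
    ultimately have T0: "emeasure lebesgue T = 0" by simp
    have "emeasure lebesgue S = emeasure lebesgue (S - T) + emeasure lebesgue T"
      using T(2) S Tl by (subst plus_emeasure) (auto simp: Un_absorb2)
    also have "\<dots> = emeasure lebesgue (S - T)" using T0 by simp
    also note T(4)
    finally show False using fin by (simp add: emeasure_eq_ennreal_measure)
  qed
  have "AE x in lebesgue. x \<notin> S"
    using null S by (intro AE_not_in) (auto simp: null_sets_def)
  then have "AE x in circle. x \<notin> S"
    unfolding circle_def by (subst AE_restrict_space_iff) (auto elim: AE_mp)
  then show ?thesis using AE_circle_not_2pi AE_space
    by eventually_elim (auto simp: S_def)
qed

lemma rep_uminus_AE: "AE x in circle. rep_L2 (- u) x = - rep_L2 u x"
proof -
  have "abs_L2 (\<lambda>x. (-1) * rep_L2 u x) = - u"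
    using abs_L2_scale[OF square_integrable_rep[of u], of "-1"] by simp
  with rep_abs_L2_AE[OF square_integrable_uminus[OF square_integrable_rep[of u]]] show ?thesis by simp
qed

text \<open>The hypotheses are symmetric under \<open>v \<mapsto> - v\<close>, so the sign result
  holds for both and leaves only 0.\<close>

lemma trigonometric_system_complete:
  assumes v: "(LINT x|circle. rep_L2 v x) = 0" "\<And>k. k \<noteq> 0 \<Longrightarrow> inner v (e_basis k) = 0"
  shows "v = 0"
proof -
  have v_nonpos: "AE x in circle. rep_L2 v x \<le> 0" by (rule orthogonal_imp_nonpos) (use v in auto)
  have "(LINT x|circle. rep_L2 (- v) x) = (LINT x|circle. - rep_L2 v x)"
    by (rule integral_cong_AE) (use rep_uminus_AE[of v] in auto)
  then have "(LINT x|circle. rep_L2 (- v) x) = 0" using v(1) by simp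
  then have "AE x in circle. rep_L2 (- v) x \<le> 0"
    by (rule orthogonal_imp_nonpos) (simp add: v(2))
  then have "AE x in circle. rep_L2 v x = 0"
    using v_nonpos rep_uminus_AE[of v] by eventually_elim simp
  then show ?thesis
    using abs_L2_eqI[OF square_integrable_rep square_integrable_0] by (simp add: abs_L2_zero)
qed

section \<open>Fourier series\<close>

definition l2 :: "(int \<Rightarrow> real) \<Rightarrow> bool" where
  "l2 c \<longleftrightarrow> (\<lambda>k. (c k)\<^sup>2) summable_on nonzero_ints"

text \<open>The inverse of taking coefficients. The value of \<open>c\<close> at 0 is ignored, and
  for a sequence that is not summable the infinite sum takes its default value 0, which still has
  mean zero.\<close>

definition synth :: "(int \<Rightarrow> real) \<Rightarrow> L2" where
  "synth c = (\<Sum>\<^sub>\<infinity>k\<in>nonzero_ints. c k *\<^sub>R e_basis k)"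

lemma inner_sum_basis:
  assumes "finite F" "F \<subseteq> nonzero_ints" "j \<noteq> 0"
  shows "inner (\<Sum>k\<in>F. c k *\<^sub>R e_basis k) (e_basis j) = (if j \<in> F then c j else 0)"
proof -
  have "inner (\<Sum>k\<in>F. c k *\<^sub>R e_basis k) (e_basis j) = (\<Sum>k\<in>F. if k = j then c k else 0)"
    unfolding inner_sum_left
  proof (intro sum.cong refl)
    fix k assume "k \<in> F"
    then have "k \<noteq> 0" using assms(2) by auto
    then show "inner (c k *\<^sub>R e_basis k) (e_basis j) = (if k = j then c k else 0)"
      using assms(3) by (simp add: inner_e_basis)
  qed
  then show ?thesis using assms(1) by simp
qed

lemma norm_sum_basis:
  assumes "finite F" "F \<subseteq> nonzero_ints"
  shows "(norm (\<Sum>k\<in>F. c k *\<^sub>R e_basis k))\<^sup>2 = (\<Sum>k\<in>F. (c k)\<^sup>2)"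
proof -
  have "(norm (\<Sum>k\<in>F. c k *\<^sub>R e_basis k))\<^sup>2 =
      (\<Sum>j\<in>F. c j * inner (\<Sum>k\<in>F. c k *\<^sub>R e_basis k) (e_basis j))"
    unfolding power2_norm_eq_inner
    by (subst inner_sum_right) simp
  also have "\<dots> = (\<Sum>k\<in>F. (c k)\<^sup>2)"
    using assms by (intro sum.cong refl) (subst inner_sum_basis, auto simp: power2_eq_square)
  finally show ?thesis .
qed

text \<open>Cauchy criterion along the filter of finite index sets: two sets that both capture
  almost all of the sum of squares are each compared with their union, and there Pythagoras bounds
  the difference by the missing squares.\<close>

lemma summable_on_basis:
  assumes "l2 c"
  shows "(\<lambda>k. c k *\<^sub>R e_basis k) summable_on nonzero_ints"
proof -
  let ?f = "\<lambda>k. c k *\<^sub>R e_basis k" and ?A = nonzero_ints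
  define S where "S = (\<Sum>\<^sub>\<infinity>k\<in>?A. (c k)\<^sup>2)"
  have hs: "((\<lambda>k. (c k)\<^sup>2) has_sum S) ?A"
    using assms by (simp add: l2_def S_def)
  have "\<exists>P. eventually P (finite_subsets_at_top ?A) \<and>
              (\<forall>F F'. P F \<and> P F' \<longrightarrow> dist (sum ?f F) (sum ?f F') < e)" if e: "e > 0" for e
  proof -
    define P where "P F \<longleftrightarrow> finite F \<and> F \<subseteq> ?A \<and> (\<Sum>k\<in>F. (c k)\<^sup>2) > S - (e/2)\<^sup>2" for F
    have "eventually P (finite_subsets_at_top ?A)"
    proof -
      have "eventually (\<lambda>F. (\<Sum>k\<in>F. (c k)\<^sup>2) > S - (e/2)\<^sup>2) (finite_subsets_at_top ?A)"
        using hs[unfolded has_sum_def] e by (intro order_tendstoD(1)[where y = S]) auto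
      then show ?thesis
        unfolding P_def by (auto simp: eventually_conj_iff eventually_finite_subsets_at_top_weakI)
    qed
    moreover have "dist (sum ?f F) (sum ?f F') < e" if "P F" "P F'" for F F'
    proof -
      have half: "norm (sum ?f (F1 \<union> F2) - sum ?f F1) < e/2" if "P F1" "P F2" for F1 F2
      proof -
        have fin: "finite F1" "finite F2" "F1 \<subseteq> ?A" "F2 \<subseteq> ?A" using that by (auto simp: P_def)
        have "sum ?f (F1 \<union> F2) - sum ?f F1 = sum ?f (F2 - F1)"
          using fin by (subst sum_diff[symmetric]) (auto intro!: sum.cong)
        then have "(norm (sum ?f (F1 \<union> F2) - sum ?f F1))\<^sup>2 = (\<Sum>k\<in>F2 - F1. (c k)\<^sup>2)"
          using fin by (simp only:) (rule norm_sum_basis, auto)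
        also have "\<dots> = (\<Sum>k\<in>F1 \<union> F2. (c k)\<^sup>2) - (\<Sum>k\<in>F1. (c k)\<^sup>2)"
          using fin by (subst sum_diff[symmetric]) (auto intro!: sum.cong)
        also have "(\<Sum>k\<in>F1 \<union> F2. (c k)\<^sup>2) \<le> S"
          using fin by (intro has_sum_mono_neutral[OF has_sum_finite hs]) auto
        finally have "(norm (sum ?f (F1 \<union> F2) - sum ?f F1))\<^sup>2 < (e/2)\<^sup>2"
          using that(1) by (simp add: P_def)
        then show ?thesis by (rule power2_less_imp_less) (use e in simp)
      qed
      have "dist (sum ?f F) (sum ?f F') \<le> dist (sum ?f (F \<union> F')) (sum ?f F) + dist (sum ?f (F \<union> F')) (sum ?f F')"
        by (rule dist_triangle3)
      then show ?thesis
        using half[OF that] half[OF that(2,1)] unfolding dist_norm Un_commute[of F' F] by linarith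
    qed
    ultimately show ?thesis by blast
  qed
  then have "cauchy_filter (filtermap (sum ?f) (finite_subsets_at_top ?A))"
    by (simp add: cauchy_filter_metric_filtermap)
  moreover note complete_UNIV[where 'a = L2]
  ultimately obtain L' where "(sum ?f \<longlongrightarrow> L') (finite_subsets_at_top ?A)"
    using complete_uniform[where S=UNIV] by (force simp add: filterlim_def)
  then show ?thesis
    using summable_on_def has_sum_def by blast
qed

lemma has_sum_synth: "l2 c \<Longrightarrow> ((\<lambda>k. c k *\<^sub>R e_basis k) has_sum synth c) nonzero_ints"
  unfolding synth_def by (rule has_sum_infsum[OF summable_on_basis])

lemma inner_synth:
  assumes "l2 c" "j \<noteq> 0"
  shows "inner (synth c) (e_basis j) = c j"
proof -
  have "((\<lambda>F. inner (\<Sum>k\<in>F. c k *\<^sub>R e_basis k) (e_basis j)) \<longlongrightarrow> inner (synth c) (e_basis j)) (finite_subsets_at_top nonzero_ints)"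
    using has_sum_synth[OF assms(1)] unfolding has_sum_def by (intro tendsto_intros)
  moreover have "((\<lambda>F. inner (\<Sum>k\<in>F. c k *\<^sub>R e_basis k) (e_basis j)) \<longlongrightarrow> c j) (finite_subsets_at_top nonzero_ints)"
  proof (rule tendsto_eventually)
    show "\<forall>\<^sub>F F in finite_subsets_at_top nonzero_ints. inner (\<Sum>k\<in>F. c k *\<^sub>R e_basis k) (e_basis j) = c j"
      unfolding eventually_finite_subsets_at_top
      using assms(2) by (intro exI[of _ "{j}"]) (auto simp: inner_sum_basis)
  qed
  ultimately show ?thesis by (rule tendsto_unique[rotated]) simp
qed

lemma norm_synth:
  assumes "l2 c"
  shows "((\<lambda>k. (c k)\<^sup>2) has_sum (norm (synth c))\<^sup>2) nonzero_ints"
  unfolding has_sum_def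
proof (rule Lim_transform_eventually)
  show "((\<lambda>F. (norm (\<Sum>k\<in>F. c k *\<^sub>R e_basis k))\<^sup>2) \<longlongrightarrow> (norm (synth c))\<^sup>2) (finite_subsets_at_top nonzero_ints)"
    using has_sum_synth[OF assms] unfolding has_sum_def by (intro tendsto_intros)
  show "\<forall>\<^sub>F F in finite_subsets_at_top nonzero_ints. (norm (\<Sum>k\<in>F. c k *\<^sub>R e_basis k))\<^sup>2 = (\<Sum>k\<in>F. (c k)\<^sup>2)"
    by (rule eventually_finite_subsets_at_top_weakI) (rule norm_sum_basis)
qed

lemma norm_synth_infsum: "l2 c \<Longrightarrow> (norm (synth c))\<^sup>2 = (\<Sum>\<^sub>\<infinity>k\<in>nonzero_ints. (c k)\<^sup>2)"
  using infsumI[OF norm_synth] by simp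

lemma bessel_finite:
  assumes "finite F" "F \<subseteq> nonzero_ints"
  shows "(\<Sum>k\<in>F. (inner u (e_basis k))\<^sup>2) \<le> (norm u)\<^sup>2"
proof -
  let ?s = "\<Sum>k\<in>F. inner u (e_basis k) *\<^sub>R e_basis k"
  have "inner u ?s = (\<Sum>k\<in>F. (inner u (e_basis k))\<^sup>2)"
    by (simp add: inner_sum_right power2_eq_square)
  moreover have "(norm (u - ?s))\<^sup>2 = (norm u)\<^sup>2 - 2 * inner u ?s + (norm ?s)\<^sup>2"
    by (simp add: power2_norm_eq_inner inner_diff_left inner_diff_right inner_commute)
  moreover have "0 \<le> (norm (u - ?s))\<^sup>2" by simp
  ultimately show ?thesis using norm_sum_basis[OF assms, of "\<lambda>k. inner u (e_basis k)"] by linarith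
qed

lemma l2_inner: "l2 (\<lambda>k. inner u (e_basis k))"
  unfolding l2_def
  by (rule nonneg_bdd_above_summable_on) (auto intro!: bdd_aboveI2[where M = "(norm u)\<^sup>2"] bessel_finite)

lemma l2_mono:
  assumes "l2 c" "\<And>k. k \<noteq> 0 \<Longrightarrow> \<bar>d k\<bar> \<le> C * \<bar>c k\<bar>"
  shows "l2 d"
  unfolding l2_def
proof (rule summable_on_comparison_test)
  show "(\<lambda>k. C\<^sup>2 * (c k)\<^sup>2) summable_on nonzero_ints"
    using assms(1) unfolding l2_def by (rule summable_on_cmult_right)
  show "(d k)\<^sup>2 \<le> C\<^sup>2 * (c k)\<^sup>2" if "k \<in> nonzero_ints" for k
    using power_mono[OF assms(2)[of k] abs_ge_zero, of 2] that by (simp add: power_mult_distrib)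
qed auto

text \<open>The bound for Fourier multipliers with symbol at most \<open>C\<close>. The estimates
  for the Hilbert transform, the velocity, the heat semigroup and the truncation errors are all
  instances.\<close>

lemma norm_synth_mono:
  assumes "l2 c" "\<And>k. k \<noteq> 0 \<Longrightarrow> \<bar>d k\<bar> \<le> C * \<bar>c k\<bar>" "C \<ge> 0"
  shows "norm (synth d) \<le> C * norm (synth c)"
proof -
  have "(norm (synth d))\<^sup>2 \<le> C\<^sup>2 * (norm (synth c))\<^sup>2"
  proof (rule has_sum_mono[OF norm_synth[OF l2_mono[OF assms(1,2)]] has_sum_cmult_right[OF norm_synth[OF assms(1)]]])
    show "(d k)\<^sup>2 \<le> C\<^sup>2 * (c k)\<^sup>2" if "k \<in> nonzero_ints" for k
      using power_mono[OF assms(2)[of k] abs_ge_zero, of 2] that by (simp add: power_mult_distrib)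
  qed
  then have "(norm (synth d))\<^sup>2 \<le> (C * norm (synth c))\<^sup>2" by (simp add: power_mult_distrib)
  then show ?thesis by (rule power2_le_imp_le) (use assms(3) in simp)
qed

lemma l2_add: assumes "l2 c" "l2 d" shows "l2 (\<lambda>k. c k + d k)"
  unfolding l2_def
proof (rule summable_on_comparison_test)
  show "(\<lambda>k. 2 * (c k)\<^sup>2 + 2 * (d k)\<^sup>2) summable_on nonzero_ints"
    using assms unfolding l2_def by (intro summable_on_add summable_on_cmult_right)
  show "(c k + d k)\<^sup>2 \<le> 2 * (c k)\<^sup>2 + 2 * (d k)\<^sup>2" for k
    using sum_squares_bound[of "c k" "d k"] by (simp add: power2_sum)
qed auto

lemma l2_scale: "l2 c \<Longrightarrow> l2 (\<lambda>k. r * c k)"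
  by (rule l2_mono[where C = "\<bar>r\<bar>"]) (auto simp: abs_mult)

lemma l2_diff: assumes "l2 c" "l2 d" shows "l2 (\<lambda>k. c k - d k)"
  using l2_add[OF assms(1) l2_scale[OF assms(2), of "-1"]] by simp

lemma synth_add: "l2 c \<Longrightarrow> l2 d \<Longrightarrow> synth (\<lambda>k. c k + d k) = synth c + synth d"
  unfolding synth_def scaleR_add_left by (intro infsum_add summable_on_basis)

lemma synth_scale: "synth (\<lambda>k. r * c k) = r *\<^sub>R synth c"
  unfolding synth_def scaleR_scaleR[symmetric]
  by (cases "r = 0") (auto intro!: infsum_scaleR_right simp del: scaleR_scaleR)

lemma synth_diff: "l2 c \<Longrightarrow> l2 d \<Longrightarrow> synth (\<lambda>k. c k - d k) = synth c - synth d"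
  using synth_add[of c "\<lambda>k. (-1) * d k"] l2_scale[of d "-1"] synth_scale[of "-1" d] by simp

lemma synth_cong: "(\<And>k. k \<noteq> 0 \<Longrightarrow> c k = d k) \<Longrightarrow> synth c = synth d"
  unfolding synth_def by (rule infsum_cong) auto

text \<open>Writes the mean as an inner product, so that \<open>H_space\<close> is the orthogonal
  complement of a vector and inherits linearity and closedness.\<close>

definition one_L2 :: L2 where "one_L2 = abs_L2 (\<lambda>x. 1)"

lemma H_space_iff: "u \<in> H_space \<longleftrightarrow> inner u one_L2 = 0"
  unfolding H_space_def one_L2_def by (simp add: inner_abs_L2_right square_integrable_const)

lemma e_basis_in_H: assumes "k \<noteq> 0" shows "e_basis k \<in> H_space"
proof -
  have "inner (e_basis k) one_L2 = integral {0..2*pi} (\<lambda>x. basis_fun k x * 1)"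
    unfolding e_basis_def one_L2_def inner_abs_L2[OF square_integrable_basis_fun square_integrable_const]
    by (intro circle_integral_continuous continuous_intros continuous_basis_fun)
  also have "\<dots> = 0"
    using assms integral_cos_int[of k] integral_sin_int[of k]
    by (cases "k \<ge> 1") (auto simp: basis_fun_pos basis_fun_neg)
  finally show ?thesis by (simp add: H_space_iff)
qed

lemma H_space_0: "0 \<in> H_space" and H_space_add: "u \<in> H_space \<Longrightarrow> v \<in> H_space \<Longrightarrow> u + v \<in> H_space"
  and H_space_diff: "u \<in> H_space \<Longrightarrow> v \<in> H_space \<Longrightarrow> u - v \<in> H_space"
  and H_space_scale: "u \<in> H_space \<Longrightarrow> r *\<^sub>R u \<in> H_space"
  by (simp_all add: H_space_iff inner_add_left inner_diff_left)

lemma synth_in_H: "synth c \<in> H_space"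
proof (cases "(\<lambda>k. c k *\<^sub>R e_basis k) summable_on nonzero_ints")
  case True
  then have hs: "((\<lambda>k. c k *\<^sub>R e_basis k) has_sum synth c) nonzero_ints"
    unfolding synth_def by (rule has_sum_infsum)
  have "((\<lambda>k. inner (c k *\<^sub>R e_basis k) one_L2) has_sum inner (synth c) one_L2) nonzero_ints"
    by (rule has_sum_bounded_linear[OF bounded_linear_inner_left hs])
  moreover have "((\<lambda>k. inner (c k *\<^sub>R e_basis k) one_L2) has_sum 0) nonzero_ints"
    by (rule has_sum_0) (use e_basis_in_H in \<open>auto simp: H_space_iff\<close>)
  ultimately show ?thesis unfolding H_space_iff by (rule has_sum_unique)
next
  case False
  then show ?thesis by (simp add: synth_def infsum_not_exists H_space_0)
qed

lemma H_space_eqI: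
  assumes "u \<in> H_space" "v \<in> H_space" "\<And>k. k \<noteq> 0 \<Longrightarrow> inner u (e_basis k) = inner v (e_basis k)"
  shows "u = v"
proof -
  have "u - v \<in> H_space" using assms by (simp add: H_space_diff)
  then have "u - v = 0"
    by (intro trigonometric_system_complete) (auto simp: H_space_def inner_diff_left assms(3))
  then show ?thesis by simp
qed

lemma synth_inner: "u \<in> H_space \<Longrightarrow> synth (\<lambda>k. inner u (e_basis k)) = u"
  by (rule H_space_eqI) (auto simp: synth_in_H inner_synth l2_inner)

text \<open>\<open>Jop m\<close> is an isometry of \<open>H\<^sup>m\<close> into \<open>L\<^sup>2\<close>; it turns the topology of \<open>H\<^sup>m\<close> into that of \<open>L\<^sup>2\<close>.\<close>

definition Jop :: "nat \<Rightarrow> L2 \<Rightarrow> L2" where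
  "Jop m u = synth (\<lambda>k. \<bar>real_of_int k\<bar> ^ m * inner u (e_basis k))"

lemma weight_square: "(\<bar>real_of_int k\<bar> ^ m * x)\<^sup>2 = \<bar>real_of_int k\<bar> ^ (2 * m) * x\<^sup>2"
  by (simp add: power_mult_distrib power_mult[symmetric] mult.commute)

lemma Hdot_iff: "u \<in> Hdot m \<longleftrightarrow> u \<in> H_space \<and> l2 (\<lambda>k. \<bar>real_of_int k\<bar> ^ m * inner u (e_basis k))"
  by (simp add: Hdot_def l2_def weight_square)

lemma HdotD: "u \<in> Hdot m \<Longrightarrow> u \<in> H_space" "u \<in> Hdot m \<Longrightarrow> l2 (\<lambda>k. \<bar>real_of_int k\<bar> ^ m * inner u (e_basis k))"
  by (auto simp: Hdot_iff)

lemma Hdot_norm_Jop: "u \<in> Hdot m \<Longrightarrow> Hdot_norm m u = norm (Jop m u)"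
  unfolding Hdot_norm_def Jop_def Hdot_iff
  by (rule real_sqrt_unique) (auto simp: norm_synth_infsum weight_square)

lemma Hdot_norm_nonneg: "0 \<le> Hdot_norm m u"
  by (simp add: Hdot_norm_def infsum_nonneg)

lemma Hdot_0: "0 \<in> Hdot m"
  by (simp add: Hdot_iff H_space_0 l2_def)

lemma Hdot_add: "u \<in> Hdot m \<Longrightarrow> v \<in> Hdot m \<Longrightarrow> u + v \<in> Hdot m"
  using l2_add[of "\<lambda>k. \<bar>real_of_int k\<bar> ^ m * inner u (e_basis k)" "\<lambda>k. \<bar>real_of_int k\<bar> ^ m * inner v (e_basis k)"]
  by (auto simp: Hdot_iff H_space_add inner_add_left distrib_left)

lemma Hdot_scale: "u \<in> Hdot m \<Longrightarrow> r *\<^sub>R u \<in> Hdot m"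
  using l2_scale[of "\<lambda>k. \<bar>real_of_int k\<bar> ^ m * inner u (e_basis k)" r]
  by (auto simp: Hdot_iff H_space_scale mult.left_commute)

lemma Hdot_diff: "u \<in> Hdot m \<Longrightarrow> v \<in> Hdot m \<Longrightarrow> u - v \<in> Hdot m"
  using Hdot_add[of u m "-1 *\<^sub>R v"] Hdot_scale[of v m "-1"] by simp

lemma Jop_diff: "u \<in> Hdot m \<Longrightarrow> v \<in> Hdot m \<Longrightarrow> Jop m (u - v) = Jop m u - Jop m v"
  unfolding Jop_def inner_diff_left right_diff_distrib by (intro synth_diff HdotD)

lemma Jop_0: "Jop 0 u = u" if "u \<in> H_space"
  using that by (simp add: Jop_def synth_inner)

lemma l2_weight_mono:
  assumes "u \<in> Hdot m" "\<And>k. k \<noteq> 0 \<Longrightarrow> \<bar>s k\<bar> \<le> C * \<bar>real_of_int k\<bar> ^ m"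
  shows "l2 (\<lambda>k. s k * inner u (e_basis k))"
    and "C \<ge> 0 \<Longrightarrow> norm (synth (\<lambda>k. s k * inner u (e_basis k))) \<le> C * Hdot_norm m u"
proof -
  have le: "\<bar>s k * inner u (e_basis k)\<bar> \<le> C * \<bar>\<bar>real_of_int k\<bar> ^ m * inner u (e_basis k)\<bar>" if "k \<noteq> 0" for k
    using mult_right_mono[OF assms(2)[OF that] abs_ge_zero[of "inner u (e_basis k)"]] by (simp add: abs_mult mult.assoc)
  show "l2 (\<lambda>k. s k * inner u (e_basis k))"
    by (rule l2_mono[OF HdotD(2)[OF assms(1)] le])
  show "norm (synth (\<lambda>k. s k * inner u (e_basis k))) \<le> C * Hdot_norm m u" if "C \<ge> 0"
    unfolding Hdot_norm_Jop[OF assms(1)] Jop_def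
    by (rule norm_synth_mono[OF HdotD(2)[OF assms(1)] le that])
qed

lemma abs_int_ge_1: "k \<noteq> 0 \<Longrightarrow> 1 \<le> \<bar>real_of_int k\<bar>"
  by (simp flip: of_int_abs)

lemma Hdot_mono:
  assumes "u \<in> Hdot m" "n \<le> m"
  shows "u \<in> Hdot n" "Hdot_norm n u \<le> Hdot_norm m u"
proof -
  have w: "\<bar>\<bar>real_of_int k\<bar> ^ n\<bar> \<le> 1 * \<bar>real_of_int k\<bar> ^ m" if "k \<noteq> 0" for k
    unfolding abs_of_nonneg[OF zero_le_power[OF abs_ge_zero]] mult_1
    using power_increasing[OF assms(2) abs_int_ge_1[OF that]] .
  show *: "u \<in> Hdot n"
    using l2_weight_mono(1)[OF assms(1) w] HdotD(1)[OF assms(1)] by (simp add: Hdot_iff)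
  show "Hdot_norm n u \<le> Hdot_norm m u"
    using l2_weight_mono(2)[OF assms(1) w] by (simp add: Hdot_norm_Jop[OF *] Jop_def)
qed

lemma norm_le_Hdot_norm: assumes "u \<in> Hdot m" shows "norm u \<le> Hdot_norm m u"
  using Hdot_mono[OF assms, of 0] Jop_0[OF HdotD(1)[OF assms]] by (simp add: Hdot_norm_Jop)

lemma Metric_space_Hdot: "Metric_space (Hdot m) (\<lambda>u v. Hdot_norm m (u - v))"
proof
  fix u v w
  show "0 \<le> Hdot_norm m (u - v)" by (rule Hdot_norm_nonneg)
  show "Hdot_norm m (u - v) = Hdot_norm m (v - u)"
    by (simp add: Hdot_norm_def inner_diff_left power2_commute)
  assume uv: "u \<in> Hdot m" "v \<in> Hdot m"
  show "Hdot_norm m (u - v) = 0 \<longleftrightarrow> u = v"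
  proof
    assume "Hdot_norm m (u - v) = 0"
    then show "u = v" using norm_le_Hdot_norm[OF Hdot_diff[OF uv]] by simp
  next
    assume "u = v" then show "Hdot_norm m (u - v) = 0" by (simp add: Hdot_norm_def)
  qed
  assume "w \<in> Hdot m"
  then show "Hdot_norm m (u - w) \<le> Hdot_norm m (u - v) + Hdot_norm m (v - w)"
    using norm_triangle_ineq[of "Jop m u - Jop m v" "Jop m v - Jop m w"] uv
    by (simp add: Hdot_norm_Jop Hdot_diff Jop_diff)
qed

interpretation Hdot: Metric_space "Hdot m" "\<lambda>u v. Hdot_norm m (u - v)" for m
  by (rule Metric_space_Hdot)

text \<open>\<open>Jop m\<close> is linear and isometric on \<open>Hdot m\<close>, so the
  \<open>H\<^sup>m\<close> distance of two values is the \<open>L2\<close> distance of their images.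
  The side condition \<open>w \<in> S \<rightarrow> Hdot m\<close> remains because the right-hand
  side does not see whether the weighted coefficients are summable. From here on continuity in time
  is ordinary continuity of an \<open>L2\<close>-valued map.\<close>

lemma continuous_map_Hdot_iff:
  fixes S :: "'a::topological_space set"
  shows "continuous_map (top_of_set S) (Hdot_topology m) w \<longleftrightarrow>
     w \<in> S \<rightarrow> Hdot m \<and> continuous_on S (\<lambda>t. Jop m (w t))"
proof -
  have "continuous_map (top_of_set S) (Hdot_topology m) w \<longleftrightarrow>
     w \<in> S \<rightarrow> Hdot m \<and> (\<forall>x\<in>S. \<forall>e>0. \<exists>U. openin (top_of_set S) U \<and> x \<in> U \<and> (\<forall>y\<in>U. Hdot_norm m (w x - w y) < e))"
    (is "?L \<longleftrightarrow> ?P \<and> ?R")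
  proof
    assume ?L
    then have c: "\<forall>x\<in>S. \<forall>e>0. \<exists>U. openin (top_of_set S) U \<and> x \<in> U \<and> (\<forall>y\<in>U. w x \<in> Hdot m \<and> w y \<in> Hdot m \<and> Hdot_norm m (w x - w y) < e)"
      by (simp add: Hdot_topology_def Hdot.continuous_map_to_metric)
    have ?P
    proof
      fix x assume "x \<in> S"
      with c obtain U where "x \<in> U" "\<forall>y\<in>U. w x \<in> Hdot m" by (meson zero_less_one)
      then show "w x \<in> Hdot m" by blast
    qed
    moreover from c have ?R by meson
    ultimately show "?P \<and> ?R" ..
  next
    assume pr: "?P \<and> ?R"
    show ?L
      unfolding Hdot_topology_def Hdot.continuous_map_to_metric topspace_euclidean_subtopology Hdot.in_mball
    proof (intro ballI allI impI)
      fix x and e :: real assume x: "x \<in> S" and "0 < e"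
      with pr obtain U where U: "openin (top_of_set S) U" "x \<in> U" "\<forall>y\<in>U. Hdot_norm m (w x - w y) < e" by meson
      have "U \<subseteq> S" using openin_imp_subset[OF U(1)] .
      with U pr x show "\<exists>U. openin (top_of_set S) U \<and> x \<in> U \<and> (\<forall>y\<in>U. w x \<in> Hdot m \<and> w y \<in> Hdot m \<and> Hdot_norm m (w x - w y) < e)"
        by (intro exI[of _ U]) auto
    qed
  qed
  also have "\<dots> \<longleftrightarrow> w \<in> S \<rightarrow> Hdot m \<and> continuous_on S (\<lambda>t. Jop m (w t))"
  proof (intro conj_cong refl)
    assume w: "w \<in> S \<rightarrow> Hdot m"
    have eq: "Hdot_norm m (w x - w y) = dist (Jop m (w y)) (Jop m (w x))" if "x \<in> S" "y \<in> S" for x y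
    proof -
      have "w x \<in> Hdot m" "w y \<in> Hdot m" using w that by auto
      then show ?thesis by (simp add: Hdot_norm_Jop Hdot_diff Jop_diff dist_norm norm_minus_commute)
    qed
    have "(\<forall>x\<in>S. \<forall>e>0. \<exists>U. openin (top_of_set S) U \<and> x \<in> U \<and> (\<forall>y\<in>U. Hdot_norm m (w x - w y) < e)) \<longleftrightarrow>
      (\<forall>x\<in>S. \<forall>e>0. \<forall>\<^sub>F y in at x within S. dist (Jop m (w y)) (Jop m (w x)) < e)"
    proof (intro ball_cong all_cong refl)
      fix x and e :: real assume x: "x \<in> S" and e: "e > 0"
      show "(\<exists>U. openin (top_of_set S) U \<and> x \<in> U \<and> (\<forall>y\<in>U. Hdot_norm m (w x - w y) < e)) \<longleftrightarrow>
        (\<forall>\<^sub>F y in at x within S. dist (Jop m (w y)) (Jop m (w x)) < e)"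
      proof
        assume "\<exists>U. openin (top_of_set S) U \<and> x \<in> U \<and> (\<forall>y\<in>U. Hdot_norm m (w x - w y) < e)"
        then obtain V where "open V" "x \<in> V" "\<forall>y\<in>S \<inter> V. Hdot_norm m (w x - w y) < e"
          unfolding openin_open by blast
        then show "\<forall>\<^sub>F y in at x within S. dist (Jop m (w y)) (Jop m (w x)) < e"
          unfolding eventually_at_topological using eq[OF x] by (metis IntI)
      next
        assume "\<forall>\<^sub>F y in at x within S. dist (Jop m (w y)) (Jop m (w x)) < e"
        then obtain V where V: "open V" "x \<in> V" "\<And>y. y \<in> V \<Longrightarrow> y \<noteq> x \<Longrightarrow> y \<in> S \<Longrightarrow> dist (Jop m (w y)) (Jop m (w x)) < e"
          unfolding eventually_at_topological by blast
        show "\<exists>U. openin (top_of_set S) U \<and> x \<in> U \<and> (\<forall>y\<in>U. Hdot_norm m (w x - w y) < e)"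
        proof (intro exI conjI ballI)
          show "openin (top_of_set S) (S \<inter> V)" using V(1) by (auto simp: openin_open)
          show "x \<in> S \<inter> V" using x V by auto
          show "Hdot_norm m (w x - w y) < e" if "y \<in> S \<inter> V" for y
          proof (cases "y = x")
            case True
            then show ?thesis using e eq[OF x x] by simp
          next
            case False
            then show ?thesis using V(3)[of y] that eq[OF x, of y] by (metis IntD1 IntD2)
          qed
        qed
      qed
    qed
    also have "\<dots> \<longleftrightarrow> continuous_on S (\<lambda>t. Jop m (w t))"
      unfolding continuous_on_def tendsto_iff by blast
    finally show "(\<forall>x\<in>S. \<forall>e>0. \<exists>U. openin (top_of_set S) U \<and> x \<in> U \<and> (\<forall>y\<in>U. Hdot_norm m (w x - w y) < e)) \<longleftrightarrow>
      continuous_on S (\<lambda>t. Jop m (w t))" .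
  qed
  finally show ?thesis .
qed

section \<open>Products with bounded factors\<close>

definition bdd_L2 :: "real \<Rightarrow> L2 \<Rightarrow> bool" where
  "bdd_L2 C u \<longleftrightarrow> (AE x in circle. \<bar>rep_L2 u x\<bar> \<le> C)"

lemma mult_L2_commute: "mult_L2 f g = mult_L2 g f"
  by (simp add: mult_L2_def mult.commute)

lemma square_integrable_mult_bdd:
  assumes "bdd_L2 C g"
  shows "square_integrable (\<lambda>x. rep_L2 f x * rep_L2 g x)"
  unfolding square_integrable_def
proof
  show "integrable circle (\<lambda>x. (rep_L2 f x * rep_L2 g x)\<^sup>2)"
  proof (rule Bochner_Integration.integrable_bound)
    show "integrable circle (\<lambda>x. C\<^sup>2 * (rep_L2 f x)\<^sup>2)"
      using square_integrable_rep[of f] by (simp add: square_integrable_def)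
    show "AE x in circle. norm ((rep_L2 f x * rep_L2 g x)\<^sup>2) \<le> norm (C\<^sup>2 * (rep_L2 f x)\<^sup>2)"
      using assms unfolding bdd_L2_def
    proof eventually_elim
      case (elim x)
      have "(rep_L2 g x)\<^sup>2 \<le> C\<^sup>2" using power_mono[OF elim abs_ge_zero, of 2] by (simp only: power2_abs)
      then have "(rep_L2 f x)\<^sup>2 * (rep_L2 g x)\<^sup>2 \<le> (rep_L2 f x)\<^sup>2 * C\<^sup>2" by (rule mult_left_mono) simp
      then show ?case by (simp add: power_mult_distrib mult.commute)
    qed
  qed measurable
qed measurable

lemma rep_mult_AE:
  assumes "bdd_L2 C g"
  shows "AE x in circle. rep_L2 (mult_L2 f g) x = rep_L2 f x * rep_L2 g x"
  unfolding mult_L2_def by (rule rep_abs_L2_AE[OF square_integrable_mult_bdd[OF assms]])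

lemma norm_mult_L2:
  assumes "bdd_L2 C g" "C \<ge> 0"
  shows "norm (mult_L2 f g) \<le> C * norm f"
proof -
  have "(norm (mult_L2 f g))\<^sup>2 \<le> C\<^sup>2 * (norm f)\<^sup>2"
    unfolding norm_L2_rep
  proof (subst integral_mult_right_zero[symmetric], rule integral_mono_AE)
    show "integrable circle (\<lambda>x. (rep_L2 (mult_L2 f g) x)\<^sup>2)" "integrable circle (\<lambda>x. C\<^sup>2 * (rep_L2 f x)\<^sup>2)"
      using square_integrable_rep[of "mult_L2 f g"] square_integrable_rep[of f] by (auto simp: square_integrable_def)
    show "AE x in circle. (rep_L2 (mult_L2 f g) x)\<^sup>2 \<le> C\<^sup>2 * (rep_L2 f x)\<^sup>2"
      using rep_mult_AE[OF assms(1), of f] assms(1)[unfolded bdd_L2_def]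
    proof eventually_elim
      case (elim x)
      have "(rep_L2 g x)\<^sup>2 \<le> C\<^sup>2" using power_mono[OF elim(2) abs_ge_zero, of 2] by (simp only: power2_abs)
      then have "(rep_L2 f x)\<^sup>2 * (rep_L2 g x)\<^sup>2 \<le> (rep_L2 f x)\<^sup>2 * C\<^sup>2" by (rule mult_left_mono) simp
      then show ?case using elim(1) by (simp add: power_mult_distrib mult.commute)
    qed
  qed
  then have "(norm (mult_L2 f g))\<^sup>2 \<le> (C * norm f)\<^sup>2" by (simp only: power_mult_distrib)
  then show ?thesis by (rule power2_le_imp_le) (use assms(2) in simp)
qed

lemma mult_L2_diff_left:
  assumes "bdd_L2 C g"
  shows "mult_L2 (f - f') g = mult_L2 f g - mult_L2 f' g"
proof (rule L2_eqI)
  show "AE x in circle. rep_L2 (mult_L2 (f - f') g) x = rep_L2 (mult_L2 f g - mult_L2 f' g) x"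
    using rep_mult_AE[OF assms, of "f - f'"] rep_mult_AE[OF assms, of f] rep_mult_AE[OF assms, of f']
      rep_diff_AE[of f f'] rep_diff_AE[of "mult_L2 f g" "mult_L2 f' g"]
    by eventually_elim (simp add: left_diff_distrib)
qed

lemma bdd_L2_diff: "bdd_L2 C f \<Longrightarrow> bdd_L2 D g \<Longrightarrow> bdd_L2 (C + D) (f - g)"
  unfolding bdd_L2_def
  subgoal premises p
    using p(1) p(2) rep_diff_AE[of f g] by eventually_elim linarith
  done

lemma mult_L2_diff_right:
  assumes "bdd_L2 C g" "bdd_L2 C' g'"
  shows "mult_L2 f (g - g') = mult_L2 f g - mult_L2 f g'"
proof (rule L2_eqI)
  show "AE x in circle. rep_L2 (mult_L2 f (g - g')) x = rep_L2 (mult_L2 f g - mult_L2 f g') x"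
    using rep_mult_AE[OF bdd_L2_diff[OF assms], of f] rep_mult_AE[OF assms(1), of f] rep_mult_AE[OF assms(2), of f]
      rep_diff_AE[of g g'] rep_diff_AE[of "mult_L2 f g" "mult_L2 f g'"]
    by eventually_elim (simp add: right_diff_distrib)
qed

text \<open>One factor converges in \<open>L2\<close>, the other uniformly. The difference is split
  as \<open>(f n - f0) * g n - f0 * (g0 - g n)\<close>, where each product has a bounded right
  factor.\<close>

lemma mult_L2_tendsto:
  assumes f: "f \<longlonglongrightarrow> f0" and g0: "bdd_L2 C g0" "C \<ge> 0" and g: "\<And>n. bdd_L2 (e n) (g0 - g n)" "\<And>n. e n \<ge> 0" and e: "e \<longlonglongrightarrow> 0"
  shows "(\<lambda>n. mult_L2 (f n) (g n)) \<longlonglongrightarrow> mult_L2 f0 g0"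
proof -
  have gb: "bdd_L2 (C + e n) (g n)" for n
    using bdd_L2_diff[OF g0(1) g(1)[of n]] by simp
  have le: "norm (mult_L2 (f n) (g n) - mult_L2 f0 g0) \<le> (C + e n) * norm (f n - f0) + e n * norm f0" for n
  proof -
    have "mult_L2 (f n) (g n) - mult_L2 f0 g0 = mult_L2 (f n - f0) (g n) - mult_L2 f0 (g0 - g n)"
      by (simp add: mult_L2_diff_left[OF gb] mult_L2_diff_right[OF g0(1) gb])
    also have "norm \<dots> \<le> norm (mult_L2 (f n - f0) (g n)) + norm (mult_L2 f0 (g0 - g n))"
      by (rule norm_triangle_ineq4)
    also have "\<dots> \<le> (C + e n) * norm (f n - f0) + e n * norm f0"
      by (intro add_mono norm_mult_L2 gb g add_nonneg_nonneg g0)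
    finally show ?thesis .
  qed
  have "(\<lambda>n. (C + e n) * norm (f n - f0) + e n * norm f0) \<longlonglongrightarrow> (C + 0) * norm (f0 - f0) + 0 * norm f0"
    by (intro tendsto_intros f e)
  then have "(\<lambda>n. (C + e n) * norm (f n - f0) + e n * norm f0) \<longlonglongrightarrow> 0" by simp
  then have "(\<lambda>n. mult_L2 (f n) (g n) - mult_L2 f0 g0) \<longlonglongrightarrow> 0"
    by (rule Lim_null_comparison[rotated]) (use le in auto)
  then show ?thesis by (simp add: LIM_zero_iff)
qed

section \<open>Truncated Fourier series and the embedding into bounded functions\<close>

definition cut :: "nat \<Rightarrow> int set" where "cut n = {- int n..int n} - {0}"

lemma finite_cut [simp]: "finite (cut n)" and cut_subset: "cut n \<subseteq> nonzero_ints" and zero_notin_cut [simp]: "0 \<notin> cut n"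
  and uminus_cut: "k \<in> cut n \<Longrightarrow> - k \<in> cut n"
  by (auto simp: cut_def)

lemma filterlim_cut: "filterlim cut (finite_subsets_at_top nonzero_ints) sequentially"
  unfolding filterlim_finite_subsets_at_top
proof (intro allI impI)
  fix X :: "int set" assume X: "finite X \<and> X \<subseteq> nonzero_ints"
  define N where "N = Max (insert 0 ((\<lambda>k. nat \<bar>k\<bar>) ` X))"
  have N: "nat \<bar>k\<bar> \<le> N" if "k \<in> X" for k
    unfolding N_def using X that by (intro Max_ge) auto
  show "\<forall>\<^sub>F n in sequentially. finite (cut n) \<and> X \<subseteq> cut n \<and> cut n \<subseteq> nonzero_ints"
    using eventually_ge_at_top[of N]
  proof eventually_elim
    case (elim n)
    have "X \<subseteq> cut n"
    proof
      fix k assume "k \<in> X"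
      then have "nat \<bar>k\<bar> \<le> n" "k \<noteq> 0" using N elim X by fastforce+
      then show "k \<in> cut n" by (auto simp: cut_def)
    qed
    then show ?case using cut_subset by simp
  qed
qed

lemma has_sum_cut: "(f has_sum s) nonzero_ints \<Longrightarrow> (\<lambda>n. \<Sum>k\<in>cut n. f k) \<longlonglongrightarrow> s"
  unfolding has_sum_def by (rule filterlim_compose[OF _ filterlim_cut])

definition Sn :: "(int \<Rightarrow> real) \<Rightarrow> nat \<Rightarrow> L2" where
  "Sn c n = (\<Sum>k\<in>cut n. c k *\<^sub>R e_basis k)"

text \<open>The smooth function behind the class \<open>Sn c n\<close>. Derivatives and products are
  computed for \<open>tp\<close> by classical calculus and carried to \<open>L2\<close> by taking
  limits in \<open>n\<close>.\<close>

definition tp :: "(int \<Rightarrow> real) \<Rightarrow> nat \<Rightarrow> real \<Rightarrow> real" where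
  "tp c n x = (\<Sum>k\<in>cut n. c k * basis_fun k x)"

lemma Sn_tendsto: "l2 c \<Longrightarrow> Sn c \<longlonglongrightarrow> synth c"
  unfolding Sn_def[abs_def] by (rule has_sum_cut[OF has_sum_synth])

lemma continuous_tp: "continuous_on S (tp c n)"
  unfolding tp_def by (intro continuous_intros continuous_basis_fun)

lemma abs_tp: "abs_L2 (tp c n) = Sn c n"
proof -
  have "abs_L2 (tp c n) = (\<Sum>k\<in>cut n. abs_L2 (\<lambda>x. c k * basis_fun k x))"
    unfolding tp_def by (rule conjunct2[OF abs_L2_sum]) (auto intro: square_integrable_scale square_integrable_basis_fun)
  then show ?thesis
    by (simp add: Sn_def e_basis_def abs_L2_scale square_integrable_basis_fun)
qed

lemma rep_Sn_AE: "AE x in circle. rep_L2 (Sn c n) x = tp c n x"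
  using rep_abs_L2_AE[OF square_integrable_continuous[OF continuous_tp[of _ c n]]] by (simp add: abs_tp)

lemma summable_inverse_squares_int: "(\<lambda>k. 1 / (real_of_int k)\<^sup>2) summable_on nonzero_ints"
proof -
  have n: "(\<lambda>n. 1 / (real n)\<^sup>2) summable_on {1..}"
  proof (rule summable_on_subset_banach)
    show "(\<lambda>n. 1 / (real n)\<^sup>2) summable_on UNIV"
    proof (rule norm_summable_imp_summable_on)
      show "summable (\<lambda>n. norm (1 / (real n)\<^sup>2))"
        using inverse_power_summable[of 2, where 'a = real] by (simp add: inverse_eq_divide power_inverse)
    qed
  qed auto
  have 1: "(\<lambda>k. 1 / (real_of_int k)\<^sup>2) summable_on (int ` {1..})"
    using n by (subst summable_on_reindex) (auto simp: o_def inj_on_def)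
  have 2: "(\<lambda>k. 1 / (real_of_int k)\<^sup>2) summable_on ((\<lambda>n. - int n) ` {1..})"
    using n by (subst summable_on_reindex) (auto simp: o_def inj_on_def)
  have eq: "nonzero_ints = int ` {1..} \<union> (\<lambda>n. - int n) ` {1..}"
  proof (intro equalityI subsetI)
    fix k :: int assume "k \<in> nonzero_ints"
    then consider "k \<ge> 1" | "k \<le> -1" by fastforce
    then show "k \<in> int ` {1..} \<union> (\<lambda>n. - int n) ` {1..}"
    proof cases
      case 1 then have "k = int (nat k)" "nat k \<in> {1..}" by auto
      then show ?thesis by blast
    next
      case 2 then have "k = - int (nat (-k))" "nat (-k) \<in> {1..}" by auto
      then show ?thesis by blast
    qed
  qed auto
  show ?thesis unfolding eq by (rule summable_on_union[OF 1 2])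
qed

text \<open>The constant of the embedding of \<open>H\<^sup>1\<close> into the bounded functions.\<close>

definition Ksup :: real where "Ksup = sqrt (\<Sum>\<^sub>\<infinity>k\<in>nonzero_ints. 1 / (real_of_int k)\<^sup>2)"

lemma Ksup_nonneg: "Ksup \<ge> 0"
  unfolding Ksup_def by (simp add: infsum_nonneg)

lemma abs_basis_fun: "\<bar>basis_fun k x\<bar> \<le> 1"
proof -
  have "1 \<le> sqrt pi" using pi_ge_two by simp
  moreover have "\<bar>cos y\<bar> \<le> sqrt pi" "\<bar>sin y\<bar> \<le> sqrt pi" for y :: real
    using \<open>1 \<le> sqrt pi\<close> abs_cos_le_one[of y] abs_sin_le_one[of y] by linarith+
  ultimately show ?thesis by (auto simp: basis_fun_def abs_divide divide_le_eq)
qed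

text \<open>Cauchy-Schwarz with the weights \<open>1 / k\<close> and \<open>k\<close>. The bound
  depends neither on the point nor on \<open>n\<close>, so it survives the passage to the
  limit.\<close>

lemma tp_bound:
  assumes "l2 (\<lambda>k. real_of_int k * c k)"
  shows "\<bar>tp c n x\<bar> \<le> Ksup * norm (synth (\<lambda>k. real_of_int k * c k))"
proof -
  have "\<bar>tp c n x\<bar> \<le> (\<Sum>k\<in>cut n. \<bar>c k * basis_fun k x\<bar>)" unfolding tp_def by (rule sum_abs)
  also have "\<dots> \<le> (\<Sum>k\<in>cut n. \<bar>1 / real_of_int k\<bar> * \<bar>real_of_int k * c k\<bar>)"
  proof (rule sum_mono)
    fix k assume "k \<in> cut n"
    then have "k \<noteq> 0" by auto
    then show "\<bar>c k * basis_fun k x\<bar> \<le> \<bar>1 / real_of_int k\<bar> * \<bar>real_of_int k * c k\<bar>"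
      using mult_left_mono[OF abs_basis_fun[of k x] abs_ge_zero[of "c k"]] by (simp add: abs_mult)
  qed
  also have "\<dots> \<le> L2_set (\<lambda>k. 1 / real_of_int k) (cut n) * L2_set (\<lambda>k. real_of_int k * c k) (cut n)"
    by (rule L2_set_mult_ineq)
  also have "\<dots> \<le> Ksup * norm (synth (\<lambda>k. real_of_int k * c k))"
  proof (rule mult_mono)
    have "(\<Sum>k\<in>cut n. (1 / real_of_int k)\<^sup>2) \<le> (\<Sum>\<^sub>\<infinity>k\<in>nonzero_ints. 1 / (real_of_int k)\<^sup>2)"
      unfolding power_one_over power_divide power_one
      by (rule finite_sum_le_infsum[OF summable_inverse_squares_int]) (use cut_subset in auto)
    then show "L2_set (\<lambda>k. 1 / real_of_int k) (cut n) \<le> Ksup"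
      unfolding L2_set_def Ksup_def by (rule real_sqrt_le_mono)
    have "(\<Sum>k\<in>cut n. (real_of_int k * c k)\<^sup>2) \<le> (norm (synth (\<lambda>k. real_of_int k * c k)))\<^sup>2"
      by (rule has_sum_mono_neutral[OF has_sum_finite norm_synth[OF assms]]) (use cut_subset in auto)
    then show "L2_set (\<lambda>k. real_of_int k * c k) (cut n) \<le> norm (synth (\<lambda>k. real_of_int k * c k))"
      unfolding L2_set_def by (rule real_le_lsqrt[OF norm_ge_zero])
  qed (simp_all add: Ksup_nonneg L2_set_nonneg)
  finally show ?thesis .
qed

lemma l2_of_weighted: "l2 (\<lambda>k. real_of_int k * c k) \<Longrightarrow> l2 c"
  by (erule l2_mono[where C = 1]) (use abs_int_ge_1 in \<open>auto simp: abs_mult mult_le_cancel_right1\<close>)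

lemma bdd_synth:
  assumes "l2 (\<lambda>k. real_of_int k * c k)"
  shows "bdd_L2 (Ksup * norm (synth (\<lambda>k. real_of_int k * c k))) (synth c)"
  unfolding bdd_L2_def
proof (rule AE_bounded_limit[OF _ Sn_tendsto[OF l2_of_weighted[OF assms]]])
  show "AE x in circle. \<bar>rep_L2 (Sn c n) x\<bar> \<le> Ksup * norm (synth (\<lambda>k. real_of_int k * c k))" for n
    using rep_Sn_AE[of c n] by eventually_elim (simp add: tp_bound[OF assms])
qed

lemma Sn_eq_synth: "Sn c n = synth (\<lambda>k. if k \<in> cut n then c k else 0)"
  unfolding Sn_def synth_def using cut_subset[of n]
  by (subst infsum_cong_neutral[where T = "cut n" and g = "\<lambda>k. c k *\<^sub>R e_basis k"]) auto

lemma l2_if: "l2 c \<Longrightarrow> l2 (\<lambda>k. if P k then c k else 0)"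
  by (erule l2_mono[where C = 1]) auto

text \<open>The embedding is applied to the coefficients outside the cut. For functions in
  \<open>H\<^sup>1\<close> it gives uniform convergence of the Fourier series, which the limits of
  products require.\<close>

lemma bdd_tail:
  assumes "l2 (\<lambda>k. real_of_int k * c k)"
  shows "bdd_L2 (Ksup * norm (synth (\<lambda>k. real_of_int k * c k) - Sn (\<lambda>k. real_of_int k * c k) n)) (synth c - Sn c n)"
proof -
  let ?d = "\<lambda>k. if k \<in> cut n then 0 else c k"
  have eq: "(\<lambda>k. real_of_int k * ?d k) = (\<lambda>k. real_of_int k * c k - (if k \<in> cut n then real_of_int k * c k else 0))"
    by auto
  have 1: "l2 (\<lambda>k. real_of_int k * ?d k)"
    unfolding eq by (intro l2_diff l2_if assms)
  have 2: "synth (\<lambda>k. real_of_int k * ?d k) = synth (\<lambda>k. real_of_int k * c k) - Sn (\<lambda>k. real_of_int k * c k) n"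
    unfolding eq Sn_eq_synth by (intro synth_diff l2_if assms)
  have "synth ?d = synth (\<lambda>k. c k - (if k \<in> cut n then c k else 0))" by (rule synth_cong) auto
  also have "\<dots> = synth c - Sn c n"
    unfolding Sn_eq_synth by (intro synth_diff l2_if l2_of_weighted[OF assms])
  finally show ?thesis using bdd_synth[OF 1] by (simp add: 2)
qed

lemma bdd_tail_tendsto:
  assumes "l2 (\<lambda>k. real_of_int k * c k)"
  shows "(\<lambda>n. Ksup * norm (synth (\<lambda>k. real_of_int k * c k) - Sn (\<lambda>k. real_of_int k * c k) n)) \<longlonglongrightarrow> 0"
proof -
  let ?s = "synth (\<lambda>k. real_of_int k * c k)"
  have "(\<lambda>n. Ksup * norm (?s - Sn (\<lambda>k. real_of_int k * c k) n)) \<longlonglongrightarrow> Ksup * norm (?s - ?s)"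
    by (intro tendsto_intros Sn_tendsto assms)
  then show ?thesis by simp
qed

lemma mult_Sn_tendsto:
  assumes "l2 d" "l2 (\<lambda>k. real_of_int k * c k)"
  shows "(\<lambda>n. mult_L2 (Sn d n) (Sn c n)) \<longlonglongrightarrow> mult_L2 (synth d) (synth c)"
  by (rule mult_L2_tendsto[OF Sn_tendsto[OF assms(1)] bdd_synth[OF assms(2)] _ bdd_tail[OF assms(2)] _ bdd_tail_tendsto[OF assms(2)]])
     (simp_all add: Ksup_nonneg)

lemma mult_Sn_tp: "mult_L2 (Sn d n) (Sn c n) = abs_L2 (\<lambda>x. tp d n x * tp c n x)"
  unfolding mult_L2_def
proof (rule abs_L2_eqI)
  have "bdd_L2 (Ksup * norm (synth (\<lambda>k. real_of_int k * (if k \<in> cut n then c k else 0)))) (Sn c n)"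
    unfolding Sn_eq_synth
  proof (rule bdd_synth)
    have "l2 (\<lambda>k. if k \<in> cut n then real_of_int k * c k else 0)"
      unfolding l2_def by (rule finite_nonzero_values_imp_summable_on) (auto intro: finite_subset[of _ "cut n"])
    then show "l2 (\<lambda>k. real_of_int k * (if k \<in> cut n then c k else 0))" by (simp add: if_distrib cong: if_cong)
  qed
  then show "square_integrable (\<lambda>x. rep_L2 (Sn d n) x * rep_L2 (Sn c n) x)"
    by (rule square_integrable_mult_bdd)
  show "square_integrable (\<lambda>x. tp d n x * tp c n x)"
    by (intro square_integrable_continuous continuous_intros continuous_tp)
  show "AE x in circle. rep_L2 (Sn d n) x * rep_L2 (Sn c n) x = tp d n x * tp c n x"
    using rep_Sn_AE[of d n] rep_Sn_AE[of c n] by eventually_elim simp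
qed

section \<open>Weak derivatives and the velocity\<close>

lemma basis_fun_deriv: "(basis_fun k has_real_derivative (- real_of_int k * basis_fun (- k) x)) (at x)"
proof (cases "k \<ge> 1")
  case True
  have eq: "- real_of_int k * basis_fun (- k) x = (- sin (real_of_int k * x) * real_of_int k) / sqrt pi"
    using True by (simp add: basis_fun_def mult.commute)
  show ?thesis
    unfolding eq basis_fun_pos[OF True] by (rule DERIV_cdivide) (auto intro!: derivative_eq_intros)
next
  case False
  then have k: "k < 1" by simp
  have eq: "- real_of_int k * basis_fun (- k) x = (- (cos (real_of_int k * x) * real_of_int k)) / sqrt pi"
    using k by (cases "k = 0") (auto simp: basis_fun_def mult.commute)
  show ?thesis
    unfolding eq basis_fun_neg[OF k] by (rule DERIV_cdivide) (auto intro!: derivative_eq_intros)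
qed

lemma basis_fun_periodic: "basis_fun k (x + 2 * pi) = basis_fun k x"
proof -
  have "sin (- (real_of_int k * (2 * pi))) = 0" "cos (real_of_int k * (2 * pi)) = 1" "sin (real_of_int k * (2 * pi)) = 0"
    using sin_integer_2pi[of "of_int k"] cos_integer_2pi[of "of_int k"] by (simp_all add: mult_ac)
  then show ?thesis
    by (simp add: basis_fun_def distrib_left cos_add sin_add sin_diff)
qed

text \<open>Differentiation exchanges the cosine and the sine of a frequency, hence the index \<open>- k\<close>.\<close>

definition Dc :: "(int \<Rightarrow> real) \<Rightarrow> int \<Rightarrow> real" where "Dc c k = real_of_int k * c (- k)"

text \<open>The cuts are symmetric about 0 for this purpose: differentiation exchanges the indices
  \<open>k\<close> and \<open>- k\<close> and must not lead out of a cut.\<close>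

lemma sum_cut_uminus: "(\<Sum>k\<in>cut n. f (- k)) = (\<Sum>k\<in>cut n. f k)"
  by (rule sum.reindex_bij_witness[of _ uminus uminus]) (auto simp: uminus_cut)

lemma tp_deriv: "(tp c n has_real_derivative tp (Dc c) n x) (at x)"
proof -
  have "((\<lambda>x. \<Sum>k\<in>cut n. c k * basis_fun k x) has_real_derivative (\<Sum>k\<in>cut n. c k * (- real_of_int k * basis_fun (- k) x))) (at x)"
    by (intro DERIV_sum DERIV_cmult basis_fun_deriv)
  moreover have "(\<Sum>k\<in>cut n. c k * (- real_of_int k * basis_fun (- k) x)) = tp (Dc c) n x"
    unfolding tp_def Dc_def by (subst sum_cut_uminus[symmetric]) (auto intro!: sum.cong simp: mult_ac)
  ultimately show ?thesis by (simp add: tp_def[abs_def])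
qed

lemma tp_periodic: "tp c n (x + 2 * pi) = tp c n x"
  by (simp add: tp_def basis_fun_periodic)

lemma circle_integral_deriv_periodic:
  fixes f f' :: "real \<Rightarrow> real"
  assumes "\<And>x. (f has_real_derivative f' x) (at x)" "continuous_on UNIV f'" "\<And>x. f (x + 2*pi) = f x"
  shows "(LINT x|circle. f' x) = 0"
proof -
  have c: "continuous_on {0..2*pi} f'" using assms(2) by (rule continuous_on_subset) simp
  have "(f' has_integral (f (2*pi) - f 0)) {0..2*pi}"
    using assms(1) by (intro fundamental_theorem_of_calculus)
      (auto simp flip: has_real_derivative_iff_has_vector_derivative intro: has_field_derivative_at_within)
  then show ?thesis using assms(3)[of 0] by (simp add: circle_integral_continuous(1)[OF c] integral_unique)
qed

lemma has_weak_deriv_smooth: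
  fixes f f' :: "real \<Rightarrow> real"
  assumes f: "\<And>x. (f has_real_derivative f' x) (at x)" "continuous_on UNIV f'" "\<And>x. f (x + 2*pi) = f x"
  shows "has_weak_deriv (abs_L2 f) (abs_L2 f')"
  unfolding has_weak_deriv_def
proof (intro allI impI)
  fix \<phi> \<phi>' :: "real \<Rightarrow> real"
  assume \<phi>: "\<forall>x. \<phi> (x + 2 * pi) = \<phi> x" "\<forall>x. (\<phi> has_real_derivative \<phi>' x) (at x)" "continuous_on UNIV \<phi>'"
  have cf: "continuous_on UNIV f" using f(1) by (meson DERIV_continuous_on has_field_derivative_at_within)
  have cp: "continuous_on UNIV \<phi>" using \<phi>(2) by (meson DERIV_continuous_on has_field_derivative_at_within)
  have c: "continuous_on {0..2*pi} f" "continuous_on {0..2*pi} f'" "continuous_on {0..2*pi} \<phi>" "continuous_on {0..2*pi} \<phi>'"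
    using cf cp f(2) \<phi>(3) by (auto intro: continuous_on_subset)
  have si: "square_integrable f" "square_integrable f'" "square_integrable \<phi>" "square_integrable \<phi>'"
    using c by (auto intro: square_integrable_continuous)
  have 1: "(LINT x|circle. rep_L2 (abs_L2 f) x * \<phi>' x) = (LINT x|circle. f x * \<phi>' x)"
    using inner_abs_L2_right[OF si(4), of "abs_L2 f"] inner_abs_L2[OF si(1) si(4)] by simp
  have 2: "(LINT x|circle. rep_L2 (abs_L2 f') x * \<phi> x) = (LINT x|circle. f' x * \<phi> x)"
    using inner_abs_L2_right[OF si(3), of "abs_L2 f'"] inner_abs_L2[OF si(2) si(3)] by simp
  have "(LINT x|circle. f' x * \<phi> x + f x * \<phi>' x) = 0"
  proof (rule circle_integral_deriv_periodic)
    show "((\<lambda>x. f x * \<phi> x) has_real_derivative f' x * \<phi> x + f x * \<phi>' x) (at x)" for x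
      using DERIV_mult[OF f(1)[of x] \<phi>(2)[rule_format, of x]] by (simp add: mult.commute add.commute)
    show "continuous_on UNIV (\<lambda>x. f' x * \<phi> x + f x * \<phi>' x)"
      using f(2) cp cf \<phi>(3) by (intro continuous_intros)
  qed (use f(3) \<phi>(1) in simp)
  then have "(LINT x|circle. f' x * \<phi> x) + (LINT x|circle. f x * \<phi>' x) = 0"
    using square_integrable_mult[OF si(2) si(3)] square_integrable_mult[OF si(1) si(4)]
    by (subst (asm) Bochner_Integration.integral_add) auto
  then show "(LINT x|circle. rep_L2 (abs_L2 f) x * \<phi>' x) = - (LINT x|circle. rep_L2 (abs_L2 f') x * \<phi> x)"
    unfolding 1 2 by linarith
qed

text \<open>In terms of inner products the condition is visibly stable under \<open>L2\<close>
  limits of both functions, which is how derivatives of truncations pass to the limit.\<close>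

lemma has_weak_deriv_iff_inner:
  "has_weak_deriv f g \<longleftrightarrow>
     (\<forall>\<phi> \<phi>'. (\<forall>x. \<phi> (x + 2 * pi) = \<phi> x) \<longrightarrow>
             (\<forall>x. (\<phi> has_real_derivative \<phi>' x) (at x)) \<longrightarrow> continuous_on UNIV \<phi>' \<longrightarrow>
        inner f (abs_L2 \<phi>') = - inner g (abs_L2 \<phi>))"
proof -
  have *: "inner f (abs_L2 \<phi>') = (LINT x|circle. rep_L2 f x * \<phi>' x)" "inner g (abs_L2 \<phi>) = (LINT x|circle. rep_L2 g x * \<phi> x)"
    if "\<forall>x. (\<phi> has_real_derivative \<phi>' x) (at x)" "continuous_on UNIV \<phi>'" for \<phi> \<phi>'
  proof -
    have "continuous_on UNIV \<phi>" using that(1) by (meson DERIV_continuous_on has_field_derivative_at_within)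
    then have "square_integrable \<phi>" "square_integrable \<phi>'"
      using that(2) by (auto intro: square_integrable_continuous continuous_on_subset)
    then show "inner f (abs_L2 \<phi>') = (LINT x|circle. rep_L2 f x * \<phi>' x)" "inner g (abs_L2 \<phi>) = (LINT x|circle. rep_L2 g x * \<phi> x)"
      by (simp_all add: inner_abs_L2_right)
  qed
  show ?thesis unfolding has_weak_deriv_def by (intro iff_allI imp_cong refl) (simp only: *)
qed

lemma has_weak_deriv_closed:
  assumes "\<And>n. has_weak_deriv (f n) (g n)" "f \<longlonglongrightarrow> f0" "g \<longlonglongrightarrow> g0"
  shows "has_weak_deriv f0 g0"
  unfolding has_weak_deriv_iff_inner
proof (intro allI impI)
  fix \<phi> \<phi>' :: "real \<Rightarrow> real"
  assume \<phi>: "\<forall>x. \<phi> (x + 2 * pi) = \<phi> x" "\<forall>x. (\<phi> has_real_derivative \<phi>' x) (at x)" "continuous_on UNIV \<phi>'"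
  have "inner (f n) (abs_L2 \<phi>') = - inner (g n) (abs_L2 \<phi>)" for n
    using assms(1)[of n] \<phi> unfolding has_weak_deriv_iff_inner by blast
  moreover have "(\<lambda>n. inner (f n) (abs_L2 \<phi>')) \<longlonglongrightarrow> inner f0 (abs_L2 \<phi>')"
    by (intro tendsto_intros assms)
  moreover have "(\<lambda>n. - inner (g n) (abs_L2 \<phi>)) \<longlonglongrightarrow> - inner g0 (abs_L2 \<phi>)"
    by (intro tendsto_intros assms)
  ultimately show "inner f0 (abs_L2 \<phi>') = - inner g0 (abs_L2 \<phi>)"
    by (simp add: LIMSEQ_unique)
qed

text \<open>The basis functions and the constant 1 are admissible test functions. Testing with them
  determines all coefficients of the derivative, and conversely the nonzero modes of the primitive;
  both uniqueness statements below rest on this.\<close>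

lemma has_weak_deriv_basis:
  assumes "has_weak_deriv f g"
  shows "inner g (e_basis k) = real_of_int k * inner f (e_basis (- k))" and "inner g one_L2 = 0"
proof -
  have "inner f (abs_L2 (\<lambda>x. - real_of_int k * basis_fun (- k) x)) = - inner g (abs_L2 (basis_fun k))"
  proof (rule assms[unfolded has_weak_deriv_iff_inner, rule_format])
    show "continuous_on UNIV (\<lambda>x. - real_of_int k * basis_fun (- k) x)"
      by (intro continuous_intros continuous_basis_fun)
  qed (simp_all only: basis_fun_periodic basis_fun_deriv)
  then show "inner g (e_basis k) = real_of_int k * inner f (e_basis (- k))"
    unfolding abs_L2_scale[OF square_integrable_basis_fun] by (simp add: e_basis_def)
  have "inner f (abs_L2 (\<lambda>x. 0)) = - inner g (abs_L2 (\<lambda>x. 1))"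
    by (rule assms[unfolded has_weak_deriv_iff_inner, rule_format]) auto
  then show "inner g one_L2 = 0" by (simp add: one_L2_def abs_L2_zero)
qed

lemma L2_eq_by_coeffs:
  assumes "inner g one_L2 = inner g' one_L2" "\<And>k. k \<noteq> 0 \<Longrightarrow> inner g (e_basis k) = inner g' (e_basis k)"
  shows "g = g'"
proof -
  have "g - g' = 0"
  proof (rule trigonometric_system_complete)
    have "g - g' \<in> H_space" using assms(1) by (simp add: H_space_iff inner_diff_left)
    then show "(LINT x|circle. rep_L2 (g - g') x) = 0" by (simp add: H_space_def)
  qed (simp add: inner_diff_left assms(2))
  then show ?thesis by simp
qed

lemma has_weak_deriv_unique: "has_weak_deriv f g \<Longrightarrow> has_weak_deriv f g' \<Longrightarrow> g = g'"
  using has_weak_deriv_basis by (intro L2_eq_by_coeffs) metis+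

lemma weak_deriv_eq: "has_weak_deriv f g \<Longrightarrow> weak_deriv f = g"
  unfolding weak_deriv_def by (intro the_equality) (auto intro: has_weak_deriv_unique)

lemma weak_antideriv_unique:
  assumes "has_weak_deriv f g" "has_weak_deriv f' g" "f \<in> H_space" "f' \<in> H_space"
  shows "f = f'"
proof (rule H_space_eqI[OF assms(3,4)])
  fix k :: int assume "k \<noteq> 0"
  then show "inner f (e_basis k) = inner f' (e_basis k)"
    using has_weak_deriv_basis(1)[OF assms(1), of "-k"] has_weak_deriv_basis(1)[OF assms(2), of "-k"] by simp
qed

section \<open>Hilbert transform and velocity as Fourier multipliers\<close>

lemma l2_uminus: assumes "l2 c" shows "l2 (\<lambda>k. c (- k))"
proof -
  have "uminus ` nonzero_ints = nonzero_ints"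
  proof
    show "nonzero_ints \<subseteq> uminus ` nonzero_ints"
      by (rule subsetI, rule image_eqI[of _ _ "- x" for x]) auto
  qed auto
  then show ?thesis
    using assms summable_on_reindex[of uminus nonzero_ints "\<lambda>k. (c k)\<^sup>2"] by (simp add: l2_def o_def)
qed

lemma norm_synth_uminus: "l2 c \<Longrightarrow> norm (synth (\<lambda>k. c (- k))) = norm (synth c)"
proof -
  assume c: "l2 c"
  have "(norm (synth (\<lambda>k. c (- k))))\<^sup>2 = (norm (synth c))\<^sup>2"
    unfolding norm_synth_infsum[OF c] norm_synth_infsum[OF l2_uminus[OF c]]
    by (rule infsum_reindex_bij_witness[of _ uminus uminus]) auto
  then show ?thesis by simp
qed

text \<open>The symbol \<open>- \<i> * sgn k\<close> in the real basis: it sends a cosine to the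
  sine of the same frequency and a sine to minus the cosine, hence the index \<open>- k\<close>.
  Likewise \<open>vel_coef\<close> below is the symbol \<open>- 1 / \<bar>k\<bar>\<close> of the
  operator that recovers the velocity from the vorticity.\<close>

definition hilb_coef :: "(int \<Rightarrow> real) \<Rightarrow> int \<Rightarrow> real" where "hilb_coef c k = - real_of_int (sgn k) * c (- k)"
definition vel_coef :: "(int \<Rightarrow> real) \<Rightarrow> int \<Rightarrow> real" where "vel_coef c k = - c k / \<bar>real_of_int k\<bar>"

definition coef :: "L2 \<Rightarrow> int \<Rightarrow> real" where "coef u k = inner u (e_basis k)"

definition Hil :: "L2 \<Rightarrow> L2" where "Hil w = synth (hilb_coef (coef w))"
definition Vel :: "L2 \<Rightarrow> L2" where "Vel w = synth (vel_coef (coef w))"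
definition Dx :: "L2 \<Rightarrow> L2" where "Dx w = synth (Dc (coef w))"

lemma l2_coef: "l2 (coef u)"
  using l2_inner by (simp add: coef_def[abs_def])

lemma l2_hilb_coef: "l2 c \<Longrightarrow> l2 (hilb_coef c)"
  by (rule l2_mono[OF l2_uminus[of c], where C = 1]) (auto simp: hilb_coef_def abs_mult sgn_if)

lemma l2_vel_coef: "l2 c \<Longrightarrow> l2 (vel_coef c)"
proof (erule l2_mono[where C = 1])
  fix k :: int assume "k \<noteq> 0"
  then show "\<bar>vel_coef c k\<bar> \<le> 1 * \<bar>c k\<bar>"
    using mult_left_mono[OF abs_int_ge_1, of k "\<bar>c k\<bar>"] by (simp add: vel_coef_def divide_le_eq)
qed

lemma fourier_coeff_eq:
  "fourier_coeff u k = of_real (1 / (2 * pi)) *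
     (of_real (LINT x|circle. rep_L2 u x * cos (real_of_int k * x)) - \<i> * of_real (LINT x|circle. rep_L2 u x * sin (real_of_int k * x)))"
proof -
  have ci: "integrable circle (\<lambda>x. rep_L2 u x * cos (real_of_int k * x))" "integrable circle (\<lambda>x. rep_L2 u x * sin (real_of_int k * x))"
    by (intro integrable_rep_mult_continuous continuous_intros)+
  have e: "exp (- \<i> * of_int k * complex_of_real x) = of_real (cos (real_of_int k * x)) - \<i> * of_real (sin (real_of_int k * x))" for x
  proof -
    have "- \<i> * of_int k * complex_of_real x = \<i> * of_real (- (real_of_int k * x))" by simp
    then show ?thesis by (simp only: cis_conv_exp[symmetric]) (simp add: complex_eq_iff)
  qed
  have "(LINT x|circle. complex_of_real (rep_L2 u x) * exp (- \<i> * of_int k * complex_of_real x)) =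
    (LINT x|circle. complex_of_real (rep_L2 u x * cos (real_of_int k * x)) - \<i> * complex_of_real (rep_L2 u x * sin (real_of_int k * x)))"
    by (simp only: e) (simp add: algebra_simps)
  also have "\<dots> = of_real (LINT x|circle. rep_L2 u x * cos (real_of_int k * x)) - \<i> * of_real (LINT x|circle. rep_L2 u x * sin (real_of_int k * x))"
    by (subst Bochner_Integration.integral_diff) (use ci in \<open>auto simp del: of_real_mult simp: integral_complex_of_real\<close>)
  finally show ?thesis by (simp add: fourier_coeff_def)
qed

lemma inner_basis_cos: "k \<ge> 1 \<Longrightarrow> (LINT x|circle. rep_L2 u x * cos (real_of_int k * x)) = sqrt pi * coef u k"
  unfolding coef_def e_basis_def inner_abs_L2_right[OF square_integrable_basis_fun] by (simp add: basis_fun_pos)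

lemma inner_basis_sin: "k \<ge> 1 \<Longrightarrow> (LINT x|circle. rep_L2 u x * sin (real_of_int k * x)) = sqrt pi * coef u (- k)"
  unfolding coef_def e_basis_def inner_abs_L2_right[OF square_integrable_basis_fun] by (simp add: basis_fun_neg)

lemma fourier_coeff_pos: "k \<ge> 1 \<Longrightarrow> fourier_coeff u k = of_real (sqrt pi / (2 * pi)) * (of_real (coef u k) - \<i> * of_real (coef u (- k)))"
  unfolding fourier_coeff_eq inner_basis_cos inner_basis_sin by (simp add: algebra_simps)

lemma fourier_coeff_neg: "k \<ge> 1 \<Longrightarrow> fourier_coeff u (- k) = of_real (sqrt pi / (2 * pi)) * (of_real (coef u k) + \<i> * of_real (coef u (- k)))"
  using inner_basis_cos[of k u] inner_basis_sin[of k u] unfolding fourier_coeff_eq by (simp add: algebra_simps)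

lemma fourier_coeff_0: "fourier_coeff u 0 = of_real (inner u one_L2 / (2 * pi))"
  unfolding fourier_coeff_eq one_L2_def by (simp add: inner_abs_L2_right square_integrable_const)

lemma fourier_coeff_inject:
  assumes "\<And>k. fourier_coeff u k = fourier_coeff v k"
  shows "u = v"
proof (rule L2_eq_by_coeffs)
  show "inner u one_L2 = inner v one_L2" using assms[of 0] by (simp add: fourier_coeff_0 del: of_real_divide)
  have "coef u k = coef v k \<and> coef u (- k) = coef v (- k)" if "k \<ge> 1" for k
    using assms[of k] pi_gt_zero unfolding fourier_coeff_pos[OF that] by (simp add: complex_eq_iff)
  from this[of k for k] this[of "- k" for k] show "inner u (e_basis k) = inner v (e_basis k)" if "k \<noteq> 0" for k
    using that unfolding coef_def by (cases "k \<ge> 1") (metis, metis add.inverse_inverse linorder_not_le neg_le_iff_le int_one_le_iff_zero_less neg_0_less_iff_less not_less_iff_gr_or_eq)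
qed

text \<open>Resolves the definite description: \<open>Hil w\<close> has the prescribed complex
  coefficients, checked separately for positive, zero and negative frequencies, and complex
  coefficients determine an element of \<open>L2\<close>.\<close>

lemma hilbert_transform_eq: "hilbert_transform w = Hil w"
  unfolding hilbert_transform_def
proof (rule the_equality)
  have cH: "coef (Hil w) k = hilb_coef (coef w) k" if "k \<noteq> 0" for k
    unfolding Hil_def coef_def[of "synth _"] by (rule inner_synth[OF l2_hilb_coef[OF l2_coef] that])
  show *: "\<forall>k. fourier_coeff (Hil w) k = - \<i> * of_int (sgn k) * fourier_coeff w k"
  proof
    fix k :: int
    consider "k \<ge> 1" | "k = 0" | "- k \<ge> 1" by linarith
    then show "fourier_coeff (Hil w) k = - \<i> * of_int (sgn k) * fourier_coeff w k"
    proof cases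
      case 1
      then show ?thesis unfolding fourier_coeff_pos[OF 1]
        by (simp add: cH hilb_coef_def complex_eq_iff)
    next
      case 2
      have "Hil w \<in> H_space" by (simp add: Hil_def synth_in_H)
      then show ?thesis using 2 by (simp add: fourier_coeff_0 H_space_iff)
    next
      case 3
      then show ?thesis using fourier_coeff_neg[OF 3, of "Hil w"] fourier_coeff_neg[OF 3, of w]
        by (simp add: cH hilb_coef_def complex_eq_iff)
    qed
  qed
  fix v assume "\<forall>k. fourier_coeff v k = - \<i> * of_int (sgn k) * fourier_coeff w k"
  then show "v = Hil w" using * by (intro fourier_coeff_inject) auto
qed

section \<open>The nonlinearity\<close>

abbreviation kmul :: "(int \<Rightarrow> real) \<Rightarrow> int \<Rightarrow> real" where "kmul c \<equiv> \<lambda>k. real_of_int k * c k"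

lemma Hdot1_iff: "w \<in> Hdot 1 \<longleftrightarrow> w \<in> H_space \<and> l2 (kmul (coef w))"
proof -
  have "l2 (\<lambda>k. \<bar>real_of_int k\<bar> ^ 1 * inner w (e_basis k)) = l2 (kmul (coef w))"
    by (simp add: l2_def coef_def power_mult_distrib)
  then show ?thesis by (simp only: Hdot_iff)
qed

lemma l2_kmul: "w \<in> Hdot 1 \<Longrightarrow> l2 (kmul (coef w))"
  using Hdot1_iff by blast

lemma norm_kmul: "w \<in> Hdot 1 \<Longrightarrow> norm (synth (kmul (coef w))) = Hdot_norm 1 w"
proof -
  assume w: "w \<in> Hdot 1"
  have "(norm (synth (kmul (coef w))))\<^sup>2 = (Hdot_norm 1 w)\<^sup>2"
    unfolding norm_synth_infsum[OF l2_kmul[OF w]] Hdot_norm_Jop[OF w] Jop_def norm_synth_infsum[OF HdotD(2)[OF w]]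
    by (rule infsum_cong) (simp add: coef_def power_mult_distrib)
  then show ?thesis by (simp add: Hdot_norm_nonneg)
qed

lemma coef_synth: "l2 c \<Longrightarrow> k \<noteq> 0 \<Longrightarrow> coef (synth c) k = c k"
  by (simp add: coef_def inner_synth)

lemma synth_coef: "w \<in> H_space \<Longrightarrow> synth (coef w) = w"
  using synth_inner by (simp add: coef_def[abs_def])

lemma Dc_coef: "Dc c = (\<lambda>k. - kmul c (- k))"
  by (auto simp: Dc_def)

lemma l2_minus: "l2 c \<Longrightarrow> l2 (\<lambda>k. - c k)"
  using l2_scale[of c "-1"] by simp

lemma synth_minus: "synth (\<lambda>k. - c k) = - synth c"
  using synth_scale[of "-1" c] by simp

lemma l2_Dc: "w \<in> Hdot 1 \<Longrightarrow> l2 (Dc (coef w))"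
  unfolding Dc_coef by (intro l2_minus l2_uminus l2_kmul)

lemma norm_Dx: "w \<in> Hdot 1 \<Longrightarrow> norm (Dx w) = Hdot_norm 1 w"
  unfolding Dx_def Dc_coef synth_minus norm_minus_cancel
  by (subst norm_synth_uminus[OF l2_kmul]) (simp_all add: norm_kmul)

lemma bdd_Hdot1: assumes "w \<in> Hdot 1" shows "bdd_L2 (Ksup * Hdot_norm 1 w) w"
proof -
  have "w \<in> H_space" using assms by (rule HdotD)
  then show ?thesis using bdd_synth[OF l2_kmul[OF assms]] by (simp add: norm_kmul[OF assms] synth_coef)
qed

lemma l2_kmul_hilb: "w \<in> Hdot 1 \<Longrightarrow> l2 (kmul (hilb_coef (coef w)))"
  by (rule l2_mono[OF l2_uminus[OF l2_kmul], where C = 1]) (auto simp: hilb_coef_def abs_mult sgn_if)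

lemma Hil_in_Hdot1: assumes w: "w \<in> Hdot 1" shows "Hil w \<in> Hdot 1" and "Hdot_norm 1 (Hil w) \<le> Hdot_norm 1 w"
proof -
  have c: "kmul (coef (Hil w)) = kmul (hilb_coef (coef w))"
  proof
    show "kmul (coef (Hil w)) k = kmul (hilb_coef (coef w)) k" for k
      unfolding Hil_def using coef_synth[OF l2_hilb_coef[OF l2_coef]] by (cases "k = 0") auto
  qed
  show 1: "Hil w \<in> Hdot 1"
    unfolding Hdot1_iff c using l2_kmul_hilb[OF w] by (simp add: Hil_def synth_in_H)
  have "norm (synth (kmul (coef (Hil w)))) \<le> 1 * norm (synth (\<lambda>k. kmul (coef w) (- k)))"
    unfolding c by (rule norm_synth_mono[OF l2_uminus[OF l2_kmul[OF w]]]) (auto simp: hilb_coef_def abs_mult sgn_if)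
  then show "Hdot_norm 1 (Hil w) \<le> Hdot_norm 1 w"
    unfolding norm_kmul[OF 1] norm_synth_uminus[OF l2_kmul[OF w]] norm_kmul[OF w] by simp
qed

lemma l2_kmul_vel: "l2 (kmul (vel_coef (coef w)))"
proof (rule l2_mono[OF l2_coef[of w], where C = 1])
  show "\<bar>real_of_int k * vel_coef (coef w) k\<bar> \<le> 1 * \<bar>coef w k\<bar>" if "k \<noteq> 0" for k
    using that by (simp add: vel_coef_def abs_mult)
qed

lemma Vel_in_Hdot1: assumes w: "w \<in> H_space" shows "Vel w \<in> Hdot 1" and "Hdot_norm 1 (Vel w) \<le> norm w"
proof -
  have c: "kmul (coef (Vel w)) = kmul (vel_coef (coef w))"
  proof
    show "kmul (coef (Vel w)) k = kmul (vel_coef (coef w)) k" for k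
      unfolding Vel_def using coef_synth[OF l2_vel_coef[OF l2_coef]] by (cases "k = 0") auto
  qed
  show 1: "Vel w \<in> Hdot 1"
    unfolding Hdot1_iff c using l2_kmul_vel by (simp add: Vel_def synth_in_H)
  have "norm (synth (kmul (coef (Vel w)))) \<le> 1 * norm (synth (coef w))"
    unfolding c
  proof (rule norm_synth_mono[OF l2_coef[of w]])
    show "\<bar>real_of_int k * vel_coef (coef w) k\<bar> \<le> 1 * \<bar>coef w k\<bar>" if "k \<noteq> 0" for k
      using that by (simp add: vel_coef_def abs_mult)
  qed simp
  then show "Hdot_norm 1 (Vel w) \<le> norm w"
    unfolding norm_kmul[OF 1] synth_coef[OF w] by simp
qed

lemma Dc_vel: "k \<in> cut n \<Longrightarrow> Dc (vel_coef c) k = hilb_coef c k"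
  by (auto simp: Dc_def vel_coef_def hilb_coef_def sgn_if)

lemma tp_cong: "(\<And>k. k \<in> cut n \<Longrightarrow> c k = d k) \<Longrightarrow> tp c n = tp d n"
  by (rule ext) (auto simp: tp_def)

lemma tp_vel_deriv: "(tp (vel_coef c) n has_real_derivative tp (hilb_coef c) n x) (at x)"
  using tp_deriv[of "vel_coef c" n x] by (simp only: tp_cong[OF Dc_vel])

lemma weak_deriv_Vel: "has_weak_deriv (Vel w) (Hil w)"
proof (rule has_weak_deriv_closed)
  show "has_weak_deriv (Sn (vel_coef (coef w)) n) (Sn (hilb_coef (coef w)) n)" for n
    unfolding abs_tp[symmetric]
    by (rule has_weak_deriv_smooth[OF tp_vel_deriv continuous_tp tp_periodic])
  show "Sn (vel_coef (coef w)) \<longlonglongrightarrow> Vel w" unfolding Vel_def by (intro Sn_tendsto l2_vel_coef l2_coef)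
  show "Sn (hilb_coef (coef w)) \<longlonglongrightarrow> Hil w" unfolding Hil_def by (intro Sn_tendsto l2_hilb_coef l2_coef)
qed

lemma velocity_eq: "velocity w = Vel w"
  unfolding velocity_def hilbert_transform_eq
proof (rule the_equality)
  show "Vel w \<in> H_space \<and> has_weak_deriv (Vel w) (Hil w)" using weak_deriv_Vel by (simp add: Vel_def synth_in_H)
  fix u assume "u \<in> H_space \<and> has_weak_deriv u (Hil w)"
  then show "u = Vel w" using weak_antideriv_unique[of u "Hil w" "Vel w"] weak_deriv_Vel by (simp add: Vel_def synth_in_H)
qed

context
  fixes w assumes w: "w \<in> Hdot 1"
begin

private abbreviation "fw \<equiv> tp (coef w)"
private abbreviation "fu \<equiv> tp (vel_coef (coef w))"
private abbreviation "fh \<equiv> tp (hilb_coef (coef w))"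
private abbreviation "fd \<equiv> tp (Dc (coef w))"

text \<open>In each product the second factor is in \<open>H\<^sup>1\<close> and converges
  uniformly. For the third product this is the velocity, smoother than \<open>w\<close> by one
  derivative, since \<open>Dx w\<close> converges in \<open>L2\<close> only; this explains the order
  of the factors there.\<close>

private lemma lims:
  "(\<lambda>n. abs_L2 (\<lambda>x. fu n x * fw n x)) \<longlonglongrightarrow> mult_L2 (Vel w) w"
  "(\<lambda>n. abs_L2 (\<lambda>x. fh n x * fw n x)) \<longlonglongrightarrow> mult_L2 (Hil w) w"
  "(\<lambda>n. abs_L2 (\<lambda>x. fd n x * fu n x)) \<longlonglongrightarrow> mult_L2 (Vel w) (Dx w)"
  "(\<lambda>n. abs_L2 (\<lambda>x. fw n x)) \<longlonglongrightarrow> w"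
proof -
  have wH: "w \<in> H_space" using w by (rule HdotD)
  show "(\<lambda>n. abs_L2 (\<lambda>x. fu n x * fw n x)) \<longlonglongrightarrow> mult_L2 (Vel w) w"
    using mult_Sn_tendsto[OF l2_vel_coef[OF l2_coef[of w]] l2_kmul[OF w]] by (simp add: mult_Sn_tp Vel_def synth_coef[OF wH])
  show "(\<lambda>n. abs_L2 (\<lambda>x. fh n x * fw n x)) \<longlonglongrightarrow> mult_L2 (Hil w) w"
    using mult_Sn_tendsto[OF l2_hilb_coef[OF l2_coef[of w]] l2_kmul[OF w]] by (simp add: mult_Sn_tp Hil_def synth_coef[OF wH])
  show "(\<lambda>n. abs_L2 (\<lambda>x. fd n x * fu n x)) \<longlonglongrightarrow> mult_L2 (Vel w) (Dx w)"
    unfolding mult_L2_commute[of "Vel w" "Dx w"]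
    using mult_Sn_tendsto[OF l2_Dc[OF w] l2_kmul_vel[of w]] by (simp add: mult_Sn_tp Dx_def Vel_def)
  show "(\<lambda>n. abs_L2 (\<lambda>x. fw n x)) \<longlonglongrightarrow> w"
    using Sn_tendsto[OF l2_coef[of w]] by (simp add: abs_tp synth_coef[OF wH])
qed

lemma weak_deriv_product: "has_weak_deriv (mult_L2 (Vel w) w) (mult_L2 (Hil w) w + mult_L2 (Vel w) (Dx w))"
proof (rule has_weak_deriv_closed[OF _ lims(1) tendsto_add[OF lims(2) lims(3)]])
  fix n
  have "has_weak_deriv (abs_L2 (\<lambda>x. fu n x * fw n x)) (abs_L2 (\<lambda>x. fh n x * fw n x + fd n x * fu n x))"
  proof (rule has_weak_deriv_smooth)
    show "((\<lambda>x. fu n x * fw n x) has_real_derivative fh n x * fw n x + fd n x * fu n x) (at x)" for x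
      by (rule DERIV_mult[OF tp_vel_deriv tp_deriv])
    show "continuous_on UNIV (\<lambda>x. fh n x * fw n x + fd n x * fu n x)" by (intro continuous_intros continuous_tp)
  qed (simp add: tp_periodic)
  also have "abs_L2 (\<lambda>x. fh n x * fw n x + fd n x * fu n x) = abs_L2 (\<lambda>x. fh n x * fw n x) + abs_L2 (\<lambda>x. fd n x * fu n x)"
    by (intro abs_L2_add square_integrable_continuous continuous_intros continuous_tp)
  finally show "has_weak_deriv (abs_L2 (\<lambda>x. fu n x * fw n x)) (abs_L2 (\<lambda>x. fh n x * fw n x) + abs_L2 (\<lambda>x. fd n x * fu n x))" .
qed

text \<open>The product rule for the transport term gives
  \<open>2 (u\<^sub>x w + u w\<^sub>x)\<close>, from which the stretching term takes
  \<open>u\<^sub>x w\<close> once. The coefficients 1 and 2 that remain are those for which testing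
  with \<open>w\<close> gives a total derivative.\<close>

lemma nonlinearity_eq: "nonlinearity (-2) w = mult_L2 (Hil w) w + 2 *\<^sub>R mult_L2 (Vel w) (Dx w)"
proof -
  have 1: "weak_deriv (mult_L2 (Vel w) w) = mult_L2 (Hil w) w + mult_L2 (Vel w) (Dx w)"
    by (rule weak_deriv_eq[OF weak_deriv_product])
  have 2: "weak_deriv (Vel w) = Hil w" by (rule weak_deriv_eq[OF weak_deriv_Vel])
  have "nonlinearity (-2) w = 2 *\<^sub>R (mult_L2 (Hil w) w + mult_L2 (Vel w) (Dx w)) + (-1) *\<^sub>R mult_L2 (Hil w) w"
    unfolding nonlinearity_def velocity_eq 1 2 by simp
  also have "\<dots> = mult_L2 (Hil w) w + 2 *\<^sub>R mult_L2 (Vel w) (Dx w)"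
    by (simp add: scaleR_add_right scaleR_2)
  finally show ?thesis .
qed

text \<open>The transport term is tested against \<open>w\<close>: \<open>(u\<^sub>x w + 2 u w\<^sub>x) w = (u w\<^sup>2)\<^sub>x\<close>.\<close>

lemma nonlinearity_orthogonal: "inner (nonlinearity (-2) w) w = 0"
proof -
  let ?N = "\<lambda>n. abs_L2 (\<lambda>x. fh n x * fw n x) + 2 *\<^sub>R abs_L2 (\<lambda>x. fd n x * fu n x)"
  have "inner (?N n) (abs_L2 (\<lambda>x. fw n x)) = 0" for n
  proof -
    have c: "continuous_on {0..2*pi} (\<lambda>x. fh n x * fw n x)" "continuous_on {0..2*pi} (\<lambda>x. fd n x * fu n x)"
      "continuous_on {0..2*pi} (fw n)"
      by (intro continuous_intros continuous_tp)+
    note si = c[THEN square_integrable_continuous]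
    have "inner (?N n) (abs_L2 (\<lambda>x. fw n x)) = inner (abs_L2 (\<lambda>x. fh n x * fw n x + 2 * (fd n x * fu n x))) (abs_L2 (fw n))"
      using abs_L2_add[OF si(1) square_integrable_scale[OF si(2)], of 2] abs_L2_scale[OF si(2), of 2] by simp
    also have "\<dots> = (LINT x|circle. (fh n x * fw n x + 2 * (fd n x * fu n x)) * fw n x)"
      by (intro inner_abs_L2 square_integrable_add square_integrable_scale si)
    also have "\<dots> = 0"
    proof (rule circle_integral_deriv_periodic)
      fix x
      have "((\<lambda>x. (fu n x * fw n x) * fw n x) has_real_derivative
         (fh n x * fw n x + fd n x * fu n x) * fw n x + fd n x * (fu n x * fw n x)) (at x)"
        by (rule DERIV_mult[OF DERIV_mult[OF tp_vel_deriv tp_deriv] tp_deriv])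
      moreover have "(fh n x * fw n x + fd n x * fu n x) * fw n x + fd n x * (fu n x * fw n x) =
          (fh n x * fw n x + 2 * (fd n x * fu n x)) * fw n x" by (simp add: algebra_simps)
      ultimately show "((\<lambda>x. (fu n x * fw n x) * fw n x) has_real_derivative
         (fh n x * fw n x + 2 * (fd n x * fu n x)) * fw n x) (at x)" by simp
    next
      show "continuous_on UNIV (\<lambda>x. (fh n x * fw n x + 2 * (fd n x * fu n x)) * fw n x)"
        by (intro continuous_intros continuous_tp)
    qed (simp add: tp_periodic)
    finally show ?thesis .
  qed
  moreover have "(\<lambda>n. inner (?N n) (abs_L2 (\<lambda>x. fw n x))) \<longlonglongrightarrow> inner (nonlinearity (-2) w) w"
    unfolding nonlinearity_eq by (intro tendsto_intros lims)
  ultimately show ?thesis by (simp add: LIMSEQ_const_iff)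
qed

end

lemma coef_diff: "coef (u - v) k = coef u k - coef v k"
  by (simp add: coef_def inner_diff_left)

lemma Hil_diff: "Hil (u - v) = Hil u - Hil v"
proof -
  have "hilb_coef (coef (u - v)) = (\<lambda>k. hilb_coef (coef u) k - hilb_coef (coef v) k)"
    by (simp add: hilb_coef_def fun_eq_iff coef_diff right_diff_distrib)
  then show ?thesis unfolding Hil_def by (simp only: synth_diff l2_hilb_coef l2_coef)
qed

lemma Vel_diff: "Vel (u - v) = Vel u - Vel v"
proof -
  have "vel_coef (coef (u - v)) = (\<lambda>k. vel_coef (coef u) k - vel_coef (coef v) k)"
    by (simp add: vel_coef_def fun_eq_iff coef_diff diff_divide_distrib)
  then show ?thesis unfolding Vel_def by (simp only: synth_diff l2_vel_coef l2_coef)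
qed

lemma Dx_diff: "u \<in> Hdot 1 \<Longrightarrow> v \<in> Hdot 1 \<Longrightarrow> Dx (u - v) = Dx u - Dx v"
proof -
  assume "u \<in> Hdot 1" "v \<in> Hdot 1"
  moreover have "Dc (coef (u - v)) = (\<lambda>k. Dc (coef u) k - Dc (coef v) k)"
    by (simp add: Dc_def fun_eq_iff coef_diff right_diff_distrib)
  ultimately show ?thesis unfolding Dx_def by (simp only: synth_diff l2_Dc)
qed

text \<open>Both products are bilinear, so their differences telescope. In every term the first
  factor is bounded through its \<open>H\<^sup>1\<close> norm: the Hilbert transform does not
  increase that norm and the velocity gains a derivative. The constant 3 adds the weights 1 and 2 of
  the two products.\<close>

lemma nonlinearity_diff_bound:
  assumes "v \<in> Hdot 1" "w \<in> Hdot 1"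
  shows "norm (nonlinearity (-2) v - nonlinearity (-2) w) \<le> 3 * Ksup * (Hdot_norm 1 v + Hdot_norm 1 w) * Hdot_norm 1 (v - w)"
proof -
  let ?n = "Hdot_norm 1" and ?d = "v - w"
  have d: "?d \<in> Hdot 1" by (rule Hdot_diff[OF assms])
  have H: "v \<in> H_space" "w \<in> H_space" "?d \<in> H_space" using assms d by (auto intro: HdotD)
  have n0: "\<And>u. 0 \<le> ?n u" by (rule Hdot_norm_nonneg)
  have hb: "bdd_L2 (Ksup * ?n (Hil u)) (Hil u)" if "u \<in> Hdot 1" for u using bdd_Hdot1[OF Hil_in_Hdot1(1)[OF that]] .
  have vb: "bdd_L2 (Ksup * ?n (Vel u)) (Vel u)" if "u \<in> H_space" for u using bdd_Hdot1[OF Vel_in_Hdot1(1)[OF that]] .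
  have p1: "norm (mult_L2 (Hil u) f) \<le> Ksup * ?n u * norm f" if "u \<in> Hdot 1" for u f
  proof -
    have "norm (mult_L2 (Hil u) f) \<le> (Ksup * ?n (Hil u)) * norm f"
      by (subst mult_L2_commute) (intro norm_mult_L2 hb that mult_nonneg_nonneg Ksup_nonneg n0)
    also have "\<dots> \<le> (Ksup * ?n u) * norm f"
      by (intro mult_right_mono mult_left_mono Hil_in_Hdot1 that Ksup_nonneg norm_ge_zero)
    finally show ?thesis .
  qed
  have p2: "norm (mult_L2 (Vel u) f) \<le> Ksup * ?n u * norm f" if "u \<in> Hdot 1" for u f
  proof -
    have uH: "u \<in> H_space" using that by (rule HdotD)
    have "norm (mult_L2 (Vel u) f) \<le> (Ksup * ?n (Vel u)) * norm f"
      by (subst mult_L2_commute) (intro norm_mult_L2 vb uH mult_nonneg_nonneg Ksup_nonneg n0)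
    also have "\<dots> \<le> (Ksup * ?n u) * norm f"
      by (intro mult_right_mono mult_left_mono order_trans[OF Vel_in_Hdot1(2)[OF uH]] norm_le_Hdot_norm that Ksup_nonneg norm_ge_zero)
    finally show ?thesis .
  qed
  have e1: "mult_L2 (Hil v) v - mult_L2 (Hil w) w = mult_L2 (Hil ?d) v + mult_L2 (Hil w) ?d"
    by (simp add: Hil_diff mult_L2_diff_left[OF bdd_Hdot1[OF assms(1)]] mult_L2_diff_right[OF bdd_Hdot1[OF assms(1)] bdd_Hdot1[OF assms(2)]])
  have e2: "mult_L2 (Vel v) (Dx v) - mult_L2 (Vel w) (Dx w) = mult_L2 (Vel ?d) (Dx v) + mult_L2 (Vel w) (Dx ?d)"
    by (simp add: Vel_diff Dx_diff[OF assms] mult_L2_commute[of _ "Dx v"] mult_L2_commute[of _ "Dx w"] mult_L2_commute[of _ "Dx v - Dx w"]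
         mult_L2_diff_left[OF vb[OF H(2)]] mult_L2_diff_right[OF vb[OF H(1)] vb[OF H(2)]])
  have "nonlinearity (-2) v - nonlinearity (-2) w =
     (mult_L2 (Hil v) v - mult_L2 (Hil w) w) + 2 *\<^sub>R (mult_L2 (Vel v) (Dx v) - mult_L2 (Vel w) (Dx w))"
    unfolding nonlinearity_eq[OF assms(1)] nonlinearity_eq[OF assms(2)] by (simp add: scaleR_diff_right)
  also have "norm \<dots> \<le> norm (mult_L2 (Hil ?d) v) + norm (mult_L2 (Hil w) ?d) + 2 * (norm (mult_L2 (Vel ?d) (Dx v)) + norm (mult_L2 (Vel w) (Dx ?d)))"
    unfolding e1 e2
    using norm_triangle_ineq[of "mult_L2 (Hil ?d) v + mult_L2 (Hil w) ?d" "2 *\<^sub>R (mult_L2 (Vel ?d) (Dx v) + mult_L2 (Vel w) (Dx ?d))"]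
      norm_triangle_ineq[of "mult_L2 (Hil ?d) v" "mult_L2 (Hil w) ?d"]
      norm_triangle_ineq[of "mult_L2 (Vel ?d) (Dx v)" "mult_L2 (Vel w) (Dx ?d)"]
    unfolding norm_scaleR by simp
  also have "\<dots> \<le> Ksup * ?n ?d * ?n v + Ksup * ?n w * ?n ?d + 2 * (Ksup * ?n ?d * ?n v + Ksup * ?n w * ?n ?d)"
  proof -
    have a: "norm (mult_L2 (Hil ?d) v) \<le> Ksup * ?n ?d * ?n v"
      by (rule order_trans[OF p1[OF d]]) (intro mult_left_mono norm_le_Hdot_norm assms mult_nonneg_nonneg Ksup_nonneg n0)
    have b: "norm (mult_L2 (Hil w) ?d) \<le> Ksup * ?n w * ?n ?d"
      by (rule order_trans[OF p1[OF assms(2)]]) (intro mult_left_mono norm_le_Hdot_norm d mult_nonneg_nonneg Ksup_nonneg n0)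
    have c: "norm (mult_L2 (Vel ?d) (Dx v)) \<le> Ksup * ?n ?d * ?n v" using p2[OF d, of "Dx v"] by (simp only: norm_Dx assms)
    have d: "norm (mult_L2 (Vel w) (Dx ?d)) \<le> Ksup * ?n w * ?n ?d" using p2[OF assms(2), of "Dx ?d"] by (simp only: norm_Dx d)
    show ?thesis by (intro add_mono mult_left_mono a b c d) simp_all
  qed
  also have "\<dots> = 3 * Ksup * (?n v + ?n w) * ?n ?d" by (simp add: algebra_simps)
  finally show ?thesis .
qed

lemma continuous_on_nonlinearity:
  fixes w :: "'a::topological_space \<Rightarrow> L2"
  assumes w: "\<And>t. t \<in> S \<Longrightarrow> w t \<in> Hdot 1" and c: "continuous_on S (\<lambda>t. Jop 1 (w t))"
  shows "continuous_on S (\<lambda>t. nonlinearity (-2) (w t))"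
  unfolding continuous_on_def
proof
  fix t assume t: "t \<in> S"
  have J: "((\<lambda>s. Jop 1 (w s)) \<longlongrightarrow> Jop 1 (w t)) (at t within S)" using c t by (simp add: continuous_on_def)
  have "((\<lambda>s. 3 * Ksup * (norm (Jop 1 (w s)) + norm (Jop 1 (w t))) * norm (Jop 1 (w s) - Jop 1 (w t))) \<longlongrightarrow>
     3 * Ksup * (norm (Jop 1 (w t)) + norm (Jop 1 (w t))) * norm (Jop 1 (w t) - Jop 1 (w t))) (at t within S)"
    by (intro tendsto_intros J)
  then have lim: "((\<lambda>s. 3 * Ksup * (norm (Jop 1 (w s)) + norm (Jop 1 (w t))) * norm (Jop 1 (w s) - Jop 1 (w t))) \<longlongrightarrow> 0) (at t within S)"
    by simp
  have "\<forall>\<^sub>F s in at t within S. s \<in> S" by (simp add: eventually_at_filter)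
  then have "\<forall>\<^sub>F s in at t within S. norm (nonlinearity (-2) (w s) - nonlinearity (-2) (w t)) \<le>
      3 * Ksup * (norm (Jop 1 (w s)) + norm (Jop 1 (w t))) * norm (Jop 1 (w s) - Jop 1 (w t))"
  proof eventually_elim
    case (elim s)
    show ?case using nonlinearity_diff_bound[OF w[OF elim] w[OF t]]
      by (simp add: Hdot_norm_Jop w elim t Hdot_diff Jop_diff del: One_nat_def)
  qed
  then have "((\<lambda>s. nonlinearity (-2) (w s) - nonlinearity (-2) (w t)) \<longlongrightarrow> 0) (at t within S)"
    by (rule Lim_null_comparison) (rule lim)
  then show "((\<lambda>s. nonlinearity (-2) (w s)) \<longlongrightarrow> nonlinearity (-2) (w t)) (at t within S)"
    by (simp add: LIM_zero_iff)
qed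

section \<open>From the mild to the integrated equation\<close>

lemma heat_synth: "heat \<tau> f = synth (\<lambda>k. exp (- (real_of_int k)\<^sup>2 * \<tau>) * coef f k)"
  by (simp add: heat_def synth_def coef_def)

lemma exp_heat_le: "\<tau> \<ge> 0 \<Longrightarrow> \<bar>exp (- (real_of_int k)\<^sup>2 * \<tau>) * c\<bar> \<le> 1 * \<bar>c\<bar>"
  unfolding abs_mult by (intro mult_right_mono) auto

lemma l2_heat: "\<tau> \<ge> 0 \<Longrightarrow> l2 c \<Longrightarrow> l2 (\<lambda>k. exp (- (real_of_int k)\<^sup>2 * \<tau>) * c k)"
  by (erule l2_mono, erule exp_heat_le)

lemma coef_heat: "\<tau> \<ge> 0 \<Longrightarrow> k \<noteq> 0 \<Longrightarrow> coef (heat \<tau> f) k = exp (- (real_of_int k)\<^sup>2 * \<tau>) * coef f k"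
  unfolding heat_synth by (rule coef_synth[OF l2_heat[OF _ l2_coef]])

text \<open>For \<open>f\<close> with a nonzero mean, \<open>synth (coef f)\<close> is the
  orthogonal projection of \<open>f\<close> onto \<open>H_space\<close>, so this is Bessel's
  inequality and not an equality.\<close>

lemma norm_synth_coef_le: "norm (synth (coef f)) \<le> norm f"
proof -
  have "(\<lambda>n. \<Sum>k\<in>cut n. (coef f k)\<^sup>2) \<longlonglongrightarrow> (norm (synth (coef f)))\<^sup>2"
    by (rule has_sum_cut[OF norm_synth[OF l2_coef]])
  then have "(norm (synth (coef f)))\<^sup>2 \<le> (norm f)\<^sup>2"
    by (rule LIMSEQ_le_const2) (use bessel_finite[OF finite_cut cut_subset, of f] in \<open>auto simp: coef_def\<close>)
  then show ?thesis by (rule power2_le_imp_le) simp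
qed

lemma heat_contraction:
  assumes "\<tau> \<ge> 0" shows "norm (heat \<tau> f - heat \<tau> g) \<le> norm (f - g)"
proof -
  have "heat \<tau> f - heat \<tau> g = synth (\<lambda>k. exp (- (real_of_int k)\<^sup>2 * \<tau>) * coef (f - g) k)"
    unfolding heat_synth coef_diff right_diff_distrib
    by (intro synth_diff[symmetric] l2_heat l2_coef assms)
  also have "norm \<dots> \<le> 1 * norm (synth (coef (f - g)))"
    by (rule norm_synth_mono[OF l2_coef exp_heat_le]) (use assms in auto)
  finally show ?thesis using norm_synth_coef_le[of "f - g"] by simp
qed

text \<open>The truncated series are continuous in time and converge uniformly: the multipliers are
  at most 1, so the tail at any time is no larger than the tail at time 0.\<close>

lemma continuous_heat_time: "continuous_on {0..} (\<lambda>\<tau>. heat \<tau> f)"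
proof (rule uniform_limit_theorem)
  let ?h = "\<lambda>n \<tau>. \<Sum>k\<in>cut n. (exp (- (real_of_int k)\<^sup>2 * \<tau>) * coef f k) *\<^sub>R e_basis k"
  show "\<forall>\<^sub>F n in sequentially. continuous_on {0..} (?h n)"
    by (intro always_eventually allI continuous_intros)
  show "uniform_limit {0..} ?h (\<lambda>\<tau>. heat \<tau> f) sequentially"
    unfolding uniform_limit_iff
  proof (intro allI impI)
    fix e :: real assume e: "e > 0"
    have "(\<lambda>n. norm (synth (coef f) - Sn (coef f) n)) \<longlonglongrightarrow> norm (synth (coef f) - synth (coef f))"
      by (intro tendsto_intros Sn_tendsto l2_coef)
    then have "(\<lambda>n. norm (synth (coef f) - Sn (coef f) n)) \<longlonglongrightarrow> 0" by simp
    then have "\<forall>\<^sub>F n in sequentially. norm (synth (coef f) - Sn (coef f) n) < e"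
      using e by (rule order_tendstoD(2))
    then show "\<forall>\<^sub>F n in sequentially. \<forall>\<tau>\<in>{0..}. dist (?h n \<tau>) (heat \<tau> f) < e"
    proof eventually_elim
      case (elim n)
      show ?case
      proof
        fix \<tau> :: real assume "\<tau> \<in> {0..}"
        then have \<tau>: "\<tau> \<ge> 0" by simp
        let ?c = "\<lambda>k. exp (- (real_of_int k)\<^sup>2 * \<tau>) * coef f k"
        have tail: "synth c - Sn c n = synth (\<lambda>k. if k \<in> cut n then 0 else c k)" if "l2 c" for c
        proof -
          have "synth c - Sn c n = synth (\<lambda>k. c k - (if k \<in> cut n then c k else 0))"
            unfolding Sn_eq_synth by (intro synth_diff[symmetric] l2_if that)
          also have "\<dots> = synth (\<lambda>k. if k \<in> cut n then 0 else c k)" by (rule synth_cong) auto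
          finally show ?thesis .
        qed
        have l2': "l2 (\<lambda>k. if k \<in> cut n then 0 else coef f k)"
          by (rule l2_mono[OF l2_coef[of f], where C = 1]) auto
        have "norm (synth (\<lambda>k. if k \<in> cut n then 0 else ?c k)) \<le> 1 * norm (synth (\<lambda>k. if k \<in> cut n then 0 else coef f k))"
          by (rule norm_synth_mono[OF l2']) (use exp_heat_le[OF \<tau>] in auto)
        then have "norm (heat \<tau> f - ?h n \<tau>) \<le> norm (synth (coef f) - Sn (coef f) n)"
          using tail[OF l2_coef[of f]] tail[OF l2_heat[OF \<tau> l2_coef[of f]]] by (simp add: heat_synth Sn_def)
        then show "dist (?h n \<tau>) (heat \<tau> f) < e" using elim by (simp add: dist_norm norm_minus_commute)
      qed
    qed
  qed
qed simp

lemma continuous_heat_convolution: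
  assumes g: "continuous_on {0..t} g" and nu: "\<nu> \<ge> 0"
  shows "continuous_on {0..t} (\<lambda>s. heat (\<nu> * (t - s)) (g s))"
  unfolding continuous_on_def
proof
  fix s0 assume s0: "s0 \<in> {0..t}"
  have ev: "\<forall>\<^sub>F s in at s0 within {0..t}. s \<in> {0..t}" by (simp add: eventually_at_filter)
  have c1: "continuous_on {0..t} (\<lambda>s. heat (\<nu> * (t - s)) (g s0))"
    by (rule continuous_on_compose2[OF continuous_heat_time]) (use nu in \<open>auto intro!: continuous_intros\<close>)
  have "((\<lambda>s. heat (\<nu> * (t - s)) (g s) - heat (\<nu> * (t - s)) (g s0)) \<longlongrightarrow> 0) (at s0 within {0..t})"
  proof (rule Lim_null_comparison)
    show "\<forall>\<^sub>F s in at s0 within {0..t}. norm (heat (\<nu> * (t - s)) (g s) - heat (\<nu> * (t - s)) (g s0)) \<le> norm (g s - g s0)"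
      using ev
    proof eventually_elim
      case (elim s)
      then have "\<nu> * (t - s) \<ge> 0" using nu by simp
      then show ?case by (rule heat_contraction)
    qed
    have "((\<lambda>s. norm (g s - g s0)) \<longlongrightarrow> norm (g s0 - g s0)) (at s0 within {0..t})"
      using g s0 by (intro tendsto_intros) (auto simp: continuous_on_def)
    then show "((\<lambda>s. norm (g s - g s0)) \<longlongrightarrow> 0) (at s0 within {0..t})" by simp
  qed
  moreover have "((\<lambda>s. heat (\<nu> * (t - s)) (g s0)) \<longlongrightarrow> heat (\<nu> * (t - s0)) (g s0)) (at s0 within {0..t})"
    using c1 s0 by (auto simp: continuous_on_def)
  ultimately have "((\<lambda>s. (heat (\<nu> * (t - s)) (g s) - heat (\<nu> * (t - s)) (g s0)) + heat (\<nu> * (t - s)) (g s0)) \<longlongrightarrow> 0 + heat (\<nu> * (t - s0)) (g s0)) (at s0 within {0..t})"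
    by (rule tendsto_add)
  then show "((\<lambda>s. heat (\<nu> * (t - s)) (g s)) \<longlongrightarrow> heat (\<nu> * (t - s0)) (g s0)) (at s0 within {0..t})" by simp
qed

text \<open>Taking a coefficient is a bounded linear functional and commutes with the gauge integral
  once the latter exists; existence comes from continuity of the integrand.\<close>

lemma coef_integral_heat:
  assumes g: "continuous_on {0..t} g" and nu: "\<nu> \<ge> 0" and k: "k \<noteq> 0"
  shows "coef (integral {0..t} (\<lambda>s. heat (\<nu> * (t - s)) (g s))) k =
     integral {0..t} (\<lambda>s. exp (- (real_of_int k)\<^sup>2 * (\<nu> * (t - s))) * coef (g s) k)"
proof -
  let ?h = "\<lambda>s. heat (\<nu> * (t - s)) (g s)"
  have "?h integrable_on {0..t}"
    by (rule integrable_continuous_real[OF continuous_heat_convolution[OF g nu]])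
  then have "integral {0..t} ((\<lambda>u. inner u (e_basis k)) \<circ> ?h) = inner (integral {0..t} ?h) (e_basis k)"
    by (rule integral_linear[OF _ bounded_linear_inner_left])
  moreover have "integral {0..t} ((\<lambda>u. inner u (e_basis k)) \<circ> ?h) =
      integral {0..t} (\<lambda>s. exp (- (real_of_int k)\<^sup>2 * (\<nu> * (t - s))) * coef (g s) k)"
  proof (rule integral_cong)
    fix s assume "s \<in> {0..t}"
    then have "\<nu> * (t - s) \<ge> 0" using nu by simp
    from coef_heat[OF this k, of "g s"]
    show "((\<lambda>u. inner u (e_basis k)) \<circ> ?h) s = exp (- (real_of_int k)\<^sup>2 * (\<nu> * (t - s))) * coef (g s) k"
      by (simp add: coef_def)
  qed
  ultimately show ?thesis by (simp add: coef_def)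
qed

section \<open>Riemann-Stieltjes sums on a uniform grid\<close>

lemma integral_partition:
  fixes h :: "real \<Rightarrow> real"
  assumes "mono \<tau>" "h integrable_on {\<tau> 0..\<tau> n}"
  shows "integral {\<tau> 0..\<tau> n} h = (\<Sum>i<n. integral {\<tau> i..\<tau> (Suc i)} h)"
  using assms(2)
proof (induction n)
  case (Suc n)
  have le: "\<tau> 0 \<le> \<tau> n" "\<tau> n \<le> \<tau> (Suc n)" using assms(1) by (auto simp: mono_def)
  have "h integrable_on {\<tau> 0..\<tau> n}" by (rule integrable_subinterval_real[OF Suc.prems]) (use le in auto)
  then show ?case
    using Suc.IH Henstock_Kurzweil_Integration.integral_combine[OF le Suc.prems] by simp
qed simp

definition grid :: "real \<Rightarrow> nat \<Rightarrow> nat \<Rightarrow> real" where "grid t n i = t * real i / real n"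

lemma grid_0 [simp]: "grid t n 0 = 0" and grid_n: "n > 0 \<Longrightarrow> grid t n n = t"
  by (auto simp: grid_def)

lemma mono_grid: "t \<ge> 0 \<Longrightarrow> mono (grid t n)"
  unfolding grid_def by (intro monoI divide_right_mono mult_left_mono) auto

lemma grid_step: "grid t n (Suc i) - grid t n i = t / real n"
  by (simp add: grid_def diff_divide_distrib[symmetric] algebra_simps)

lemma grid_in: "t \<ge> 0 \<Longrightarrow> i \<le> n \<Longrightarrow> grid t n i \<in> {0..t}"
  by (cases "n = 0") (auto simp: grid_def divide_le_eq mult_left_mono)

lemma grid_less: "t > 0 \<Longrightarrow> n > 0 \<Longrightarrow> grid t n i < grid t n (Suc i)"
proof -
  assume "t > 0" "n > 0"
  then have "t / real n > 0" by simp
  then show ?thesis using grid_step[of t n i] by linarith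
qed

lemma uniform_modulus:
  fixes f :: "real \<Rightarrow> 'a::metric_space"
  assumes "continuous_on {0..t} f" "e > 0" "t \<ge> 0"
  shows "\<forall>\<^sub>F n in sequentially. \<forall>x\<in>{0..t}. \<forall>y\<in>{0..t}. \<bar>x - y\<bar> \<le> t / real n \<longrightarrow> dist (f x) (f y) < e"
proof -
  have "uniformly_continuous_on {0..t} f" by (rule compact_uniformly_continuous[OF assms(1)]) simp
  then obtain d where d: "d > 0" "\<forall>y\<in>{0..t}. \<forall>x\<in>{0..t}. dist x y < d \<longrightarrow> dist (f x) (f y) < e"
    using assms(2) unfolding uniformly_continuous_on_def by blast
  have "(\<lambda>n. t / real n) \<longlonglongrightarrow> 0" by (rule lim_const_over_n)
  then have "\<forall>\<^sub>F n in sequentially. t / real n < d" using d(1) by (rule order_tendstoD(2))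
  then show ?thesis
    by eventually_elim (use d(2) in \<open>auto simp: dist_real_def\<close>)
qed

text \<open>Summation by parts moves the increments from the merely continuous \<open>f\<close> to
  the smooth \<open>g\<close>. The new sum has right-endpoint values of \<open>f\<close> against
  increments of \<open>g\<close>, and uniform continuity of \<open>f\<close> replaces it by the
  integral of \<open>f * g'\<close>.\<close>

lemma riemann_stieltjes_limit:
  fixes f g g' :: "real \<Rightarrow> real"
  assumes f: "continuous_on {0..t} f" and t: "t \<ge> 0"
    and g: "\<And>x. (g has_real_derivative g' x) (at x)" "continuous_on UNIV g'"
  shows "(\<lambda>n. \<Sum>i<n. g (grid t n i) * (f (grid t n (Suc i)) - f (grid t n i))) \<longlonglongrightarrow>
     g t * f t - g 0 * f 0 - integral {0..t} (\<lambda>s. f s * g' s)"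
proof -
  have cg': "continuous_on S g'" for S using g(2) by (rule continuous_on_subset) simp
  have int: "(\<lambda>s. f s * g' s) integrable_on {0..t}"
    by (intro integrable_continuous_real continuous_intros f cg')
  have "compact (g' ` {0..t})" by (intro compact_continuous_image cg') simp
  then have "bounded (g' ` {0..t})" by (rule compact_imp_bounded)
  then obtain G where G: "G > 0" "\<And>s. s \<in> {0..t} \<Longrightarrow> \<bar>g' s\<bar> \<le> G"
    unfolding bounded_pos by (metis imageI real_norm_def)
  define R where "R n = (\<Sum>i<n. f (grid t n (Suc i)) * (g (grid t n (Suc i)) - g (grid t n i)))" for n
  have parts: "(\<Sum>i<n. g (grid t n i) * (f (grid t n (Suc i)) - f (grid t n i))) = g t * f t - g 0 * f 0 - R n" if "n > 0" for n
  proof -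
    have "(\<Sum>i<n. g (grid t n i) * (f (grid t n (Suc i)) - f (grid t n i))) + R n =
       (\<Sum>i<n. g (grid t n (Suc i)) * f (grid t n (Suc i)) - g (grid t n i) * f (grid t n i))"
      unfolding R_def sum.distrib[symmetric] by (intro sum.cong refl) (simp add: algebra_simps)
    also have "\<dots> = g t * f t - g 0 * f 0"
      using sum_lessThan_telescope[of "\<lambda>i. g (grid t n i) * f (grid t n i)" n] by (simp add: grid_n[OF that])
    finally show ?thesis by simp
  qed
  have "(\<lambda>n. R n - integral {0..t} (\<lambda>s. f s * g' s)) \<longlonglongrightarrow> 0"
  proof (rule tendstoI)
    fix e :: real assume e: "e > 0"
    \<comment> \<open>Chosen so that the accumulated error \<open>d * G * t\<close> is at most
      \<open>e / 2\<close>; \<open>t + 1\<close> in place of \<open>t\<close> covers the interval of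
      length 0.\<close>
    define d where "d = e / (2 * (G * (t + 1)))"
    have d: "d > 0" using e G(1) t by (simp add: d_def)
    have "\<forall>\<^sub>F n in sequentially. \<forall>x\<in>{0..t}. \<forall>y\<in>{0..t}. \<bar>x - y\<bar> \<le> t / real n \<longrightarrow> dist (f x) (f y) < d"
      by (rule uniform_modulus[OF f d t])
    then show "\<forall>\<^sub>F n in sequentially. dist (R n - integral {0..t} (\<lambda>s. f s * g' s)) 0 < e"
      using eventually_gt_at_top[of 0]
    proof eventually_elim
      case (elim n)
      let ?I = "\<lambda>i. {grid t n i..grid t n (Suc i)}"
      have le: "grid t n i \<le> grid t n (Suc i)" for i using mono_grid[OF t] by (auto simp: mono_def)
      have sub: "?I i \<subseteq> {0..t}" if "i < n" for i
        using grid_in[OF t, of i n] grid_in[OF t, of "Suc i" n] that by auto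
      have i1: "g' integrable_on ?I i" for i by (intro integrable_continuous_real cg')
      have i2: "(\<lambda>s. f s * g' s) integrable_on ?I i" if "i < n" for i
        by (rule integrable_subinterval_real[OF int sub[OF that]])
      have "R n - integral {0..t} (\<lambda>s. f s * g' s) = (\<Sum>i<n. integral (?I i) (\<lambda>s. (f (grid t n (Suc i)) - f s) * g' s))"
      proof -
        have "integral {0..t} (\<lambda>s. f s * g' s) = (\<Sum>i<n. integral (?I i) (\<lambda>s. f s * g' s))"
          using integral_partition[OF mono_grid[OF t], of "\<lambda>s. f s * g' s" n n] int elim(2) by (simp add: grid_n)
        moreover have gi: "g (grid t n (Suc i)) - g (grid t n i) = integral (?I i) g'" for i
          by (rule sym, rule integral_unique, rule fundamental_theorem_of_calculus[OF le])
             (use g(1) in \<open>auto simp flip: has_real_derivative_iff_has_vector_derivative intro: has_field_derivative_at_within\<close>)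
        ultimately have "R n - integral {0..t} (\<lambda>s. f s * g' s) =
            (\<Sum>i<n. f (grid t n (Suc i)) * integral (?I i) g' - integral (?I i) (\<lambda>s. f s * g' s))"
          by (simp only: R_def gi sum_subtractf)
        also have "\<dots> = (\<Sum>i<n. integral (?I i) (\<lambda>s. (f (grid t n (Suc i)) - f s) * g' s))"
        proof (rule sum.cong[OF refl])
          fix i assume "i \<in> {..<n}"
          then have "integral (?I i) (\<lambda>s. f (grid t n (Suc i)) * g' s - f s * g' s) =
             integral (?I i) (\<lambda>s. f (grid t n (Suc i)) * g' s) - integral (?I i) (\<lambda>s. f s * g' s)"
            by (intro Henstock_Kurzweil_Integration.integral_diff integrable_on_mult_right i1 i2) simp
          then show "f (grid t n (Suc i)) * integral (?I i) g' - integral (?I i) (\<lambda>s. f s * g' s) =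
             integral (?I i) (\<lambda>s. (f (grid t n (Suc i)) - f s) * g' s)"
            by (simp add: left_diff_distrib)
        qed
        finally show ?thesis .
      qed
      also have "\<bar>\<dots>\<bar> \<le> (\<Sum>i<n. d * G * (t / real n))"
      proof (rule order_trans[OF sum_abs], rule sum_mono)
        fix i assume "i \<in> {..<n}"
        then have i: "i < n" by simp
        have "norm (integral (?I i) (\<lambda>s. (f (grid t n (Suc i)) - f s) * g' s)) \<le> d * G * (grid t n (Suc i) - grid t n i)"
        proof (rule integral_bound[OF le])
          show "continuous_on (?I i) (\<lambda>s. (f (grid t n (Suc i)) - f s) * g' s)"
            by (intro continuous_intros continuous_on_subset[OF f sub[OF i]] cg')
          fix s assume s: "s \<in> ?I i"
          have "\<bar>grid t n (Suc i) - s\<bar> \<le> t / real n"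
            using s grid_step[of t n i] unfolding atLeastAtMost_iff by linarith
          moreover have "grid t n (Suc i) \<in> {0..t}" using i by (intro grid_in t) simp
          moreover have "s \<in> {0..t}" using s sub[OF i] by blast
          ultimately have "dist (f (grid t n (Suc i))) (f s) < d" using elim(1) by blast
          then have "\<bar>f (grid t n (Suc i)) - f s\<bar> \<le> d" by (simp add: dist_real_def)
          moreover have "\<bar>g' s\<bar> \<le> G" using G(2) s sub[OF i] by auto
          ultimately show "norm ((f (grid t n (Suc i)) - f s) * g' s) \<le> d * G"
            unfolding real_norm_def abs_mult using d by (intro mult_mono) auto
        qed
        then show "\<bar>integral (?I i) (\<lambda>s. (f (grid t n (Suc i)) - f s) * g' s)\<bar> \<le> d * G * (t / real n)"
          by (simp only: grid_step real_norm_def)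
      qed
      also have "\<dots> = d * G * t" using elim(2) by simp
      also have "\<dots> \<le> d * G * (t + 1)" using d G by simp
      also have "\<dots> = e / 2"
      proof -
        have "G * (t + 1) \<noteq> 0" using G(1) t by auto
        then have "d * (G * (t + 1)) = e / 2" unfolding d_def by (metis divide_divide_eq_left mult.commute nonzero_eq_divide_eq times_divide_eq_right)
        then show ?thesis by (simp only: mult.assoc)
      qed
      also have "\<dots> < e" using e by simp
      finally show ?case by (simp add: dist_real_def)
    qed
  qed
  then have "R \<longlonglongrightarrow> integral {0..t} (\<lambda>s. f s * g' s)" by (simp add: LIM_zero_iff)
  then have "(\<lambda>n. g t * f t - g 0 * f 0 - R n) \<longlonglongrightarrow> g t * f t - g 0 * f 0 - integral {0..t} (\<lambda>s. f s * g' s)"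
    by (intro tendsto_intros)
  then show ?thesis
    by (rule Lim_transform_eventually) (use parts in \<open>auto intro!: eventually_mono[OF eventually_gt_at_top[of 0]]\<close>)
qed

lemma wiener_integral_sums:
  "wiener_integral t g B x = lim (\<lambda>n. \<Sum>i<n. g (grid t n i) * (B (grid t n (Suc i)) x - B (grid t n i) x))"
  by (simp add: wiener_integral_def grid_def)

text \<open>Integration by parts path by path: the kernel is 1 at the upper end and the path
  vanishes at the lower end, so only one boundary term is left. The increments disappear and the
  result is an ordinary integral of the path.\<close>

lemma wiener_integral_exp:
  fixes B :: "real \<Rightarrow> 'w \<Rightarrow> real"
  assumes c: "continuous_on {0..t} (\<lambda>s. B s x)" and t: "t \<ge> 0" and 0: "B 0 x = 0"
  shows "(\<lambda>n. \<Sum>i<n. exp (- l * (t - grid t n i)) * (B (grid t n (Suc i)) x - B (grid t n i) x))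
       \<longlonglongrightarrow> B t x - l * integral {0..t} (\<lambda>s. exp (- l * (t - s)) * B s x)"
    and "wiener_integral t (\<lambda>s. exp (- l * (t - s))) B x = B t x - l * integral {0..t} (\<lambda>s. exp (- l * (t - s)) * B s x)"
proof -
  have "(\<lambda>n. \<Sum>i<n. exp (- l * (t - grid t n i)) * (B (grid t n (Suc i)) x - B (grid t n i) x)) \<longlonglongrightarrow>
     exp (- l * (t - t)) * B t x - exp (- l * (t - 0)) * B 0 x - integral {0..t} (\<lambda>s. B s x * (l * exp (- l * (t - s))))"
    by (rule riemann_stieltjes_limit[OF c t]) (auto intro!: derivative_eq_intros continuous_intros)
  moreover have "integral {0..t} (\<lambda>s. B s x * (l * exp (- l * (t - s)))) = l * integral {0..t} (\<lambda>s. exp (- l * (t - s)) * B s x)"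
    by (subst integral_mult_right[symmetric]) (simp add: mult_ac)
  ultimately show *: "(\<lambda>n. \<Sum>i<n. exp (- l * (t - grid t n i)) * (B (grid t n (Suc i)) x - B (grid t n i) x))
       \<longlonglongrightarrow> B t x - l * integral {0..t} (\<lambda>s. exp (- l * (t - s)) * B s x)" by (simp add: 0)
  show "wiener_integral t (\<lambda>s. exp (- l * (t - s))) B x = B t x - l * integral {0..t} (\<lambda>s. exp (- l * (t - s)) * B s x)"
    unfolding wiener_integral_sums using limI[OF *] .
qed

text \<open>Variation of constants, read backwards: the mild form on a dense set of times gives the
  integrated equation at all times.\<close>

lemma mild_imp_integral_equation:
  fixes x f \<beta> :: "real \<Rightarrow> real"
  assumes T: "T \<ge> 0" and x: "continuous_on {0..T} x" and f: "continuous_on {0..T} f" and \<beta>: "continuous_on {0..T} \<beta>"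
    and D: "D \<subseteq> {0..T}" "closure D = {0..T}"
    and mild: "\<And>t. t \<in> D \<Longrightarrow> x t = exp (- l * t) * x0 + integral {0..t} (\<lambda>s. exp (- l * (t - s)) * f s)
        + b * (\<beta> t - l * integral {0..t} (\<lambda>s. exp (- l * (t - s)) * \<beta> s))"
    and st: "0 \<le> s" "s \<le> t" "t \<le> T"
  shows "x t - x s = integral {s..t} (\<lambda>r. - l * x r + f r) + b * (\<beta> t - \<beta> s)"
    and "x 0 = x0 + b * \<beta> 0"
proof -
  \<comment> \<open>The rough term is removed by passing to \<open>x - b * \<beta>\<close>, which
    solves the linear equation with source \<open>q\<close>; \<open>E\<close> is its variation of
    constants formula. The equation for \<open>E\<close> turns back into the drift of
    \<open>x\<close> because \<open>- l * E + q\<close> equals \<open>- l * x + f\<close>.\<close>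
  define q where "q r = f r - b * l * \<beta> r" for r
  have cq: "continuous_on {0..T} q" unfolding q_def by (intro continuous_intros f \<beta>)
  define E where "E t = exp (- l * t) * (x0 + integral {0..t} (\<lambda>r. exp (l * r) * q r))" for t
  have ce: "continuous_on {0..T} (\<lambda>r. exp (l * r) * q r)" by (intro continuous_intros cq)
  have dI: "((\<lambda>t. integral {0..t} (\<lambda>r. exp (l * r) * q r)) has_real_derivative exp (l * t) * q t) (at t within {0..T})"
    if "t \<in> {0..T}" for t
    by (rule integral_has_real_derivative[OF ce that])
  have dE: "(E has_real_derivative (- l * E t + q t)) (at t within {0..T})" if t: "t \<in> {0..T}" for t
  proof -
    have "(E has_real_derivative (exp (- l * t) * (- l)) * (x0 + integral {0..t} (\<lambda>r. exp (l * r) * q r)) + (exp (l * t) * q t) * exp (- l * t)) (at t within {0..T})"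
      unfolding E_def
      by (rule DERIV_mult) (use dI[OF t] in \<open>auto intro!: derivative_eq_intros\<close>)
    moreover have "exp (l * t) * exp (- l * t) = 1" by (simp flip: exp_add)
    ultimately show ?thesis by (simp add: E_def algebra_simps)
  qed
  have cE: "continuous_on {0..T} E" using dE by (rule DERIV_continuous_on)
  have eqD: "x t = E t + b * \<beta> t" if "t \<in> D" for t
  proof -
    have t: "t \<in> {0..T}" using that D(1) by auto
    have c: "continuous_on {0..t} f" "continuous_on {0..t} \<beta>" using f \<beta> t by (auto intro: continuous_on_subset)
    have i: "(\<lambda>s. exp (- l * (t - s)) * f s) integrable_on {0..t}" "(\<lambda>s. exp (- l * (t - s)) * \<beta> s) integrable_on {0..t}"
      by (intro integrable_continuous_real continuous_intros c)+
    have "exp (- l * t) * integral {0..t} (\<lambda>r. exp (l * r) * q r) = integral {0..t} (\<lambda>r. exp (- l * t) * (exp (l * r) * q r))"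
      by simp
    also have "\<dots> = integral {0..t} (\<lambda>r. exp (- l * (t - r)) * f r - b * l * (exp (- l * (t - r)) * \<beta> r))"
    proof (rule integral_cong)
      fix r
      have "exp (- l * t) * exp (l * r) = exp (- l * (t - r))" by (simp flip: exp_add add: algebra_simps)
      then show "exp (- l * t) * (exp (l * r) * q r) = exp (- l * (t - r)) * f r - b * l * (exp (- l * (t - r)) * \<beta> r)"
        unfolding q_def mult.assoc[symmetric] by (simp add: algebra_simps)
    qed
    also have "\<dots> = integral {0..t} (\<lambda>r. exp (- l * (t - r)) * f r) - b * l * integral {0..t} (\<lambda>r. exp (- l * (t - r)) * \<beta> r)"
      using i by (subst Henstock_Kurzweil_Integration.integral_diff) (auto intro: integrable_on_mult_right)
    finally show ?thesis using mild[OF that] by (simp add: E_def algebra_simps)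
  qed
  \<comment> \<open>Both sides are continuous in time, so the identity extends from the dense set
    \<open>D\<close> to its closure.\<close>
  have eq: "x t = E t + b * \<beta> t" if "t \<in> {0..T}" for t
  proof -
    have "x t - E t - b * \<beta> t = 0"
    proof (rule continuous_constant_on_closure[of D "\<lambda>t. x t - E t - b * \<beta> t"])
      show "continuous_on (closure D) (\<lambda>t. x t - E t - b * \<beta> t)"
        unfolding D(2) by (intro continuous_intros x cE \<beta>)
    qed (use eqD that D(2) in auto)
    then show ?thesis by simp
  qed
  have "(((\<lambda>r. - l * x r + f r)) has_integral (E t - E s)) {s..t}"
  proof (rule fundamental_theorem_of_calculus[OF st(2)])
    fix r assume r: "r \<in> {s..t}"
    then have rT: "r \<in> {0..T}" using st by auto
    have "(E has_real_derivative (- l * E r + q r)) (at r within {s..t})"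
      by (rule DERIV_subset[OF dE[OF rT]]) (use st in auto)
    moreover have "- l * E r + q r = - l * x r + f r" using eq[OF rT] by (simp add: q_def algebra_simps)
    ultimately show "(E has_vector_derivative (- l * x r + f r)) (at r within {s..t})"
      by (simp add: has_real_derivative_iff_has_vector_derivative)
  qed
  then show "x t - x s = integral {s..t} (\<lambda>r. - l * x r + f r) + b * (\<beta> t - \<beta> s)"
    using eq[of t] eq[of s] st by (simp add: integral_unique algebra_simps)
  show "x 0 = x0 + b * \<beta> 0" using eq[of 0] T by (simp add: E_def)
qed

section \<open>Martingale transforms of the Brownian increments\<close>

locale noise =
  fixes M :: "'w measure" and F :: "real \<Rightarrow> 'w measure" and \<beta> :: "int \<Rightarrow> real \<Rightarrow> 'w \<Rightarrow> real"
  assumes brownian_family: "brownian_family M F \<beta>"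
begin

lemma prob_space_M: "prob_space M"
  using brownian_family by (simp add: brownian_family_def filtered_prob_space_def)

sublocale prob_space M by (rule prob_space_M)

lemma subalgebra_F: "s \<ge> 0 \<Longrightarrow> subalgebra M (F s)"
  using brownian_family by (simp add: brownian_family_def filtered_prob_space_def)

lemma F_mono: "0 \<le> s \<Longrightarrow> s \<le> t \<Longrightarrow> sets (F s) \<subseteq> sets (F t)"
  using brownian_family by (simp add: brownian_family_def filtered_prob_space_def)

lemma space_F: "s \<ge> 0 \<Longrightarrow> space (F s) = space M"
  using subalgebra_F by (simp add: subalgebra_def)

lemma measurable_F_M: "s \<ge> 0 \<Longrightarrow> f \<in> F s \<rightarrow>\<^sub>M N \<Longrightarrow> f \<in> M \<rightarrow>\<^sub>M N"
  by (rule measurable_from_subalg[OF subalgebra_F])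

lemma measurable_F_mono: "0 \<le> s \<Longrightarrow> s \<le> t \<Longrightarrow> f \<in> F s \<rightarrow>\<^sub>M N \<Longrightarrow> f \<in> F t \<rightarrow>\<^sub>M N"
  using F_mono[of s t] space_F[of s] space_F[of t] by (auto simp: measurable_def)

lemma adapted_\<beta>: "k \<noteq> 0 \<Longrightarrow> t \<ge> 0 \<Longrightarrow> \<beta> k t \<in> borel_measurable (F t)"
  using brownian_family by (auto simp: brownian_family_def)

lemma measurable_\<beta>: "k \<noteq> 0 \<Longrightarrow> t \<ge> 0 \<Longrightarrow> \<beta> k t \<in> borel_measurable M"
  by (rule measurable_F_M[OF _ adapted_\<beta>])

lemma bm: "k \<noteq> 0 \<Longrightarrow> brownian_motion M (\<beta> k)"
  using brownian_family by (auto simp: brownian_family_def)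

definition inc :: "int \<Rightarrow> real \<Rightarrow> real \<Rightarrow> 'w \<Rightarrow> real" where
  "inc k s t x = \<beta> k t x - \<beta> k s x"

lemma measurable_inc: "k \<noteq> 0 \<Longrightarrow> 0 \<le> s \<Longrightarrow> s \<le> t \<Longrightarrow> inc k s t \<in> borel_measurable M"
  unfolding inc_def[abs_def] by (intro borel_measurable_diff measurable_\<beta>) auto

lemma measurable_inc_F: "k \<noteq> 0 \<Longrightarrow> 0 \<le> s \<Longrightarrow> s \<le> t \<Longrightarrow> inc k s t \<in> borel_measurable (F t)"
  unfolding inc_def[abs_def] by (intro borel_measurable_diff adapted_\<beta> measurable_F_mono[OF _ _ adapted_\<beta>]) auto

lemma distributed_inc:
  "k \<noteq> 0 \<Longrightarrow> 0 \<le> s \<Longrightarrow> s < t \<Longrightarrow> distributed M lborel (inc k s t) (normal_density 0 (sqrt (t - s)))"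
  using bm[of k] unfolding brownian_motion_def inc_def[abs_def] by blast

lemma inc_moments:
  assumes "k \<noteq> 0" "0 \<le> s" "s < t"
  shows "integrable M (inc k s t)" "expectation (inc k s t) = 0"
    "integrable M (\<lambda>x. (inc k s t x)\<^sup>2)" "expectation (\<lambda>x. (inc k s t x)\<^sup>2) = t - s"
proof -
  note d = distributed_inc[OF assms]
  let ?s = "sqrt (t - s)"
  have s: "?s > 0" using assms by simp
  note odd = normal_moment_odd[OF s, of 0 0] and even = normal_moment_even[OF s, of 0 1]
  show "integrable M (inc k s t)"
    using distributed_integrable[OF d, of "\<lambda>x. x"] integrable.intros[OF odd] by simp
  show "expectation (inc k s t) = 0"
    using distributed_integral[OF d, of "\<lambda>x. x"] has_bochner_integral_integral_eq[OF odd] by simp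
  show "integrable M (\<lambda>x. (inc k s t x)\<^sup>2)"
    using distributed_integrable[OF d, of "\<lambda>x. x\<^sup>2"] integrable.intros[OF even] by simp
  show "expectation (\<lambda>x. (inc k s t x)\<^sup>2) = t - s"
    using distributed_integral[OF d, of "\<lambda>x. x\<^sup>2"] has_bochner_integral_integral_eq[OF even] assms
    by (simp add: fact_numeral)
qed

text \<open>A measurable function \<open>\<phi>\<close> of the increments after \<open>s\<close>
  generates a smaller sigma-algebra than the increments themselves, which are independent of
  \<open>F s\<close>. The function may combine several modes, as second moments require.\<close>

lemma indep_future:
  assumes s: "s \<ge> 0" and X: "X \<in> borel_measurable (F s)"
    and \<phi>: "\<phi> \<in> borel_measurable (Pi\<^sub>M (nonzero_ints \<times> {s..}) (\<lambda>_. borel))"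
    and Y: "Y \<in> borel_measurable M" "\<And>x. Y x = \<phi> (\<lambda>(k, t)\<in>nonzero_ints \<times> {s..}. \<beta> k t x - \<beta> k s x)"
  shows "indep_var borel (X :: _ \<Rightarrow> real) borel (Y :: _ \<Rightarrow> real)"
proof -
  let ?h = "\<lambda>x. \<lambda>(k, t)\<in>nonzero_ints \<times> {s..}. \<beta> k t x - \<beta> k s x"
  let ?V = "vimage_algebra (space M) ?h (Pi\<^sub>M (nonzero_ints \<times> {s..}) (\<lambda>_. borel))"
  have ind: "indep_set (sets (F s)) (sets ?V)"
    using brownian_family s unfolding brownian_family_def by blast
  have "?h \<in> ?V \<rightarrow>\<^sub>M Pi\<^sub>M (nonzero_ints \<times> {s..}) (\<lambda>_. borel)"
    by (rule measurable_vimage_algebra1) (auto simp: space_PiM)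
  from measurable_compose[OF this \<phi>] have YV: "Y \<in> borel_measurable ?V"
    by (simp add: Y(2)[abs_def])
  have a: "sigma_sets (space M) {X -` A \<inter> space M |A. A \<in> sets borel} \<subseteq> sets (F s)"
    using measurable_sets[OF X] unfolding space_F[OF s, symmetric] by (intro sets.sigma_sets_subset) auto
  have b: "sigma_sets (space M) {Y -` A \<inter> space M |A. A \<in> sets borel} \<subseteq> sets ?V"
  proof -
    have sp: "space ?V = space M" by simp
    show ?thesis
      using measurable_sets[OF YV] sets.sigma_sets_subset[of "{Y -` A \<inter> space M |A. A \<in> sets borel}" ?V] unfolding sp by blast
  qed
  show ?thesis
    unfolding indep_var_eq
  proof (intro conjI)
    show "random_variable borel X" by (rule measurable_F_M[OF s X])
    show "random_variable borel Y" by (rule Y(1))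
    show "indep_set (sigma_sets (space M) {X -` A \<inter> space M |A. A \<in> sets borel}) (sigma_sets (space M) {Y -` A \<inter> space M |A. A \<in> sets borel})"
      unfolding indep_set_def
      by (rule indep_sets_mono_sets[OF ind[unfolded indep_set_def]]) (use a b in \<open>auto split: bool.split\<close>)
  qed
qed

lemma indep_inc:
  assumes "0 \<le> s" "s \<le> t" "X \<in> borel_measurable (F s)" "k \<noteq> 0"
  shows "indep_var borel X borel (inc k s t)"
proof (rule indep_future[OF assms(1,3)])
  show "(\<lambda>z. z (k, t)) \<in> borel_measurable (Pi\<^sub>M (nonzero_ints \<times> {s..}) (\<lambda>_. borel))"
    using assms by (intro measurable_component_singleton) auto
  show "inc k s t \<in> borel_measurable M" using assms by (intro measurable_inc) auto
  show "inc k s t x = (\<lambda>(k, t)\<in>nonzero_ints \<times> {s..}. \<beta> k t x - \<beta> k s x) (k, t)" for x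
    using assms by (simp add: inc_def)
qed

text \<open>Independence of each increment separately would not do: the square of a sum over modes
  contains products of two increments with a common coefficient from the past.\<close>

lemma indep_inc2:
  assumes "0 \<le> s" "s \<le> t" "X \<in> borel_measurable (F s)" "k \<noteq> 0" "l \<noteq> 0"
  shows "indep_var borel X borel (\<lambda>x. inc k s t x * inc l s t x)"
proof (rule indep_future[OF assms(1,3)])
  show "(\<lambda>z. z (k, t) * z (l, t) :: real) \<in> borel_measurable (Pi\<^sub>M (nonzero_ints \<times> {s..}) (\<lambda>_. borel))"
    using assms by (intro borel_measurable_times measurable_component_singleton) auto
  show "(\<lambda>x. inc k s t x * inc l s t x) \<in> borel_measurable M" using assms by (intro borel_measurable_times measurable_inc) auto
  show "inc k s t x * inc l s t x = (\<lambda>(k, t)\<in>nonzero_ints \<times> {s..}. \<beta> k t x - \<beta> k s x) (k, t) *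
      (\<lambda>(k, t)\<in>nonzero_ints \<times> {s..}. \<beta> k t x - \<beta> k s x) (l, t)" for x
    using assms by (simp add: inc_def)
qed

lemma inc_cross:
  assumes "0 \<le> s" "s < t" "k \<noteq> 0" "l \<noteq> 0" "k \<noteq> l"
  shows "integrable M (\<lambda>x. inc k s t x * inc l s t x)" "expectation (\<lambda>x. inc k s t x * inc l s t x) = 0"
proof -
  have iv: "indep_vars (\<lambda>_. borel) (\<lambda>k. inc k s t) nonzero_ints"
  proof -
    have "indep_vars (\<lambda>_. Pi\<^sub>M {0..} (\<lambda>_. borel)) (\<lambda>k x. \<lambda>t\<in>{0..}. \<beta> k t x) nonzero_ints"
      using brownian_family by (simp add: brownian_family_def)
    from indep_vars_compose2[OF this, of "\<lambda>_ z. z t - z s" "\<lambda>_. borel"]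
    have "indep_vars (\<lambda>_. borel) (\<lambda>k x. (\<lambda>t\<in>{0..}. \<beta> k t x) t - (\<lambda>t\<in>{0..}. \<beta> k t x) s) nonzero_ints"
      using assms by (auto intro!: borel_measurable_diff measurable_component_singleton)
    then show ?thesis using assms by (simp add: inc_def[abs_def])
  qed
  have "indep_vars (\<lambda>_. borel) (\<lambda>k. inc k s t) (insert k {l})"
    by (rule indep_vars_subset[OF iv]) (use assms in auto)
  \<comment> \<open>This rule separates one variable from the sum of the others; here that sum has
    the single term of index \<open>l\<close>.\<close>
  from indep_vars_sum[OF _ _ this] have i2: "indep_var borel (inc k s t) borel (inc l s t)"
    using assms by simp
  show "integrable M (\<lambda>x. inc k s t x * inc l s t x)"
    by (rule indep_var_integrable[OF i2]) (use assms in \<open>auto intro!: inc_moments\<close>)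
  show "expectation (\<lambda>x. inc k s t x * inc l s t x) = 0"
    using indep_var_lebesgue_integral[OF i2] inc_moments[of k s t] inc_moments[of l s t] assms by simp
qed

lemma inc_products:
  assumes "0 \<le> s" "s < t" "k \<noteq> 0" "l \<noteq> 0"
  shows "integrable M (\<lambda>x. inc k s t x * inc l s t x)"
    "expectation (\<lambda>x. inc k s t x * inc l s t x) = (if k = l then t - s else 0)"
  using inc_cross[OF assms] inc_moments[of k s t] assms by (cases "k = l"; simp add: power2_eq_square)+

lemma indep_mult_integral:
  assumes "indep_var borel (X :: 'w \<Rightarrow> real) borel Y" "integrable M X" "integrable M Y"
  shows "integrable M (\<lambda>x. X x * Y x)" "expectation (\<lambda>x. X x * Y x) = expectation X * expectation Y"
  using indep_var_integrable[OF assms] indep_var_lebesgue_integral[OF assms] by auto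

lemma integrable_bounded_F:
  fixes f :: "'w \<Rightarrow> real"
  assumes "s \<ge> 0" "f \<in> borel_measurable (F s)" "\<And>x. x \<in> space M \<Longrightarrow> \<bar>f x\<bar> \<le> C"
  shows "integrable M f"
  by (rule integrable_const_bound[where B = C]) (use assms measurable_F_M[OF assms(1,2)] in auto)

text \<open>Ito isometry for one time step: the coefficients are known at time \<open>s\<close>, and
  the increments are independent of the past with covariance \<open>t - s\<close> times the
  identity. The last claim, orthogonality to everything integrable and known at time
  \<open>s\<close>, removes the cross term when steps are added.\<close>

lemma transform_step:
  fixes C :: real and f :: "int \<Rightarrow> 'w \<Rightarrow> real"
  assumes st: "0 \<le> s" "s < t" and A: "finite A" "0 \<notin> A"
    and f: "\<And>k. k \<in> A \<Longrightarrow> f k \<in> borel_measurable (F s)" "\<And>k x. k \<in> A \<Longrightarrow> x \<in> space M \<Longrightarrow> \<bar>f k x\<bar> \<le> C"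
  defines "G \<equiv> (\<lambda>x. \<Sum>k\<in>A. f k x * inc k s t x)"
  shows "G \<in> borel_measurable (F t)" "integrable M G" "expectation G = 0"
    "integrable M (\<lambda>x. (G x)\<^sup>2)" "expectation (\<lambda>x. (G x)\<^sup>2) = (t - s) * (\<Sum>k\<in>A. expectation (\<lambda>x. (f k x)\<^sup>2))"
    "\<And>S. S \<in> borel_measurable (F s) \<Longrightarrow> integrable M S \<Longrightarrow> integrable M (\<lambda>x. S x * G x) \<and> expectation (\<lambda>x. S x * G x) = 0"
proof -
  have k0: "k \<noteq> 0" if "k \<in> A" for k using that A by auto
  have S: "integrable M (\<lambda>x. S x * G x) \<and> expectation (\<lambda>x. S x * G x) = 0"
    if S: "S \<in> borel_measurable (F s)" "integrable M S" for S
  proof -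
    have one: "integrable M (\<lambda>x. (S x * f k x) * inc k s t x) \<and> expectation (\<lambda>x. (S x * f k x) * inc k s t x) = 0" if "k \<in> A" for k
    proof -
      have m: "(\<lambda>x. S x * f k x) \<in> borel_measurable (F s)" using S f(1)[OF that] by simp
      have i: "integrable M (\<lambda>x. S x * f k x)"
      proof (rule Bochner_Integration.integrable_bound)
        show "integrable M (\<lambda>x. C * \<bar>S x\<bar>)" using S(2) by simp
        show "AE x in M. norm (S x * f k x) \<le> norm (C * \<bar>S x\<bar>)"
        proof (rule AE_I2)
          fix x assume "x \<in> space M"
          then have "\<bar>S x\<bar> * \<bar>f k x\<bar> \<le> \<bar>S x\<bar> * C" using f(2)[OF that] by (intro mult_left_mono) auto
          also have "\<dots> \<le> \<bar>C * \<bar>S x\<bar>\<bar>" by (simp add: mult.commute)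
          finally show "norm (S x * f k x) \<le> norm (C * \<bar>S x\<bar>)" by (simp add: abs_mult)
        qed
      qed (rule measurable_F_M[OF st(1) m])
      have iv: "indep_var borel (\<lambda>x. S x * f k x) borel (inc k s t)"
        by (rule indep_inc[OF _ _ m k0[OF that]]) (use st in auto)
      show ?thesis using indep_mult_integral[OF iv i] inc_moments[OF k0[OF that] st] by simp
    qed
    have eq: "(\<lambda>x. S x * G x) = (\<lambda>x. \<Sum>k\<in>A. (S x * f k x) * inc k s t x)"
      by (simp add: G_def sum_distrib_left mult.assoc)
    show ?thesis unfolding eq using one by (simp add: Bochner_Integration.integral_sum)
  qed
  show "\<And>S. S \<in> borel_measurable (F s) \<Longrightarrow> integrable M S \<Longrightarrow> integrable M (\<lambda>x. S x * G x) \<and> expectation (\<lambda>x. S x * G x) = 0"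
    by (rule S)
  have "integrable M (\<lambda>x. 1 * G x) \<and> expectation (\<lambda>x. 1 * G x) = 0" by (rule S) simp_all
  then show "integrable M G" "expectation G = 0" by simp_all
  show "G \<in> borel_measurable (F t)"
    unfolding G_def using st k0
    by (intro borel_measurable_sum borel_measurable_times measurable_F_mono[OF _ _ f(1)] measurable_inc_F) auto
  have two: "integrable M (\<lambda>x. (f k x * f l x) * (inc k s t x * inc l s t x)) \<and>
      expectation (\<lambda>x. (f k x * f l x) * (inc k s t x * inc l s t x)) = (if k = l then (t - s) * expectation (\<lambda>x. (f k x)\<^sup>2) else 0)"
    if kl: "k \<in> A" "l \<in> A" for k l
  proof -
    have m: "(\<lambda>x. f k x * f l x) \<in> borel_measurable (F s)" using f(1) kl by simp
    have i: "integrable M (\<lambda>x. f k x * f l x)"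
    proof (rule integrable_bounded_F[OF st(1) m])
      fix x assume x: "x \<in> space M"
      show "\<bar>f k x * f l x\<bar> \<le> C * C" unfolding abs_mult using f(2)[OF kl(1) x] f(2)[OF kl(2) x] by (intro mult_mono) auto
    qed
    have iv: "indep_var borel (\<lambda>x. f k x * f l x) borel (\<lambda>x. inc k s t x * inc l s t x)"
      by (rule indep_inc2[OF _ _ m k0[OF kl(1)] k0[OF kl(2)]]) (use st in auto)
    show ?thesis
      using indep_mult_integral[OF iv i] inc_products[OF st k0[OF kl(1)] k0[OF kl(2)]]
      by (auto simp: power2_eq_square)
  qed
  have eq: "(\<lambda>x. (G x)\<^sup>2) = (\<lambda>x. \<Sum>k\<in>A. \<Sum>l\<in>A. (f k x * f l x) * (inc k s t x * inc l s t x))"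
    by (simp add: G_def power2_eq_square sum_product mult_ac)
  show "integrable M (\<lambda>x. (G x)\<^sup>2)" unfolding eq using two by (intro Bochner_Integration.integrable_sum) auto
  have "expectation (\<lambda>x. (G x)\<^sup>2) = (\<Sum>k\<in>A. \<Sum>l\<in>A. expectation (\<lambda>x. (f k x * f l x) * (inc k s t x * inc l s t x)))"
    unfolding eq using two by (subst Bochner_Integration.integral_sum Bochner_Integration.integrable_sum; auto)+
  also have "\<dots> = (\<Sum>k\<in>A. \<Sum>l\<in>A. if k = l then (t - s) * expectation (\<lambda>x. (f k x)\<^sup>2) else 0)"
    using two by (intro sum.cong refl) auto
  also have "\<dots> = (t - s) * (\<Sum>k\<in>A. expectation (\<lambda>x. (f k x)\<^sup>2))"
    using A by (simp add: sum_distrib_left)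
  finally show "expectation (\<lambda>x. (G x)\<^sup>2) = (t - s) * (\<Sum>k\<in>A. expectation (\<lambda>x. (f k x)\<^sup>2))" .
qed

text \<open>The discrete Ito isometry, by induction on the number of steps. The sum up to step
  \<open>n\<close> is known at time \<open>\<tau> n\<close>, so its product with the next step has
  mean zero and the second moments add up.\<close>

lemma martingale_transform:
  fixes C :: real and f :: "nat \<Rightarrow> int \<Rightarrow> 'w \<Rightarrow> real" and \<tau> :: "nat \<Rightarrow> real"
  assumes \<tau>: "\<And>i. 0 \<le> \<tau> i" "\<And>i. \<tau> i < \<tau> (Suc i)" and A: "finite A" "0 \<notin> A"
    and f: "\<And>i k. k \<in> A \<Longrightarrow> f i k \<in> borel_measurable (F (\<tau> i))" "\<And>i k x. k \<in> A \<Longrightarrow> x \<in> space M \<Longrightarrow> \<bar>f i k x\<bar> \<le> C"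
  defines "S \<equiv> (\<lambda>n x. \<Sum>i<n. \<Sum>k\<in>A. f i k x * inc k (\<tau> i) (\<tau> (Suc i)) x)"
  shows "S n \<in> borel_measurable (F (\<tau> n)) \<and> integrable M (S n) \<and> expectation (S n) = 0 \<and>
    integrable M (\<lambda>x. (S n x)\<^sup>2) \<and>
    expectation (\<lambda>x. (S n x)\<^sup>2) = (\<Sum>i<n. (\<tau> (Suc i) - \<tau> i) * (\<Sum>k\<in>A. expectation (\<lambda>x. (f i k x)\<^sup>2)))"
proof (induction n)
  case 0
  show ?case by (simp add: S_def)
next
  case (Suc n)
  let ?G = "\<lambda>x. \<Sum>k\<in>A. f n k x * inc k (\<tau> n) (\<tau> (Suc n)) x"
  note G = transform_step[OF \<tau>(1)[of n] \<tau>(2)[of n] A, where f = "f n" and C = C, OF f(1) f(2)]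
  have eq: "S (Suc n) x = S n x + ?G x" for x by (simp add: S_def)
  have cross: "integrable M (\<lambda>x. S n x * ?G x) \<and> expectation (\<lambda>x. S n x * ?G x) = 0"
    using Suc by (intro G(6)) auto
  have "S n \<in> borel_measurable (F (\<tau> (Suc n)))"
    by (rule measurable_F_mono[OF \<tau>(1) less_imp_le[OF \<tau>(2)]]) (use Suc in blast)
  then have "S (Suc n) \<in> borel_measurable (F (\<tau> (Suc n)))"
    unfolding eq[abs_def] using G(1) by simp
  moreover have "integrable M (S (Suc n)) \<and> expectation (S (Suc n)) = 0"
    unfolding eq[abs_def] using Suc G(2,3) by simp
  moreover have sq: "(\<lambda>x. (S (Suc n) x)\<^sup>2) = (\<lambda>x. (S n x)\<^sup>2 + (2 * (S n x * ?G x) + (?G x)\<^sup>2))"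
    unfolding eq[abs_def] by (simp add: power2_sum algebra_simps)
  moreover have "integrable M (\<lambda>x. (S (Suc n) x)\<^sup>2)"
    unfolding sq using Suc cross G(4) by (intro Bochner_Integration.integrable_add) auto
  moreover have "expectation (\<lambda>x. (S (Suc n) x)\<^sup>2) =
      expectation (\<lambda>x. (S n x)\<^sup>2) + (\<tau> (Suc n) - \<tau> n) * (\<Sum>k\<in>A. expectation (\<lambda>x. (f n k x)\<^sup>2))"
    unfolding sq using Suc cross G(4,5)
    by (subst Bochner_Integration.integral_add, simp, simp)+ simp
  ultimately show ?case using Suc by simp
qed

end

section \<open>The stochastic convolution\<close>

lemma l2_cutI:
  assumes "\<And>n. (\<Sum>k\<in>cut n. (c k)\<^sup>2) \<le> B"
  shows "l2 c"
  unfolding l2_def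
proof (rule nonneg_bdd_above_summable_on)
  show "bdd_above (sum (\<lambda>k. (c k)\<^sup>2) ` {F. F \<subseteq> nonzero_ints \<and> finite F})"
  proof (rule bdd_aboveI2)
    fix F assume F: "F \<in> {F. F \<subseteq> nonzero_ints \<and> finite F}"
    then have "eventually (\<lambda>G. F \<subseteq> G) (finite_subsets_at_top nonzero_ints)"
      unfolding eventually_finite_subsets_at_top by blast
    then have "eventually (\<lambda>n. F \<subseteq> cut n) sequentially"
      by (rule eventually_compose_filterlim[OF _ filterlim_cut])
    then obtain n where "F \<subseteq> cut n" by (auto simp: eventually_sequentially)
    then have "(\<Sum>k\<in>F. (c k)\<^sup>2) \<le> (\<Sum>k\<in>cut n. (c k)\<^sup>2)" by (intro sum_mono2) auto
    then show "(\<Sum>k\<in>F. (c k)\<^sup>2) \<le> B" using assms[of n] by simp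
  qed
qed simp

lemma closure_rational_interval: "T > 0 \<Longrightarrow> closure ({0<..<T} \<inter> \<rat>) = {0..T :: real}"
proof -
  assume T: "T > 0"
  have "{0<..<T} \<subseteq> closure ({0<..<T} \<inter> \<rat>)"
    using open_Int_closure_subset[of "{0<..<T}" "\<rat>"] by (simp add: Rats_closure_real)
  then have "closure {0<..<T} \<subseteq> closure ({0<..<T} \<inter> \<rat>)" by (simp add: closure_minimal)
  moreover have "closure ({0<..<T} \<inter> \<rat>) \<subseteq> closure {0<..<T}" by (rule closure_mono) auto
  ultimately show ?thesis using T by simp
qed

lemma continuous_coef:
  assumes "\<And>t. t \<in> S \<Longrightarrow> w t \<in> Hdot 1" "continuous_on S (\<lambda>t. Jop 1 (w t))"
  shows "continuous_on S (\<lambda>t. coef (w t) k)"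
proof (cases "k = 0")
  case True
  \<comment> \<open>Index 0 falls into the sine branch of \<open>basis_fun\<close>, where the
    function vanishes identically.\<close>
  then have "e_basis k = 0" by (simp add: e_basis_def basis_fun_def[abs_def] abs_L2_zero)
  then show ?thesis by (simp add: coef_def)
next
  case False
  have eq: "coef (w t) k = coef (Jop 1 (w t)) k / \<bar>real_of_int k\<bar>" if "t \<in> S" for t
    using coef_synth[OF HdotD(2)[OF assms(1)[OF that]] False] False by (simp add: Jop_def coef_def)
  have "continuous_on S (\<lambda>t. coef (Jop 1 (w t)) k / \<bar>real_of_int k\<bar>)"
    unfolding coef_def using False by (intro continuous_intros assms(2)) auto
  then show ?thesis by (rule continuous_on_cong[THEN iffD1, rotated 2]) (use eq in auto)
qed

context noise
begin

definition wconv :: "real \<Rightarrow> int \<Rightarrow> real \<Rightarrow> 'w \<Rightarrow> real" where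
  "wconv l k t x = wiener_integral t (\<lambda>s. exp (- l * (t - s))) (\<beta> k) x"

definition wsum :: "real \<Rightarrow> int \<Rightarrow> real \<Rightarrow> nat \<Rightarrow> 'w \<Rightarrow> real" where
  "wsum l k t n x = (\<Sum>i<n. exp (- l * (t - grid t n i)) * inc k (grid t n i) (grid t n (Suc i)) x)"

lemma grid_nonneg: "t \<ge> 0 \<Longrightarrow> 0 \<le> grid t n i"
  by (simp add: grid_def)

lemma measurable_wsum: "k \<noteq> 0 \<Longrightarrow> t \<ge> 0 \<Longrightarrow> wsum l k t n \<in> borel_measurable M"
  unfolding wsum_def[abs_def]
  by (intro borel_measurable_sum borel_measurable_times measurable_inc borel_measurable_const grid_nonneg)
     (use mono_grid[of t n] in \<open>auto simp: mono_def\<close>)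

lemma wconv_lim: "wconv l k t x = lim (\<lambda>n. wsum l k t n x)"
  by (simp add: wconv_def wiener_integral_sums wsum_def inc_def)

lemma measurable_wconv: "k \<noteq> 0 \<Longrightarrow> t \<ge> 0 \<Longrightarrow> wconv l k t \<in> borel_measurable M"
  unfolding wconv_lim[abs_def] by (intro borel_measurable_lim_metric measurable_wsum)

lemma AE_path: "k \<noteq> 0 \<Longrightarrow> AE x in M. \<beta> k 0 x = 0 \<and> continuous_on {0..} (\<lambda>t. \<beta> k t x)"
  using bm[of k] unfolding brownian_motion_def by (auto intro: AE_conjI)

lemma path_wsum:
  assumes "\<beta> k 0 x = 0" "continuous_on {0..} (\<lambda>t. \<beta> k t x)" "t \<ge> 0"
  shows "(\<lambda>n. wsum l k t n x) \<longlonglongrightarrow> wconv l k t x"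
    and "wconv l k t x = \<beta> k t x - l * integral {0..t} (\<lambda>s. exp (- l * (t - s)) * \<beta> k s x)"
proof -
  have c: "continuous_on {0..t} (\<lambda>t. \<beta> k t x)" using assms(2) by (rule continuous_on_subset) auto
  show "wconv l k t x = \<beta> k t x - l * integral {0..t} (\<lambda>s. exp (- l * (t - s)) * \<beta> k s x)"
    unfolding wconv_def by (rule wiener_integral_exp(2)[where B = "\<beta> k" and x = x, OF c assms(3,1)])
  then show "(\<lambda>n. wsum l k t n x) \<longlonglongrightarrow> wconv l k t x"
    unfolding wsum_def inc_def using wiener_integral_exp(1)[where B = "\<beta> k" and x = x, OF c assms(3,1), of l] by simp
qed

lemma wsum_second_moment:
  assumes k: "k \<noteq> 0" and t: "t > 0" and l: "l \<ge> 0" and n: "n > 0"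
  shows "integrable M (\<lambda>x. (wsum l k t n x)\<^sup>2)" "expectation (\<lambda>x. (wsum l k t n x)\<^sup>2) \<le> t"
proof -
  \<comment> \<open>The transform asks for bounded coefficients at every step, including those past
    \<open>t\<close>, where the plain exponential would exceed 1. For \<open>i < n\<close> the
    maximum changes nothing.\<close>
  define f where "f i j x = exp (- l * max 0 (t - grid t n i))" for i and j :: int and x :: 'w
  have eq: "wsum l k t n x = (\<Sum>i<n. \<Sum>j\<in>{k}. f i j x * inc j (grid t n i) (grid t n (Suc i)) x)" for x
    unfolding wsum_def
  proof (intro sum.cong refl)
    fix i assume "i \<in> {..<n}"
    then have "grid t n i \<le> t" using grid_in[of t i n] t by auto
    then show "exp (- l * (t - grid t n i)) * inc k (grid t n i) (grid t n (Suc i)) x =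
        (\<Sum>j\<in>{k}. f i j x * inc j (grid t n i) (grid t n (Suc i)) x)"
      by (simp add: f_def)
  qed
  have mt: "integrable M (\<lambda>x. (\<Sum>i<n. \<Sum>j\<in>{k}. f i j x * inc j (grid t n i) (grid t n (Suc i)) x)\<^sup>2) \<and>
     expectation (\<lambda>x. (\<Sum>i<n. \<Sum>j\<in>{k}. f i j x * inc j (grid t n i) (grid t n (Suc i)) x)\<^sup>2) =
      (\<Sum>i<n. (grid t n (Suc i) - grid t n i) * (\<Sum>j\<in>{k}. expectation (\<lambda>x. (f i j x)\<^sup>2)))"
  proof -
    have m: "f i j \<in> borel_measurable (F (grid t n i))" for i j by (simp add: f_def[abs_def])
    have "\<bar>f i j x\<bar> \<le> 1" for i j x using l by (simp add: f_def)
    from martingale_transform[of "grid t n" "{k}" f 1 n, OF grid_nonneg[OF less_imp_le[OF t]] grid_less[OF t n] _ _ m this]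
    show ?thesis using k by blast
  qed
  from mt show "integrable M (\<lambda>x. (wsum l k t n x)\<^sup>2)" by (simp only: eq)
  have "expectation (\<lambda>x. (wsum l k t n x)\<^sup>2) = (\<Sum>i<n. (t / real n) * expectation (\<lambda>x. (f i k x)\<^sup>2))"
    using mt by (simp add: eq grid_step)
  also have "\<dots> \<le> (\<Sum>i<n. (t / real n) * 1)"
  proof (intro sum_mono mult_left_mono)
    fix i
    have "(exp (- l * max 0 (t - grid t n i)))\<^sup>2 \<le> 1\<^sup>2"
      using l by (intro power_mono) auto
    then show "expectation (\<lambda>x. (f i k x)\<^sup>2) \<le> 1" by (simp add: f_def prob_space)
  qed (use t in simp)
  also have "\<dots> = t" using n by simp
  finally show "expectation (\<lambda>x. (wsum l k t n x)\<^sup>2) \<le> t" .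
qed

lemma wconv_second_moment:
  assumes k: "k \<noteq> 0" and t: "t > 0" and l: "l \<ge> 0"
  shows "(\<integral>\<^sup>+x. ennreal ((wconv l k t x)\<^sup>2) \<partial>M) \<le> ennreal t"
proof -
  have "(\<integral>\<^sup>+x. ennreal ((wconv l k t x)\<^sup>2) \<partial>M) = (\<integral>\<^sup>+x. liminf (\<lambda>n. ennreal ((wsum l k t n x)\<^sup>2)) \<partial>M)"
  proof (rule nn_integral_cong_AE)
    show "AE x in M. ennreal ((wconv l k t x)\<^sup>2) = liminf (\<lambda>n. ennreal ((wsum l k t n x)\<^sup>2))"
      using AE_path[OF k]
    proof eventually_elim
      case (elim x)
      have "(\<lambda>n. wsum l k t n x) \<longlonglongrightarrow> wconv l k t x"
        by (rule path_wsum(1)) (use elim t in auto)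
      then have "(\<lambda>n. ennreal ((wsum l k t n x)\<^sup>2)) \<longlonglongrightarrow> ennreal ((wconv l k t x)\<^sup>2)"
        by (intro tendsto_ennrealI tendsto_power)
      then show ?case by (intro lim_imp_Liminf[symmetric]) auto
    qed
  qed
  also have "\<dots> \<le> liminf (\<lambda>n. \<integral>\<^sup>+x. ennreal ((wsum l k t n x)\<^sup>2) \<partial>M)"
    by (rule nn_integral_liminf) (intro measurable_compose[OF _ measurable_ennreal] borel_measurable_power measurable_wsum k less_imp_le[OF t])
  also have "\<dots> \<le> liminf (\<lambda>n. ennreal t)"
  proof (rule Liminf_mono)
    show "\<forall>\<^sub>F n in sequentially. (\<integral>\<^sup>+x. ennreal ((wsum l k t n x)\<^sup>2) \<partial>M) \<le> ennreal t"
      using eventually_gt_at_top[of 0]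
    proof eventually_elim
      case (elim n)
      show ?case
        using wsum_second_moment[OF k t l elim]
        by (subst nn_integral_eq_integral) (auto intro: ennreal_leI)
    qed
  qed
  also have "\<dots> = ennreal t" by (simp add: Liminf_const)
  finally show ?thesis .
qed

text \<open>Each convolution has second moment at most \<open>t\<close>, whatever its rate, so by
  monotone convergence the sum of the weighted squares has expectation at most \<open>t\<close>
  times the sum of the \<open>(b k)\<^sup>2\<close>, and is finite almost surely. The exceptional
  null set depends on \<open>t\<close>.\<close>

lemma AE_l2_wconv:
  assumes b: "l2 b" and t: "t > 0" and l: "\<And>k. l k \<ge> 0"
  shows "AE x in M. l2 (\<lambda>k. b k * wconv (l k) k t x)"
proof -
  define B where "B = (norm (synth b))\<^sup>2"
  have Bc: "(\<Sum>k\<in>cut n. (b k)\<^sup>2) \<le> B" for n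
    unfolding B_def by (rule has_sum_mono_neutral[OF has_sum_finite norm_synth[OF b]]) (use cut_subset in auto)
  define g where "g n x = (\<Sum>k\<in>cut n. ennreal ((b k * wconv (l k) k t x)\<^sup>2))" for n x
  have m: "wconv (l k) k t \<in> borel_measurable M" if "k \<in> cut n" for k n
    using that t by (intro measurable_wconv) auto
  have gm: "g n \<in> borel_measurable M" for n
    unfolding g_def[abs_def] using m by (intro borel_measurable_sum) measurable
  have inc: "incseq g"
  proof (intro incseq_SucI le_funI)
    show "g n x \<le> g (Suc n) x" for n x
      unfolding g_def by (rule sum_mono2) (auto simp: cut_def)
  qed
  have "(\<integral>\<^sup>+x. (SUP n. g n x) \<partial>M) = (SUP n. \<integral>\<^sup>+x. g n x \<partial>M)"
    by (rule nn_integral_monotone_convergence_SUP[OF inc gm])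
  also have "\<dots> \<le> ennreal (t * B)"
  proof (rule SUP_least)
    fix n
    have "(\<integral>\<^sup>+x. g n x \<partial>M) = (\<Sum>k\<in>cut n. \<integral>\<^sup>+x. ennreal ((b k)\<^sup>2) * ennreal ((wconv (l k) k t x)\<^sup>2) \<partial>M)"
      unfolding g_def by (subst nn_integral_sum) (use m in \<open>auto simp: power_mult_distrib ennreal_mult intro!: sum.cong\<close>)
    also have "\<dots> = (\<Sum>k\<in>cut n. ennreal ((b k)\<^sup>2) * (\<integral>\<^sup>+x. ennreal ((wconv (l k) k t x)\<^sup>2) \<partial>M))"
      using m by (intro sum.cong refl nn_integral_cmult) measurable
    also have "\<dots> \<le> (\<Sum>k\<in>cut n. ennreal ((b k)\<^sup>2) * ennreal t)"
      by (intro sum_mono mult_left_mono wconv_second_moment t l) auto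
    also have "\<dots> = ennreal (t * (\<Sum>k\<in>cut n. (b k)\<^sup>2))"
      using t by (simp add: sum_distrib_left mult.commute ennreal_mult[symmetric])
    also have "\<dots> \<le> ennreal (t * B)" using t Bc by (intro ennreal_leI mult_left_mono) auto
    finally show "(\<integral>\<^sup>+x. g n x \<partial>M) \<le> ennreal (t * B)" .
  qed
  also have "\<dots> < \<infinity>" by simp
  finally have "AE x in M. (SUP n. g n x) \<noteq> \<infinity>"
    using gm by (intro nn_integral_noteq_infinite) auto
  then show ?thesis
  proof eventually_elim
    case (elim x)
    then obtain r where r: "(SUP n. g n x) = ennreal r" "r \<ge> 0" by (cases "SUP n. g n x") auto
    show ?case
    proof (rule l2_cutI)
      fix n
      have "ennreal (\<Sum>k\<in>cut n. (b k * wconv (l k) k t x)\<^sup>2) = g n x" unfolding g_def by simp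
      also have "\<dots> \<le> ennreal r" unfolding r(1)[symmetric] by (rule SUP_upper) simp
      finally show "(\<Sum>k\<in>cut n. (b k * wconv (l k) k t x)\<^sup>2) \<le> r" using r(2) by (simp add: ennreal_le_iff)
    qed
  qed
qed

lemma stoch_conv_synth: "stoch_conv \<nu> b \<beta> t x = synth (\<lambda>k. b k * wconv ((real_of_int k)\<^sup>2 * \<nu>) k t x)"
  by (simp add: stoch_conv_def synth_def wconv_def mult.assoc)

text \<open>What the energy balance uses of a sample path: regularity, the initial coefficients and
  the integrated equation mode by mode. After this point the estimates for a single path are
  deterministic.\<close>

definition good_path :: "real \<Rightarrow> (int \<Rightarrow> real) \<Rightarrow> real \<Rightarrow> L2 \<Rightarrow> (real \<Rightarrow> 'w \<Rightarrow> L2) \<Rightarrow> 'w \<Rightarrow> bool" where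
  "good_path \<nu> b T y w x \<longleftrightarrow>
     (\<forall>t\<in>{0..T}. w t x \<in> Hdot 1) \<and> continuous_on {0..T} (\<lambda>t. Jop 1 (w t x)) \<and>
     (\<forall>k. k \<noteq> 0 \<longrightarrow> coef (w 0 x) k = coef y k) \<and>
     (\<forall>k s t. k \<noteq> 0 \<longrightarrow> 0 \<le> s \<longrightarrow> s \<le> t \<longrightarrow> t \<le> T \<longrightarrow>
        coef (w t x) k - coef (w s x) k =
          integral {s..t} (\<lambda>r. - ((real_of_int k)\<^sup>2 * \<nu>) * coef (w r x) k + coef (nonlinearity (-2) (w r x)) k)
          + b k * inc k s t x)"

text \<open>The mild equation is projected to one mode at a time, where the stochastic convolution
  is an explicit integral of the Brownian path, and the scalar variation of constants formula is
  then undone.\<close>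

lemma AE_good_path:
  assumes nu: "\<nu> > 0" and b: "l2 b" and sol: "global_solution M (-2) \<nu> b \<beta> 1 y w" and T: "T > 0"
  shows "AE x in M. good_path \<nu> b T y w x"
proof -
  \<comment> \<open>The series of the stochastic convolution is known to be summable almost surely
    only at a fixed positive time. Countably many times share one null set, and continuity of the
    path recovers the others.\<close>
  let ?D = "{0<..<T} \<inter> \<rat>"
  have "countable ?D" using countable_rat by auto
  then have sum: "AE x in M. \<forall>t\<in>?D. l2 (\<lambda>k. b k * wconv ((real_of_int k)\<^sup>2 * \<nu>) k t x)"
    using nu by (subst AE_ball_countable) (auto intro!: AE_l2_wconv b)
  have "countable nonzero_ints" by simp
  then have paths: "AE x in M. \<forall>k\<in>nonzero_ints. \<beta> k 0 x = 0 \<and> continuous_on {0..} (\<lambda>t. \<beta> k t x)"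
    by (subst AE_ball_countable) (simp, rule ballI, rule AE_path, simp)
  have so: "solution_on M (-2) \<nu> b \<beta> 1 T y w" using sol T by (simp add: global_solution_def)
  then have cont: "AE x in M. continuous_map (top_of_set {0..T}) (Hdot_topology 1) (\<lambda>t. w t x)"
    and mild: "AE x in M. \<forall>t\<in>{0..T}. w t x = heat (\<nu> * t) y
              + integral {0..t} (\<lambda>s. heat (\<nu> * (t - s)) (nonlinearity (-2) (w s x))) + stoch_conv \<nu> b \<beta> t x"
    unfolding solution_on_def by auto
  show ?thesis using sum paths cont mild
  proof eventually_elim
    case (elim x)
    have w: "w t x \<in> Hdot 1" if "t \<in> {0..T}" for t
      using elim(3)[unfolded continuous_map_Hdot_iff] that by auto
    have J: "continuous_on {0..T} (\<lambda>t. Jop 1 (w t x))"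
      using elim(3)[unfolded continuous_map_Hdot_iff] by auto
    have cN: "continuous_on {0..T} (\<lambda>t. nonlinearity (-2) (w t x))"
      by (rule continuous_on_nonlinearity[OF w J])
    have main: "coef (w 0 x) k = coef y k \<and> (0 \<le> s \<longrightarrow> s \<le> t \<longrightarrow> t \<le> T \<longrightarrow>
        coef (w t x) k - coef (w s x) k =
          integral {s..t} (\<lambda>r. - ((real_of_int k)\<^sup>2 * \<nu>) * coef (w r x) k + coef (nonlinearity (-2) (w r x)) k)
          + b k * inc k s t x)" if k: "k \<noteq> 0" for k s t
    proof -
      let ?l = "(real_of_int k)\<^sup>2 * \<nu>"
      have p: "\<beta> k 0 x = 0" "continuous_on {0..} (\<lambda>t. \<beta> k t x)" using elim(2) k by auto
      have c\<beta>: "continuous_on {0..T} (\<lambda>t. \<beta> k t x)" using p(2) by (rule continuous_on_subset) auto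
      have cw: "continuous_on {0..T} (\<lambda>t. coef (w t x) k)" by (rule continuous_coef[OF w J])
      have cNk: "continuous_on {0..T} (\<lambda>t. coef (nonlinearity (-2) (w t x)) k)"
        unfolding coef_def by (intro continuous_intros cN)
      have m: "coef (w t x) k = exp (- ?l * t) * coef y k + integral {0..t} (\<lambda>s. exp (- ?l * (t - s)) * coef (nonlinearity (-2) (w s x)) k)
        + b k * (\<beta> k t x - ?l * integral {0..t} (\<lambda>s. exp (- ?l * (t - s)) * \<beta> k s x))" if t: "t \<in> ?D" for t
      proof -
        have t0: "t \<ge> 0" "t \<in> {0..T}" using t by auto
        have l2t: "l2 (\<lambda>k. b k * wconv ((real_of_int k)\<^sup>2 * \<nu>) k t x)" using elim(1) t by blast
        have sc: "coef (stoch_conv \<nu> b \<beta> t x) k = b k * (\<beta> k t x - ?l * integral {0..t} (\<lambda>s. exp (- ?l * (t - s)) * \<beta> k s x))"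
          unfolding stoch_conv_synth coef_synth[OF l2t k] path_wsum(2)[OF p t0(1)] ..
        have ih: "coef (integral {0..t} (\<lambda>s. heat (\<nu> * (t - s)) (nonlinearity (-2) (w s x)))) k =
           integral {0..t} (\<lambda>s. exp (- (real_of_int k)\<^sup>2 * (\<nu> * (t - s))) * coef (nonlinearity (-2) (w s x)) k)"
          by (rule coef_integral_heat[OF _ _ k]) (use cN t0 nu in \<open>auto intro: continuous_on_subset\<close>)
        have hy: "coef (heat (\<nu> * t) y) k = exp (- (real_of_int k)\<^sup>2 * (\<nu> * t)) * coef y k"
          by (rule coef_heat[OF _ k]) (use nu t0 in auto)
        have "coef (w t x) k = coef (heat (\<nu> * t) y) k + coef (integral {0..t} (\<lambda>s. heat (\<nu> * (t - s)) (nonlinearity (-2) (w s x)))) k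
           + coef (stoch_conv \<nu> b \<beta> t x) k"
          using elim(4) t0(2) by (metis coef_def inner_add_left)
        then show ?thesis unfolding sc ih hy by (simp add: mult.assoc)
      qed
      have D: "?D \<subseteq> {0..T}" by auto
      note mi = mild_imp_integral_equation[OF less_imp_le[OF T] cw cNk c\<beta> D closure_rational_interval[OF T] m]
      show ?thesis
      proof (intro conjI impI)
        show "coef (w 0 x) k = coef y k" using mi(2)[of 0 0] T p(1) by simp
        assume st: "0 \<le> s" "s \<le> t" "t \<le> T"
        show "coef (w t x) k - coef (w s x) k =
          integral {s..t} (\<lambda>r. - ((real_of_int k)\<^sup>2 * \<nu>) * coef (w r x) k + coef (nonlinearity (-2) (w r x)) k)
          + b k * inc k s t x"
          using mi(1)[OF _ st] by (simp add: inc_def)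
      qed
    qed
    show ?case unfolding good_path_def using w J main by blast
  qed
qed

end

section \<open>Energy balance along a path\<close>

lemma sum_mult_le_L2_set:
  fixes f g :: "'a \<Rightarrow> real"
  shows "\<bar>\<Sum>k\<in>A. f k * g k\<bar> \<le> L2_set f A * L2_set g A"
proof -
  have "\<bar>\<Sum>k\<in>A. f k * g k\<bar> \<le> (\<Sum>k\<in>A. \<bar>f k\<bar> * \<bar>g k\<bar>)"
    by (rule order_trans[OF sum_abs]) (simp add: abs_mult)
  also have "\<dots> \<le> L2_set f A * L2_set g A" by (rule L2_set_mult_ineq)
  finally show ?thesis .
qed

lemma L2_set_coef_le: "L2_set (coef v) (cut l) \<le> norm v"
  unfolding L2_set_def using bessel_finite[OF finite_cut cut_subset, of v l]
  by (intro real_le_lsqrt norm_ge_zero) (simp add: coef_def)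

lemma L2_set_kmul_le: assumes "v \<in> Hdot 1" shows "L2_set (kmul (coef v)) (cut l) \<le> Hdot_norm 1 v"
proof -
  have "(\<Sum>k\<in>cut l. (kmul (coef v) k)\<^sup>2) \<le> (norm (synth (kmul (coef v))))\<^sup>2"
    by (rule has_sum_mono_neutral[OF has_sum_finite norm_synth[OF l2_kmul[OF assms]]]) (use cut_subset in auto)
  then show ?thesis
    unfolding L2_set_def norm_kmul[OF assms] by (intro real_le_lsqrt Hdot_norm_nonneg)
qed

lemma norm_tail_le:
  assumes "u \<in> Hdot 1"
  shows "norm (u - Sn (coef u) l) \<le> Hdot_norm 1 u / real (Suc l)"
proof -
  have uH: "u \<in> H_space" using assms by (rule HdotD)
  have "u - Sn (coef u) l = synth (\<lambda>k. coef u k - (if k \<in> cut l then coef u k else 0))"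
    unfolding Sn_eq_synth by (subst synth_diff) (simp_all add: l2_coef l2_if synth_coef[OF uH])
  also have "norm \<dots> \<le> (1 / real (Suc l)) * norm (synth (kmul (coef u)))"
  proof (rule norm_synth_mono[OF l2_kmul[OF assms]])
    fix k :: int assume k: "k \<noteq> 0"
    show "\<bar>coef u k - (if k \<in> cut l then coef u k else 0)\<bar> \<le> 1 / real (Suc l) * \<bar>real_of_int k * coef u k\<bar>"
    proof (cases "k \<in> cut l")
      case False
      then have "int (Suc l) \<le> \<bar>k\<bar>" using k by (auto simp: cut_def)
      then have "real (Suc l) \<le> \<bar>real_of_int k\<bar>" by linarith
      then have "real (Suc l) * \<bar>coef u k\<bar> \<le> \<bar>real_of_int k\<bar> * \<bar>coef u k\<bar>" by (rule mult_right_mono) simp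
      then show ?thesis using False by (simp add: abs_mult field_simps)
    qed simp
  qed simp
  finally show ?thesis by (simp add: norm_kmul[OF assms])
qed

text \<open>Truncation destroys the exact cancellation. Since the full inner product vanishes, what
  is left is the nonlinearity tested against the high modes of \<open>u\<close>, whose norm is of
  order \<open>1 / (l + 1)\<close> for \<open>u\<close> in \<open>H\<^sup>1\<close>.\<close>

lemma truncated_nonlinearity_orthogonal:
  assumes "u \<in> Hdot 1"
  shows "\<bar>\<Sum>k\<in>cut l. coef u k * coef (nonlinearity (-2) u) k\<bar> \<le> Hdot_norm 1 u * norm (nonlinearity (-2) u) / real (Suc l)"
proof -
  let ?N = "nonlinearity (-2) u"
  have "(\<Sum>k\<in>cut l. coef u k * coef ?N k) = inner ?N (Sn (coef u) l)"
    by (simp add: Sn_def inner_sum_right coef_def mult.commute)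
  also have "\<dots> = - inner ?N (u - Sn (coef u) l)"
    using nonlinearity_orthogonal[OF assms] by (simp add: inner_diff_right)
  also have "\<bar>\<dots>\<bar> \<le> norm ?N * norm (u - Sn (coef u) l)"
    using Cauchy_Schwarz_ineq2[of ?N "u - Sn (coef u) l"] by simp
  also have "\<dots> \<le> norm ?N * (Hdot_norm 1 u / real (Suc l))"
    by (intro mult_left_mono norm_tail_le assms norm_ge_zero)
  finally show ?thesis by (simp add: mult.commute)
qed

definition drift :: "real \<Rightarrow> (real \<Rightarrow> L2) \<Rightarrow> int \<Rightarrow> real \<Rightarrow> real" where
  "drift \<nu> u k r = - ((real_of_int k)\<^sup>2 * \<nu>) * coef (u r) k + coef (nonlinearity (-2) (u r)) k"

text \<open>The mesh \<open>T / (l + 1) ^ 3\<close> is small compared with \<open>1 / l ^ 2\<close>, the reciprocal of the largest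
  eigenvalue on the first \<open>l\<close> modes.\<close>

definition ngrid :: "nat \<Rightarrow> nat" where "ngrid l = (Suc l) ^ 3"

lemma ngrid_pos: "ngrid l > 0" by (simp add: ngrid_def)

lemma ngrid_filterlim: "filterlim ngrid sequentially sequentially"
proof (rule filterlim_at_top_mono[OF filterlim_ident])
  have "l \<le> ngrid l" for l using power_increasing[of 1 3 "Suc l"] by (simp add: ngrid_def)
  then show "\<forall>\<^sub>F l in sequentially. l \<le> ngrid l" by simp
qed

locale path =
  fixes \<nu> T :: real and u :: "real \<Rightarrow> L2" and Wb Nb :: real
  assumes nu: "\<nu> > 0" and T: "T > 0"
    and u: "\<And>t. t \<in> {0..T} \<Longrightarrow> u t \<in> Hdot 1" and J: "continuous_on {0..T} (\<lambda>t. Jop 1 (u t))"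
    and Wb: "\<And>t. t \<in> {0..T} \<Longrightarrow> Hdot_norm 1 (u t) \<le> Wb"
    and Nb: "\<And>t. t \<in> {0..T} \<Longrightarrow> norm (nonlinearity (-2) (u t)) \<le> Nb"
begin

lemma Wb_nonneg: "Wb \<ge> 0" using order_trans[OF Hdot_norm_nonneg Wb[of 0]] T by simp
lemma Nb_nonneg: "Nb \<ge> 0" using order_trans[OF norm_ge_zero Nb[of 0]] T by simp

lemma cont_coef: "continuous_on {0..T} (\<lambda>t. coef (u t) k)"
  by (rule continuous_coef[OF u J])

lemma cont_N: "continuous_on {0..T} (\<lambda>t. coef (nonlinearity (-2) (u t)) k)"
  unfolding coef_def by (intro continuous_intros continuous_on_nonlinearity[OF u J])

lemma cont_drift: "continuous_on {0..T} (drift \<nu> u k)"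
  unfolding drift_def[abs_def] by (intro continuous_intros cont_coef cont_N)

text \<open>With the coefficient frozen at \<open>p\<close>, the integrand splits into three sums:
  the viscous term against \<open>u s - u p\<close>, the nonlinearity against
  \<open>u s - u p\<close>, and the nonlinearity against \<open>u s\<close> itself. Continuity in
  \<open>H\<^sup>1\<close> makes the first two small, the truncated cancellation the third.\<close>

lemma energy_increment:
  assumes pq: "0 \<le> p" "p \<le> q" "q \<le> T" and e: "\<And>s. s \<in> {p..q} \<Longrightarrow> Hdot_norm 1 (u s - u p) \<le> e"
  shows "\<bar>\<Sum>k\<in>cut l. coef (u p) k * integral {p..q} (drift \<nu> u k) + \<nu> * (real_of_int k)\<^sup>2 * (coef (u p) k)\<^sup>2 * (q - p)\<bar>
     \<le> ((\<nu> * Wb + Nb) * e + Wb * Nb / real (Suc l)) * (q - p)"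
proof -
  have sub: "{p..q} \<subseteq> {0..T}" using pq by auto
  have p: "p \<in> {0..T}" using pq by auto
  let ?g = "\<lambda>k s. coef (u p) k * drift \<nu> u k s + \<nu> * (real_of_int k)\<^sup>2 * (coef (u p) k)\<^sup>2"
  have cd: "continuous_on {p..q} (drift \<nu> u k)" for k using cont_drift sub by (rule continuous_on_subset)
  have cg: "continuous_on {p..q} (?g k)" for k by (intro continuous_intros cd)
  have "(\<Sum>k\<in>cut l. coef (u p) k * integral {p..q} (drift \<nu> u k) + \<nu> * (real_of_int k)\<^sup>2 * (coef (u p) k)\<^sup>2 * (q - p))
     = (\<Sum>k\<in>cut l. integral {p..q} (?g k))"
  proof (intro sum.cong refl)
    fix k
    have "integral {p..q} (?g k) = integral {p..q} (\<lambda>s. coef (u p) k * drift \<nu> u k s) + integral {p..q} (\<lambda>s. \<nu> * (real_of_int k)\<^sup>2 * (coef (u p) k)\<^sup>2)"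
      by (intro Henstock_Kurzweil_Integration.integral_add integrable_continuous_real continuous_intros cd)
    also have "integral {p..q} (\<lambda>s. \<nu> * (real_of_int k)\<^sup>2 * (coef (u p) k)\<^sup>2) = \<nu> * (real_of_int k)\<^sup>2 * (coef (u p) k)\<^sup>2 * (q - p)"
      using pq by simp
    also have "integral {p..q} (\<lambda>s. coef (u p) k * drift \<nu> u k s) = coef (u p) k * integral {p..q} (drift \<nu> u k)"
      by simp
    finally show "coef (u p) k * integral {p..q} (drift \<nu> u k) + \<nu> * (real_of_int k)\<^sup>2 * (coef (u p) k)\<^sup>2 * (q - p) = integral {p..q} (?g k)" ..
  qed
  also have "\<dots> = integral {p..q} (\<lambda>s. \<Sum>k\<in>cut l. ?g k s)"
    by (rule integral_sum[symmetric]) (auto intro: integrable_continuous_real cg)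
  finally have eq: "(\<Sum>k\<in>cut l. coef (u p) k * integral {p..q} (drift \<nu> u k) + \<nu> * (real_of_int k)\<^sup>2 * (coef (u p) k)\<^sup>2 * (q - p))
     = integral {p..q} (\<lambda>s. \<Sum>k\<in>cut l. ?g k s)" .
  have "norm (integral {p..q} (\<lambda>s. \<Sum>k\<in>cut l. ?g k s)) \<le> ((\<nu> * Wb + Nb) * e + Wb * Nb / real (Suc l)) * (q - p)"
  proof (rule integral_bound[OF pq(2)])
    show "continuous_on {p..q} (\<lambda>s. \<Sum>k\<in>cut l. ?g k s)" by (intro continuous_intros cg)
    fix s assume s: "s \<in> {p..q}"
    then have sT: "s \<in> {0..T}" using sub by auto
    let ?d = "u s - u p" and ?N = "nonlinearity (-2) (u s)"
    have d: "?d \<in> Hdot 1" by (rule Hdot_diff[OF u[OF sT] u[OF p]])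
    have e0: "e \<ge> 0" using order_trans[OF Hdot_norm_nonneg e[OF s]] .
    have "(\<Sum>k\<in>cut l. ?g k s) = - (\<nu> * (\<Sum>k\<in>cut l. kmul (coef (u p)) k * kmul (coef ?d) k))
        - (\<Sum>k\<in>cut l. coef ?d k * coef ?N k) + (\<Sum>k\<in>cut l. coef (u s) k * coef ?N k)"
      unfolding sum_distrib_left sum_negf[symmetric] sum_subtractf[symmetric] sum.distrib[symmetric]
      by (intro sum.cong refl) (simp add: drift_def coef_diff algebra_simps power2_eq_square)
    then have "\<bar>\<Sum>k\<in>cut l. ?g k s\<bar> \<le> \<bar>\<nu> * (\<Sum>k\<in>cut l. kmul (coef (u p)) k * kmul (coef ?d) k)\<bar>
        + \<bar>\<Sum>k\<in>cut l. coef ?d k * coef ?N k\<bar> + \<bar>\<Sum>k\<in>cut l. coef (u s) k * coef ?N k\<bar>" by linarith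
    also have "\<dots> \<le> \<nu> * (Wb * e) + e * Nb + Wb * Nb / real (Suc l)"
    proof (intro add_mono)
      have "\<bar>\<Sum>k\<in>cut l. kmul (coef (u p)) k * kmul (coef ?d) k\<bar> \<le> Wb * e"
        by (rule order_trans[OF sum_mult_le_L2_set], rule mult_mono)
           (auto intro!: order_trans[OF L2_set_kmul_le] u p Wb d e s L2_set_nonneg Wb_nonneg)
      then show "\<bar>\<nu> * (\<Sum>k\<in>cut l. kmul (coef (u p)) k * kmul (coef ?d) k)\<bar> \<le> \<nu> * (Wb * e)"
        using nu by (simp add: abs_mult)
      show "\<bar>\<Sum>k\<in>cut l. coef ?d k * coef ?N k\<bar> \<le> e * Nb"
      proof (rule order_trans[OF sum_mult_le_L2_set], rule mult_mono)
        show "L2_set (coef ?d) (cut l) \<le> e"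
          by (rule order_trans[OF L2_set_coef_le order_trans[OF norm_le_Hdot_norm[OF d] e[OF s]]])
        show "L2_set (coef ?N) (cut l) \<le> Nb" by (rule order_trans[OF L2_set_coef_le Nb[OF sT]])
      qed (auto intro: L2_set_nonneg e0)
      have "Hdot_norm 1 (u s) * norm ?N \<le> Wb * Nb"
        by (intro mult_mono Wb Nb sT Wb_nonneg norm_ge_zero)
      then show "\<bar>\<Sum>k\<in>cut l. coef (u s) k * coef ?N k\<bar> \<le> Wb * Nb / real (Suc l)"
        by (intro order_trans[OF truncated_nonlinearity_orthogonal[OF u[OF sT]]] divide_right_mono) auto
    qed
    also have "\<dots> = (\<nu> * Wb + Nb) * e + Wb * Nb / real (Suc l)" by (simp add: algebra_simps)
    finally show "norm (\<Sum>k\<in>cut l. ?g k s) \<le> (\<nu> * Wb + Nb) * e + Wb * Nb / real (Suc l)" by simp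
  qed
  then show ?thesis unfolding eq by simp
qed

text \<open>Duality: the vector of integrals is tested with itself, so its squared length is the
  integral of a scalar product and one factor of the length cancels. One derivative of the viscous
  term is absorbed by the \<open>H\<^sup>1\<close> norm, the other costs the factor
  \<open>l + 1\<close>.\<close>

lemma drift_increment:
  assumes pq: "0 \<le> p" "p \<le> q" "q \<le> T"
  shows "(\<Sum>k\<in>cut l. (integral {p..q} (drift \<nu> u k))\<^sup>2) \<le> ((\<nu> * Wb + Nb) * real (Suc l) * (q - p))\<^sup>2"
proof -
  let ?a = "\<lambda>k. integral {p..q} (drift \<nu> u k)"
  let ?s = "L2_set ?a (cut l)"
  have sub: "{p..q} \<subseteq> {0..T}" using pq by auto
  have cd: "continuous_on {p..q} (drift \<nu> u k)" for k using cont_drift sub by (rule continuous_on_subset)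
  have B0: "(\<nu> * Wb + Nb) * real (Suc l) \<ge> 0" using nu Wb_nonneg Nb_nonneg by simp
  have sq: "?s\<^sup>2 = (\<Sum>k\<in>cut l. (?a k)\<^sup>2)" by (simp add: L2_set_def sum_nonneg)
  have "(\<Sum>k\<in>cut l. (?a k)\<^sup>2) = (\<Sum>k\<in>cut l. integral {p..q} (\<lambda>s. ?a k * drift \<nu> u k s))"
    by (simp add: power2_eq_square)
  also have "\<dots> = integral {p..q} (\<lambda>s. \<Sum>k\<in>cut l. ?a k * drift \<nu> u k s)"
    by (rule integral_sum[symmetric]) (auto intro!: integrable_continuous_real continuous_intros cd)
  also have "norm \<dots> \<le> (?s * ((\<nu> * Wb + Nb) * real (Suc l))) * (q - p)"
  proof (rule integral_bound[OF pq(2)])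
    show "continuous_on {p..q} (\<lambda>s. \<Sum>k\<in>cut l. ?a k * drift \<nu> u k s)" by (intro continuous_intros cd)
    fix s assume "s \<in> {p..q}"
    then have sT: "s \<in> {0..T}" using sub by auto
    have "L2_set (\<lambda>k. drift \<nu> u k s) (cut l) \<le>
       L2_set (\<lambda>k. - ((real_of_int k)\<^sup>2 * \<nu>) * coef (u s) k) (cut l) + L2_set (coef (nonlinearity (-2) (u s))) (cut l)"
      unfolding drift_def by (rule L2_set_triangle_ineq)
    also have "L2_set (\<lambda>k. - ((real_of_int k)\<^sup>2 * \<nu>) * coef (u s) k) (cut l) \<le> L2_set (\<lambda>k. (\<nu> * real (Suc l)) * (\<bar>kmul (coef (u s)) k\<bar>)) (cut l)"
    proof -
      have "L2_set (\<lambda>k. - ((real_of_int k)\<^sup>2 * \<nu>) * coef (u s) k) (cut l) = L2_set (\<lambda>k. \<bar>((real_of_int k)\<^sup>2 * \<nu>) * coef (u s) k\<bar>) (cut l)"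
        by (simp add: L2_set_def)
      also have "\<dots> \<le> L2_set (\<lambda>k. (\<nu> * real (Suc l)) * (\<bar>kmul (coef (u s)) k\<bar>)) (cut l)"
      proof (rule L2_set_mono)
        fix k assume "k \<in> cut l"
        then have "\<bar>k\<bar> \<le> int l" by (auto simp: cut_def)
        then have "\<bar>real_of_int k\<bar> \<le> real (Suc l)" by linarith
        then have "\<bar>real_of_int k\<bar> * (\<nu> * \<bar>kmul (coef (u s)) k\<bar>) \<le> real (Suc l) * (\<nu> * \<bar>kmul (coef (u s)) k\<bar>)"
          using nu by (intro mult_right_mono) auto
        then show "\<bar>((real_of_int k)\<^sup>2 * \<nu>) * coef (u s) k\<bar> \<le> (\<nu> * real (Suc l)) * (\<bar>kmul (coef (u s)) k\<bar>)"
          using nu by (simp add: abs_mult power2_eq_square mult_ac)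
      qed simp
      finally show ?thesis .
    qed
    also have "\<dots> = (\<nu> * real (Suc l)) * L2_set (kmul (coef (u s))) (cut l)"
      using nu by (subst L2_set_right_distrib[symmetric]) (auto simp: L2_set_def)
    also have "\<dots> + L2_set (coef (nonlinearity (-2) (u s))) (cut l) \<le> (\<nu> * real (Suc l)) * Wb + Nb * real (Suc l)"
    proof (intro add_mono mult_left_mono)
      show "L2_set (kmul (coef (u s))) (cut l) \<le> Wb" by (rule order_trans[OF L2_set_kmul_le[OF u[OF sT]] Wb[OF sT]])
      have "L2_set (coef (nonlinearity (-2) (u s))) (cut l) \<le> Nb * 1"
        using order_trans[OF L2_set_coef_le Nb[OF sT]] by simp
      also have "\<dots> \<le> Nb * real (Suc l)" using Nb_nonneg by (intro mult_left_mono) auto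
      finally show "L2_set (coef (nonlinearity (-2) (u s))) (cut l) \<le> Nb * real (Suc l)" .
    qed (use nu in simp)
    finally have D: "L2_set (\<lambda>k. drift \<nu> u k s) (cut l) \<le> (\<nu> * Wb + Nb) * real (Suc l)" by (simp add: algebra_simps)
    have "\<bar>\<Sum>k\<in>cut l. ?a k * drift \<nu> u k s\<bar> \<le> ?s * L2_set (\<lambda>k. drift \<nu> u k s) (cut l)"
      by (rule sum_mult_le_L2_set)
    also have "\<dots> \<le> ?s * ((\<nu> * Wb + Nb) * real (Suc l))" by (intro mult_left_mono D L2_set_nonneg)
    finally show "norm (\<Sum>k\<in>cut l. ?a k * drift \<nu> u k s) \<le> ?s * ((\<nu> * Wb + Nb) * real (Suc l))" by simp
  qed
  finally have "?s\<^sup>2 \<le> ?s * (((\<nu> * Wb + Nb) * real (Suc l)) * (q - p))"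
    unfolding sq by (simp add: sum_nonneg mult.assoc)
  then have "?s \<le> ((\<nu> * Wb + Nb) * real (Suc l)) * (q - p)"
  proof (cases "?s = 0")
    case True
    then show ?thesis using B0 pq by simp
  next
    case False
    then have "?s > 0" using L2_set_nonneg[of ?a "cut l"] by linarith
    then show ?thesis using \<open>?s\<^sup>2 \<le> _\<close> by (simp add: power2_eq_square)
  qed
  from power_mono[OF this L2_set_nonneg, of 2] show ?thesis unfolding sq .
qed

text \<open>The two errors of the discrete balance: the deviation of the linear drift term from the
  exact dissipation, and the squared drift increments. The factor 3 on the squares is 1 from
  expanding the square and 2 from Young's inequality for drift times noise.\<close>

definition err :: "nat \<Rightarrow> real" where
  "err l = (\<Sum>i<ngrid l. 2 * \<bar>\<Sum>k\<in>cut l. coef (u (grid T (ngrid l) i)) k * integral {grid T (ngrid l) i..grid T (ngrid l) (Suc i)} (drift \<nu> u k)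
        + \<nu> * (real_of_int k)\<^sup>2 * (coef (u (grid T (ngrid l) i)) k)\<^sup>2 * (T / real (ngrid l))\<bar>
      + 3 * (\<Sum>k\<in>cut l. (integral {grid T (ngrid l) i..grid T (ngrid l) (Suc i)} (drift \<nu> u k))\<^sup>2))"

lemma err_bound:
  assumes e: "\<forall>x\<in>{0..T}. \<forall>y\<in>{0..T}. \<bar>x - y\<bar> \<le> T / real (ngrid l) \<longrightarrow> dist (Jop 1 (u x)) (Jop 1 (u y)) < e"
  shows "err l \<le> 2 * T * (\<nu> * Wb + Nb) * e + (2 * T * Wb * Nb + 3 * T\<^sup>2 * (\<nu> * Wb + Nb)\<^sup>2) / real (Suc l)"
proof -
  let ?n = "ngrid l" let ?h = "T / real ?n"
  have "err l \<le> (\<Sum>i<?n. 2 * (((\<nu> * Wb + Nb) * e + Wb * Nb / real (Suc l)) * ?h) + 3 * ((\<nu> * Wb + Nb) * real (Suc l) * ?h)\<^sup>2)"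
    unfolding err_def
  proof (intro sum_mono add_mono mult_left_mono)
    fix i assume "i \<in> {..<?n}"
    then have i: "i < ?n" by simp
    let ?p = "grid T ?n i" and ?q = "grid T ?n (Suc i)"
    have pq: "0 \<le> ?p" "?p \<le> ?q" "?q \<le> T"
      using grid_in[of T i ?n] grid_in[of T "Suc i" ?n] grid_less[OF T ngrid_pos, of l i] T i by auto
    have "Hdot_norm 1 (u s - u ?p) \<le> e" if s: "s \<in> {?p..?q}" for s
    proof -
      have "\<bar>s - ?p\<bar> \<le> ?h" using s grid_step[of T ?n i] unfolding atLeastAtMost_iff by linarith
      moreover have sT: "s \<in> {0..T}" "?p \<in> {0..T}" using s pq by auto
      ultimately have "dist (Jop 1 (u s)) (Jop 1 (u ?p)) < e" using e by blast
      then show ?thesis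
        using u[OF sT(1)] u[OF sT(2)] by (simp add: Hdot_norm_Jop Hdot_diff Jop_diff dist_norm del: One_nat_def)
    qed
    from energy_increment[OF pq this, of l]
    show "\<bar>\<Sum>k\<in>cut l. coef (u ?p) k * integral {?p..?q} (drift \<nu> u k) + \<nu> * (real_of_int k)\<^sup>2 * (coef (u ?p) k)\<^sup>2 * ?h\<bar>
       \<le> ((\<nu> * Wb + Nb) * e + Wb * Nb / real (Suc l)) * ?h"
      by (simp only: grid_step)
    from drift_increment[OF pq, of l]
    show "(\<Sum>k\<in>cut l. (integral {?p..?q} (drift \<nu> u k))\<^sup>2) \<le> ((\<nu> * Wb + Nb) * real (Suc l) * ?h)\<^sup>2"
      by (simp only: grid_step)
  qed simp_all
  also have "\<dots> = 2 * T * (\<nu> * Wb + Nb) * e + 2 * T * Wb * Nb / real (Suc l) + 3 * (real ?n * ((\<nu> * Wb + Nb) * real (Suc l) * ?h)\<^sup>2)"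
  proof -
    define X where "X = (\<nu> * Wb + Nb) * e + Wb * Nb / real (Suc l)"
    define Z where "Z = ((\<nu> * Wb + Nb) * real (Suc l) * ?h)\<^sup>2"
    have nh: "real ?n * ?h = T" using ngrid_pos[of l] by simp
    have "real ?n * (2 * (X * H) + 3 * Z) = 2 * X * (real ?n * H) + 3 * (real ?n * Z)" for H :: real
      by (simp add: algebra_simps)
    from this[of ?h] have "real ?n * (2 * (X * ?h) + 3 * Z) = 2 * X * T + 3 * (real ?n * Z)"
      unfolding nh .
    moreover have "2 * X * T = 2 * T * (\<nu> * Wb + Nb) * e + 2 * T * Wb * Nb / real (Suc l)"
      unfolding X_def by (simp add: distrib_left distrib_right mult_ac del: of_nat_Suc)
    ultimately show ?thesis unfolding X_def[symmetric] Z_def[symmetric] by (simp only: sum_constant card_lessThan)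
  qed
  \<comment> \<open>With \<open>(l + 1) ^ 3\<close> steps, squares of size
    \<open>((l + 1) * T / n)\<^sup>2\<close> add up to order \<open>1 / (l + 1)\<close>; a mesh of
    \<open>(l + 1) ^ 2\<close> steps would leave a constant.\<close>
  also have "real ?n * ((\<nu> * Wb + Nb) * real (Suc l) * ?h)\<^sup>2 = T\<^sup>2 * (\<nu> * Wb + Nb)\<^sup>2 / real (Suc l)"
  proof -
    have n: "real ?n = real (Suc l) * (real (Suc l))\<^sup>2"
      unfolding ngrid_def of_nat_power by (simp only: power2_eq_square power3_eq_cube mult.assoc)
    have "(L * L\<^sup>2) * (c * L * (T / (L * L\<^sup>2)))\<^sup>2 = T\<^sup>2 * c\<^sup>2 / L" if "L > 0" for L c :: real
      using that by (simp add: field_simps power2_eq_square)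
    from this[of "real (Suc l)"] show ?thesis unfolding n by simp
  qed
  finally show ?thesis by (simp add: add_divide_distrib del: of_nat_Suc)
qed

lemma err_nonneg: "err l \<ge> 0"
  unfolding err_def by (intro sum_nonneg add_nonneg_nonneg mult_nonneg_nonneg) auto

lemma err_tendsto: "err \<longlonglongrightarrow> 0"
proof (rule tendstoI)
  fix r :: real assume r: "r > 0"
  define K where "K = 2 * T * (\<nu> * Wb + Nb) + 1"
  define K' where "K' = 2 * T * Wb * Nb + 3 * T\<^sup>2 * (\<nu> * Wb + Nb)\<^sup>2"
  have K: "K > 0" unfolding K_def using T nu Wb_nonneg Nb_nonneg by (intro add_nonneg_pos) auto
  have "\<forall>\<^sub>F n in sequentially. \<forall>x\<in>{0..T}. \<forall>y\<in>{0..T}. \<bar>x - y\<bar> \<le> T / real n \<longrightarrow> dist (Jop 1 (u x)) (Jop 1 (u y)) < r / (2 * K)"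
    by (rule uniform_modulus[OF J]) (use r K T in auto)
  then have 1: "\<forall>\<^sub>F l in sequentially. \<forall>x\<in>{0..T}. \<forall>y\<in>{0..T}. \<bar>x - y\<bar> \<le> T / real (ngrid l) \<longrightarrow> dist (Jop 1 (u x)) (Jop 1 (u y)) < r / (2 * K)"
    by (rule eventually_compose_filterlim[OF _ ngrid_filterlim])
  have "(\<lambda>l. K' / real (Suc l)) \<longlonglongrightarrow> 0" by (rule LIMSEQ_Suc[OF lim_const_over_n])
  then have 2: "\<forall>\<^sub>F l in sequentially. K' / real (Suc l) < r / 2" by (rule order_tendstoD(2)) (use r in simp)
  show "\<forall>\<^sub>F l in sequentially. dist (err l) 0 < r"
    using 1 2
  proof eventually_elim
    case (elim l)
    have "2 * T * (\<nu> * Wb + Nb) * (r / (2 * K)) \<le> K * (r / (2 * K))"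
      unfolding K_def[symmetric] using r K by (intro mult_right_mono) (auto simp: K_def)
    also have "\<dots> = r / 2" using K by simp
    finally have "err l < r" using err_bound[OF elim(1)] elim(2) unfolding K'_def by linarith
    then show ?case using err_nonneg[of l] by (simp add: dist_real_def)
  qed
qed

end

text \<open>The Riemann-Stieltjes limit with \<open>g\<close> the identity. On each cell
  \<open>f * h\<close> at the left end is the increment of \<open>s * f s\<close> minus
  \<open>s\<close> times the increment of \<open>f\<close> minus the product of both increments; the
  last one telescopes to a term of order \<open>1 / n\<close>.\<close>

lemma riemann_sum_left:
  fixes f :: "real \<Rightarrow> real"
  assumes f: "continuous_on {0..t} f" and t: "t \<ge> 0"
  shows "(\<lambda>n. \<Sum>i<n. f (grid t n i) * (t / real n)) \<longlonglongrightarrow> integral {0..t} f"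
proof -
  have 1: "(\<lambda>n. \<Sum>i<n. grid t n i * (f (grid t n (Suc i)) - f (grid t n i))) \<longlonglongrightarrow> t * f t - 0 * f 0 - integral {0..t} (\<lambda>s. f s * 1)"
    by (rule riemann_stieltjes_limit[OF f t, where g = "\<lambda>x. x" and g' = "\<lambda>_. 1"]) auto
  have 2: "(\<lambda>n. t / real n * (f t - f 0)) \<longlonglongrightarrow> 0 * (f t - f 0)"
    by (intro tendsto_intros lim_const_over_n)
  have "(\<lambda>n. t * f t - (\<Sum>i<n. grid t n i * (f (grid t n (Suc i)) - f (grid t n i))) - t / real n * (f t - f 0)) \<longlonglongrightarrow>
     t * f t - (t * f t - 0 * f 0 - integral {0..t} (\<lambda>s. f s * 1)) - 0 * (f t - f 0)"
    by (intro tendsto_diff tendsto_const 1 2)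
  then have lim: "(\<lambda>n. t * f t - (\<Sum>i<n. grid t n i * (f (grid t n (Suc i)) - f (grid t n i))) - t / real n * (f t - f 0)) \<longlonglongrightarrow> integral {0..t} f"
    by simp
  have eq: "t * f t - (\<Sum>i<n. grid t n i * (f (grid t n (Suc i)) - f (grid t n i))) - t / real n * (f t - f 0) = (\<Sum>i<n. f (grid t n i) * (t / real n))"
    if n: "n > 0" for n
  proof -
    have a: "(\<Sum>i<n. grid t n (Suc i) * f (grid t n (Suc i)) - grid t n i * f (grid t n i)) = t * f t"
      using sum_lessThan_telescope[of "\<lambda>i. grid t n i * f (grid t n i)" n] by (simp add: grid_n[OF n])
    have b: "(\<Sum>i<n. t / real n * (f (grid t n (Suc i)) - f (grid t n i))) = t / real n * (f t - f 0)"
      using sum_lessThan_telescope[of "\<lambda>i. f (grid t n i)" n] by (simp only: sum_distrib_left[symmetric]) (simp add: grid_n[OF n])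
    have "(\<Sum>i<n. f (grid t n i) * (t / real n)) =
       (\<Sum>i<n. (grid t n (Suc i) * f (grid t n (Suc i)) - grid t n i * f (grid t n i)) - grid t n i * (f (grid t n (Suc i)) - f (grid t n i))
          - t / real n * (f (grid t n (Suc i)) - f (grid t n i)))"
    proof (intro sum.cong refl)
      fix i
      have "grid t n (Suc i) = grid t n i + t / real n" using grid_step[of t n i] by simp
      then show "f (grid t n i) * (t / real n) = (grid t n (Suc i) * f (grid t n (Suc i)) - grid t n i * f (grid t n i)) - grid t n i * (f (grid t n (Suc i)) - f (grid t n i))
          - t / real n * (f (grid t n (Suc i)) - f (grid t n i))"
        by (simp only:) (simp add: algebra_simps)
    qed
    also have "\<dots> = t * f t - (\<Sum>i<n. grid t n i * (f (grid t n (Suc i)) - f (grid t n i))) - t / real n * (f t - f 0)"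
      by (subst sum_subtractf, subst sum_subtractf) (simp only: a b)
    finally show ?thesis ..
  qed
  show ?thesis
    by (rule Lim_transform_eventually[OF lim]) (use eq in \<open>auto intro!: eventually_mono[OF eventually_gt_at_top[of 0]]\<close>)
qed

context path
begin

definition diss :: "nat \<Rightarrow> real \<Rightarrow> real" where
  "diss l t = (\<Sum>k\<in>cut l. (real_of_int k)\<^sup>2 * (coef (u t) k)\<^sup>2)"

lemma diss_eq: "diss l t = (\<Sum>k\<in>cut l. (kmul (coef (u t)) k)\<^sup>2)"
  by (simp add: diss_def power_mult_distrib)

lemma diss_tendsto: "t \<in> {0..T} \<Longrightarrow> (\<lambda>l. diss l t) \<longlonglongrightarrow> (Hdot_norm 1 (u t))\<^sup>2"
  unfolding diss_eq norm_kmul[OF u, symmetric] by (rule has_sum_cut[OF norm_synth[OF l2_kmul[OF u]]])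

lemma diss_le: "t \<in> {0..T} \<Longrightarrow> diss l t \<le> (Hdot_norm 1 (u t))\<^sup>2"
  unfolding diss_eq norm_kmul[OF u, symmetric]
  by (rule has_sum_mono_neutral[OF has_sum_finite norm_synth[OF l2_kmul[OF u]]]) (use cut_subset in auto)

lemma diss_mono: "l \<le> l' \<Longrightarrow> diss l t \<le> diss l' t"
  unfolding diss_eq by (rule sum_mono2) (auto simp: cut_def)

lemma cont_diss: "continuous_on {0..T} (diss l)"
  unfolding diss_def[abs_def] by (intro continuous_intros cont_coef)

lemma cont_Hdot_norm: "continuous_on {0..T} (\<lambda>t. (Hdot_norm 1 (u t))\<^sup>2)"
proof -
  have "continuous_on {0..T} (\<lambda>t. (norm (Jop 1 (u t)))\<^sup>2)" by (intro continuous_intros J)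
  then show ?thesis by (rule continuous_on_cong[THEN iffD1, rotated 2]) (simp_all add: Hdot_norm_Jop[OF u] del: One_nat_def)
qed

text \<open>The index \<open>l\<close> governs the number of modes and the mesh at once. They are
  separated by fixing a number \<open>L\<close> of modes whose dissipation already exceeds
  \<open>z\<close>, refining the mesh for this \<open>L\<close>, and using that more modes only add
  dissipation.\<close>

lemma dissipation_liminf:
  assumes "z < integral {0..T} (\<lambda>t. (Hdot_norm 1 (u t))\<^sup>2)"
  shows "\<forall>\<^sub>F l in sequentially. z < (\<Sum>i<ngrid l. diss l (grid T (ngrid l) i) * (T / real (ngrid l)))"
proof -
  have "(\<lambda>l. integral {0..T} (diss l)) \<longlonglongrightarrow> integral {0..T} (\<lambda>t. (Hdot_norm 1 (u t))\<^sup>2)"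
  proof (rule dominated_convergence(2))
    show "(\<lambda>t. (Hdot_norm 1 (u t))\<^sup>2) integrable_on {0..T}" by (rule integrable_continuous_real[OF cont_Hdot_norm])
    show "diss l integrable_on {0..T}" for l by (rule integrable_continuous_real[OF cont_diss])
    show "norm (diss l t) \<le> (Hdot_norm 1 (u t))\<^sup>2" if "t \<in> {0..T}" for l t
      using diss_le[OF that, of l] by (simp add: diss_def sum_nonneg)
    show "(\<lambda>l. diss l t) \<longlonglongrightarrow> (Hdot_norm 1 (u t))\<^sup>2" if "t \<in> {0..T}" for t
      by (rule diss_tendsto[OF that])
  qed
  then have "\<forall>\<^sub>F l in sequentially. z < integral {0..T} (diss l)" using assms by (rule order_tendstoD(1))
  then obtain L where L: "z < integral {0..T} (diss L)" by (auto simp: eventually_sequentially)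
  have "(\<lambda>n. \<Sum>i<n. diss L (grid T n i) * (T / real n)) \<longlonglongrightarrow> integral {0..T} (diss L)"
    by (rule riemann_sum_left[OF cont_diss]) (use T in simp)
  then have "\<forall>\<^sub>F n in sequentially. z < (\<Sum>i<n. diss L (grid T n i) * (T / real n))" using L by (rule order_tendstoD(1))
  then have "\<forall>\<^sub>F l in sequentially. z < (\<Sum>i<ngrid l. diss L (grid T (ngrid l) i) * (T / real (ngrid l)))"
    by (rule eventually_compose_filterlim[OF _ ngrid_filterlim])
  then show ?thesis using eventually_ge_at_top[of L]
  proof eventually_elim
    case (elim l)
    have "(\<Sum>i<ngrid l. diss L (grid T (ngrid l) i) * (T / real (ngrid l))) \<le> (\<Sum>i<ngrid l. diss l (grid T (ngrid l) i) * (T / real (ngrid l)))"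
      using T by (intro sum_mono mult_right_mono diss_mono elim) auto
    then show ?case using elim(1) by simp
  qed
qed

end

section \<open>The energy bound\<close>

text \<open>Once the decreasing switch \<open>g\<close> is off it stays off, so the sum is the
  stopped energy minus the initial one, and the stopped energy is nonnegative.\<close>

lemma stopped_telescope_ge:
  fixes E g :: "nat \<Rightarrow> real"
  assumes E: "\<And>i. E i \<ge> 0" and g: "\<And>i. g i \<in> {0, 1}" "\<And>i. g (Suc i) \<le> g i"
  shows "(\<Sum>i<n. g i * (E (Suc i) - E i)) \<ge> - E 0"
proof -
  have "(\<Sum>i<n. g i * (E (Suc i) - E i)) \<ge> g n * E n - g 0 * E 0"
  proof (induction n)
    case (Suc n)
    have "g (Suc n) * E (Suc n) \<le> g n * E (Suc n)" using g(2) E by (intro mult_right_mono)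
    then show ?case using Suc by (simp add: right_diff_distrib)
  qed simp
  moreover have "g n * E n \<ge> 0" using g(1)[of n] E[of n] by auto
  moreover have "g 0 * E 0 \<le> E 0" using g(1)[of 0] E[of 0] by auto
  ultimately show ?thesis by linarith
qed

locale energy_setting = noise M F \<beta>
  for M :: "'w measure" and F and \<beta> +
  fixes \<nu> T :: real and b :: "int \<Rightarrow> real" and y :: L2 and w :: "real \<Rightarrow> 'w \<Rightarrow> L2"
  assumes nu: "\<nu> > 0" and T: "T > 0" and b: "l2 b"
    and sol: "global_solution M (-2) \<nu> b \<beta> 1 y w"
    and adapted_coef: "\<And>t k. t \<ge> 0 \<Longrightarrow> k \<noteq> 0 \<Longrightarrow> (\<lambda>x. coef (w t x) k) \<in> borel_measurable (F t)"
begin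

abbreviation nn :: "nat \<Rightarrow> nat" where "nn l \<equiv> ngrid l"
abbreviation gr :: "nat \<Rightarrow> nat \<Rightarrow> real" where "gr l i \<equiv> grid T (nn l) i"
abbreviation h :: "nat \<Rightarrow> real" where "h l \<equiv> T / real (nn l)"
abbreviation c :: "nat \<Rightarrow> nat \<Rightarrow> int \<Rightarrow> 'w \<Rightarrow> real" where "c l i k x \<equiv> coef (w (gr l i) x) k"
abbreviation dB :: "nat \<Rightarrow> nat \<Rightarrow> int \<Rightarrow> 'w \<Rightarrow> real" where "dB l i k x \<equiv> inc k (gr l i) (gr l (Suc i)) x"

text \<open>The drift part of an increment, defined as what is left after the noise is removed. It
  is thus measurable by construction, while the identification with an integral of the drift is made
  on good paths.\<close>

definition a :: "nat \<Rightarrow> nat \<Rightarrow> int \<Rightarrow> 'w \<Rightarrow> real" where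
  "a l i k x = c l (Suc i) k x - c l i k x - b k * dB l i k x"
definition En :: "nat \<Rightarrow> nat \<Rightarrow> 'w \<Rightarrow> real" where
  "En l i x = (\<Sum>k\<in>cut l. (c l i k x)\<^sup>2)"
text \<open>Stopping when the energy of the first \<open>l\<close> modes exceeds
  \<open>R\<^sup>2\<close> at a grid time. It depends on the grid times up to \<open>i\<close> only,
  so it may multiply the next Brownian increment and keeps the coefficients of the transform
  bounded.\<close>

definition chi :: "real \<Rightarrow> nat \<Rightarrow> nat \<Rightarrow> 'w \<Rightarrow> real" where
  "chi R l i x = (if \<forall>j\<le>i. En l j x \<le> R\<^sup>2 then 1 else 0)"
definition Err :: "nat \<Rightarrow> 'w \<Rightarrow> real" where
  "Err l x = (\<Sum>i<nn l. 2 * \<bar>\<Sum>k\<in>cut l. c l i k x * a l i k x + \<nu> * (real_of_int k)\<^sup>2 * (c l i k x)\<^sup>2 * h l\<bar>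
      + 3 * (\<Sum>k\<in>cut l. (a l i k x)\<^sup>2))"
definition Dis :: "nat \<Rightarrow> nat \<Rightarrow> 'w \<Rightarrow> real" where
  "Dis l i x = (\<Sum>k\<in>cut l. (real_of_int k)\<^sup>2 * (c l i k x)\<^sup>2)"
definition Y :: "real \<Rightarrow> nat \<Rightarrow> 'w \<Rightarrow> real" where
  "Y R l x = 2 * \<nu> * (\<Sum>i<nn l. chi R l i x * (Dis l i x * h l))"
definition Q :: "nat \<Rightarrow> 'w \<Rightarrow> real" where
  "Q l x = (\<Sum>i<nn l. \<Sum>k\<in>cut l. (b k)\<^sup>2 * (dB l i k x)\<^sup>2)"
definition S :: "real \<Rightarrow> nat \<Rightarrow> 'w \<Rightarrow> real" where
  "S R l x = (\<Sum>i<nn l. \<Sum>k\<in>cut l. (chi R l i x * (2 * b k * c l i k x)) * dB l i k x)"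

lemma nn_pos: "nn l > 0" by (simp add: ngrid_def)

lemma h_nonneg: "h l \<ge> 0" using T by simp

lemma En_nonneg: "En l i x \<ge> 0" unfolding En_def by (rule sum_nonneg) simp

lemma chi_values: "chi R l i x \<in> {0, 1}"
  by (simp add: chi_def)

lemma chi_antimono: "chi R l (Suc i) x \<le> chi R l i x"
proof (cases "\<forall>j\<le>Suc i. En l j x \<le> R\<^sup>2")
  case True
  then have "\<forall>j\<le>i. En l j x \<le> R\<^sup>2" using le_SucI by blast
  then have "chi R l i x = 1" unfolding chi_def by (rule if_P)
  then show ?thesis using chi_values[of R l "Suc i" x] by auto
next
  case False
  then have "chi R l (Suc i) x = 0" unfolding chi_def by (rule if_not_P)
  then show ?thesis using chi_values[of R l i x] by auto
qed

lemma chi_le_1: "chi R l i x \<le> 1"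
  using chi_values[of R l i x] by auto

lemma chi_nonneg: "chi R l i x \<ge> 0" using chi_values[of R l i x] by auto

text \<open>The new coefficient is \<open>C + A + D\<close> with drift increment \<open>A\<close>
  and noise increment \<open>D\<close>. The mixed product obeys
  \<open>2 * A * D \<le> 2 * A\<^sup>2 + D\<^sup>2 / 2\<close>, which gives the factors 3 and 3/2;
  the product \<open>2 * C * D\<close> is the martingale part and is kept exactly, and the viscous
  term is added and subtracted.\<close>

lemma En_step:
  "En l (Suc i) x - En l i x \<le>
     (2 * \<bar>\<Sum>k\<in>cut l. c l i k x * a l i k x + \<nu> * (real_of_int k)\<^sup>2 * (c l i k x)\<^sup>2 * h l\<bar> + 3 * (\<Sum>k\<in>cut l. (a l i k x)\<^sup>2))
     - 2 * \<nu> * (Dis l i x * h l) + 3/2 * (\<Sum>k\<in>cut l. (b k)\<^sup>2 * (dB l i k x)\<^sup>2) + (\<Sum>k\<in>cut l. (2 * b k * c l i k x) * dB l i k x)"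
proof -
  let ?c = "\<lambda>k. c l i k x" and ?a = "\<lambda>k. a l i k x" and ?d = "\<lambda>k. dB l i k x"
  have "En l (Suc i) x - En l i x = (\<Sum>k\<in>cut l. (c l (Suc i) k x)\<^sup>2 - (?c k)\<^sup>2)"
    by (simp add: En_def sum_subtractf)
  also have "\<dots> \<le> (\<Sum>k\<in>cut l. 2 * (?c k * ?a k + \<nu> * (real_of_int k)\<^sup>2 * (?c k)\<^sup>2 * h l) + 3 * (?a k)\<^sup>2
      - 2 * \<nu> * (((real_of_int k)\<^sup>2 * (?c k)\<^sup>2) * h l) + 3/2 * ((b k)\<^sup>2 * (?d k)\<^sup>2) + (2 * b k * ?c k) * ?d k)"
  proof (rule sum_mono)
    fix k
    define C A D V where "C = ?c k" and "A = ?a k" and "D = b k * ?d k" and "V = \<nu> * (real_of_int k)\<^sup>2 * (?c k)\<^sup>2 * h l"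
    have nx: "c l (Suc i) k x = C + A + D" by (simp add: C_def A_def D_def a_def)
    have "0 \<le> (2 * A - D)\<^sup>2" by simp
    then have "2 * A * D \<le> 2 * A\<^sup>2 + D\<^sup>2 / 2" by (simp add: power2_diff power_mult_distrib)
    then have "(C + A + D)\<^sup>2 - C\<^sup>2 \<le> 2 * (C * A + V) + 3 * A\<^sup>2 - 2 * V + 3/2 * D\<^sup>2 + 2 * (C * D)"
      by (simp add: power2_sum algebra_simps)
    then show "(c l (Suc i) k x)\<^sup>2 - (?c k)\<^sup>2 \<le> 2 * (?c k * ?a k + \<nu> * (real_of_int k)\<^sup>2 * (?c k)\<^sup>2 * h l) + 3 * (?a k)\<^sup>2
      - 2 * \<nu> * (((real_of_int k)\<^sup>2 * (?c k)\<^sup>2) * h l) + 3/2 * ((b k)\<^sup>2 * (?d k)\<^sup>2) + (2 * b k * ?c k) * ?d k"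
      unfolding nx by (simp add: C_def A_def D_def V_def power_mult_distrib mult_ac)
  qed
  also have "\<dots> = 2 * (\<Sum>k\<in>cut l. ?c k * ?a k + \<nu> * (real_of_int k)\<^sup>2 * (?c k)\<^sup>2 * h l) + 3 * (\<Sum>k\<in>cut l. (?a k)\<^sup>2)
      - 2 * \<nu> * (Dis l i x * h l) + 3/2 * (\<Sum>k\<in>cut l. (b k)\<^sup>2 * (?d k)\<^sup>2) + (\<Sum>k\<in>cut l. (2 * b k * ?c k) * ?d k)"
    unfolding Dis_def by (simp only: sum.distrib sum_subtractf sum_distrib_left[symmetric] sum_distrib_right[symmetric])
  finally show ?thesis by linarith
qed

text \<open>The one-step inequality is multiplied by the switch and summed. In the error and in the
  noise squares the switch is bounded by 1; it stays in the dissipation and in the martingale part,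
  which is bounded only when stopped.\<close>

lemma energy_inequality: "Y R l x \<le> S R l x + En l 0 x + 3/2 * Q l x + Err l x"
proof -
  let ?e = "\<lambda>i. 2 * \<bar>\<Sum>k\<in>cut l. c l i k x * a l i k x + \<nu> * (real_of_int k)\<^sup>2 * (c l i k x)\<^sup>2 * h l\<bar> + 3 * (\<Sum>k\<in>cut l. (a l i k x)\<^sup>2)"
  let ?q = "\<lambda>i. \<Sum>k\<in>cut l. (b k)\<^sup>2 * (dB l i k x)\<^sup>2"
  let ?s = "\<lambda>i. \<Sum>k\<in>cut l. (2 * b k * c l i k x) * dB l i k x"
  have e0: "?e i \<ge> 0" for i by (intro add_nonneg_nonneg mult_nonneg_nonneg sum_nonneg) auto
  have q0: "?q i \<ge> 0" for i by (intro sum_nonneg) auto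
  have "- En l 0 x \<le> (\<Sum>i<nn l. chi R l i x * (En l (Suc i) x - En l i x))"
    by (rule stopped_telescope_ge) (use En_nonneg chi_values chi_antimono in auto)
  also have "\<dots> \<le> (\<Sum>i<nn l. ?e i + 3/2 * ?q i - 2 * \<nu> * (chi R l i x * (Dis l i x * h l)) + chi R l i x * ?s i)"
  proof (rule sum_mono)
    fix i
    have "chi R l i x * (En l (Suc i) x - En l i x) \<le> chi R l i x * (?e i - 2 * \<nu> * (Dis l i x * h l) + 3/2 * ?q i + ?s i)"
      by (rule mult_left_mono[OF En_step chi_nonneg])
    also have "\<dots> = chi R l i x * (?e i + 3/2 * ?q i) - 2 * \<nu> * (chi R l i x * (Dis l i x * h l)) + chi R l i x * ?s i"
      by (simp add: algebra_simps)
    also have "chi R l i x * (?e i + 3/2 * ?q i) \<le> 1 * (?e i + 3/2 * ?q i)"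
      by (intro mult_right_mono chi_le_1 add_nonneg_nonneg[OF e0] mult_nonneg_nonneg[OF _ q0]) simp
    finally show "chi R l i x * (En l (Suc i) x - En l i x) \<le> ?e i + 3/2 * ?q i - 2 * \<nu> * (chi R l i x * (Dis l i x * h l)) + chi R l i x * ?s i"
      by simp
  qed
  also have "\<dots> = Err l x + 3/2 * Q l x - Y R l x + S R l x"
    unfolding Err_def Q_def Y_def S_def
    by (simp only: sum.distrib sum_subtractf sum_distrib_left mult.assoc)
  finally show ?thesis by linarith
qed

lemma gr_nonneg: "0 \<le> gr l i" by (rule grid_nonneg) (use T in simp)
lemma gr_less: "gr l i < gr l (Suc i)" by (rule grid_less[OF T nn_pos])
lemma gr_mono: "i \<le> j \<Longrightarrow> gr l i \<le> gr l j" using mono_grid[of T "nn l"] T by (simp add: mono_def)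

lemma cut_nz: "k \<in> cut l \<Longrightarrow> k \<noteq> 0" by auto

lemma meas_c: "j \<le> i \<Longrightarrow> k \<noteq> 0 \<Longrightarrow> c l j k \<in> borel_measurable (F (gr l i))"
  by (rule measurable_F_mono[OF gr_nonneg gr_mono]) (assumption, rule adapted_coef[OF gr_nonneg])

lemma meas_En: "j \<le> i \<Longrightarrow> En l j \<in> borel_measurable (F (gr l i))"
  unfolding En_def[abs_def] by (intro borel_measurable_sum borel_measurable_power meas_c) (assumption, rule cut_nz)

lemma meas_chi: "chi R l i \<in> borel_measurable (F (gr l i))"
proof -
  have m[measurable]: "En l j \<in> borel_measurable (F (gr l i))" if "j \<in> {..i}" for j using that by (intro meas_En) simp
  have "{x \<in> space (F (gr l i)). \<forall>j\<in>{..i}. En l j x \<le> R\<^sup>2} \<in> sets (F (gr l i))"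
    by (intro sets.sets_Collect_finite_All' borel_measurable_le m borel_measurable_const) auto
  then have "{x \<in> space (F (gr l i)). \<forall>j\<le>i. En l j x \<le> R\<^sup>2} \<in> sets (F (gr l i))" by simp
  then show ?thesis unfolding chi_def[abs_def] by (intro measurable_If) auto
qed

end

context energy_setting
begin

lemma chi_En: "chi R l i x * En l i x \<le> R\<^sup>2"
proof (cases "\<forall>j\<le>i. En l j x \<le> R\<^sup>2")
  case True
  then have "chi R l i x = 1" unfolding chi_def by (rule if_P)
  then show ?thesis using True by simp
next
  case False
  then have "chi R l i x = 0" unfolding chi_def by (rule if_not_P)
  then show ?thesis by simp
qed

abbreviation Bn :: real where "Bn \<equiv> (norm (synth b))\<^sup>2"

lemma sum_b_le: "(\<Sum>k\<in>cut l. (b k)\<^sup>2) \<le> Bn"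
  by (rule has_sum_mono_neutral[OF has_sum_finite norm_synth[OF b]]) (use cut_subset in auto)

lemma b_le: "k \<in> cut l \<Longrightarrow> (b k)\<^sup>2 \<le> Bn"
  by (rule order_trans[OF member_le_sum sum_b_le]) auto

lemma coefficient_square:
  "(\<Sum>k\<in>cut l. (chi R l i x * (2 * b k * c l i k x))\<^sup>2) \<le> 4 * Bn * R\<^sup>2"
proof -
  have chi2: "(chi R l i x)\<^sup>2 = chi R l i x" using chi_values[of R l i x] by auto
  have "(\<Sum>k\<in>cut l. (chi R l i x * (2 * b k * c l i k x))\<^sup>2) \<le> (\<Sum>k\<in>cut l. 4 * Bn * (chi R l i x * (c l i k x)\<^sup>2))"
  proof (rule sum_mono)
    fix k assume k: "k \<in> cut l"
    have "(chi R l i x * (2 * b k * c l i k x))\<^sup>2 = (b k)\<^sup>2 * (4 * (chi R l i x * (c l i k x)\<^sup>2))"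
      by (simp add: power_mult_distrib chi2)
    also have "\<dots> \<le> Bn * (4 * (chi R l i x * (c l i k x)\<^sup>2))"
      by (intro mult_right_mono b_le[OF k] mult_nonneg_nonneg chi_nonneg) simp_all
    finally show "(chi R l i x * (2 * b k * c l i k x))\<^sup>2 \<le> 4 * Bn * (chi R l i x * (c l i k x)\<^sup>2)"
      by (simp only: mult_ac)
  qed
  also have "\<dots> = 4 * Bn * (chi R l i x * En l i x)"
    unfolding En_def by (simp only: sum_distrib_left)
  also have "\<dots> \<le> 4 * Bn * R\<^sup>2" by (intro mult_left_mono chi_En) simp
  finally show ?thesis .
qed

text \<open>The stopped coefficients have squared length at most \<open>4 * Bn * R\<^sup>2\<close>.
  The resulting second moment grows with \<open>R\<close> but is uniform in \<open>l\<close>, which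
  allows the limit in \<open>l\<close> to be taken for fixed \<open>R\<close>.\<close>

lemma S_moments:
  "S R l \<in> borel_measurable M" "integrable M (S R l)" "expectation (S R l) = 0"
  "integrable M (\<lambda>x. (S R l x)\<^sup>2)" "expectation (\<lambda>x. (S R l x)\<^sup>2) \<le> 4 * Bn * R\<^sup>2 * T"
proof -
  define f where "f i k x = chi R l i x * (2 * b k * c l i k x)" for i k x
  have fm: "f i k \<in> borel_measurable (F (gr l i))" if "k \<in> cut l" for i k
    unfolding f_def[abs_def]
    by (intro borel_measurable_times borel_measurable_const meas_chi meas_c[OF order_refl] cut_nz[OF that])
  have fsq: "(\<Sum>k\<in>cut l. (f i k x)\<^sup>2) \<le> 4 * Bn * R\<^sup>2" for i x
    unfolding f_def by (rule coefficient_square)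
  have fb: "\<bar>f i k x\<bar> \<le> sqrt (4 * Bn * R\<^sup>2)" if "k \<in> cut l" for i k x
  proof -
    have "(f i k x)\<^sup>2 \<le> 4 * Bn * R\<^sup>2"
      by (rule order_trans[OF member_le_sum fsq]) (use that in auto)
    then show ?thesis by (rule real_le_rsqrt[of "\<bar>f i k x\<bar>", simplified power2_abs])
  qed
  have mt: "S R l \<in> borel_measurable (F (gr l (nn l))) \<and> integrable M (S R l) \<and> expectation (S R l) = 0 \<and>
    integrable M (\<lambda>x. (S R l x)\<^sup>2) \<and>
    expectation (\<lambda>x. (S R l x)\<^sup>2) = (\<Sum>i<nn l. (gr l (Suc i) - gr l i) * (\<Sum>k\<in>cut l. expectation (\<lambda>x. (f i k x)\<^sup>2)))"
    using martingale_transform[of "grid T (nn l)" "cut l" f "sqrt (4 * Bn * R\<^sup>2)" "nn l", OF gr_nonneg gr_less finite_cut zero_notin_cut fm fb]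
    unfolding S_def[abs_def] f_def by simp
  then show "S R l \<in> borel_measurable M" "integrable M (S R l)" "expectation (S R l) = 0" "integrable M (\<lambda>x. (S R l x)\<^sup>2)"
    using measurable_F_M[OF gr_nonneg] by blast+
  have fi: "integrable M (\<lambda>x. (f i k x)\<^sup>2)" if "k \<in> cut l" for i k
  proof (rule integrable_const_bound[where B = "4 * Bn * R\<^sup>2"])
    show "AE x in M. norm ((f i k x)\<^sup>2) \<le> 4 * Bn * R\<^sup>2"
    proof (rule AE_I2)
      fix x
      have "(f i k x)\<^sup>2 \<le> 4 * Bn * R\<^sup>2"
        by (rule order_trans[OF member_le_sum fsq]) (use that in auto)
      then show "norm ((f i k x)\<^sup>2) \<le> 4 * Bn * R\<^sup>2" by (simp only: real_norm_def abs_power2)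
    qed
    show "(\<lambda>x. (f i k x)\<^sup>2) \<in> borel_measurable M"
      by (intro borel_measurable_power measurable_F_M[OF gr_nonneg fm[OF that]])
  qed
  have "expectation (\<lambda>x. (S R l x)\<^sup>2) = (\<Sum>i<nn l. h l * (\<Sum>k\<in>cut l. expectation (\<lambda>x. (f i k x)\<^sup>2)))"
    using mt by (simp only: grid_step)
  also have "\<dots> \<le> (\<Sum>i<nn l. h l * (4 * Bn * R\<^sup>2))"
  proof (intro sum_mono mult_left_mono h_nonneg)
    fix i
    have "(\<Sum>k\<in>cut l. expectation (\<lambda>x. (f i k x)\<^sup>2)) = expectation (\<lambda>x. \<Sum>k\<in>cut l. (f i k x)\<^sup>2)"
      by (rule Bochner_Integration.integral_sum[symmetric]) (rule fi)
    also have "\<dots> \<le> expectation (\<lambda>x. 4 * Bn * R\<^sup>2)"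
      by (rule integral_mono) (auto intro: Bochner_Integration.integrable_sum fi fsq)
    also have "\<dots> = 4 * Bn * R\<^sup>2" by (simp add: prob_space)
    finally show "(\<Sum>k\<in>cut l. expectation (\<lambda>x. (f i k x)\<^sup>2)) \<le> 4 * Bn * R\<^sup>2" .
  qed
  also have "\<dots> = 4 * Bn * R\<^sup>2 * T" using nn_pos[of l] by simp
  finally show "expectation (\<lambda>x. (S R l x)\<^sup>2) \<le> 4 * Bn * R\<^sup>2 * T" .
qed

lemma Q_moments: "integrable M (Q l)" "expectation (Q l) \<le> T * Bn" "Q l x \<ge> 0"
proof -
  have i: "integrable M (\<lambda>x. (b k)\<^sup>2 * (dB l i k x)\<^sup>2)" if "k \<in> cut l" for i k
    using inc_moments(3)[OF cut_nz[OF that] gr_nonneg gr_less] by simp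
  show "integrable M (Q l)"
    unfolding Q_def[abs_def] by (intro Bochner_Integration.integrable_sum i)
  have "expectation (Q l) = (\<Sum>i<nn l. \<Sum>k\<in>cut l. expectation (\<lambda>x. (b k)\<^sup>2 * (dB l i k x)\<^sup>2))"
    unfolding Q_def[abs_def]
    by (subst Bochner_Integration.integral_sum, intro Bochner_Integration.integrable_sum i, assumption)
       (intro sum.cong refl Bochner_Integration.integral_sum i)
  also have "\<dots> = (\<Sum>i<nn l. \<Sum>k\<in>cut l. (b k)\<^sup>2 * h l)"
    using inc_moments(4)[OF cut_nz gr_nonneg gr_less] by (intro sum.cong refl) (simp add: grid_step)
  also have "\<dots> = T * (\<Sum>k\<in>cut l. (b k)\<^sup>2)"
    by (simp only: sum_distrib_right[symmetric] sum_constant card_lessThan) (use nn_pos[of l] in simp)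
  also have "\<dots> \<le> T * Bn" using T by (intro mult_left_mono sum_b_le) simp
  finally show "expectation (Q l) \<le> T * Bn" .
  show "Q l x \<ge> 0" unfolding Q_def by (intro sum_nonneg) simp
qed

lemma meas_c_M: "k \<noteq> 0 \<Longrightarrow> c l i k \<in> borel_measurable M"
  by (rule measurable_F_M[OF gr_nonneg meas_c[OF order_refl]])

lemma meas_a: "k \<in> cut l \<Longrightarrow> a l i k \<in> borel_measurable M"
  unfolding a_def[abs_def]
  by (intro borel_measurable_diff borel_measurable_times borel_measurable_const meas_c_M measurable_inc gr_nonneg gr_mono cut_nz) auto

lemma meas_Err: "Err l \<in> borel_measurable M"
  unfolding Err_def[abs_def]
  by (intro borel_measurable_sum borel_measurable_add borel_measurable_times borel_measurable_const borel_measurable_abs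
       borel_measurable_power meas_a meas_c_M cut_nz)

lemma meas_Y: "Y R l \<in> borel_measurable M"
  unfolding Y_def[abs_def] Dis_def
  by (intro borel_measurable_sum borel_measurable_times borel_measurable_const borel_measurable_power
       measurable_F_M[OF gr_nonneg meas_chi] meas_c_M cut_nz)

lemma Dis_nonneg: "Dis l i x \<ge> 0" unfolding Dis_def by (intro sum_nonneg) simp

lemma Y_nonneg: "Y R l x \<ge> 0"
  unfolding Y_def using nu by (intro mult_nonneg_nonneg sum_nonneg chi_nonneg Dis_nonneg h_nonneg) auto

text \<open>A continuous path on a compact interval is bounded in \<open>H\<^sup>1\<close>, and once
  \<open>R\<close> exceeds that bound the switch is never turned off on the grid. Then
  \<open>Y R l x\<close> is the full discrete dissipation and converges as in the deterministic
  setting; the threshold depends on the path.\<close>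

lemma good_path_limits:
  assumes "good_path \<nu> b T y w x"
  shows "(\<lambda>l. Err l x) \<longlonglongrightarrow> 0" "En l 0 x \<le> (norm y)\<^sup>2"
    "\<exists>R0. \<forall>R\<ge>R0. \<forall>z. z < integral {0..T} (\<lambda>t. (Hdot_norm 1 (w t x))\<^sup>2) \<longrightarrow> (\<forall>\<^sub>F l in sequentially. 2 * \<nu> * z \<le> Y R l x)"
proof -
  note gp = assms[unfolded good_path_def]
  have u: "\<And>t. t \<in> {0..T} \<Longrightarrow> w t x \<in> Hdot 1" using gp[THEN conjunct1] by (rule bspec)
  have J: "continuous_on {0..T} (\<lambda>t. Jop 1 (w t x))" using gp[THEN conjunct2, THEN conjunct1] .
  have c0: "\<And>k. k \<noteq> 0 \<Longrightarrow> coef (w 0 x) k = coef y k"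
    by (rule gp[THEN conjunct2, THEN conjunct2, THEN conjunct1, rule_format])
  have eqn: "coef (w t x) k - coef (w s x) k = integral {s..t} (drift \<nu> (\<lambda>t. w t x) k) + b k * inc k s t x"
    if "k \<noteq> 0" "0 \<le> s" "s \<le> t" "t \<le> T" for k s t
    unfolding drift_def by (rule gp[THEN conjunct2, THEN conjunct2, THEN conjunct2, rule_format, OF that])
  have T0: "compact {0..T}" "{0..T} \<noteq> {}" using T by auto
  obtain Wb where Wb: "\<And>t. t \<in> {0..T} \<Longrightarrow> norm (Jop 1 (w t x)) \<le> Wb"
    using continuous_attains_sup[OF T0 continuous_on_norm[OF J]] by blast
  obtain Nb where Nb: "\<And>t. t \<in> {0..T} \<Longrightarrow> norm (nonlinearity (-2) (w t x)) \<le> Nb"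
    using continuous_attains_sup[OF T0 continuous_on_norm[OF continuous_on_nonlinearity[OF u J]]] by blast
  interpret p: path \<nu> T "\<lambda>t. w t x" Wb Nb
    by unfold_locales (use nu T u J Nb in \<open>auto simp: Hdot_norm_Jop[OF u] Wb simp del: One_nat_def\<close>)
  have grT: "gr l (Suc i) \<le> T" if "i < nn l" for l i
    using grid_in[of T "Suc i" "nn l"] T that by auto
  have a: "a l i k x = integral {gr l i..gr l (Suc i)} (drift \<nu> (\<lambda>t. w t x) k)" if "i < nn l" "k \<in> cut l" for l i k
    using eqn[OF cut_nz[OF that(2)] gr_nonneg less_imp_le[OF gr_less] grT[OF that(1)]] by (simp add: a_def)
  have "Err l x = p.err l" for l
    unfolding Err_def p.err_def by (intro sum.cong arg_cong2[where f = "(+)"] arg_cong2[where f = "(*)"] arg_cong[where f = abs] refl) (simp_all add: a)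
  then show "(\<lambda>l. Err l x) \<longlonglongrightarrow> 0" using p.err_tendsto by simp
  show "En l 0 x \<le> (norm y)\<^sup>2"
  proof -
    have "En l 0 x = (\<Sum>k\<in>cut l. (inner y (e_basis k))\<^sup>2)"
      unfolding En_def
    proof (intro sum.cong refl)
      fix k assume "k \<in> cut l"
      then show "(c l 0 k x)\<^sup>2 = (inner y (e_basis k))\<^sup>2"
        using c0[OF cut_nz] by (simp add: coef_def[symmetric])
    qed
    also have "\<dots> \<le> (norm y)\<^sup>2" by (rule bessel_finite[OF finite_cut cut_subset])
    finally show ?thesis .
  qed
  show "\<exists>R0. \<forall>R\<ge>R0. \<forall>z. z < integral {0..T} (\<lambda>t. (Hdot_norm 1 (w t x))\<^sup>2) \<longrightarrow> (\<forall>\<^sub>F l in sequentially. 2 * \<nu> * z \<le> Y R l x)"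
  proof (intro exI allI impI)
    fix R z assume R: "Wb \<le> R" and z: "z < integral {0..T} (\<lambda>t. (Hdot_norm 1 (w t x))\<^sup>2)"
    have chi1: "chi R l i x = 1" if i: "i < nn l" for l i
    proof -
      have "En l j x \<le> R\<^sup>2" if "j \<le> i" for j
      proof -
        have jT: "gr l j \<in> {0..T}" using grid_in[of T j "nn l"] T that i by auto
        have "En l j x \<le> (norm (w (gr l j) x))\<^sup>2"
          unfolding En_def coef_def by (rule bessel_finite[OF finite_cut cut_subset])
        also have "\<dots> \<le> R\<^sup>2"
          using norm_le_Hdot_norm[OF u[OF jT]] p.Wb[OF jT] R by (intro power_mono) auto
        finally show ?thesis .
      qed
      then have "\<forall>j\<le>i. En l j x \<le> R\<^sup>2" by blast
      then show ?thesis unfolding chi_def by (rule if_P)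
    qed
    have YD: "Y R l x = 2 * \<nu> * (\<Sum>i<nn l. p.diss l (gr l i) * h l)" for l
    proof -
      have "(\<Sum>i<nn l. chi R l i x * (Dis l i x * h l)) = (\<Sum>i<nn l. p.diss l (gr l i) * h l)"
        by (intro sum.cong refl) (simp add: chi1 Dis_def p.diss_def)
      then show ?thesis by (simp add: Y_def)
    qed
    show "\<forall>\<^sub>F l in sequentially. 2 * \<nu> * z \<le> Y R l x"
      using p.dissipation_liminf[OF z]
    proof eventually_elim
      case (elim l)
      then show ?case unfolding YD using nu by (intro mult_left_mono) auto
    qed
  qed
qed

text \<open>The martingale part has mean zero on the whole space but not on the event where the
  error is at most 1. Off that event it is compensated by
  \<open>(d * S\<^sup>2 + 1 / d) / 2\<close>, which is at least \<open>- S\<close>, so that a single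
  majorant \<open>U\<close> works everywhere and its expectation can be computed.\<close>

lemma truncated_energy_bound:
  "\<forall>\<^sub>F l in sequentially. (\<integral>\<^sup>+x. ennreal (indicator {x\<in>space M. Err l x \<le> 1} x * Y R l x) \<partial>M) \<le> ennreal ((norm y)\<^sup>2 + 3/2 * T * Bn + 2)"
proof -
  define G where "G l = {x\<in>space M. Err l x \<le> 1}" for l
  have G[measurable]: "G l \<in> sets M" for l unfolding G_def using meas_Err by measurable
  define cc where "cc = 4 * Bn * R\<^sup>2 * T"
  have cc: "cc \<ge> 0" using T by (simp add: cc_def)
  \<comment> \<open>Makes \<open>d\<close> times the second moment of \<open>S\<close> at most 1.
    The complement of the event eventually has probability below \<open>d\<close>, so its part,
    divided by \<open>d\<close>, is at most 1 too; half of their sum and the error bound 1 give the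
    additive 2.\<close>
  define d where "d = 1 / (cc + 1)"
  have d: "d > 0" using cc by (simp add: d_def)
  have good: "AE x in M. good_path \<nu> b T y w x" by (rule AE_good_path[OF nu b sol T])
  have "(\<lambda>l. expectation (indicator (space M - G l))) \<longlonglongrightarrow> expectation (\<lambda>x. 0 :: real)"
  proof (rule integral_dominated_convergence[where w = "\<lambda>x. 1"])
    show "AE x in M. (\<lambda>l. indicator (space M - G l) x :: real) \<longlonglongrightarrow> 0"
      using good AE_space
    proof eventually_elim
      case (elim x)
      have "\<forall>\<^sub>F l in sequentially. Err l x < 1"
        using good_path_limits(1)[OF elim(1)] by (rule order_tendstoD(2)) simp
      then have "\<forall>\<^sub>F l in sequentially. (indicator (space M - G l) x :: real) = 0"
        by eventually_elim (use elim(2) in \<open>simp add: G_def\<close>)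
      then show ?case by (rule tendsto_eventually)
    qed
    show "AE x in M. norm (indicator (space M - G l) x :: real) \<le> 1" for l by (simp add: indicator_def)
  qed auto
  then have "(\<lambda>l. prob (space M - G l)) \<longlonglongrightarrow> 0" by simp
  then have "\<forall>\<^sub>F l in sequentially. prob (space M - G l) < d" by (rule order_tendstoD(2)[OF _ d])
  then show ?thesis unfolding G_def[symmetric]
  proof eventually_elim
    case (elim l)
    define U where "U x = S R l x + (d * (S R l x)\<^sup>2 + indicator (space M - G l) x / d) / 2 + (norm y)\<^sup>2 + 3/2 * Q l x + 1" for x
    have le: "AE x in M. indicator (G l) x * Y R l x \<le> U x"
      using good AE_space
    proof eventually_elim
      case (elim x)
      show ?case
      proof (cases "x \<in> G l")
        case True
        then have "Y R l x \<le> S R l x + (norm y)\<^sup>2 + 3/2 * Q l x + 1"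
          using energy_inequality[of R l x] good_path_limits(2)[OF elim(1), of l] by (simp add: G_def)
        moreover have "0 \<le> d * (S R l x)\<^sup>2" using d by simp
        ultimately show ?thesis using True by (simp add: U_def)
      next
        case False
        have "0 \<le> (d * S R l x + 1)\<^sup>2 / d" using d by simp
        also have "\<dots> = d * (S R l x)\<^sup>2 + 2 * S R l x + 1 / d"
          using d by (simp add: power2_sum add_divide_distrib power_mult_distrib) (simp add: power2_eq_square)
        finally have "0 \<le> d * (S R l x)\<^sup>2 + 2 * S R l x + 1 / d" .
        moreover have "0 \<le> p + 2 * s + q \<Longrightarrow> 0 \<le> s + (p + q) / 2" for p s q :: real
          by (simp add: field_simps)
        ultimately have "0 \<le> S R l x + (d * (S R l x)\<^sup>2 + 1 / d) / 2" by blast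
        then show ?thesis using False elim(2) Q_moments(3)[of l x] by (simp add: U_def)
      qed
    qed
    have iG: "integrable M (indicat_real (space M - G l))"
      by (intro integrable_real_indicator) (auto simp: emeasure_eq_measure)
    have iU: "integrable M U"
      unfolding U_def[abs_def] using S_moments(2,4)[of R l] Q_moments(1)[of l] iG
      by (intro Bochner_Integration.integrable_add integrable_divide integrable_mult_right) auto
    have U0: "AE x in M. 0 \<le> U x"
      using le by eventually_elim (use Y_nonneg[of R l] in \<open>auto intro: order_trans[rotated]\<close>)
    have EU: "expectation U = expectation (S R l) + (d * expectation (\<lambda>x. (S R l x)\<^sup>2) + prob (space M - G l) / d) / 2 + (norm y)\<^sup>2 + 3/2 * expectation (Q l) + 1"
      unfolding U_def[abs_def] using S_moments(2,4)[of R l] Q_moments(1)[of l] iG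
      by (simp add: Bochner_Integration.integral_add prob_space)
    have "d * expectation (\<lambda>x. (S R l x)\<^sup>2) \<le> d * cc" using S_moments(5)[of R l] d by (intro mult_left_mono) (auto simp: cc_def)
    also have "\<dots> \<le> 1" using cc by (simp add: d_def)
    finally have e1: "d * expectation (\<lambda>x. (S R l x)\<^sup>2) \<le> 1" .
    have e2: "prob (space M - G l) / d \<le> 1" using elim d by simp
    have "expectation U \<le> (norm y)\<^sup>2 + 3/2 * T * Bn + 2"
    proof -
      have "0 + (p + q) / 2 + n + 3/2 * z + 1 \<le> n + 3/2 * v + 2" if "p \<le> 1" "q \<le> 1" "z \<le> v" for p q n z v :: real
        using that by (simp add: field_simps)
      from this[OF e1 e2 Q_moments(2)[of l], of "(norm y)\<^sup>2"] show ?thesis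
        unfolding EU S_moments(3) by (simp only: mult.assoc)
    qed
    have "(\<integral>\<^sup>+x. ennreal (indicator (G l) x * Y R l x) \<partial>M) \<le> (\<integral>\<^sup>+x. ennreal (U x) \<partial>M)"
      by (rule nn_integral_mono_AE) (use le in \<open>auto intro: ennreal_leI\<close>)
    also have "\<dots> = ennreal (expectation U)" by (rule nn_integral_eq_integral[OF iU U0])
    also have "\<dots> \<le> ennreal ((norm y)\<^sup>2 + 3/2 * T * Bn + 2)" by (rule ennreal_leI) fact
    finally show ?case .
  qed
qed

text \<open>The dissipation integral is compared with a majorant \<open>D\<close> that is a lower
  limit of finite sums and hence measurable, so Markov's inequality can later be applied to
  \<open>D\<close>.\<close>

theorem energy_bound:
  "\<exists>D\<in>borel_measurable M. (AE x in M. ennreal (2 * \<nu> * integral {0..T} (\<lambda>t. (Hdot_norm 1 (w t x))\<^sup>2)) \<le> D x) \<and>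
      (\<integral>\<^sup>+x. D x \<partial>M) \<le> ennreal ((norm y)\<^sup>2 + 3/2 * T * Bn + 2)"
proof -
  let ?K = "ennreal ((norm y)\<^sup>2 + 3/2 * T * Bn + 2)"
  define g where "g R l x = ennreal (indicator {x\<in>space M. Err l x \<le> 1} x * Y R l x)" for R l x
  have gm[measurable]: "g R l \<in> borel_measurable M" for R l
    unfolding g_def[abs_def] using meas_Err meas_Y by measurable
  \<comment> \<open>For fixed \<open>R\<close> the grid is refined, then \<open>R\<close> runs
    through the integers and passes the threshold of the given path. Fatou's lemma applies to each
    lower limit, the bound being the same for all \<open>R\<close>.\<close>
  define D where "D x = liminf (\<lambda>r. liminf (\<lambda>l. g (real r) l x))" for x
  have Dm: "D \<in> borel_measurable M" unfolding D_def[abs_def] by measurable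
  have 1: "(\<integral>\<^sup>+x. liminf (\<lambda>l. g R l x) \<partial>M) \<le> ?K" for R
  proof -
    have "(\<integral>\<^sup>+x. liminf (\<lambda>l. g R l x) \<partial>M) \<le> liminf (\<lambda>l. \<integral>\<^sup>+x. g R l x \<partial>M)"
      by (rule nn_integral_liminf) measurable
    also have "\<dots> \<le> liminf (\<lambda>l::nat. ?K)"
      by (rule Liminf_mono) (use truncated_energy_bound[of R] in \<open>simp add: g_def\<close>)
    finally show ?thesis by (simp add: Liminf_const)
  qed
  have "(\<integral>\<^sup>+x. D x \<partial>M) \<le> liminf (\<lambda>r. \<integral>\<^sup>+x. liminf (\<lambda>l. g (real r) l x) \<partial>M)"
    unfolding D_def by (rule nn_integral_liminf) measurable
  also have "\<dots> \<le> liminf (\<lambda>r::nat. ?K)"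
    by (rule Liminf_mono) (use 1 in simp)
  also have "\<dots> = ?K" by (simp add: Liminf_const)
  finally have int: "(\<integral>\<^sup>+x. D x \<partial>M) \<le> ?K" .
  have "AE x in M. ennreal (2 * \<nu> * integral {0..T} (\<lambda>t. (Hdot_norm 1 (w t x))\<^sup>2)) \<le> D x"
    using AE_good_path[OF nu b sol T] AE_space
  proof eventually_elim
    case (elim x)
    let ?I = "integral {0..T} (\<lambda>t. (Hdot_norm 1 (w t x))\<^sup>2)"
    obtain R0 where R0: "\<And>R z. R \<ge> R0 \<Longrightarrow> z < ?I \<Longrightarrow> \<forall>\<^sub>F l in sequentially. 2 * \<nu> * z \<le> Y R l x"
      using good_path_limits(3)[OF elim(1)] by blast
    have Ex: "\<forall>\<^sub>F l in sequentially. Err l x < 1"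
      using good_path_limits(1)[OF elim(1)] by (rule order_tendstoD(2)) simp
    have low: "ennreal (2 * \<nu> * z) \<le> D x" if z: "z < ?I" for z
    proof -
      have "ennreal (2 * \<nu> * z) \<le> liminf (\<lambda>l. g R l x)" if R: "R \<ge> R0" for R
      proof (rule Liminf_bounded)
        show "\<forall>\<^sub>F l in sequentially. ennreal (2 * \<nu> * z) \<le> g R l x"
          using R0[OF R z] Ex
        proof eventually_elim
          case (elim l)
          have "x \<in> {x\<in>space M. Err l x \<le> 1}" using elim(2) \<open>x \<in> space M\<close> by simp
          then show ?case unfolding g_def using elim(1) by (simp add: ennreal_leI)
        qed
      qed
      then show ?thesis
        unfolding D_def
        by (intro Liminf_bounded) (auto intro!: eventually_mono[OF eventually_ge_at_top[of "nat \<lceil>R0\<rceil>"]] simp: nat_le_iff ceiling_le_iff)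
    qed
    \<comment> \<open>The comparison is available for values strictly below the integral, hence the
      approximation by \<open>?I - 1 / n\<close>.\<close>
    show "ennreal (2 * \<nu> * ?I) \<le> D x"
    proof (rule LIMSEQ_le_const2)
      have "(\<lambda>n. ?I - 1 / real n) \<longlonglongrightarrow> ?I - 0" by (intro tendsto_intros lim_const_over_n)
      then show "(\<lambda>n. ennreal (2 * \<nu> * (?I - 1 / real n))) \<longlonglongrightarrow> ennreal (2 * \<nu> * ?I)"
        by (intro tendsto_ennrealI tendsto_mult tendsto_const) simp
      show "\<exists>N. \<forall>n\<ge>N. ennreal (2 * \<nu> * (?I - 1 / real n)) \<le> D x"
        by (intro exI[of _ 1] allI impI low) simp
    qed
  qed
  with Dm int show ?thesis by blast
qed

end

section \<open>Borel sets and Lipschitz functions\<close>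

lemma openin_Hdot_subset: "openin (Hdot_topology m) U \<Longrightarrow> U \<subseteq> Hdot m"
  unfolding Hdot_topology_def using openin_subset[of "Hdot.mtopology m" U] by simp

lemma space_Hdot_borel [simp]: "space (Hdot_borel m) = Hdot m"
  unfolding Hdot_borel_def by (rule space_measure_of) (use openin_Hdot_subset in auto)

lemma sets_Hdot_borel: "sets (Hdot_borel m) = sigma_sets (Hdot m) {U. openin (Hdot_topology m) U}"
  unfolding Hdot_borel_def by (rule sets_measure_of) (use openin_Hdot_subset in auto)

text \<open>A ball of \<open>H\<^sup>m\<close> lies in the \<open>L2\<close> ball of the same
  radius, so traces of \<open>L2\<close> open sets are open in the finer topology.\<close>

lemma continuous_measurable_Hdot_borel:
  fixes f :: "L2 \<Rightarrow> 'b::topological_space"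
  assumes "continuous_on (Hdot m) f"
  shows "f \<in> borel_measurable (Hdot_borel m)"
proof (rule borel_measurableI)
  fix S :: "'b set" assume S: "open S"
  have "openin (Hdot_topology m) (f -` S \<inter> Hdot m)"
    unfolding Hdot_topology_def Hdot.openin_mtopology
  proof (intro conjI allI impI)
    fix x assume x: "x \<in> f -` S \<inter> Hdot m"
    have "openin (top_of_set (Hdot m)) (Hdot m \<inter> f -` S)"
      by (rule continuous_openin_preimage_gen[OF assms S])
    then obtain r where r: "r > 0" "ball x r \<inter> Hdot m \<subseteq> f -` S"
      using x unfolding openin_contains_ball by blast
    have "Hdot.mball m x r \<subseteq> f -` S \<inter> Hdot m"
    proof
      fix v assume v: "v \<in> Hdot.mball m x r"
      then have "norm (x - v) < r"
        using norm_le_Hdot_norm[OF Hdot_diff, of x m v] by simp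
      then have "v \<in> ball x r" by (simp add: dist_norm)
      then show "v \<in> f -` S \<inter> Hdot m" using r v by auto
    qed
    then show "\<exists>r>0. Hdot.mball m x r \<subseteq> f -` S \<inter> Hdot m" using r(1) by blast
  qed simp
  then show "f -` S \<inter> space (Hdot_borel m) \<in> sets (Hdot_borel m)"
    unfolding sets_Hdot_borel space_Hdot_borel by (intro sigma_sets.Basic) simp
qed

lemma measurable_coef_Hdot: "(\<lambda>u. coef u k) \<in> borel_measurable (Hdot_borel m)"
  unfolding coef_def by (intro continuous_measurable_Hdot_borel continuous_intros)

text \<open>The sigma-algebra of the coordinates. It is shown to be the whole Borel algebra of
  \<open>H\<^sup>m\<close>, so that Borel sets can be built from functions that are Lipschitz in the
  weaker \<open>L2\<close> norm.\<close>

definition coord_algebra :: "nat \<Rightarrow> L2 measure" where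
  "coord_algebra m = sigma (Hdot m) {{u \<in> Hdot m. coef u k < r} | k r. True}"

lemma coord_generators_subset: "{{u \<in> Hdot m. coef u k < r} | k r. True} \<subseteq> Pow (Hdot m)"
  by auto

lemma space_coord_algebra [simp]: "space (coord_algebra m) = Hdot m"
  unfolding coord_algebra_def by (rule space_measure_of[OF coord_generators_subset])

lemma sets_coord_algebra: "sets (coord_algebra m) = sigma_sets (Hdot m) {{u \<in> Hdot m. coef u k < r} | k r. True}"
  unfolding coord_algebra_def by (rule sets_measure_of[OF coord_generators_subset])

lemma measurable_coef_coord: "(\<lambda>u. coef u k) \<in> borel_measurable (coord_algebra m)"
  unfolding borel_measurable_iff_less space_coord_algebra sets_coord_algebra
  by (intro allI sigma_sets.Basic) blast

lemma Hdot_norm_sq_has_sum: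
  assumes "u \<in> Hdot m"
  shows "((\<lambda>k. (\<bar>real_of_int k\<bar> ^ m * coef u k)\<^sup>2) has_sum (Hdot_norm m u)\<^sup>2) nonzero_ints"
  unfolding Hdot_norm_Jop[OF assms] Jop_def coef_def by (rule norm_synth[OF HdotD(2)[OF assms]])

lemma ball_in_coord_algebra:
  assumes d: "d \<in> Hdot m" and r: "r > 0"
  shows "Hdot.mball m d r \<in> sets (coord_algebra m)"
proof -
  define f where "f u = lim (\<lambda>n. \<Sum>k\<in>cut n. (\<bar>real_of_int k\<bar> ^ m * (coef d k - coef u k))\<^sup>2)" for u
  have fm: "f \<in> borel_measurable (coord_algebra m)"
    unfolding f_def[abs_def]
    by (intro borel_measurable_lim_metric borel_measurable_sum borel_measurable_power borel_measurable_times borel_measurable_diff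
          borel_measurable_const measurable_coef_coord)
  have f: "f u = (Hdot_norm m (d - u))\<^sup>2" if "u \<in> Hdot m" for u
    using has_sum_cut[OF Hdot_norm_sq_has_sum[OF Hdot_diff[OF d that]]] unfolding f_def coef_diff by (rule limI)
  have "Hdot.mball m d r = {u \<in> space (coord_algebra m). f u < r\<^sup>2}"
  proof (intro set_eqI iffI)
    fix u assume "u \<in> Hdot.mball m d r"
    then have u: "u \<in> Hdot m" "Hdot_norm m (d - u) < r" by auto
    then show "u \<in> {u \<in> space (coord_algebra m). f u < r\<^sup>2}"
      using power_strict_mono[OF u(2) Hdot_norm_nonneg, of 2] by (simp add: f)
  next
    fix u assume "u \<in> {u \<in> space (coord_algebra m). f u < r\<^sup>2}"
    then have u: "u \<in> Hdot m" "(Hdot_norm m (d - u))\<^sup>2 < r\<^sup>2" by (auto simp: f)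
    have "Hdot_norm m (d - u) < r" using power2_less_imp_less[OF u(2)] r by simp
    then show "u \<in> Hdot.mball m d r" using u d by simp
  qed
  also have "\<dots> \<in> sets (coord_algebra m)" by (intro borel_measurable_less fm borel_measurable_const)
  finally show ?thesis .
qed

lemma finite_support_in_Hdot: "Sn c n \<in> Hdot m"
proof -
  have l2c: "l2 (\<lambda>k. if k \<in> cut n then g k else 0)" for g :: "int \<Rightarrow> real"
    unfolding l2_def by (rule finite_nonzero_values_imp_summable_on) (auto intro: finite_subset[of _ "cut n"])
  have "coef (Sn c n) k = (if k \<in> cut n then c k else 0)" if "k \<noteq> 0" for k
    unfolding Sn_eq_synth by (rule coef_synth[OF l2c that])
  then have "l2 (\<lambda>k. \<bar>real_of_int k\<bar> ^ m * inner (Sn c n) (e_basis k)) = l2 (\<lambda>k. if k \<in> cut n then \<bar>real_of_int k\<bar> ^ m * c k else 0)"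
    unfolding l2_def by (intro summable_on_cong) (simp add: coef_def)
  then show ?thesis unfolding Hdot_iff using l2c by (simp add: Sn_eq_synth synth_in_H)
qed

lemma coef_Sn: "k \<noteq> 0 \<Longrightarrow> coef (Sn c n) k = (if k \<in> cut n then c k else 0)"
  unfolding coef_def Sn_def by (rule inner_sum_basis[OF finite_cut cut_subset])

lemma coef_Sn_cut: "k \<in> cut n \<Longrightarrow> coef (Sn c n) k = c k"
  using coef_Sn[of k c n] by (metis zero_notin_cut)

text \<open>Finitely many rational coefficients: a countable set that lies in every
  \<open>H\<^sup>m\<close> and witnesses separability.\<close>

definition rational_points :: "L2 set" where
  "rational_points = (\<Union>n. (\<lambda>q. Sn q n) ` (PiE (cut n) (\<lambda>_. \<rat>)))"

lemma countable_rational_points: "countable rational_points"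
  unfolding rational_points_def by (intro countable_UN countable_image countable_PiE countable_rat) auto

lemma rational_points_Hdot: "rational_points \<subseteq> Hdot m"
  unfolding rational_points_def using finite_support_in_Hdot by auto

lemma rational_points_dense:
  assumes u: "u \<in> Hdot m" and e: "e > 0"
  shows "\<exists>d\<in>rational_points. Hdot_norm m (d - u) < e"
proof -
  let ?w = "\<lambda>k. \<bar>real_of_int k\<bar> ^ m"
  let ?s = "\<lambda>n. \<Sum>k\<in>cut n. (?w k * coef u k)\<^sup>2"
  have "?s \<longlonglongrightarrow> (Hdot_norm m u)\<^sup>2" by (rule has_sum_cut[OF Hdot_norm_sq_has_sum[OF u]])
  then have "\<forall>\<^sub>F n in sequentially. (Hdot_norm m u)\<^sup>2 - (e/2)\<^sup>2 < ?s n"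
    by (rule order_tendstoD(1)) (use e in simp)
  \<comment> \<open>The high modes of \<open>u\<close> beyond \<open>n\<close> contribute less than
    \<open>(e / 2)\<^sup>2\<close> to the squared norm.\<close>
  then obtain n where n: "(Hdot_norm m u)\<^sup>2 - (e/2)\<^sup>2 < ?s n" by (auto simp: eventually_sequentially)
  have w0: "?w k > 0" if "k \<in> cut n" for k using that by (auto simp: cut_def)
  \<comment> \<open>Allowed weighted error per mode, so that the sum over the cut stays below
    \<open>e / 2\<close>; the summand 1 covers the empty cut.\<close>
  define dd where "dd = e / (2 * (real (card (cut n)) + 1))"
  have dd: "dd > 0" using e by (simp add: dd_def add_nonneg_pos)
  have "\<exists>q\<in>\<rat>. \<bar>q - coef u k\<bar> < dd / ?w k" if "k \<in> cut n" for k
  proof -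
    have "dd / ?w k > 0" using dd w0[OF that] by simp
    then obtain q where "q \<in> \<rat>" "coef u k < q" "q < coef u k + dd / ?w k"
      using Rats_dense_in_real[of "coef u k" "coef u k + dd / ?w k"] by auto
    then show ?thesis by (intro bexI[of _ q]) auto
  qed
  then obtain q0 where q0: "\<And>k. k \<in> cut n \<Longrightarrow> q0 k \<in> \<rat> \<and> \<bar>q0 k - coef u k\<bar> < dd / ?w k" by metis
  define q where "q = restrict q0 (cut n)"
  have q: "q \<in> PiE (cut n) (\<lambda>_. \<rat>)" using q0 by (auto simp: q_def)
  have qk: "?w k * \<bar>q k - coef u k\<bar> \<le> dd" if "k \<in> cut n" for k
    using q0[OF that] w0[OF that] that by (simp add: q_def field_simps less_imp_le)
  have split: "Hdot_norm m (Sn q n - u) \<le> Hdot_norm m (Sn q n - Sn (coef u) n) + Hdot_norm m (Sn (coef u) n - u)"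
    by (rule Hdot.triangle) (use u finite_support_in_Hdot in auto)
  have 1: "Hdot_norm m (Sn q n - Sn (coef u) n) < e/2"
  proof -
    have "((\<lambda>k. (?w k * coef (Sn q n - Sn (coef u) n) k)\<^sup>2) has_sum (Hdot_norm m (Sn q n - Sn (coef u) n))\<^sup>2) nonzero_ints"
      by (intro Hdot_norm_sq_has_sum Hdot_diff finite_support_in_Hdot)
    moreover have "((\<lambda>k. (?w k * coef (Sn q n - Sn (coef u) n) k)\<^sup>2) has_sum (\<Sum>k\<in>cut n. (?w k * (q k - coef u k))\<^sup>2)) nonzero_ints"
      by (rule has_sum_finite_neutralI[OF finite_cut[of n] cut_subset[of n]])
         (auto simp: coef_diff coef_Sn coef_Sn_cut intro!: sum.cong)
    ultimately have "(Hdot_norm m (Sn q n - Sn (coef u) n))\<^sup>2 = (\<Sum>k\<in>cut n. (?w k * (q k - coef u k))\<^sup>2)"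
      by (rule has_sum_unique)
    then have "Hdot_norm m (Sn q n - Sn (coef u) n) = L2_set (\<lambda>k. ?w k * (q k - coef u k)) (cut n)"
      unfolding L2_set_def by (rule real_sqrt_unique[OF _ Hdot_norm_nonneg, symmetric])
    also have "\<dots> \<le> (\<Sum>k\<in>cut n. \<bar>?w k * (q k - coef u k)\<bar>)" by (rule L2_set_le_sum_abs)
    also have "\<dots> \<le> (\<Sum>k\<in>cut n. dd)"
      using qk by (intro sum_mono) (simp add: abs_mult)
    also have "\<dots> = real (card (cut n)) * dd" by simp
    also have "\<dots> < (real (card (cut n)) + 1) * dd" using dd by (intro mult_strict_right_mono) auto
    also have "\<dots> = e / 2"
    proof -
      have K: "K * (e / (2 * K)) = e / 2" if "K > 0" for K :: real using that by simp
      have pos: "real (card (cut n)) + 1 > 0" by linarith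
      show ?thesis unfolding dd_def by (rule K[OF pos])
    qed
    finally show ?thesis .
  qed
  have 2: "Hdot_norm m (Sn (coef u) n - u) < e/2"
  proof -
    have d: "Sn (coef u) n - u \<in> Hdot m" by (rule Hdot_diff[OF finite_support_in_Hdot u])
    have a: "((\<lambda>k. (?w k * coef (Sn (coef u) n - u) k)\<^sup>2) has_sum (Hdot_norm m (Sn (coef u) n - u))\<^sup>2) nonzero_ints"
      by (rule Hdot_norm_sq_has_sum[OF d])
    have b: "((\<lambda>k. if k \<in> cut n then (?w k * coef u k)\<^sup>2 else 0) has_sum ?s n) nonzero_ints"
    proof (rule has_sum_finite_neutralI[OF finite_cut[of n] cut_subset[of n]])
      show "(if k \<in> cut n then (?w k * coef u k)\<^sup>2 else 0) = 0" if "k \<in> nonzero_ints - cut n" for k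
        using that by (simp only: Diff_iff if_False)
      show "?s n = (\<Sum>k\<in>cut n. if k \<in> cut n then (?w k * coef u k)\<^sup>2 else 0)"
        by (rule sum.cong[OF refl]) (simp only: if_True)
    qed
    have "((\<lambda>k. (?w k * coef u k)\<^sup>2 - (if k \<in> cut n then (?w k * coef u k)\<^sup>2 else 0)) has_sum ((Hdot_norm m u)\<^sup>2 - ?s n)) nonzero_ints"
      using has_sum_add[OF Hdot_norm_sq_has_sum[OF u] has_sum_cmult_right[OF b, of "-1"]]
      by (simp only: mult_minus1 diff_conv_add_uminus[symmetric])
    also have "?this \<longleftrightarrow> ((\<lambda>k. (?w k * coef (Sn (coef u) n - u) k)\<^sup>2) has_sum ((Hdot_norm m u)\<^sup>2 - ?s n)) nonzero_ints"
    proof (rule has_sum_cong)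
      fix k assume "k \<in> nonzero_ints"
      then have "k \<noteq> 0" by simp
      then have "coef (Sn (coef u) n - u) k = (if k \<in> cut n then 0 else - coef u k)" by (simp add: coef_diff coef_Sn)
      then show "(?w k * coef u k)\<^sup>2 - (if k \<in> cut n then (?w k * coef u k)\<^sup>2 else 0) = (?w k * coef (Sn (coef u) n - u) k)\<^sup>2"
        by simp
    qed
    finally have "(Hdot_norm m (Sn (coef u) n - u))\<^sup>2 = (Hdot_norm m u)\<^sup>2 - ?s n" using a has_sum_unique by blast
    then have "(Hdot_norm m (Sn (coef u) n - u))\<^sup>2 < (e/2)\<^sup>2" using n by linarith
    then show ?thesis by (rule power2_less_imp_less) (use e in simp)
  qed
  have "Hdot_norm m (Sn q n - u) < e" using split 1 2 by linarith
  moreover have "Sn q n \<in> rational_points" unfolding rational_points_def using q by blast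
  ultimately show ?thesis by blast
qed

text \<open>By separability an open set is a countable union of balls with rational centre and
  radius. A ball belongs to the coordinate algebra since the norm is a limit of finite sums in the
  coordinates.\<close>

lemma open_in_coord_algebra:
  assumes "openin (Hdot_topology m) U"
  shows "U \<in> sets (coord_algebra m)"
proof -
  define I where "I = {(d, r). d \<in> rational_points \<and> r \<in> \<rat> \<and> r > 0 \<and> Hdot.mball m d r \<subseteq> U}"
  have "I \<subseteq> rational_points \<times> \<rat>" by (auto simp: I_def)
  then have cI: "countable I" by (rule countable_subset) (intro countable_SIGMA countable_rational_points countable_rat)
  have "U = (\<Union>(d, r)\<in>I. Hdot.mball m d r)"
  proof
    show "U \<subseteq> (\<Union>(d, r)\<in>I. Hdot.mball m d r)"
    proof
      fix u assume "u \<in> U"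
      with assms obtain r where r: "r > 0" "Hdot.mball m u r \<subseteq> U"
        unfolding Hdot_topology_def Hdot.openin_mtopology by blast
      have u: "u \<in> Hdot m" using openin_Hdot_subset[OF assms] \<open>u \<in> U\<close> by auto
      obtain s where s: "s \<in> \<rat>" "0 < s" "s < r/2" using Rats_dense_in_real[of 0 "r/2"] r by auto
      obtain d where d: "d \<in> rational_points" "Hdot_norm m (d - u) < s"
        using rational_points_dense[OF u s(2)] by blast
      have dH: "d \<in> Hdot m" using d rational_points_Hdot by auto
      have "Hdot.mball m d s \<subseteq> Hdot.mball m u r"
      proof
        fix v assume v: "v \<in> Hdot.mball m d s"
        then have "Hdot_norm m (u - v) \<le> Hdot_norm m (u - d) + Hdot_norm m (d - v)"
          using Hdot.triangle[of u m d v] u dH by simp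
        also have "Hdot_norm m (u - d) = Hdot_norm m (d - u)" by (rule Hdot.commute)
        also have "\<dots> + Hdot_norm m (d - v) < r" using d(2) v s(3) by simp
        finally show "v \<in> Hdot.mball m u r" using v u by simp
      qed
      then have "(d, s) \<in> I" using d s r unfolding I_def by auto
      moreover have "u \<in> Hdot.mball m d s" using d u dH by simp
      ultimately show "u \<in> (\<Union>(d, r)\<in>I. Hdot.mball m d r)" by blast
    qed
  qed (auto simp: I_def)
  also have "\<dots> \<in> sets (coord_algebra m)"
    by (rule sets.countable_UN'[OF cI]) (auto simp: I_def intro!: ball_in_coord_algebra dest: subsetD[OF rational_points_Hdot])
  finally show ?thesis .
qed

lemma sets_Hdot_borel_coord: "sets (Hdot_borel m) = sigma_sets (Hdot m) {{u \<in> Hdot m. coef u k < r} | k r. True}"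
proof
  show "sets (Hdot_borel m) \<subseteq> sigma_sets (Hdot m) {{u \<in> Hdot m. coef u k < r} | k r. True}"
  proof -
    have "sigma_sets (space (coord_algebra m)) {U. openin (Hdot_topology m) U} \<subseteq> sets (coord_algebra m)"
      by (rule sets.sigma_sets_subset) (use open_in_coord_algebra in blast)
    then show ?thesis by (simp only: sets_Hdot_borel sets_coord_algebra space_coord_algebra)
  qed
  show "sigma_sets (Hdot m) {{u \<in> Hdot m. coef u k < r} | k r. True} \<subseteq> sets (Hdot_borel m)"
    unfolding space_Hdot_borel[symmetric]
  proof (rule sets.sigma_sets_subset, safe)
    fix k r
    show "{u \<in> space (Hdot_borel m). coef u k < r} \<in> sets (Hdot_borel m)"
      using measurable_coef_Hdot[of k m] unfolding borel_measurable_iff_less by blast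
  qed
qed

text \<open>The Lipschitz bound refers to the \<open>L2\<close> norm and not to that of
  \<open>H\<^sup>m\<close>, because the stability estimate controls the distance of two solutions in
  \<open>L2\<close>.\<close>

definition lip01 :: "real \<Rightarrow> (L2 \<Rightarrow> real) \<Rightarrow> bool" where
  "lip01 L \<phi> \<longleftrightarrow> L \<ge> 0 \<and> (\<forall>u. 0 \<le> \<phi> u \<and> \<phi> u \<le> 1) \<and> (\<forall>u v. \<bar>\<phi> u - \<phi> v\<bar> \<le> L * norm (u - v))"

lemma lip01_continuous: "lip01 L \<phi> \<Longrightarrow> continuous_on S \<phi>"
proof -
  assume l: "lip01 L \<phi>"
  have "L-lipschitz_on S \<phi>"
    by (rule lipschitz_onI) (use l in \<open>auto simp: lip01_def dist_norm\<close>)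
  then show ?thesis by (rule lipschitz_on_continuous_on)
qed

lemma lip01_measurable: "lip01 L \<phi> \<Longrightarrow> \<phi> \<in> borel_measurable (Hdot_borel m)"
  by (intro continuous_measurable_Hdot_borel lip01_continuous)

lemma lip01_compl: "lip01 L \<phi> \<Longrightarrow> lip01 L (\<lambda>u. 1 - \<phi> u)"
  by (auto simp: lip01_def abs_minus_commute)

lemma abs_max_diff: "\<bar>max a b - max c d\<bar> \<le> \<bar>a - c\<bar> + \<bar>b - d\<bar>" for a b c d :: real
  by (simp add: max_def abs_if)

lemma lip01_max:
  assumes "lip01 L \<phi>" "lip01 K \<psi>"
  shows "lip01 (L + K) (\<lambda>u. max (\<phi> u) (\<psi> u))"
  unfolding lip01_def
proof (intro conjI allI)
  show "0 \<le> L + K" using assms by (simp add: lip01_def)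
  show "0 \<le> max (\<phi> u) (\<psi> u)" "max (\<phi> u) (\<psi> u) \<le> 1" for u using assms by (auto simp: lip01_def max_def)
  show "\<bar>max (\<phi> u) (\<psi> u) - max (\<phi> v) (\<psi> v)\<bar> \<le> (L + K) * norm (u - v)" for u v
  proof -
    have "\<bar>\<phi> u - \<phi> v\<bar> \<le> L * norm (u - v)" "\<bar>\<psi> u - \<psi> v\<bar> \<le> K * norm (u - v)" using assms by (auto simp: lip01_def)
    then show ?thesis using abs_max_diff[of "\<phi> u" "\<psi> u" "\<phi> v" "\<psi> v"] unfolding distrib_right by linarith
  qed
qed

lemma lip01_clamp:
  assumes "k \<noteq> 0" "K \<ge> 0"
  shows "lip01 K (\<lambda>u. min 1 (max 0 (K * (r - coef u k))))"
  unfolding lip01_def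
proof (intro conjI allI)
  fix u v
  have "\<bar>min 1 (max 0 (K * (r - coef u k))) - min 1 (max 0 (K * (r - coef v k)))\<bar> \<le> \<bar>K * (r - coef u k) - K * (r - coef v k)\<bar>"
    by (simp add: min_def max_def abs_if)
  also have "\<dots> = K * \<bar>coef (u - v) k\<bar>"
  proof -
    have "K * (r - coef u k) - K * (r - coef v k) = - (K * coef (u - v) k)" by (simp add: coef_diff algebra_simps)
    then show ?thesis using assms(2) by (simp only: abs_minus_cancel abs_mult abs_of_nonneg)
  qed
  also have "\<dots> \<le> K * norm (u - v)"
    using Cauchy_Schwarz_ineq2[of "u - v" "e_basis k"] assms by (intro mult_left_mono) (auto simp: coef_def)
  finally show "\<bar>min 1 (max 0 (K * (r - coef u k))) - min 1 (max 0 (K * (r - coef v k)))\<bar> \<le> K * norm (u - v)" .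
qed (use assms in auto)

definition approximable :: "nat \<Rightarrow> L2 measure \<Rightarrow> L2 measure \<Rightarrow> L2 set \<Rightarrow> bool" where
  "approximable m \<mu> \<mu>' A \<longleftrightarrow> A \<in> sets (Hdot_borel m) \<and> (\<forall>e>0. \<exists>L \<phi>. lip01 L \<phi> \<and>
     (LINT u|\<mu>. \<bar>indicator A u - \<phi> u\<bar>) < e \<and> (LINT u|\<mu>'. \<bar>indicator A u - \<phi> u\<bar>) < e)"

text \<open>Half-spaces in one coordinate are approximated by steep ramps, and the approximable sets
  form a sigma-algebra. One function serves both measures, since it will be integrated against their
  difference.\<close>

lemma approximable_Hdot_borel:
  assumes p: "prob_space \<mu>" "prob_space \<mu>'" and s: "sets \<mu> = sets (Hdot_borel m)" "sets \<mu>' = sets (Hdot_borel m)"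
    and A: "A \<in> sets (Hdot_borel m)"
  shows "approximable m \<mu> \<mu>' A"
proof -
  interpret \<mu>: prob_space \<mu> by (rule p)
  interpret \<mu>': prob_space \<mu>' by (rule p)
  have sp: "space \<mu> = Hdot m" "space \<mu>' = Hdot m" using sets_eq_imp_space_eq[OF s(1)] sets_eq_imp_space_eq[OF s(2)] by auto
  have meas: "\<phi> \<in> borel_measurable \<mu>" "\<phi> \<in> borel_measurable \<mu>'" if "lip01 L \<phi>" for L \<phi>
    using lip01_measurable[OF that] by (simp_all add: measurable_cong_sets[OF s(1) refl] measurable_cong_sets[OF s(2) refl])
  have int: "integrable \<mu> (\<lambda>u. \<bar>indicator A u - \<phi> u\<bar>)" "integrable \<mu>' (\<lambda>u. \<bar>indicator A u - \<phi> u\<bar>)"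
    if "lip01 L \<phi>" "A \<in> sets (Hdot_borel m)" for L \<phi> A
  proof -
    have b: "norm \<bar>indicator A u - \<phi> u\<bar> \<le> 1" for u using that by (auto simp: lip01_def indicator_def abs_le_iff) (smt (verit))+
    show "integrable \<mu> (\<lambda>u. \<bar>indicator A u - \<phi> u\<bar>)"
      by (rule \<mu>.integrable_const_bound[where B = 1]) (use b that s meas(1)[OF that(1)] in auto)
    show "integrable \<mu>' (\<lambda>u. \<bar>indicator A u - \<phi> u\<bar>)"
      by (rule \<mu>'.integrable_const_bound[where B = 1]) (use b that s meas(2)[OF that(1)] in auto)
  qed
  from A[unfolded sets_Hdot_borel_coord] show ?thesis
  proof (induction rule: sigma_sets.induct)
    case (Basic A)
    then obtain k r where A: "A = {u \<in> Hdot m. coef u k < r}" by blast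
    have Ab: "A \<in> sets (Hdot_borel m)" unfolding sets_Hdot_borel_coord by (rule sigma_sets.Basic[OF Basic])
    show ?case
    proof (cases "k = 0")
      case True
      \<comment> \<open>The basis vector of index 0 is zero, so this generator is the whole space or
        empty and a constant function is exact.\<close>
      then have "coef u k = 0" for u by (simp add: coef_def e_basis_def basis_fun_def[abs_def] abs_L2_zero)
      then have "A = Hdot m \<or> A = {}" unfolding A by auto
      then obtain z :: real where z: "z \<in> {0, 1}" "\<And>u. u \<in> Hdot m \<Longrightarrow> indicator A u = z"
        by (metis empty_iff indicator_simps(1) indicator_simps(2) insertI1 insertI2)
      have l: "lip01 0 (\<lambda>u. z)" using z(1) by (auto simp: lip01_def)
      have "(LINT u|\<mu>. \<bar>indicator A u - z\<bar>) = (LINT u|\<mu>. 0)" "(LINT u|\<mu>'. \<bar>indicator A u - z\<bar>) = (LINT u|\<mu>'. 0)"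
        by (intro Bochner_Integration.integral_cong refl; use z(2) sp in simp)+
      then have z0: "(LINT u|\<mu>. \<bar>indicator A u - z\<bar>) = 0" "(LINT u|\<mu>'. \<bar>indicator A u - z\<bar>) = 0" by simp_all
      show ?thesis unfolding approximable_def
      proof (intro conjI Ab allI impI)
        fix e :: real assume "e > 0"
        with l z0 show "\<exists>L \<phi>. lip01 L \<phi> \<and> (LINT u|\<mu>. \<bar>indicator A u - \<phi> u\<bar>) < e \<and> (LINT u|\<mu>'. \<bar>indicator A u - \<phi> u\<bar>) < e"
          by (intro exI[of _ "0::real"] exI[of _ "\<lambda>u. z"]) simp
      qed
    next
      case False
      define \<phi> where "\<phi> n u = min 1 (max 0 (real n * (r - coef u k)))" for n u
      have l: "lip01 (real n) (\<phi> n)" for n unfolding \<phi>_def by (rule lip01_clamp[OF False]) simp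
      have lim: "(\<lambda>n. \<bar>indicator A u - \<phi> n u\<bar>) \<longlonglongrightarrow> 0" if u: "u \<in> Hdot m" for u
      proof (cases "coef u k < r")
        case True
        obtain N :: nat where N: "1 / (r - coef u k) < real N" using reals_Archimedean2 by blast
        have "\<forall>\<^sub>F n in sequentially. \<bar>indicator A u - \<phi> n u\<bar> = 0"
          using eventually_ge_at_top[of N]
        proof eventually_elim
          case (elim n)
          have "1 \<le> real N * (r - coef u k)" using N True by (simp add: field_simps)
          also have "\<dots> \<le> real n * (r - coef u k)" using elim True by (intro mult_right_mono) auto
          finally have "\<phi> n u = 1" by (simp add: \<phi>_def)
          then show ?case using True u by (simp add: A)
        qed
        then show ?thesis by (rule tendsto_eventually)
      next
        case False
        then have "\<phi> n u = 0" for n by (simp add: \<phi>_def mult_nonneg_nonpos)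
        then show ?thesis using False by (simp add: A)
      qed
      have b: "norm \<bar>indicator A u - \<phi> n u\<bar> \<le> 1" for u n by (auto simp: \<phi>_def indicator_def min_def max_def)
      have "(\<lambda>n. LINT u|\<mu>. \<bar>indicator A u - \<phi> n u\<bar>) \<longlonglongrightarrow> (LINT u|\<mu>. 0)"
        by (rule integral_dominated_convergence[where w = "\<lambda>_. 1"])
           (use int(1)[OF l Ab] lim b sp in \<open>auto intro!: AE_I2\<close>)
      moreover have "(\<lambda>n. LINT u|\<mu>'. \<bar>indicator A u - \<phi> n u\<bar>) \<longlonglongrightarrow> (LINT u|\<mu>'. 0)"
        by (rule integral_dominated_convergence[where w = "\<lambda>_. 1"])
           (use int(2)[OF l Ab] lim b sp in \<open>auto intro!: AE_I2\<close>)
      ultimately have lims: "(\<lambda>n. LINT u|\<mu>. \<bar>indicator A u - \<phi> n u\<bar>) \<longlonglongrightarrow> 0" "(\<lambda>n. LINT u|\<mu>'. \<bar>indicator A u - \<phi> n u\<bar>) \<longlonglongrightarrow> 0" by simp_all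
      show ?thesis unfolding approximable_def
      proof (intro conjI Ab allI impI)
        fix e :: real assume e: "e > 0"
        have "\<forall>\<^sub>F n in sequentially. (LINT u|\<mu>. \<bar>indicator A u - \<phi> n u\<bar>) < e \<and> (LINT u|\<mu>'. \<bar>indicator A u - \<phi> n u\<bar>) < e"
          by (intro eventually_conj order_tendstoD(2)[OF lims(1) e] order_tendstoD(2)[OF lims(2) e])
        then obtain n where "(LINT u|\<mu>. \<bar>indicator A u - \<phi> n u\<bar>) < e \<and> (LINT u|\<mu>'. \<bar>indicator A u - \<phi> n u\<bar>) < e"
          by (auto simp: eventually_sequentially)
        with l show "\<exists>L \<phi>. lip01 L \<phi> \<and> (LINT u|\<mu>. \<bar>indicator A u - \<phi> u\<bar>) < e \<and> (LINT u|\<mu>'. \<bar>indicator A u - \<phi> u\<bar>) < e" by blast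
      qed
    qed
  next
    case Empty
    have "lip01 0 (\<lambda>u. 0)" by (simp add: lip01_def)
    then show ?case unfolding approximable_def by (auto intro!: exI[of _ "0::real"] exI[of _ "\<lambda>u. 0"])
  next
    case (Compl A)
    have Ab: "Hdot m - A \<in> sets (Hdot_borel m)" using Compl.IH unfolding approximable_def by (metis sets.compl_sets space_Hdot_borel)
    show ?case unfolding approximable_def
    proof (intro conjI Ab allI impI)
      fix e :: real assume "e > 0"
      with Compl.IH obtain L \<phi> where l: "lip01 L \<phi>" and e: "(LINT u|\<mu>. \<bar>indicator A u - \<phi> u\<bar>) < e" "(LINT u|\<mu>'. \<bar>indicator A u - \<phi> u\<bar>) < e"
        unfolding approximable_def by blast
      have "(LINT u|\<mu>. \<bar>indicator (Hdot m - A) u - (1 - \<phi> u)\<bar>) = (LINT u|\<mu>. \<bar>indicator A u - \<phi> u\<bar>)"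
        "(LINT u|\<mu>'. \<bar>indicator (Hdot m - A) u - (1 - \<phi> u)\<bar>) = (LINT u|\<mu>'. \<bar>indicator A u - \<phi> u\<bar>)"
        by (intro Bochner_Integration.integral_cong refl; simp add: sp indicator_def abs_minus_commute)+
      with e lip01_compl[OF l] show "\<exists>L \<phi>. lip01 L \<phi> \<and> (LINT u|\<mu>. \<bar>indicator (Hdot m - A) u - \<phi> u\<bar>) < e \<and> (LINT u|\<mu>'. \<bar>indicator (Hdot m - A) u - \<phi> u\<bar>) < e"
        by (intro exI[of _ L] exI[of _ "\<lambda>u. 1 - \<phi> u"]) simp
    qed
  next
    case (Union A)
    have Ai: "A i \<in> sets (Hdot_borel m)" for i using Union.IH by (simp add: approximable_def)
    have Ub: "(\<Union>i. A i) \<in> sets (Hdot_borel m)" using Ai by blast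
    \<comment> \<open>The maximum of two functions handles a union of two sets, the Lipschitz
      constants adding up. Since they grow with the number of sets, a countable union is cut off at
      a finite one by dominated convergence.\<close>
    have fin: "\<exists>L \<phi>. lip01 L \<phi> \<and> (LINT u|\<mu>. \<bar>indicator (\<Union>i<n. A i) u - \<phi> u\<bar>) < e \<and> (LINT u|\<mu>'. \<bar>indicator (\<Union>i<n. A i) u - \<phi> u\<bar>) < e"
      if "e > 0" for n e using that
    proof (induction n arbitrary: e)
      case 0
      have "lip01 0 (\<lambda>u. 0)" by (simp add: lip01_def)
      then show ?case using 0 by (intro exI[of _ "0::real"] exI[of _ "\<lambda>u. 0"]) simp
    next
      case (Suc n)
      then have e2: "e/2 > 0" by simp
      obtain L \<phi> where l: "lip01 L \<phi>" and e: "(LINT u|\<mu>. \<bar>indicator (\<Union>i<n. A i) u - \<phi> u\<bar>) < e/2" "(LINT u|\<mu>'. \<bar>indicator (\<Union>i<n. A i) u - \<phi> u\<bar>) < e/2"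
        using Suc.IH[OF e2] by blast
      obtain K \<psi> where k: "lip01 K \<psi>" and f: "(LINT u|\<mu>. \<bar>indicator (A n) u - \<psi> u\<bar>) < e/2" "(LINT u|\<mu>'. \<bar>indicator (A n) u - \<psi> u\<bar>) < e/2"
        using Union.IH[of n] e2 unfolding approximable_def by blast
      have Un: "(\<Union>i<n. A i) \<in> sets (Hdot_borel m)" and Us: "(\<Union>i<Suc n. A i) \<in> sets (Hdot_borel m)" using Ai by auto
      have le: "\<bar>indicator (\<Union>i<Suc n. A i) u - max (\<phi> u) (\<psi> u)\<bar> \<le> \<bar>indicator (\<Union>i<n. A i) u - \<phi> u\<bar> + \<bar>indicator (A n) u - \<psi> u\<bar>" for u
      proof -
        have "(indicator (\<Union>i<Suc n. A i) u :: real) = max (indicator (\<Union>i<n. A i) u) (indicator (A n) u)"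
          unfolding lessThan_Suc by (auto simp: indicator_def)
        then show ?thesis by (simp only: abs_max_diff)
      qed
      have "(LINT u|\<mu>. \<bar>indicator (\<Union>i<Suc n. A i) u - max (\<phi> u) (\<psi> u)\<bar>) \<le> (LINT u|\<mu>. \<bar>indicator (\<Union>i<n. A i) u - \<phi> u\<bar> + \<bar>indicator (A n) u - \<psi> u\<bar>)"
        by (intro integral_mono int(1)[OF lip01_max[OF l k] Us] Bochner_Integration.integrable_add int(1)[OF l Un] int(1)[OF k Ai] le)
      also have "\<dots> < e" using e(1) f(1) by (subst Bochner_Integration.integral_add[OF int(1)[OF l Un] int(1)[OF k Ai]]) linarith
      finally have 1: "(LINT u|\<mu>. \<bar>indicator (\<Union>i<Suc n. A i) u - max (\<phi> u) (\<psi> u)\<bar>) < e" .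
      have "(LINT u|\<mu>'. \<bar>indicator (\<Union>i<Suc n. A i) u - max (\<phi> u) (\<psi> u)\<bar>) \<le> (LINT u|\<mu>'. \<bar>indicator (\<Union>i<n. A i) u - \<phi> u\<bar> + \<bar>indicator (A n) u - \<psi> u\<bar>)"
        by (intro integral_mono int(2)[OF lip01_max[OF l k] Us] Bochner_Integration.integrable_add int(2)[OF l Un] int(2)[OF k Ai] le)
      also have "\<dots> < e" using e(2) f(2) by (subst Bochner_Integration.integral_add[OF int(2)[OF l Un] int(2)[OF k Ai]]) linarith
      finally have 2: "(LINT u|\<mu>'. \<bar>indicator (\<Union>i<Suc n. A i) u - max (\<phi> u) (\<psi> u)\<bar>) < e" .
      show ?case using lip01_max[OF l k] 1 2 by blast
    qed
    have lim0: "(\<lambda>n. \<bar>indicator (\<Union>i. A i) u - indicator (\<Union>i<n. A i) u\<bar> :: real) \<longlonglongrightarrow> 0" for u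
    proof (cases "u \<in> (\<Union>i. A i)")
      case True
      then obtain i where i: "u \<in> A i" by blast
      have "\<forall>\<^sub>F n in sequentially. \<bar>indicator (\<Union>i. A i) u - indicator (\<Union>i<n. A i) u\<bar> = (0::real)"
        using eventually_gt_at_top[of i] by eventually_elim (use True i in \<open>auto simp: indicator_def\<close>)
      then show ?thesis by (rule tendsto_eventually)
    qed (simp add: indicator_def)
    have b: "norm \<bar>indicator (\<Union>i. A i) u - indicator (\<Union>i<n. A i) u :: real\<bar> \<le> 1" for u n by (auto simp: indicator_def)
    have im: "(\<lambda>u. \<bar>indicator (\<Union>i. A i) u - indicator (\<Union>i<n. A i) u\<bar> :: real) \<in> borel_measurable \<mu>"
         "(\<lambda>u. \<bar>indicator (\<Union>i. A i) u - indicator (\<Union>i<n. A i) u\<bar> :: real) \<in> borel_measurable \<mu>'" for n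
      using Ai Ub s by auto
    have "(\<lambda>n. LINT u|\<mu>. \<bar>indicator (\<Union>i. A i) u - indicator (\<Union>i<n. A i) u :: real\<bar>) \<longlonglongrightarrow> (LINT u|\<mu>. 0)"
      by (rule integral_dominated_convergence[where w = "\<lambda>_. 1"]) (simp, rule im(1), simp, rule AE_I2, rule lim0, rule AE_I2, rule b)
    moreover have "(\<lambda>n. LINT u|\<mu>'. \<bar>indicator (\<Union>i. A i) u - indicator (\<Union>i<n. A i) u :: real\<bar>) \<longlonglongrightarrow> (LINT u|\<mu>'. 0)"
      by (rule integral_dominated_convergence[where w = "\<lambda>_. 1"]) (simp, rule im(2), simp, rule AE_I2, rule lim0, rule AE_I2, rule b)
    ultimately have lims: "(\<lambda>n. LINT u|\<mu>. \<bar>indicator (\<Union>i. A i) u - indicator (\<Union>i<n. A i) u :: real\<bar>) \<longlonglongrightarrow> 0"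
       "(\<lambda>n. LINT u|\<mu>'. \<bar>indicator (\<Union>i. A i) u - indicator (\<Union>i<n. A i) u :: real\<bar>) \<longlonglongrightarrow> 0" by simp_all
    show ?case unfolding approximable_def
    proof (intro conjI Ub allI impI)
      fix e :: real assume "e > 0"
      then have e2: "e/2 > 0" by simp
      have "\<forall>\<^sub>F n in sequentially. (LINT u|\<mu>. \<bar>indicator (\<Union>i. A i) u - indicator (\<Union>i<n. A i) u :: real\<bar>) < e/2 \<and> (LINT u|\<mu>'. \<bar>indicator (\<Union>i. A i) u - indicator (\<Union>i<n. A i) u :: real\<bar>) < e/2"
        by (intro eventually_conj order_tendstoD(2)[OF lims(1) e2] order_tendstoD(2)[OF lims(2) e2])
      then obtain n where n: "(LINT u|\<mu>. \<bar>indicator (\<Union>i. A i) u - indicator (\<Union>i<n. A i) u :: real\<bar>) < e/2" "(LINT u|\<mu>'. \<bar>indicator (\<Union>i. A i) u - indicator (\<Union>i<n. A i) u :: real\<bar>) < e/2"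
        by (auto simp: eventually_sequentially)
      obtain L \<phi> where l: "lip01 L \<phi>" and f: "(LINT u|\<mu>. \<bar>indicator (\<Union>i<n. A i) u - \<phi> u\<bar>) < e/2" "(LINT u|\<mu>'. \<bar>indicator (\<Union>i<n. A i) u - \<phi> u\<bar>) < e/2"
        using fin[OF e2] by blast
      have Un: "(\<Union>i<n. A i) \<in> sets (Hdot_borel m)" using Ai by auto
      have i1: "integrable \<mu> (\<lambda>u. \<bar>indicator (\<Union>i. A i) u - indicator (\<Union>i<n. A i) u :: real\<bar>)"
        by (rule \<mu>.integrable_const_bound[where B = 1, OF AE_I2[OF b] im(1)])
      have i2: "integrable \<mu>' (\<lambda>u. \<bar>indicator (\<Union>i. A i) u - indicator (\<Union>i<n. A i) u :: real\<bar>)"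
        by (rule \<mu>'.integrable_const_bound[where B = 1, OF AE_I2[OF b] im(2)])
      have le: "\<bar>indicator (\<Union>i. A i) u - \<phi> u\<bar> \<le> \<bar>indicator (\<Union>i. A i) u - indicator (\<Union>i<n. A i) u :: real\<bar> + \<bar>indicator (\<Union>i<n. A i) u - \<phi> u\<bar>" for u
        by linarith
      have "(LINT u|\<mu>. \<bar>indicator (\<Union>i. A i) u - \<phi> u\<bar>) \<le> (LINT u|\<mu>. \<bar>indicator (\<Union>i. A i) u - indicator (\<Union>i<n. A i) u :: real\<bar> + \<bar>indicator (\<Union>i<n. A i) u - \<phi> u\<bar>)"
        by (intro integral_mono int(1)[OF l Ub] Bochner_Integration.integrable_add i1 int(1)[OF l Un] le)
      also have "\<dots> < e" using n(1) f(1) by (subst Bochner_Integration.integral_add[OF i1 int(1)[OF l Un]]) linarith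
      finally have 1: "(LINT u|\<mu>. \<bar>indicator (\<Union>i. A i) u - \<phi> u\<bar>) < e" .
      have "(LINT u|\<mu>'. \<bar>indicator (\<Union>i. A i) u - \<phi> u\<bar>) \<le> (LINT u|\<mu>'. \<bar>indicator (\<Union>i. A i) u - indicator (\<Union>i<n. A i) u :: real\<bar> + \<bar>indicator (\<Union>i<n. A i) u - \<phi> u\<bar>)"
        by (intro integral_mono int(2)[OF l Ub] Bochner_Integration.integrable_add i2 int(2)[OF l Un] le)
      also have "\<dots> < e" using n(2) f(2) by (subst Bochner_Integration.integral_add[OF i2 int(2)[OF l Un]]) linarith
      finally have 2: "(LINT u|\<mu>'. \<bar>indicator (\<Union>i. A i) u - \<phi> u\<bar>) < e" .
      show "\<exists>L \<phi>. lip01 L \<phi> \<and> (LINT u|\<mu>. \<bar>indicator (\<Union>i. A i) u - \<phi> u\<bar>) < e \<and> (LINT u|\<mu>'. \<bar>indicator (\<Union>i. A i) u - \<phi> u\<bar>) < e"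
        using l 1 2 by blast
    qed
  qed
qed

section \<open>Uniqueness of the invariant measure\<close>

lemma continuous_Jop_mono:
  fixes S :: "'a::topological_space set"
  assumes w: "w \<in> S \<rightarrow> Hdot m" and nm: "n \<le> m" and J: "continuous_on S (\<lambda>t. Jop m (w t))"
  shows "continuous_on S (\<lambda>t. Jop n (w t))"
  unfolding continuous_on_def
proof
  fix t assume t: "t \<in> S"
  have wm: "w s \<in> Hdot m" if "s \<in> S" for s using w that by auto
  have wn: "w s \<in> Hdot n" if "s \<in> S" for s using Hdot_mono(1)[OF wm[OF that] nm] .
  have "((\<lambda>s. norm (Jop m (w s) - Jop m (w t))) \<longlongrightarrow> norm (Jop m (w t) - Jop m (w t))) (at t within S)"
    using J t by (intro tendsto_intros) (auto simp: continuous_on_def)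
  then have lim: "((\<lambda>s. norm (Jop m (w s) - Jop m (w t))) \<longlongrightarrow> 0) (at t within S)" by simp
  have "\<forall>\<^sub>F s in at t within S. s \<in> S" by (simp add: eventually_at_filter)
  then have "\<forall>\<^sub>F s in at t within S. norm (Jop n (w s) - Jop n (w t)) \<le> norm (Jop m (w s) - Jop m (w t))"
  proof eventually_elim
    case (elim s)
    have "Hdot_norm n (w s - w t) \<le> Hdot_norm m (w s - w t)"
      by (rule Hdot_mono(2)[OF Hdot_diff[OF wm[OF elim] wm[OF t]] nm])
    then show ?case
      by (simp only: Hdot_norm_Jop[OF Hdot_diff[OF wm[OF elim] wm[OF t]]] Hdot_norm_Jop[OF Hdot_diff[OF wn[OF elim] wn[OF t]]]
           Jop_diff[OF wm[OF elim] wm[OF t]] Jop_diff[OF wn[OF elim] wn[OF t]])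
  qed
  then have "((\<lambda>s. Jop n (w s) - Jop n (w t)) \<longlongrightarrow> 0) (at t within S)"
    by (rule Lim_null_comparison) (rule lim)
  then show "((\<lambda>s. Jop n (w s)) \<longlongrightarrow> Jop n (w t)) (at t within S)" by (simp add: LIM_zero_iff)
qed

lemma continuous_map_Hdot_mono:
  fixes S :: "'a::topological_space set"
  assumes "continuous_map (top_of_set S) (Hdot_topology m) w" "n \<le> m"
  shows "continuous_map (top_of_set S) (Hdot_topology n) w"
  using assms continuous_Jop_mono[of w S m n] Hdot_mono(1)[OF _ assms(2)] unfolding continuous_map_Hdot_iff by blast

text \<open>The energy balance and the stability estimate are statements about
  \<open>H\<^sup>1\<close>, while the solutions are given in \<open>H\<^sup>m\<close>. The mild
  equation is the same identity in \<open>L2\<close>; only continuity and the initial space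
  change.\<close>

lemma global_solution_mono:
  assumes "global_solution M a \<nu> b \<beta> m y w" "n \<le> m"
  shows "global_solution M a \<nu> b \<beta> n y w"
proof -
  have c: "AE x in M. continuous_map (top_of_set S) (Hdot_topology n) (\<lambda>t. w t x)"
    if "AE x in M. continuous_map (top_of_set S) (Hdot_topology m) (\<lambda>t. w t x)" for S :: "real set"
    using that by eventually_elim (rule continuous_map_Hdot_mono[OF _ assms(2)])
  show ?thesis
    using assms(1) c Hdot_mono(1)[OF _ assms(2)] unfolding global_solution_def solution_on_def by blast
qed

lemma noise_finite_iff: "noise_finite m b \<longleftrightarrow> l2 (\<lambda>k. \<bar>real_of_int k\<bar> ^ m * b k)"
  by (simp add: noise_finite_def l2_def weight_square)

lemma noise_finite_l2: "noise_finite m b \<Longrightarrow> l2 b"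
  unfolding noise_finite_iff
proof (erule l2_mono[where C = 1])
  fix k :: int assume "k \<noteq> 0"
  then have "1 * \<bar>b k\<bar> \<le> \<bar>real_of_int k\<bar> ^ m * \<bar>b k\<bar>"
    by (intro mult_right_mono one_le_power abs_int_ge_1) auto
  then show "\<bar>b k\<bar> \<le> 1 * \<bar>\<bar>real_of_int k\<bar> ^ m * b k\<bar>" by (simp add: abs_mult)
qed

lemma noise_B_0: "l2 b \<Longrightarrow> noise_B 0 b = (norm (synth b))\<^sup>2"
  by (simp add: noise_B_def norm_synth_infsum)

text \<open>The gauge integral takes the value 0 when it does not exist, so the sign is available
  for every sample point, also off the event of good paths.\<close>

lemma integral_nonneg_any:
  fixes f :: "real \<Rightarrow> real"
  assumes "\<And>x. f x \<ge> 0" shows "integral S f \<ge> 0"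
  by (cases "f integrable_on S") (auto intro: Henstock_Kurzweil_Integration.integral_nonneg assms simp: not_integrable_integral)

locale solution_setting = noise M F \<beta>
  for M :: "'w measure" and F and \<beta> +
  fixes b :: "int \<Rightarrow> real" and m p :: nat and \<nu> C :: real and W :: "L2 \<Rightarrow> real \<Rightarrow> 'w \<Rightarrow> L2"
  assumes m: "m \<ge> 1" and nu: "\<nu> > 0" and p: "p > m" "noise_finite p b"
    and family: "solution_family M F (-2) \<nu> b \<beta> m W"
    and stab: "stability_constant TYPE('w) C"
    and large: "\<nu> ^ 3 \<ge> 8 * C * noise_B 0 b"
begin

lemma C_pos: "C > 0" using stab by (simp add: stability_constant_def)

lemma l2_b: "l2 b" by (rule noise_finite_l2[OF p(2)])

lemma solution: "y \<in> Hdot m \<Longrightarrow> global_solution M (-2) \<nu> b \<beta> 1 y (W y)"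
  by (rule global_solution_mono[OF _ m]) (use family in \<open>simp add: solution_family_def\<close>)

lemma W_measurable_F: "y \<in> Hdot m \<Longrightarrow> t \<ge> 0 \<Longrightarrow> W y t \<in> F t \<rightarrow>\<^sub>M Hdot_borel m"
  using family by (simp add: solution_family_def adapted_def)

lemma W_measurable: "y \<in> Hdot m \<Longrightarrow> t \<ge> 0 \<Longrightarrow> W y t \<in> M \<rightarrow>\<^sub>M Hdot_borel m"
  by (rule measurable_F_M[OF _ W_measurable_F])

lemma energy_setting_W:
  assumes "y \<in> Hdot m" "T > 0"
  shows "energy_setting M F \<beta> \<nu> T b y (W y)"
proof unfold_locales
  show "(\<lambda>x. coef (W y t x) k) \<in> borel_measurable (F t)" if "t \<ge> 0" for t k
    by (rule measurable_compose[OF W_measurable_F[OF assms(1) that] measurable_coef_Hdot])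
qed (use nu assms l2_b solution in auto)

text \<open>The order of quantifiers matters: \<open>t\<close> depends on \<open>R\<close> and
  \<open>L\<close> alone, so one time serves all pairs in the ball and all functions of the given
  Lipschitz constant. The solutions may be far apart on an event of probability at most 13/16, where
  the values differ by at most 1.\<close>

lemma contraction:
  assumes R: "R \<ge> 0" and L: "L \<ge> 0"
  shows "\<exists>t>0. \<forall>\<phi> y1 y2. lip01 L \<phi> \<longrightarrow> y1 \<in> Hdot m \<longrightarrow> y2 \<in> Hdot m \<longrightarrow> norm y1 \<le> R \<longrightarrow> norm y2 \<le> R \<longrightarrow>
     \<bar>transition M W t \<phi> y1 - transition M W t \<phi> y2\<bar> \<le> 7/8"
proof -
  define B where "B = (norm (synth b))\<^sup>2"
  have B: "8 * C * B \<le> \<nu> ^ 3" "B \<ge> 0" using large noise_B_0[OF l2_b] by (simp_all add: B_def)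
  \<comment> \<open>Then \<open>exp (- K / 2)\<close> equals \<open>1 / (32 * L * R + 1)\<close>,
    and initial data at distance \<open>2 * R\<close> contracted by this factor change a function of
    Lipschitz constant \<open>L\<close> by at most 1/16.\<close>
  define K where "K = 2 * ln (32 * L * R + 1)"
  have LR: "32 * L * R + 1 \<ge> 1" using L R by simp
  have K: "K \<ge> 0" unfolding K_def using LR by simp
  have expK: "L * (2 * R * exp (- K / 2)) \<le> 1/16"
  proof -
    have "exp (- K / 2) = 1 / (32 * L * R + 1)"
      using LR by (simp add: K_def exp_minus inverse_eq_divide)
    then have "L * (2 * R * exp (- K / 2)) = 2 * L * R / (32 * L * R + 1)" by simp
    also have "\<dots> \<le> 1/16"
    proof -
      have "z \<ge> 0 \<Longrightarrow> 2 * z / (32 * z + 1) \<le> 1 / 16" for z :: real by (simp add: divide_simps)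
      from this[of "L * R"] show ?thesis using L R by (simp add: mult.assoc)
    qed
    finally show ?thesis .
  qed
  define q where "q = C * (R\<^sup>2 + 2) / \<nu>\<^sup>2"
  have q: "q \<ge> 0" using C_pos by (simp add: q_def)
  \<comment> \<open>\<open>s\<close> is the decay \<open>\<nu> * t / 4\<close> of the exponent. The
    factor 16 serves \<open>ratio\<close>, which needs \<open>2 * q + 13/8 * K \<le> s / 8\<close>;
    here \<open>q\<close> collects the part of the energy bound that does not grow with
    time.\<close>
  define s where "s = 16 * (q + K + 1)"
  have sK: "s - K > 0" using q K by (simp add: s_def)
  have s: "s > 0" using q K by (simp add: s_def)
  define t where "t = 4 * s / \<nu>"
  have t: "t > 0" using s nu by (simp add: t_def)
  \<comment> \<open>The level for \<open>2 * \<nu>\<close> times the two dissipation integrals: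
    below it they raise the exponent by at most \<open>s - K\<close>, so the exponent is at most
    \<open>- K\<close>.\<close>
  define lv where "lv = 2 * \<nu>\<^sup>2 / C * (s - K)"
  have lv: "lv > 0" using nu C_pos sK by (simp add: lv_def)
  \<comment> \<open>The mean growth \<open>C / \<nu> * (2 * (3/2 * t * B) / (2 * \<nu>))\<close> of the exponent is at most \<open>3/16 * \<nu> * t\<close>,
    which the decay \<open>\<nu> * t / 4\<close> beats.\<close>
  have ratio: "2 * (R\<^sup>2 + 3/2 * t * B + 2) \<le> 13/16 * lv"
  proof -
    have qn: "q * \<nu>\<^sup>2 = C * (R\<^sup>2 + 2)" using nu by (simp add: q_def)
    have "C * (2 * (R\<^sup>2 + 3/2 * t * B + 2)) = 2 * (q * \<nu>\<^sup>2) + 3 * t * (C * B)"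
      unfolding qn by (simp add: algebra_simps)
    also have "3 * t * (C * B) \<le> 3 * t * (\<nu> ^ 3 / 8)"
      using B(1) t by (intro mult_left_mono) auto
    also have "3 * t * (\<nu> ^ 3 / 8) = 3/2 * s * \<nu>\<^sup>2"
      using nu by (simp add: t_def power2_eq_square power3_eq_cube)
    also have "2 * (q * \<nu>\<^sup>2) + 3/2 * s * \<nu>\<^sup>2 = (2 * q + 3/2 * s) * \<nu>\<^sup>2" by (simp add: algebra_simps)
    also have "\<dots> \<le> (13/8 * (s - K)) * \<nu>\<^sup>2"
      using K by (intro mult_right_mono) (auto simp: s_def)
    also have "\<dots> = C * (13/16 * lv)" using C_pos by (simp add: lv_def)
    finally show ?thesis using C_pos by simp
  qed
  have main: "\<bar>transition M W t \<phi> y1 - transition M W t \<phi> y2\<bar> \<le> 7/8"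
    if \<phi>: "lip01 L \<phi>" and y: "y1 \<in> Hdot m" "y2 \<in> Hdot m" "norm y1 \<le> R" "norm y2 \<le> R" for \<phi> y1 y2
  proof -
    let ?I = "\<lambda>y x. integral {0..t} (\<lambda>r. (Hdot_norm 1 (W y r x))\<^sup>2)"
    have I0: "?I y x \<ge> 0" for y x by (rule integral_nonneg_any) simp
    have ex: "\<exists>D\<in>borel_measurable M. (AE x in M. ennreal (2 * \<nu> * ?I y x) \<le> D x) \<and> (\<integral>\<^sup>+x. D x \<partial>M) \<le> ennreal (R\<^sup>2 + 3/2 * t * B + 2)"
      if "y \<in> Hdot m" "norm y \<le> R" for y
    proof -
      interpret es: energy_setting M F \<beta> \<nu> t b y "W y" by (rule energy_setting_W[OF that(1) t])
      have "(norm y)\<^sup>2 + 3/2 * t * B + 2 \<le> R\<^sup>2 + 3/2 * t * B + 2"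
        using power_mono[OF that(2) norm_ge_zero, of 2] by simp
      then have "ennreal ((norm y)\<^sup>2 + 3/2 * t * B + 2) \<le> ennreal (R\<^sup>2 + 3/2 * t * B + 2)" by (rule ennreal_leI)
      then show ?thesis using es.energy_bound unfolding B_def by (meson order_trans)
    qed
    obtain D1 where D1[measurable]: "D1 \<in> borel_measurable M" and D1a: "AE x in M. ennreal (2 * \<nu> * ?I y1 x) \<le> D1 x"
      and D1i: "(\<integral>\<^sup>+x. D1 x \<partial>M) \<le> ennreal (R\<^sup>2 + 3/2 * t * B + 2)" using ex[OF y(1,3)] by blast
    obtain D2 where D2[measurable]: "D2 \<in> borel_measurable M" and D2a: "AE x in M. ennreal (2 * \<nu> * ?I y2 x) \<le> D2 x"
      and D2i: "(\<integral>\<^sup>+x. D2 x \<partial>M) \<le> ennreal (R\<^sup>2 + 3/2 * t * B + 2)" using ex[OF y(2,4)] by blast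
    \<comment> \<open>Defined through the majorants, hence measurable. Markov's inequality together
      with \<open>ratio\<close> bounds its probability.\<close>
    define bad where "bad = {x\<in>space M. ennreal lv \<le> D1 x + D2 x}"
    have bad[measurable]: "bad \<in> sets M" unfolding bad_def by measurable
    have pbad: "prob bad \<le> 13/16"
    proof -
      have "ennreal (lv * prob bad) = ennreal lv * emeasure M bad"
        using lv by (simp add: emeasure_eq_measure ennreal_mult)
      also have "\<dots> = (\<integral>\<^sup>+x. ennreal lv * indicator bad x \<partial>M)" by (simp add: nn_integral_cmult_indicator)
      also have "\<dots> \<le> (\<integral>\<^sup>+x. D1 x + D2 x \<partial>M)"
        by (rule nn_integral_mono) (simp add: bad_def indicator_def)
      also have "\<dots> = (\<integral>\<^sup>+x. D1 x \<partial>M) + (\<integral>\<^sup>+x. D2 x \<partial>M)" by (rule nn_integral_add) measurable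
      also have "\<dots> \<le> ennreal (R\<^sup>2 + 3/2 * t * B + 2) + ennreal (R\<^sup>2 + 3/2 * t * B + 2)" by (intro add_mono D1i D2i)
      also have "\<dots> = ennreal (2 * (R\<^sup>2 + 3/2 * t * B + 2))"
        using t B by (subst ennreal_plus[symmetric]) auto
      also have "\<dots> \<le> ennreal (13/16 * lv)" by (rule ennreal_leI[OF ratio])
      finally have "lv * prob bad \<le> 13/16 * lv" using lv by (simp add: ennreal_le_iff)
      then show ?thesis using lv by simp
    qed
    have st: "AE x in M. \<forall>t\<ge>0. (norm (W y1 t x - W y2 t x))\<^sup>2 \<le> (norm (y1 - y2))\<^sup>2 *
             exp (- (\<nu> * t / 4) + C / \<nu> * (integral {0..t} (\<lambda>s. (Hdot_norm 1 (W y1 s x))\<^sup>2) + integral {0..t} (\<lambda>s. (Hdot_norm 1 (W y2 s x))\<^sup>2)))"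
    proof -
      have "1 < p" using m p by simp
      then show ?thesis
        using stab brownian_family nu p(2) solution[OF y(1)] solution[OF y(2)] unfolding stability_constant_def by blast
    qed
    have le: "AE x in M. \<bar>\<phi> (W y1 t x) - \<phi> (W y2 t x)\<bar> \<le> 1/16 + indicator bad x"
      using st D1a D2a AE_space
    proof eventually_elim
      case (elim x)
      show ?case
      proof (cases "x \<in> bad")
        case True
        have "\<bar>\<phi> (W y1 t x) - \<phi> (W y2 t x)\<bar> \<le> 1"
          using \<phi> unfolding lip01_def abs_le_iff by (smt (verit))
        then show ?thesis using True by simp
      next
        case False
        then have "D1 x + D2 x < ennreal lv" using elim(4) by (simp add: bad_def not_le)
        moreover have "ennreal (2 * \<nu> * ?I y1 x + 2 * \<nu> * ?I y2 x) \<le> D1 x + D2 x"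
          using nu I0 elim(2,3) by (subst ennreal_plus) (auto intro: add_mono)
        ultimately have "ennreal (2 * \<nu> * ?I y1 x + 2 * \<nu> * ?I y2 x) < ennreal lv" by (rule le_less_trans[rotated])
        then have "2 * \<nu> * ?I y1 x + 2 * \<nu> * ?I y2 x < lv"
          by (rule contrapos_pp) (simp only: not_less ennreal_leI)
        then have sum: "2 * \<nu> * (?I y1 x + ?I y2 x) \<le> lv" by (simp add: distrib_left)
        have "C / \<nu> * (?I y1 x + ?I y2 x) = C / (2 * \<nu>\<^sup>2) * (2 * \<nu> * (?I y1 x + ?I y2 x))"
          using nu by (simp add: power2_eq_square)
        also have "\<dots> \<le> C / (2 * \<nu>\<^sup>2) * lv" using C_pos by (intro mult_left_mono sum) simp
        also have "\<dots> = s - K" using C_pos nu by (simp add: lv_def)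
        finally have "- (\<nu> * t / 4) + C / \<nu> * (?I y1 x + ?I y2 x) \<le> - K"
          using nu by (simp add: t_def)
        then have e: "exp (- (\<nu> * t / 4) + C / \<nu> * (?I y1 x + ?I y2 x)) \<le> (exp (- K / 2))\<^sup>2"
          by (simp add: power2_eq_square flip: exp_add)
        have "norm (y1 - y2) \<le> 2 * R" using norm_triangle_ineq4[of y1 y2] y(3,4) by simp
        then have n: "(norm (y1 - y2))\<^sup>2 \<le> (2 * R)\<^sup>2" by (intro power_mono) auto
        have "(norm (W y1 t x - W y2 t x))\<^sup>2 \<le> (norm (y1 - y2))\<^sup>2 * exp (- (\<nu> * t / 4) + C / \<nu> * (?I y1 x + ?I y2 x))"
          using elim(1) t by simp
        also have "\<dots> \<le> (2 * R)\<^sup>2 * (exp (- K / 2))\<^sup>2" by (intro mult_mono n e) auto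
        also have "\<dots> = (2 * R * exp (- K / 2))\<^sup>2" by (simp only: power_mult_distrib)
        finally have "norm (W y1 t x - W y2 t x) \<le> 2 * R * exp (- K / 2)"
          by (rule power2_le_imp_le) (use R in simp)
        then have "L * norm (W y1 t x - W y2 t x) \<le> L * (2 * R * exp (- K / 2))" by (rule mult_left_mono[OF _ L])
        then have "\<bar>\<phi> (W y1 t x) - \<phi> (W y2 t x)\<bar> \<le> 1/16"
          using \<phi> expK unfolding lip01_def by (meson order_trans)
        then show ?thesis using False by simp
      qed
    qed
    have im: "(\<lambda>x. \<phi> (W y t x)) \<in> borel_measurable M" if "y \<in> Hdot m" for y
      by (rule measurable_compose[OF W_measurable[OF that less_imp_le[OF t]] lip01_measurable[OF \<phi>]])
    have i: "integrable M (\<lambda>x. \<phi> (W y t x))" if "y \<in> Hdot m" for y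
      by (rule integrable_const_bound[where B = 1, OF AE_I2 im[OF that]]) (use \<phi> in \<open>simp add: lip01_def\<close>)
    have "transition M W t \<phi> y1 - transition M W t \<phi> y2 = expectation (\<lambda>x. \<phi> (W y1 t x) - \<phi> (W y2 t x))"
      unfolding transition_def by (rule Bochner_Integration.integral_diff[symmetric]) (intro i y)+
    also have "\<bar>\<dots>\<bar> \<le> expectation (\<lambda>x. \<bar>\<phi> (W y1 t x) - \<phi> (W y2 t x)\<bar>)" by (rule integral_abs_bound)
    also have "\<dots> \<le> expectation (\<lambda>x. 1/16 + indicator bad x)"
      by (rule integral_mono_AE[OF _ _ le]) (auto intro!: integrable_abs Bochner_Integration.integrable_diff i y Bochner_Integration.integrable_add integrable_real_indicator simp: emeasure_eq_measure)
    also have "\<dots> = 1/16 + prob bad"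
      by (subst Bochner_Integration.integral_add) (auto simp: prob_space emeasure_eq_measure intro!: integrable_real_indicator)
    also have "\<dots> \<le> 7/8" using pbad by simp
    finally show ?thesis .
  qed
  show ?thesis by (rule exI[of _ t]) (use t main in blast)
qed

text \<open>The shift by 1 is recorded because the integrability argument below compares invariance
  for a function and for the shifted one.\<close>

lemma transition_bounds:
  assumes "lip01 L \<phi>" "y \<in> Hdot m" "t \<ge> 0"
  shows "0 \<le> transition M W t \<phi> y" "transition M W t \<phi> y \<le> 1" "transition M W t (\<lambda>u. \<phi> u + 1) y = transition M W t \<phi> y + 1"
proof -
  have im: "(\<lambda>x. \<phi> (W y t x)) \<in> borel_measurable M"
    by (rule measurable_compose[OF W_measurable[OF assms(2,3)] lip01_measurable[OF assms(1)]])
  have i: "integrable M (\<lambda>x. \<phi> (W y t x))"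
    by (rule integrable_const_bound[where B = 1, OF AE_I2 im]) (use assms in \<open>simp add: lip01_def\<close>)
  show "0 \<le> transition M W t \<phi> y" unfolding transition_def
    by (rule Bochner_Integration.integral_nonneg) (use assms in \<open>simp add: lip01_def\<close>)
  have "transition M W t \<phi> y \<le> expectation (\<lambda>x. 1)" unfolding transition_def
    by (rule integral_mono[OF i]) (use assms in \<open>simp_all add: lip01_def\<close>)
  then show "transition M W t \<phi> y \<le> 1" by (simp add: prob_space)
  show "transition M W t (\<lambda>u. \<phi> u + 1) y = transition M W t \<phi> y + 1"
    unfolding transition_def using i by (simp add: prob_space)
qed

text \<open>Measurability of \<open>y \<mapsto> P\<^sub>t \<phi> y\<close> need not be proved from the equation: a non-integrable
  function has integral \<open>0\<close>, so invariance for both \<open>\<phi>\<close> and \<open>\<phi> + 1\<close> forces integrability.\<close>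

lemma transition_integrable:
  assumes inv: "invariant_measure m (transition M W) \<mu>" and \<phi>: "lip01 L \<phi>" and t: "t \<ge> 0"
  shows "integrable \<mu> (transition M W t \<phi>)" "(LINT y|\<mu>. transition M W t \<phi> y) = (LINT y|\<mu>. \<phi> y)"
proof -
  interpret \<mu>: prob_space \<mu> using inv by (simp add: invariant_measure_def)
  have s: "sets \<mu> = sets (Hdot_borel m)" using inv by (simp add: invariant_measure_def)
  have sp: "space \<mu> = Hdot m" using sets_eq_imp_space_eq[OF s] by simp
  have pm: "\<phi> \<in> borel_measurable (Hdot_borel m)" by (rule lip01_measurable[OF \<phi>])
  have bd: "bounded (\<phi> ` Hdot m)" "bounded ((\<lambda>u. \<phi> u + 1) ` Hdot m)"
    using \<phi> by (auto simp: bounded_iff lip01_def intro!: exI[of _ 2]) (smt (verit))+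
  have e1: "(LINT y|\<mu>. transition M W t \<phi> y) = (LINT y|\<mu>. \<phi> y)"
    using inv t pm bd(1) unfolding invariant_measure_def by blast
  then show "(LINT y|\<mu>. transition M W t \<phi> y) = (LINT y|\<mu>. \<phi> y)" .
  have "(\<lambda>u. \<phi> u + 1) \<in> borel_measurable (Hdot_borel m)" using pm by simp
  then have e2: "(LINT y|\<mu>. transition M W t (\<lambda>u. \<phi> u + 1) y) = (LINT y|\<mu>. \<phi> y + 1)"
    using inv t bd(2) unfolding invariant_measure_def by blast
  have i: "integrable \<mu> \<phi>"
  proof (rule \<mu>.integrable_const_bound[where B = 1])
    show "AE x in \<mu>. norm (\<phi> x) \<le> 1" using \<phi> by (simp add: lip01_def)
    show "\<phi> \<in> borel_measurable \<mu>" using pm by (simp add: measurable_cong_sets[OF s refl])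
  qed
  show "integrable \<mu> (transition M W t \<phi>)"
  proof (rule ccontr)
    assume n: "\<not> integrable \<mu> (transition M W t \<phi>)"
    have "\<not> integrable \<mu> (transition M W t (\<lambda>u. \<phi> u + 1))"
    proof
      assume "integrable \<mu> (transition M W t (\<lambda>u. \<phi> u + 1))"
      then have "integrable \<mu> (\<lambda>y. transition M W t (\<lambda>u. \<phi> u + 1) y - 1)" by simp
      also have "?this \<longleftrightarrow> integrable \<mu> (transition M W t \<phi>)"
        by (rule Bochner_Integration.integrable_cong[OF refl]) (simp add: sp transition_bounds(3)[OF \<phi> _ t])
      finally show False using n by simp
    qed
    then have "(LINT y|\<mu>. \<phi> y + 1) = 0" using e2 by (simp add: not_integrable_integral_eq)
    moreover have "(LINT y|\<mu>. \<phi> y) = 0" using e1 n by (simp add: not_integrable_integral_eq)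
    ultimately show False using i by (simp add: \<mu>.prob_space)
  qed
qed

end

section \<open>Integrals against two measures with a Hahn decomposition\<close>

lemma integral_indicator_mono_measure:
  assumes p: "prob_space M" "prob_space N" and s: "sets N = sets M" and A: "A \<in> sets M"
    and le: "\<And>X. X \<in> sets M \<Longrightarrow> X \<subseteq> A \<Longrightarrow> emeasure N X \<le> emeasure M X"
    and g: "g \<in> borel_measurable M" "\<And>x. x \<in> space M \<Longrightarrow> 0 \<le> g x" "\<And>x. x \<in> space M \<Longrightarrow> g x \<le> (K :: real)"
  shows "(LINT x|N. indicator A x * g x) \<le> (LINT x|M. indicator A x * g x)"
proof -
  interpret M: prob_space M by (rule p) 
  interpret N: prob_space N by (rule p)
  have sp: "space N = space M" by (rule sets_eq_imp_space_eq[OF s])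
  have gN: "g \<in> borel_measurable N" using g(1) by (simp add: measurable_cong_sets[OF s refl])
  have AN: "A \<in> sets N" using A s by simp
  have K: "\<bar>indicator A x * g x\<bar> \<le> \<bar>K\<bar>" if "x \<in> space M" for x
    using g(2,3)[OF that] by (simp add: indicator_def)
  have iM: "integrable M (\<lambda>x. indicator A x * g x)"
    by (rule M.integrable_const_bound[where B = "\<bar>K\<bar>"]) (use K g A in \<open>auto intro!: AE_I2\<close>)
  have iN: "integrable N (\<lambda>x. indicator A x * g x)"
    by (rule N.integrable_const_bound[where B = "\<bar>K\<bar>"]) (use K gN AN sp in \<open>auto intro!: AE_I2\<close>)
  \<comment> \<open>Restricted to \<open>A\<close> the two measures are ordered on every measurable
    set, so integrals of nonnegative functions can be compared.\<close>
  have dle: "density N (indicator A) \<le> density M (indicator A)"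
    using le A AN s by (subst le_measure) (auto simp: emeasure_restricted)
  have "(\<integral>\<^sup>+x. ennreal (indicator A x * g x) \<partial>N) = (\<integral>\<^sup>+x. ennreal (g x) \<partial>density N (indicator A))"
    using gN AN by (subst nn_integral_density) (auto intro!: nn_integral_cong simp: indicator_def)
  also have "\<dots> \<le> (\<integral>\<^sup>+x. ennreal (g x) \<partial>density M (indicator A))"
    by (rule nn_integral_mono_measure[OF _ dle]) (simp add: s)
  also have "\<dots> = (\<integral>\<^sup>+x. ennreal (indicator A x * g x) \<partial>M)"
    using g(1) A by (subst nn_integral_density) (auto intro!: nn_integral_cong simp: indicator_def)
  finally have "(\<integral>\<^sup>+x. ennreal (indicator A x * g x) \<partial>N) \<le> (\<integral>\<^sup>+x. ennreal (indicator A x * g x) \<partial>M)" .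
  moreover have "(\<integral>\<^sup>+x. ennreal (indicator A x * g x) \<partial>N) = ennreal (LINT x|N. indicator A x * g x)"
    by (rule nn_integral_eq_integral[OF iN]) (use g(2) sp in \<open>auto intro!: AE_I2\<close>)
  moreover have "(\<integral>\<^sup>+x. ennreal (indicator A x * g x) \<partial>M) = ennreal (LINT x|M. indicator A x * g x)"
    by (rule nn_integral_eq_integral[OF iM]) (use g(2) in \<open>auto intro!: AE_I2\<close>)
  moreover have "0 \<le> (LINT x|M. indicator A x * g x)"
    by (rule integral_nonneg_AE) (use g(2) in \<open>auto intro!: AE_I2\<close>)
  ultimately show ?thesis by (simp add: ennreal_le_iff)
qed

text \<open>On \<open>A\<close> the ordering of the measures is applied to \<open>K - g\<close>, on
  the complement to \<open>K + g\<close>, both nonnegative. The two measures have the same total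
  mass, so the difference of masses on the complement is the same up to sign and the constants add
  to \<open>2 * K\<close>.\<close>

lemma Hahn_integral_bound:
  assumes p: "prob_space M" "prob_space N" and s: "sets N = sets M" and A: "A \<in> sets M"
    and pos: "\<And>X. X \<in> sets M \<Longrightarrow> X \<subseteq> A \<Longrightarrow> emeasure N X \<le> emeasure M X"
    and neg: "\<And>X. X \<in> sets M \<Longrightarrow> X \<inter> A = {} \<Longrightarrow> emeasure M X \<le> emeasure N X"
    and g: "g \<in> borel_measurable M" "\<And>x. x \<in> space M \<Longrightarrow> \<bar>g x\<bar> \<le> (K :: real)"
  shows "(LINT x|M. g x) - (LINT x|N. g x) \<le> 2 * K * (measure M A - measure N A)"
proof -
  interpret M: prob_space M by (rule p) 
  interpret N: prob_space N by (rule p)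
  have sp: "space N = space M" by (rule sets_eq_imp_space_eq[OF s])
  have gN: "g \<in> borel_measurable N" using g(1) by (simp add: measurable_cong_sets[OF s refl])
  have AN: "A \<in> sets N" using A s by simp
  let ?A' = "space M - A"
  have A': "?A' \<in> sets M" "?A' \<in> sets N" using A AN s by auto
  have gb: "- K \<le> g x" "g x \<le> K" if "x \<in> space M" for x using g(2)[OF that] by auto
  have igM: "integrable M (\<lambda>x. indicator X x * g x)" if "X \<in> sets M" for X
    by (rule M.integrable_const_bound[where B = "\<bar>K\<bar>"]) (use g that in \<open>force intro!: AE_I2 simp: indicator_def\<close>)+
  have igN: "integrable N (\<lambda>x. indicator X x * g x)" if "X \<in> sets M" for X
    by (rule N.integrable_const_bound[where B = "\<bar>K\<bar>"]) (use g(2) gN that s sp in \<open>force intro!: AE_I2 simp: indicator_def\<close>)+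
  have icM: "integrable M (\<lambda>x. indicator X x * K)" if "X \<in> sets M" for X using that by (simp add: M.emeasure_eq_measure)
  have icN: "integrable N (\<lambda>x. indicator X x * K)" if "X \<in> sets M" for X using that s by (simp add: N.emeasure_eq_measure)
  have cM: "(LINT x|M. indicator X x * K) = measure M X * K" if "X \<in> sets M" for X
    using that sets.sets_into_space[OF that] by (simp add: Int_absorb2)
  have cN: "(LINT x|N. indicator X x * K) = measure N X * K" if "X \<in> sets M" for X
  proof -
    have "X \<in> sets N" using that s by simp
    then show ?thesis using sets.sets_into_space[of X N] by (simp add: Int_absorb2)
  qed
  have "(LINT x|N. indicator A x * (K - g x)) \<le> (LINT x|M. indicator A x * (K - g x))"
    by (rule integral_indicator_mono_measure[OF p s A pos, where K = "2 * K"]) (use g(1) gb in force)+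
  then have 1: "(LINT x|M. indicator A x * g x) - (LINT x|N. indicator A x * g x) \<le> K * (measure M A - measure N A)"
    by (simp only: right_diff_distrib Bochner_Integration.integral_diff[OF icM[OF A] igM[OF A]] Bochner_Integration.integral_diff[OF icN[OF A] igN[OF A]] cM[OF A] cN[OF A])
       (simp add: algebra_simps)
  have "(LINT x|M. indicator ?A' x * (K + g x)) \<le> (LINT x|N. indicator ?A' x * (K + g x))"
    by (rule integral_indicator_mono_measure[OF p(2,1) s[symmetric] A'(2), where K = "2 * K"])
       (use neg gN gb s sp in force)+
  then have 2: "(LINT x|M. indicator ?A' x * g x) - (LINT x|N. indicator ?A' x * g x) \<le> K * (measure N ?A' - measure M ?A')"
    by (simp only: distrib_left Bochner_Integration.integral_add[OF icM[OF A'(1)] igM[OF A'(1)]] Bochner_Integration.integral_add[OF icN[OF A'(1)] igN[OF A'(1)]] cM[OF A'(1)] cN[OF A'(1)])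
       (simp add: algebra_simps)
  have "measure M ?A' = 1 - measure M A" using M.prob_compl[OF A] .
  moreover have "measure N ?A' = 1 - measure N A" using N.prob_compl[OF AN] by (simp add: sp)
  ultimately have 2: "(LINT x|M. indicator ?A' x * g x) - (LINT x|N. indicator ?A' x * g x) \<le> K * (measure M A - measure N A)"
    using 2 by simp
  have "(LINT x|M. g x) = (LINT x|M. indicator A x * g x + indicator ?A' x * g x)"
    by (rule Bochner_Integration.integral_cong) (auto simp: indicator_def)
  then have 3: "(LINT x|M. g x) = (LINT x|M. indicator A x * g x) + (LINT x|M. indicator ?A' x * g x)"
    by (simp only: Bochner_Integration.integral_add[OF igM[OF A] igM[OF A'(1)]])
  have "(LINT x|N. g x) = (LINT x|N. indicator A x * g x + indicator ?A' x * g x)"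
    by (rule Bochner_Integration.integral_cong) (auto simp: indicator_def sp)
  then have 4: "(LINT x|N. g x) = (LINT x|N. indicator A x * g x) + (LINT x|N. indicator ?A' x * g x)"
    by (simp only: Bochner_Integration.integral_add[OF igN[OF A] igN[OF A'(1)]])
  show ?thesis using 1 2 unfolding 3 4 by (simp add: algebra_simps)
qed

context solution_setting
begin

lemma invariant_measure_unique:
  assumes inv: "invariant_measure m (transition M W) \<mu>1" "invariant_measure m (transition M W) \<mu>2"
  shows "\<mu>1 = \<mu>2"
proof (rule ccontr)
  assume neq: "\<mu>1 \<noteq> \<mu>2"
  have p: "prob_space \<mu>1" "prob_space \<mu>2" and s: "sets \<mu>1 = sets (Hdot_borel m)" "sets \<mu>2 = sets (Hdot_borel m)"
    using inv unfolding invariant_measure_def by blast+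
  have s21: "sets \<mu>2 = sets \<mu>1" using s by simp
  interpret \<mu>1: prob_space \<mu>1 by (rule p)
  interpret \<mu>2: prob_space \<mu>2 by (rule p)
  have sp: "space \<mu>1 = Hdot m" "space \<mu>2 = Hdot m" using s[THEN sets_eq_imp_space_eq] by simp_all
  obtain A where A: "A \<in> sets \<mu>1"
    and pos: "\<And>X. X \<in> sets \<mu>1 \<Longrightarrow> X \<subseteq> A \<Longrightarrow> emeasure \<mu>2 X \<le> emeasure \<mu>1 X"
    and neg: "\<And>X. X \<in> sets \<mu>1 \<Longrightarrow> X \<inter> A = {} \<Longrightarrow> emeasure \<mu>1 X \<le> emeasure \<mu>2 X"
    by (rule bexE[OF finite_unsigned_Hahn_decomposition[OF \<mu>1.finite_measure_axioms \<mu>2.finite_measure_axioms s21]]) auto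
  have Hahn: "(LINT x|\<mu>1. g x) - (LINT x|\<mu>2. g x) \<le> 2 * K * (measure \<mu>1 A - measure \<mu>2 A)"
    if "g \<in> borel_measurable \<mu>1" "\<And>x. x \<in> space \<mu>1 \<Longrightarrow> \<bar>g x\<bar> \<le> K" for g :: "L2 \<Rightarrow> real" and K
    by (rule Hahn_integral_bound[OF p s21 A]) (fact pos neg that)+
  define \<theta> where "\<theta> = measure \<mu>1 A - measure \<mu>2 A"
  \<comment> \<open>Otherwise the Hahn bound, applied to the indicator of any set and to its
    negative, makes the two measures agree.\<close>
  have \<theta>: "\<theta> > 0"
  proof (rule ccontr)
    assume n: "\<not> \<theta> > 0"
    have "emeasure \<mu>1 X = emeasure \<mu>2 X" if X: "X \<in> sets \<mu>1" for X
    proof -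
      have X2: "X \<in> sets \<mu>2" using X s21 by simp
      have i: "(LINT x|\<mu>1. indicator X x) = measure \<mu>1 X" "(LINT x|\<mu>2. indicator X x) = measure \<mu>2 X"
        using sets.sets_into_space[OF X] sets.sets_into_space[OF X2] by (simp_all add: Int_absorb2)
      have m: "(indicator X :: L2 \<Rightarrow> real) \<in> borel_measurable \<mu>1" using X by simp
      have "(LINT x|\<mu>1. indicator X x) - (LINT x|\<mu>2. indicator X x) \<le> 2 * (1::real) * (measure \<mu>1 A - measure \<mu>2 A)"
        by (rule Hahn[OF m]) (simp add: indicator_def)
      moreover have "(LINT x|\<mu>1. - indicator X x) - (LINT x|\<mu>2. - indicator X x) \<le> 2 * (1::real) * (measure \<mu>1 A - measure \<mu>2 A)"
        by (rule Hahn[OF borel_measurable_uminus[OF m]]) (simp add: indicator_def)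
      ultimately have "measure \<mu>1 X = measure \<mu>2 X"
        using n unfolding Bochner_Integration.integral_minus i \<theta>_def mult_1_right
        by - (rule antisym; simp)
      then show ?thesis by (simp add: \<mu>1.emeasure_eq_measure \<mu>2.emeasure_eq_measure)
    qed
    then have "\<mu>1 = \<mu>2" by (rule measure_eqI[OF s21[symmetric]])
    with neq show False by simp
  qed
  \<comment> \<open>The final comparison loses \<open>2 * e\<close> in approximating
    \<open>A\<close> and \<open>4 * e\<close> from the far region. In total this is 3/32 of
    \<open>\<theta>\<close>, below the gap of 1/8 left by the factor 7/8.\<close>
  define e where "e = \<theta> / 64"
  have e: "e > 0" using \<theta> by (simp add: e_def)
  have As: "A \<in> sets (Hdot_borel m)" using A s by simp
  obtain L \<phi> where \<phi>: "lip01 L \<phi>" and ap: "(LINT u|\<mu>1. \<bar>indicator A u - \<phi> u\<bar>) < e" "(LINT u|\<mu>2. \<bar>indicator A u - \<phi> u\<bar>) < e"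
    using approximable_Hdot_borel[OF p s As] e unfolding approximable_def by blast
  have \<phi>m: "\<phi> \<in> borel_measurable \<mu>1" "\<phi> \<in> borel_measurable \<mu>2"
    using lip01_measurable[OF \<phi>, of m] by (simp_all add: measurable_cong_sets[OF s(1) refl] measurable_cong_sets[OF s(2) refl])
  have \<phi>i: "integrable \<mu>1 \<phi>" "integrable \<mu>2 \<phi>"
    by (rule \<mu>1.integrable_const_bound[where B = 1] \<mu>2.integrable_const_bound[where B = 1]; use \<phi> \<phi>m in \<open>simp add: lip01_def\<close>)+
  have close: "\<bar>measure \<mu> A - (LINT u|\<mu>. \<phi> u)\<bar> < e"
    if "prob_space \<mu>" "A \<in> sets \<mu>" "integrable \<mu> \<phi>" "(LINT u|\<mu>. \<bar>indicator A u - \<phi> u\<bar>) < e" for \<mu>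
  proof -
    interpret \<mu>: prob_space \<mu> by (rule that)
    have "(LINT u|\<mu>. indicator A u) = measure \<mu> A" using sets.sets_into_space[OF that(2)] by (simp add: Int_absorb2)
    moreover have "integrable \<mu> (indicator A :: L2 \<Rightarrow> real)"
      using that(2) by (intro integrable_real_indicator) (auto simp: \<mu>.emeasure_eq_measure)
    ultimately have "measure \<mu> A - (LINT u|\<mu>. \<phi> u) = (LINT u|\<mu>. indicator A u - \<phi> u)"
      using that(3) by simp
    also have "\<bar>\<dots>\<bar> \<le> (LINT u|\<mu>. \<bar>indicator A u - \<phi> u\<bar>)" by (rule integral_abs_bound)
    finally show ?thesis using that(4) by simp
  qed
  have low: "(LINT u|\<mu>1. \<phi> u) - (LINT u|\<mu>2. \<phi> u) > \<theta> - 2 * e"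
    using close[OF p(1) A \<phi>i(1) ap(1)] close[OF p(2) _ \<phi>i(2) ap(2)] A s21 unfolding \<theta>_def by auto
  \<comment> \<open>Measured in the \<open>L2\<close> norm, in which the contraction takes its ball.
    The sets decrease to the empty set, so a common radius makes them small for both
    measures.\<close>
  define far where "far n = {u \<in> Hdot m. norm u > real n}" for n :: nat
  have farb: "far n \<in> sets (Hdot_borel m)" for n
  proof -
    have "(\<lambda>u. norm u) \<in> borel_measurable (Hdot_borel m)"
      by (intro continuous_measurable_Hdot_borel continuous_intros)
    then show ?thesis unfolding far_def space_Hdot_borel[of m, symmetric] by measurable
  qed
  have far_sets: "far n \<in> sets \<mu>1" "far n \<in> sets \<mu>2" for n using farb s by simp_all
  have far_lim: "(\<lambda>n. measure \<mu> (far n)) \<longlonglongrightarrow> 0" if "prob_space \<mu>" "\<And>n. far n \<in> sets \<mu>" for \<mu>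
  proof -
    interpret \<mu>: prob_space \<mu> by (rule that)
    have "(\<Inter>n. far n) = {}"
    proof -
      have "u \<notin> (\<Inter>n. far n)" for u
      proof -
        obtain n :: nat where "norm u < real n" using reals_Archimedean2 by blast
        then have "u \<notin> far n" by (simp add: far_def)
        then show ?thesis by blast
      qed
      then show ?thesis by blast
    qed
    moreover have "decseq far" unfolding decseq_def far_def by (auto intro: order.strict_trans1[rotated])
    moreover have "range far \<subseteq> sets \<mu>" using that(2) by blast
    ultimately show ?thesis using \<mu>.finite_Lim_measure_decseq[of far] by simp
  qed
  have "\<forall>\<^sub>F n in sequentially. measure \<mu>1 (far n) < e \<and> measure \<mu>2 (far n) < e"
    by (intro eventually_conj order_tendstoD(2)[OF far_lim[OF p(1) far_sets(1)] e] order_tendstoD(2)[OF far_lim[OF p(2) far_sets(2)] e])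
  then obtain n where n: "measure \<mu>1 (far n) < e" "measure \<mu>2 (far n) < e" by (auto simp: eventually_sequentially)
  have "L \<ge> 0" using \<phi> by (simp add: lip01_def)
  \<comment> \<open>The time is fixed last: it depends on the Lipschitz constant of
    \<open>\<phi>\<close> and on the radius \<open>n\<close>, both of which depend on
    \<open>\<theta>\<close>.\<close>
  then obtain t where t: "t > 0" and osc0: "\<And>y1 y2. y1 \<in> Hdot m \<Longrightarrow> y2 \<in> Hdot m \<Longrightarrow> norm y1 \<le> real n \<Longrightarrow> norm y2 \<le> real n \<Longrightarrow>
     \<bar>transition M W t \<phi> y1 - transition M W t \<phi> y2\<bar> \<le> 7/8"
    using contraction[of "real n" L] \<phi> by auto
  define g where "g = transition M W t \<phi>"
  define near where "near = {u \<in> Hdot m. norm u \<le> real n}"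
  have near_sets: "near \<in> sets \<mu>1" "near \<in> sets \<mu>2"
  proof -
    have "near = space \<mu>1 - far n" "near = space \<mu>2 - far n" by (auto simp: near_def far_def sp)
    then show "near \<in> sets \<mu>1" "near \<in> sets \<mu>2" using far_sets by (metis sets.compl_sets)+
  qed
  have osc: "g y1 \<le> g y2 + 7/8" if "y1 \<in> near" "y2 \<in> near" for y1 y2
    using osc0[of y1 y2] that unfolding near_def g_def abs_le_iff by simp
  have g01: "0 \<le> g y" "g y \<le> 1" if "y \<in> Hdot m" for y
    unfolding g_def using transition_bounds(1,2)[OF \<phi> that less_imp_le[OF t]] by simp_all
  have gi: "integrable \<mu>1 g" "integrable \<mu>2 g"
    and ginv: "(LINT y|\<mu>1. g y) = (LINT y|\<mu>1. \<phi> y)" "(LINT y|\<mu>2. g y) = (LINT y|\<mu>2. \<phi> y)"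
    unfolding g_def using transition_integrable[OF inv(1) \<phi> less_imp_le[OF t]] transition_integrable[OF inv(2) \<phi> less_imp_le[OF t]] by simp_all
  have zero: "0 \<in> near" by (simp add: near_def Hdot_0)
  define lo where "lo = Inf (g ` near)"
  have bb: "bdd_below (g ` near)" by (rule bdd_belowI2[where m = 0]) (simp add: g01 near_def)
  have lo: "lo \<le> g y" if "y \<in> near" for y unfolding lo_def using that bb by (intro cInf_lower) auto
  have up: "g y \<le> lo + 7/8" if "y \<in> near" for y
  proof -
    have "g y - 7/8 \<le> lo" unfolding lo_def
      by (rule cInf_greatest) (use zero osc[OF that] in \<open>auto simp: algebra_simps\<close>)
    then show ?thesis by simp
  qed
  \<comment> \<open>The midpoint of the range allowed on the ball. Subtracting it halves the sup
    norm relative to the oscillation, which offsets the factor 2 in the Hahn bound.\<close>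
  define c where "c = lo + 7/16"
  have c: "\<bar>g y - c\<bar> \<le> 7/16" if "y \<in> near" for y
    using lo[OF that] up[OF that] unfolding c_def abs_le_iff by linarith
  \<comment> \<open>A crude bound for the far region: \<open>c\<close> lies between 7/16 and 23/16
    while \<open>g\<close> takes values between 0 and 1.\<close>
  have c2: "\<bar>g y - c\<bar> \<le> 2" if "y \<in> Hdot m" for y
  proof -
    have "0 \<le> lo" unfolding lo_def by (rule cInf_greatest) (use zero g01 in \<open>auto simp: near_def\<close>)
    moreover have "lo \<le> 1" using lo[OF zero] g01(2)[of 0] by (simp add: Hdot_0)
    ultimately show ?thesis using g01[OF that] unfolding c_def abs_le_iff by linarith
  qed
  have split: "(LINT y|\<mu>. g y) - c \<le> (LINT y|\<mu>. indicator near y * (g y - c)) + 2 * measure \<mu> (far n)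
      \<and> (LINT y|\<mu>. indicator near y * (g y - c)) - 2 * measure \<mu> (far n) \<le> (LINT y|\<mu>. g y) - c"
    if \<mu>: "prob_space \<mu>" "space \<mu> = Hdot m" "far n \<in> sets \<mu>" "near \<in> sets \<mu>" "integrable \<mu> g" for \<mu>
  proof -
    interpret \<mu>: prob_space \<mu> by (rule \<mu>)
    have i0: "integrable \<mu> (\<lambda>y. g y - c)" using \<mu>(5) by simp
    have i1: "integrable \<mu> (\<lambda>y. indicator near y * (g y - c))" "integrable \<mu> (\<lambda>y. indicator (far n) y * (g y - c))"
      using integrable_mult_indicator[OF \<mu>(4) i0] integrable_mult_indicator[OF \<mu>(3) i0] by simp_all
    have "(LINT y|\<mu>. g y) - c = (LINT y|\<mu>. g y - c)" using \<mu>(5) by (simp add: \<mu>.prob_space)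
    also have "\<dots> = (LINT y|\<mu>. indicator near y * (g y - c) + indicator (far n) y * (g y - c))"
      by (rule Bochner_Integration.integral_cong) (auto simp: \<mu>(2) near_def far_def indicator_def)
    also have "\<dots> = (LINT y|\<mu>. indicator near y * (g y - c)) + (LINT y|\<mu>. indicator (far n) y * (g y - c))"
      by (rule Bochner_Integration.integral_add[OF i1])
    finally have eq: "(LINT y|\<mu>. g y) - c = (LINT y|\<mu>. indicator near y * (g y - c)) + (LINT y|\<mu>. indicator (far n) y * (g y - c))" .
    have "\<bar>LINT y|\<mu>. indicator (far n) y * (g y - c)\<bar> \<le> (LINT y|\<mu>. \<bar>indicator (far n) y * (g y - c)\<bar>)" by (rule integral_abs_bound)
    also have "\<dots> \<le> (LINT y|\<mu>. indicator (far n) y * 2)"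
    proof (rule integral_mono)
      show "integrable \<mu> (\<lambda>y. indicator (far n) y * (2::real))" using \<mu>(3) by (simp add: \<mu>.emeasure_eq_measure)
      show "\<bar>indicator (far n) y * (g y - c)\<bar> \<le> indicator (far n) y * 2" if "y \<in> space \<mu>" for y
        using c2[of y] that \<mu>(2) by (simp add: indicator_def)
    qed (use i1(2) in simp)
    also have "\<dots> = 2 * measure \<mu> (far n)"
      using sets.sets_into_space[OF \<mu>(3)] by (simp add: Int_absorb2)
    finally show ?thesis unfolding eq abs_le_iff by simp
  qed
  have "(LINT y|\<mu>1. indicator near y * (g y - c)) - (LINT y|\<mu>2. indicator near y * (g y - c)) \<le> 2 * (7/16) * \<theta>"
    unfolding \<theta>_def
  proof (rule Hahn)
    show "(\<lambda>y. indicator near y * (g y - c)) \<in> borel_measurable \<mu>1"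
      using gi(1) near_sets(1) by simp
    show "\<bar>indicator near y * (g y - c)\<bar> \<le> 7/16" for y using c[of y] by (simp add: indicator_def)
  qed
  then have "(LINT y|\<mu>1. g y) - (LINT y|\<mu>2. g y) \<le> 7/8 * \<theta> + 4 * e"
    using split[OF p(1) sp(1) far_sets(1) near_sets(1) gi(1)] split[OF p(2) sp(2) far_sets(2) near_sets(2) gi(2)] n by simp
  then show False using low \<theta> unfolding ginv e_def by simp
qed


end

theorem theorem4p3:
  fixes M :: "'w measure" and F :: "real \<Rightarrow> 'w measure"
    and \<beta> :: "int \<Rightarrow> real \<Rightarrow> 'w \<Rightarrow> real" and b :: "int \<Rightarrow> real"
    and m m_star :: nat and a \<nu> C_star :: real
    and W :: "L2 \<Rightarrow> real \<Rightarrow> 'w \<Rightarrow> L2" and \<mu>1 \<mu>2 :: "L2 measure"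
  assumes "m \<ge> 1" and "\<nu> > 0" and "a = -2"
    and "m_star > m" and "noise_finite m_star b"
    and "brownian_family M F \<beta>"
    and "solution_family M F a \<nu> b \<beta> m W"
    and "stability_constant TYPE('w) C_star"
    and "\<nu> ^ 3 \<ge> 8 * C_star * noise_B 0 b"
    and "invariant_measure m (transition M W) \<mu>1"
    and "invariant_measure m (transition M W) \<mu>2"
  shows "\<mu>1 = \<mu>2"
proof (rule solution_setting.invariant_measure_unique)
  show "solution_setting M F \<beta> b m m_star \<nu> C_star W"
  proof (intro solution_setting.intro noise.intro solution_setting_axioms.intro)
    show "solution_family M F (-2) \<nu> b \<beta> m W" using assms(3,7) by simp
  qed (fact assms)+
qed (fact assms)+

end
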